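(* The map $\boldsymbol\alpha\mapsto\mathcal K_{\boldsymbol\alpha}$ with values in the space of distributions $\mathcal D'(S\times S\times S)$, originally defined for $\boldsymbol\alpha=(\alpha_1,\alpha_2,\alpha_3)\in\mathbb C^3$ in the domain $$\Re\alpha_j>-\rho\ (j=1,2,3),\qquad \Re\alpha_1+\Re\alpha_2+\Re\alpha_3>-\rho,$$ can be extended meromorphically to $\mathbb C^3$, with at most simple poles along the family of hyperplanes of $\mathbb C^3$ defined by the equations $$\alpha_j=-\rho-2k,\quad j=1,2,3,\ k\in\mathbb N,$$ $$\alpha_1+\alpha_2+\alpha_3=-\rho-2k,\quad k\in\mathbb N .$$
   Context: Let $n\ge 3$, $S=\{x\in\mathbb R^n:|x|=1\}$ the unit sphere, $\rho=\frac{n-1}{2}$, $d\sigma$ the Lebesgue (Euclidean surface) measure on $S$, and $\mathbb N=\{0,1,2,\dots\}$. For $\boldsymbol\alpha\in\mathbb C^3$, $$K_{\boldsymbol\alpha}(x_1,x_2,x_3)=|x_2-x_3|^{-\rho+\alpha_1}\,|x_3-x_1|^{-\rho+\alpha_2}\,|x_1-x_2|^{-\rho+\alpha_3}.$$ On the domain in the claim $K_{\boldsymbol\alpha}$ is integrable on $S\times S\times S$ and $\mathcal K_{\boldsymbol\alpha}$ denotes the distribution $$\mathcal K_{\boldsymbol\alpha}(f)=\int_{S\times S\times S}K_{\boldsymbol\alpha}(x_1,x_2,x_3)f(x_1,x_2,x_3)\,d\sigma(x_1)d\sigma(x_2)d\sigma(x_3),\quad f\in\mathcal C^\infty(S\times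 S\times S).$$ Meromorphy of a distribution-valued function is understood after evaluation on test functions $f\in\mathcal C^\infty(S\times S\times S)$. *)

theory Defs
  imports "HOL-Analysis.Analysis"
begin

section \<open>The sphere, its surface measure and the kernel\<close>

text \<open>
  Surface measure by polar coordinates: the surface measure of a Borel set \<open>A\<close> of the unit sphere
  is \<open>n\<close> times the Lebesgue measure of the cone over \<open>A\<close>, i.e. of \<open>{x. 0 < |x| \<le> 1, x/|x| \<in> A}\<close>
  (see \<open>emeasure_sphere_measure\<close>). Recall that \<open>sgn x = x / |x|\<close>.
\<close>
definition sphere_measure :: "(real ^ 'n) measure" where
  "sphere_measure = scale_measure (ennreal (real CARD('n)))
     (distr (restrict_space lborel (cball 0 1 - {0})) (restrict_space borel (sphere 0 1)) sgn)"

lemma emeasure_sphere_measure: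
  fixes A :: "(real ^ 'n) set"
  assumes "A \<in> sets borel" and "A \<subseteq> sphere 0 1"
  shows "emeasure sphere_measure A =
    ennreal (real CARD('n)) * emeasure lborel {x. 0 < norm x \<and> norm x \<le> 1 \<and> sgn x \<in> A}"
proof -
  let ?R = "restrict_space lborel (cball 0 1 - {0}) :: (real ^ 'n) measure"
  let ?S = "restrict_space borel (sphere 0 1) :: (real ^ 'n) measure"
  have sgn: "sgn \<in> measurable ?R ?S"
  proof (rule measurable_restrict_space2)
    show "sgn \<in> space ?R \<rightarrow> sphere 0 1"
      by (auto simp: space_restrict_space norm_sgn)
    have "(\<lambda>x :: real ^ 'n. x /\<^sub>R norm x) \<in> measurable lborel borel"
      by measurable
    then show "sgn \<in> measurable ?R borel"
      by (auto intro: measurable_restrict_space1 simp: sgn_div_norm[abs_def])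
  qed
  have A: "A \<in> sets ?S"
    using assms by (auto simp: sets_restrict_space_iff)
  have "emeasure sphere_measure A =
      ennreal (real CARD('n)) * emeasure ?R (sgn -` A \<inter> space ?R)"
    unfolding sphere_measure_def by (simp add: emeasure_distr[OF sgn A])
  also have "emeasure ?R (sgn -` A \<inter> space ?R) = emeasure lborel (sgn -` A \<inter> space ?R)"
    by (rule emeasure_restrict_space) (auto simp: space_restrict_space)
  also have "sgn -` A \<inter> space ?R = {x. 0 < norm x \<and> norm x \<le> 1 \<and> sgn x \<in> A}"
    by (auto simp: space_restrict_space)
  finally show ?thesis .
qed

type_synonym 'n ambient3 = "(real ^ 'n) \<times> (real ^ 'n) \<times> (real ^ 'n)"

abbreviation sphere3 :: "('n::finite) ambient3 set" where
  "sphere3 \<equiv> sphere 0 1 \<times> sphere 0 1 \<times> sphere 0 1"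

text \<open>On the diagonals, a null set, the kernel takes the library's value \<open>0 powr z = 0\<close>.\<close>
fun kernel :: "real \<Rightarrow> complex ^ 3 \<Rightarrow> ('n::finite) ambient3 \<Rightarrow> complex" where
  "kernel \<rho> \<alpha> (x1, x2, x3) =
     of_real (norm (x2 - x3)) powr (- of_real \<rho> + \<alpha> $ 1) *
     of_real (norm (x3 - x1)) powr (- of_real \<rho> + \<alpha> $ 2) *
     of_real (norm (x1 - x2)) powr (- of_real \<rho> + \<alpha> $ 3)"

definition kernel_distr ::
  "real \<Rightarrow> complex ^ 3 \<Rightarrow> (('n::finite) ambient3 \<Rightarrow> complex) \<Rightarrow> complex" where
  "kernel_distr \<rho> \<alpha> f =
     (LINT x | (sphere_measure \<Otimes>\<^sub>M (sphere_measure \<Otimes>\<^sub>M sphere_measure)). kernel \<rho> \<alpha> x * f x)"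

definition conv_domain :: "real \<Rightarrow> (complex ^ 3) set" where
  "conv_domain \<rho> =
     {\<alpha>. (\<forall>j. Re (\<alpha> $ j) > - \<rho>) \<and> Re (\<alpha> $ 1) + Re (\<alpha> $ 2) + Re (\<alpha> $ 3) > - \<rho>}"


section \<open>Test functions and distributions on the triple product of the sphere\<close>

primrec iter_deriv ::
  "'a list \<Rightarrow> ('a :: real_normed_vector \<Rightarrow> 'b :: real_normed_vector) \<Rightarrow> 'a \<Rightarrow> 'b" where
  "iter_deriv [] F = F"
| "iter_deriv (v # vs) F = (\<lambda>x. frechet_derivative (iter_deriv vs F) (at x) v)"

text \<open>Intended for open \<open>U\<close>.\<close>
definition smooth_on :: "'a set \<Rightarrow> ('a :: real_normed_vector \<Rightarrow> 'b :: real_normed_vector) \<Rightarrow> bool"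
  where "smooth_on U F \<longleftrightarrow> (\<forall>vs. \<forall>x\<in>U. iter_deriv vs F differentiable (at x))"

text \<open>
  Smooth functions on the submanifold \<open>sphere3\<close>: restrictions of smooth functions on open
  neighbourhoods. Elements are total functions, whose values off \<open>sphere3\<close> carry no meaning.
\<close>
definition test_funs :: "(('n::finite) ambient3 \<Rightarrow> complex) set" where
  "test_funs = {f. \<exists>U F. open U \<and> sphere3 \<subseteq> U \<and> smooth_on U F \<and> (\<forall>x\<in>sphere3. f x = F x)}"

fun hom_ext ::
  "(('n::finite) ambient3 \<Rightarrow> complex) \<Rightarrow> 'n ambient3 \<Rightarrow> complex"
  where "hom_ext f (x1, x2, x3) = f (sgn x1, sgn x2, sgn x3)"

text \<open>
  Convergence in the Frechet space of smooth functions on \<open>sphere3\<close>: uniform convergence of all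
  derivatives. Derivatives of functions on the sphere are taken after extending them to be
  homogeneous of degree 0 in each variable; at points of \<open>sphere3\<close> these depend only on the
  tangential derivatives of the function, and control all of them.
\<close>
definition test_tendsto ::
  "(nat \<Rightarrow> ('n::finite) ambient3 \<Rightarrow> complex) \<Rightarrow>
   ('n ambient3 \<Rightarrow> complex) \<Rightarrow> bool" where
  "test_tendsto f g \<longleftrightarrow>
     (\<forall>vs. uniform_limit sphere3 (\<lambda>i. iter_deriv vs (hom_ext (f i))) (iter_deriv vs (hom_ext g)) sequentially)"

text \<open>
  Continuity is stated sequentially, which is the same as continuity since the space of test
  functions is metrizable.
\<close>
definition is_distribution ::
  "((('n::finite) ambient3 \<Rightarrow> complex) \<Rightarrow> complex) \<Rightarrow> bool" where
  "is_distribution T \<longleftrightarrow>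
     (\<forall>f\<in>test_funs. \<forall>g\<in>test_funs. (\<forall>x\<in>sphere3. f x = g x) \<longrightarrow> T f = T g) \<and>
     (\<forall>f\<in>test_funs. \<forall>g\<in>test_funs. \<forall>a b. T (\<lambda>x. a * f x + b * g x) = a * T f + b * T g) \<and>
     (\<forall>f g. (\<forall>i. f i \<in> test_funs) \<and> g \<in> test_funs \<and> test_tendsto f g \<longrightarrow>
        (\<lambda>i. T (f i)) \<longlonglongrightarrow> T g)"


section \<open>Meromorphic functions of several complex variables\<close>

text \<open>Intended for open \<open>U\<close>: complex Frechet differentiability at every point.\<close>
definition cholomorphic_on :: "(complex ^ 'm \<Rightarrow> complex) \<Rightarrow> (complex ^ 'm) set \<Rightarrow> bool" where
  "cholomorphic_on F U \<longleftrightarrow>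
     (\<forall>z\<in>U. \<exists>D. (F has_derivative D) (at z) \<and> (\<forall>c v. D (c *s v) = c * D v))"

text \<open>
  Locally a quotient of holomorphic functions, with denominator not vanishing on any nonempty open
  set. The values of \<open>F\<close> at zeros of the denominator carry no meaning.
\<close>
definition cmeromorphic_on :: "(complex ^ 'm \<Rightarrow> complex) \<Rightarrow> (complex ^ 'm) set \<Rightarrow> bool" where
  "cmeromorphic_on F \<Omega> \<longleftrightarrow>
     (\<forall>a\<in>\<Omega>. \<exists>U g h. open U \<and> a \<in> U \<and> U \<subseteq> \<Omega> \<and>
        cholomorphic_on g U \<and> cholomorphic_on h U \<and> interior {z\<in>U. h z = 0} = {} \<and>
        (\<forall>z\<in>U. h z \<noteq> 0 \<longrightarrow> F z = g z / h z))"

text \<open>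
  \<open>L\<close> is a family of affine forms, one for each hyperplane. Near every point \<open>a\<close> the denominator can
  be chosen as the product of the forms of the hyperplanes through \<open>a\<close>, each to the first power; in
  particular \<open>F\<close> is holomorphic off the union of the hyperplanes.
\<close>
definition simple_poles_along :: "(complex ^ 'm \<Rightarrow> complex) \<Rightarrow> (complex ^ 'm \<Rightarrow> complex) set \<Rightarrow> bool"
  where
  "simple_poles_along F L \<longleftrightarrow>
     (\<forall>a. finite {l\<in>L. l a = 0} \<and>
        (\<exists>U g. open U \<and> a \<in> U \<and> cholomorphic_on g U \<and>
           (\<forall>z\<in>U. (\<Prod>l\<in>{l\<in>L. l a = 0}. l z) \<noteq> 0 \<longrightarrow>
              F z = g z / (\<Prod>l\<in>{l\<in>L. l a = 0}. l z))))"

definition pole_forms :: "real \<Rightarrow> (complex ^ 3 \<Rightarrow> complex) set" where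
  "pole_forms \<rho> =
     {l. \<exists>j k. l = (\<lambda>\<alpha>. \<alpha> $ j - (- of_real \<rho> - 2 * of_nat k))} \<union>
     {l. \<exists>k. l = (\<lambda>\<alpha>. \<alpha> $ 1 + \<alpha> $ 2 + \<alpha> $ 3 - (- of_real \<rho> - 2 * of_nat k))}"

end

theory Submission
  imports Defs "HOL-Complex_Analysis.Complex_Analysis"
begin

text \<open>
  Up to relabelling the points, the triple product splits into six copies of the sector
  \<open>|x1 - x2| \<le> |x1 - x3|\<close>, with a cutoff \<open>|x2 - x3|^(2N) / (sum of the three |xi - xj|^(2N))\<close>
  which also smooths the singularity along \<open>x2 = x3\<close>. In polar coordinates around \<open>x1\<close> with angles
  \<open>pi r s\<close> and \<open>pi r\<close> for \<open>x2\<close> and \<open>x3\<close>, every distance is \<open>|r|\<close> (for \<open>|x1 - x2|\<close>: \<open>|r s|\<close>) times a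
  factor of class \<open>C^(2m)\<close>, so each piece becomes a Mellin integral
  \<open>\<integral> |r|^(z1 - 1) |s|^(z2 - 1) h(r, s)\<close> over \<open>[-1,1]\<^sup>2\<close> with \<open>z1 = \<alpha>1 + \<alpha>2 + \<alpha>3 + \<rho>\<close> and
  \<open>z2 = \<alpha>j + \<rho>\<close> for some \<open>j\<close>. The angles run through both signs, so only even powers of \<open>r\<close> and
  \<open>s\<close> matter; this is why only every second hyperplane occurs.

  Instead of expanding \<open>h\<close>, one replaces it by a finite combination of the dilates
  \<open>h(\<plusminus> lam^k r, \<plusminus> lam^l s)\<close> that annihilates the even powers below \<open>2m\<close> in each variable. This
  multiplies the integral by \<open>D(z1) D(z2)\<close> with \<open>D(z) = \<Prod>j<m. (lam^(-z) - lam^(2j))\<close>, and the new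
  integrand is so small at the origin that the integral converges for \<open>Re z > -m\<close>. For \<open>lam\<close> close to
  1 the zeros of \<open>D\<close> in a given ball are exactly \<open>z = 0, -2, -4, \<dots>\<close>, and they are simple. The pieces
  obtained on balls of growing radius agree by the identity theorem.
\<close>

section \<open>Complex differentiability and the identity theorem\<close>

text \<open>The obstacle is the third edge. In a sector \<open>|x1 - x2|\<close> and
  \<open>|x1 - x3|\<close> are monomials in \<open>r\<close> and \<open>s\<close> up to factors
  bounded away from 0, but \<open>|x2 - x3|\<close> still vanishes inside the chart, for instance
  where \<open>s = 1\<close> and the two directions coincide, and is no monomial there. Rather than
  resolve this further, the cutoff raises its exponent by \<open>2N\<close>; the poles belonging to
  that edge come from the sectors in which it is the short one. The price is finite smoothness, so a
  given \<open>N\<close> and \<open>m\<close> serve only a bounded set of exponents. Mixed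
  derivatives in \<open>r\<close> and \<open>s\<close> never occur. Taylor expansion in one variable
  at a time yields the bounds \<open>|r|^(2m)\<close> and \<open>|s|^(2m)\<close>, and the smaller
  is at most \<open>|r|^m |s|^m\<close>; this is why \<open>2m\<close> derivatives reach only
  \<open>Re z > -m\<close>. With \<open>lam = exp (- eps)\<close> the zeros of \<open>D\<close> are
  \<open>-2j + 2 pi i k / eps\<close>; those with \<open>k\<close> nonzero leave any ball as
  \<open>eps\<close> tends to 0. A sector contributes one factor \<open>D(z1)\<close> and one
  \<open>D(z2)\<close>, with distinct linear forms, so no hyperplane is met twice. Uniformity of all
  estimates over bounded sets of test functions gives continuity.\<close>

definition cdiff :: "(complex ^ 'm \<Rightarrow> complex) \<Rightarrow> complex ^ 'm \<Rightarrow> bool" where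
  "cdiff F z \<longleftrightarrow> (\<exists>D. (F has_derivative D) (at z) \<and> (\<forall>c v. D (c *s v) = c * D v))"

lemma cholomorphic_on_iff: "cholomorphic_on F U \<longleftrightarrow> (\<forall>z\<in>U. cdiff F z)"
  by (simp add: cholomorphic_on_def cdiff_def)

lemma cdiff_const: "cdiff (\<lambda>z. k) z"
  unfolding cdiff_def by (rule exI[of _ "\<lambda>_. 0"]) auto

lemma cdiff_nth: "cdiff (\<lambda>z. z $ i) z"
  unfolding cdiff_def
  by (rule exI[of _ "\<lambda>v. v $ i"]) (auto intro!: bounded_linear_imp_has_derivative bounded_linear_vec_nth)

lemma cdiff_add:
  assumes "cdiff F z" "cdiff G z" shows "cdiff (\<lambda>z. F z + G z) z"
proof -
  from assms obtain D E where "(F has_derivative D) (at z)" "\<forall>c v. D (c *s v) = c * D v"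
    "(G has_derivative E) (at z)" "\<forall>c v. E (c *s v) = c * E v"
    unfolding cdiff_def by blast
  then show ?thesis unfolding cdiff_def
    by (intro exI[of _ "\<lambda>v. D v + E v"]) (auto intro!: has_derivative_add simp: algebra_simps)
qed

lemma cdiff_mult:
  assumes "cdiff F z" "cdiff G z" shows "cdiff (\<lambda>z. F z * G z) z"
proof -
  from assms obtain D E where *: "(F has_derivative D) (at z)" "\<forall>c v. D (c *s v) = c * D v"
    "(G has_derivative E) (at z)" "\<forall>c v. E (c *s v) = c * E v"
    unfolding cdiff_def by blast
  have "((\<lambda>z. F z * G z) has_derivative (\<lambda>v. F z * E v + D v * G z)) (at z)"
    by (rule has_derivative_mult[OF *(1,3)])
  with * show ?thesis unfolding cdiff_def
    by (intro exI[of _ "\<lambda>v. F z * E v + D v * G z"]) (auto simp: algebra_simps)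
qed

lemma cdiff_compose:
  assumes "cdiff F z" "(g has_field_derivative g') (at (F z))" shows "cdiff (\<lambda>z. g (F z)) z"
proof -
  from assms obtain D where *: "(F has_derivative D) (at z)" "\<forall>c v. D (c *s v) = c * D v"
    unfolding cdiff_def by blast
  have "((\<lambda>z. g (F z)) has_derivative (\<lambda>v. g' * D v)) (at z)"
    using has_derivative_compose[OF *(1) assms(2)[unfolded has_field_derivative_def]] .
  with * show ?thesis unfolding cdiff_def
    by (intro exI[of _ "\<lambda>v. g' * D v"]) (auto simp: algebra_simps)
qed

lemma cdiff_cmult: "cdiff F z \<Longrightarrow> cdiff (\<lambda>z. k * F z) z"
  by (intro cdiff_mult cdiff_const)

lemma cdiff_diff:
  assumes "cdiff F z" "cdiff G z" shows "cdiff (\<lambda>z. F z - G z) z"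
  using cdiff_add[OF assms(1) cdiff_cmult[OF assms(2), of "-1"]] by simp

lemma cdiff_exp: "cdiff F z \<Longrightarrow> cdiff (\<lambda>z. exp (F z)) z"
  by (rule cdiff_compose[where g = exp]) (auto intro: DERIV_exp)

text \<open>The base does not vary, so the power is \<open>exp (F z * Ln x)\<close>; for
  \<open>x = 0\<close> the convention \<open>0 powr w = 0\<close> makes it constant.\<close>

lemma cdiff_powr:
  assumes "cdiff F z" shows "cdiff (\<lambda>z. of_real x powr F z) z"
proof (cases "x = 0")
  case False
  then show ?thesis
    using cdiff_exp[OF cdiff_mult[OF assms cdiff_const[of "Ln (of_real x)"]]]
    by (simp add: powr_def mult.commute)
qed (simp add: cdiff_const)

lemma cdiff_divide:
  assumes "cdiff F z" "cdiff G z" "G z \<noteq> 0" shows "cdiff (\<lambda>z. F z / G z) z"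
proof -
  have "cdiff (\<lambda>z. inverse (G z)) z"
    by (rule cdiff_compose[OF assms(2), where g = inverse]) (rule DERIV_inverse[OF assms(3)])
  from cdiff_mult[OF assms(1) this] show ?thesis by (simp add: divide_inverse)
qed

lemma cdiff_sum: "(\<And>i. i \<in> A \<Longrightarrow> cdiff (F i) z) \<Longrightarrow> cdiff (\<lambda>z. \<Sum>i\<in>A. F i z) z"
  by (induction A rule: infinite_finite_induct) (auto intro: cdiff_const cdiff_add)

lemma cdiff_prod: "(\<And>i. i \<in> A \<Longrightarrow> cdiff (F i) z) \<Longrightarrow> cdiff (\<lambda>z. \<Prod>i\<in>A. F i z) z"
  by (induction A rule: infinite_finite_induct) (auto intro: cdiff_const cdiff_mult)

lemma cdiff_imp_continuous: "cdiff F z \<Longrightarrow> isCont F z"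
  unfolding cdiff_def using has_derivative_continuous by blast

text \<open>The bridge to one complex variable: identity theorem and Cauchy estimates are applied on
  complex lines.\<close>

lemma cdiff_line:
  assumes "cdiff F (a + t *s v)"
  shows "(\<lambda>t. F (a + t *s v)) field_differentiable (at t)"
proof -
  from assms obtain D where *: "(F has_derivative D) (at (a + t *s v))" "\<forall>c v. D (c *s v) = c * D v"
    unfolding cdiff_def by blast
  have "bounded_linear (\<lambda>t. t *s v)"
    by (rule linear_conv_bounded_linear[THEN iffD1])
       (auto simp: linear_iff vec_eq_iff algebra_simps)
  then have "((\<lambda>t. a + t *s v) has_derivative (\<lambda>t. t *s v)) (at t)"
    by (auto intro!: derivative_eq_intros bounded_linear_imp_has_derivative)
  from has_derivative_compose[OF this *(1)] *(2)
  have "((\<lambda>t. F (a + t *s v)) has_derivative (\<lambda>t. D v * t)) (at t)"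
    by (simp add: mult.commute)
  then show ?thesis
    unfolding field_differentiable_def has_field_derivative_def by auto
qed

text \<open>Only the one-variable theorem is invoked: \<open>F\<close> is restricted to the complex
  line through \<open>b\<close> and \<open>a\<close>, and convexity of \<open>U\<close> makes the
  part of that line inside \<open>U\<close> connected.\<close>

lemma cholomorphic_identity:
  assumes "cholomorphic_on F U" "convex U" "open U" "open W" "W \<subseteq> U" "b \<in> W"
    and zero: "\<And>z. z \<in> W \<Longrightarrow> F z = 0" and "a \<in> U"
  shows "F a = 0"
proof -
  define L where "L t = b + t *s (a - b)" for t :: complex
  have contL: "continuous_on UNIV L"
    unfolding L_def vector_scalar_mult_def by (intro continuous_intros)
  have preopen: "open (L -` V)" if "open V" for V
    using contL that by (simp add: continuous_on_open_vimage)
  have convL: "convex (L -` U)"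
  proof (rule convexI)
    fix x y :: complex and u v :: real
    assume "x \<in> L -` U" "y \<in> L -` U" and uv: "0 \<le> u" "0 \<le> v" "u + v = 1"
    then have "u *\<^sub>R L x + v *\<^sub>R L y \<in> U"
      using assms(2) by (auto simp: convex_def)
    moreover have "u *\<^sub>R L x + v *\<^sub>R L y = L (u *\<^sub>R x + v *\<^sub>R y)"
    proof -
      have v: "v = 1 - u" using uv by simp
      show ?thesis unfolding L_def vec_eq_iff v
        by (auto simp: scaleR_conv_of_real[where 'a = complex] algebra_simps scaleR_left_diff_distrib)
    qed
    ultimately show "u *\<^sub>R x + v *\<^sub>R y \<in> L -` U" by auto
  qed
  have hol: "(\<lambda>t. F (L t)) holomorphic_on (L -` U)"
    unfolding holomorphic_on_open[OF preopen[OF assms(3)]]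
    using assms(1) cdiff_line[of F b _ "a - b"]
    by (auto simp: L_def cholomorphic_on_iff field_differentiable_def)
  have 0: "0 \<in> L -` W" using assms(6) by (simp add: L_def)
  have "F (L 1) = 0"
  proof (rule analytic_continuation_open[where s = "L -` W" and s' = "L -` U" and f = "\<lambda>t. F (L t)" and g = "\<lambda>_. 0"])
    show "open (L -` W)" "open (L -` U)" by (auto intro: preopen assms)
    show "L -` W \<noteq> {}" using 0 by auto
    show "connected (L -` U)" by (rule convex_connected[OF convL])
    show "L -` W \<subseteq> L -` U" using assms by auto
    show "1 \<in> L -` U" using assms(8) by (simp add: L_def)
  qed (use hol zero in auto)
  then show ?thesis by (simp add: L_def)
qed

section \<open>Holomorphic dependence of integrals on parameters\<close>

lemma bounded_holomorphic_Lipschitz: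
  assumes "f holomorphic_on ball 0 1" "\<And>t. norm t < 1 \<Longrightarrow> norm (f t) \<le> B" "norm t \<le> 1/2"
  shows "norm (f t - f 0) \<le> 4 * B * norm t"
proof -
  \<comment> \<open>Cauchy's estimate on the disc of radius 1/4 around \<open>w\<close>, which stays
    inside the unit disc; its reciprocal radius is the constant 4.\<close>
  have d: "norm (deriv f w) \<le> 4 * B" if "w \<in> cball 0 (1/2)" for w
  proof -
    have sub: "cball w (1/4) \<subseteq> ball 0 1"
    proof
      fix u assume "u \<in> cball w (1/4)"
      then have "norm (u - w) \<le> 1/4" by (simp add: dist_norm norm_minus_commute)
      moreover have "norm u \<le> norm w + norm (u - w)" by (rule norm_triangle_sub)
      ultimately show "u \<in> ball 0 1" using that by simp
    qed
    have "norm ((deriv ^^ 1) f w) \<le> fact 1 * B / (1/4) ^ 1"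
    proof (rule Cauchy_inequality)
      show "f holomorphic_on ball w (1/4)"
        using sub ball_subset_cball by (blast intro: holomorphic_on_subset[OF assms(1)])
      show "continuous_on (cball w (1/4)) f"
        using sub by (blast intro: holomorphic_on_imp_continuous_on holomorphic_on_subset[OF assms(1)])
      show "norm (f x) \<le> B" if "norm (w - x) = 1/4" for x
        using that sub by (intro assms(2)) (auto simp: dist_norm subset_iff)
    qed auto
    then show ?thesis by simp
  qed
  have "norm (f t - f 0) \<le> 4 * B * norm (t - 0)"
  proof (rule field_differentiable_bound[where S = "cball 0 (1/2)" and f' = "deriv f"])
    show "(f has_field_derivative deriv f z) (at z within cball 0 (1/2))" if "z \<in> cball 0 (1/2)" for z
      using that by (intro holomorphic_derivI[OF assms(1)]) auto
  qed (use d assms in auto)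
  then show ?thesis by simp
qed

lemma norm_vector_scalar_mult: "norm (c *s v) = norm c * norm (v :: complex ^ 'm)"
  by (simp add: norm_vec_def L2_set_def norm_mult power_mult_distrib flip: sum_distrib_left)
     (simp add: real_sqrt_mult)

text \<open>A majorant of \<open>G\<close> alone is enough: for holomorphic integrands Cauchy's
  estimate bounds the difference quotients by the same majorant up to a constant, and dominated
  convergence does the rest.\<close>

lemma cdiff_integral:
  fixes G :: "complex ^ 'm \<Rightarrow> 'x \<Rightarrow> complex"
  assumes R: "R > 0"
    and diff: "\<And>x z. x \<in> space M \<Longrightarrow> z \<in> ball a R \<Longrightarrow> cdiff (\<lambda>s. G s x) z"
    and meas: "\<And>z. z \<in> ball a R \<Longrightarrow> G z \<in> borel_measurable M"
    and bnd: "\<And>x z. x \<in> space M \<Longrightarrow> z \<in> ball a R \<Longrightarrow> norm (G z x) \<le> g x"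
    and g: "integrable M g"
  shows "cdiff (\<lambda>s. \<integral>x. G s x \<partial>M) a"
proof -
  have "\<exists>D. ((\<lambda>s. G s x) has_derivative D) (at a) \<and> (\<forall>c v. D (c *s v) = c * D v)" if "x \<in> space M" for x
    using diff[OF that, of a] R by (auto simp: cdiff_def)
  then obtain D where D: "\<And>x. x \<in> space M \<Longrightarrow> ((\<lambda>s. G s x) has_derivative D x) (at a)"
    and Dh: "\<And>x c v. x \<in> space M \<Longrightarrow> D x (c *s v) = c * D x v"
    by metis
  have int: "integrable M (G z)" if "z \<in> ball a R" for z
    by (rule Bochner_Integration.integrable_bound[OF g meas[OF that]])
       (use bnd[OF _ that] in \<open>auto intro!: AE_I2 order_trans[OF _ abs_ge_self]\<close>)
  \<comment> \<open>On the complex line through \<open>a\<close> in direction \<open>h\<close>,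
    scaled so that the unit disc gets an image of radius \<open>R/2\<close>, the increment
    \<open>h\<close> corresponds to a parameter \<open>t\<close> of modulus
    \<open>2 |h| / R\<close>. This explains \<open>8 / R\<close>, and \<open>|h| <= R/4\<close>
    keeps \<open>|t|\<close> at most 1/2.\<close>
  have lip: "norm (G (a + h) x - G a x) \<le> 8 / R * norm h * g x"
    if x: "x \<in> space M" and h: "norm h \<le> R/4" for x h
  proof (cases "h = 0")
    case False
    define v where "v = (of_real (R / 2 / norm h)) *s h"
    define t where "t = complex_of_real (norm h * 2 / R)"
    have tv: "t *s v = h" using False R by (simp add: t_def v_def vec_eq_iff)
    have nv: "norm v = R/2" using False R by (simp add: v_def norm_vector_scalar_mult norm_mult norm_divide)
    have nt: "norm t = norm h * 2 / R" using R by (simp add: t_def norm_mult norm_divide)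
    have in_ball: "a + u *s v \<in> ball a R" if "norm u < 1" for u
    proof -
      have "norm u * (R/2) \<le> 1 * (R/2)" using that R by (intro mult_right_mono) auto
      then have "norm u * (R/2) < R" using R by simp
      then show ?thesis by (simp add: dist_norm norm_vector_scalar_mult nv)
    qed
    have "norm (G (a + t *s v) x - G (a + 0 *s v) x) \<le> 4 * g x * norm t"
    proof (rule bounded_holomorphic_Lipschitz[where f = "\<lambda>t. G (a + t *s v) x"])
      show "(\<lambda>t. G (a + t *s v) x) holomorphic_on ball 0 1"
        unfolding holomorphic_on_open[OF open_ball]
        using cdiff_line[OF diff[OF x in_ball]] by (auto simp: field_differentiable_def)
      show "norm t \<le> 1/2" unfolding nt using h R by (simp add: field_simps)
    qed (use bnd[OF x in_ball] in auto)
    then show ?thesis using R by (simp add: tv nt algebra_simps)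
  qed auto
  have lim: "((\<lambda>t. (G (a + t *\<^sub>R v) x - G a x) /\<^sub>R t) \<longlongrightarrow> D x v) (at 0)"
    if x: "x \<in> space M" for x v
  proof -
    have "((\<lambda>t. a + t *\<^sub>R v) has_derivative (\<lambda>t. t *\<^sub>R v)) (at (0::real))"
      by (auto intro!: derivative_eq_intros)
    from has_derivative_compose[OF this, of "\<lambda>s. G s x" "D x"] D[OF x]
    have "((\<lambda>t. G (a + t *\<^sub>R v) x) has_derivative (\<lambda>t. D x (t *\<^sub>R v))) (at 0)" by simp
    moreover have "D x (t *\<^sub>R v) = t *\<^sub>R D x v" for t
      using has_derivative_linear[OF D[OF x]] by (simp add: linear_scale)
    ultimately have "((\<lambda>h. norm (G (a + h *\<^sub>R v) x - G a x - h *\<^sub>R D x v) / norm h) \<longlongrightarrow> 0) (at 0)"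
      by (simp add: has_derivative_at)
    then have "((\<lambda>h. norm ((G (a + h *\<^sub>R v) x - G a x) /\<^sub>R h - D x v)) \<longlongrightarrow> 0) (at 0)"
    proof (rule Lim_transform_eventually)
      show "\<forall>\<^sub>F h in at 0. norm (G (a + h *\<^sub>R v) x - G a x - h *\<^sub>R D x v) / norm h =
          norm ((G (a + h *\<^sub>R v) x - G a x) /\<^sub>R h - D x v)"
        using eventually_neq_at_within[of 0 0 UNIV]
      proof eventually_elim
        case (elim h)
        have "(G (a + h *\<^sub>R v) x - G a x) /\<^sub>R h - D x v = (G (a + h *\<^sub>R v) x - G a x - h *\<^sub>R D x v) /\<^sub>R h"
          using elim by (simp add: algebra_simps)
        then show ?case by (simp add: divide_inverse mult.commute)
      qed
    qed
    then show ?thesis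
      by (subst Lim_null) (rule tendsto_norm_zero_cancel)
  qed

  \<comment> \<open>\<open>D\<close> was obtained by choice, separately for each \<open>x\<close>,
    so measurability in \<open>x\<close> has to be recovered from difference quotients along a
    sequence of real steps.\<close>
  have measD: "(\<lambda>x. D x v) \<in> borel_measurable M" for v
  proof (rule borel_measurable_LIMSEQ_metric)
    define c where "c = R / (2 * (norm v + 1))"
    define v' where "v' i = (c / real (Suc i)) *\<^sub>R v" for i
    have c: "c > 0" "c * norm v < R"
    proof -
      have *: "2 * (norm v + 1) > 0" by (simp add: add_nonneg_pos)
      then show "c > 0" using R unfolding c_def by (rule divide_pos_pos[rotated])
      have "0 \<le> norm v" by simp
      then have "norm v < 2 * (norm v + 1)" by (simp only: distrib_left)
      from mult_strict_left_mono[OF this R] have "R * norm v < R * (2 * (norm v + 1))" .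
      with * show "c * norm v < R"
        unfolding c_def times_divide_eq_left by (simp only: pos_divide_less_eq)
    qed
    have inb: "a + v' i \<in> ball a R" for i
    proof -
      have "norm (v' i) = c * norm v / real (Suc i)"
        using c by (simp add: v'_def)
      also have "\<dots> \<le> c * norm v / 1"
        using c(1) by (intro divide_left_mono) auto
      also have "\<dots> < R" using c by simp
      finally show "a + v' i \<in> ball a R" by (simp add: dist_norm)
    qed
    show "(\<lambda>x. (G (a + v' i) x - G a x) /\<^sub>R (c / real (Suc i))) \<in> borel_measurable M" for i
      by (intro borel_measurable_scaleR borel_measurable_diff borel_measurable_const meas inb)
         (use R in simp)
    fix x assume x: "x \<in> space M"
    have "(\<lambda>i. c / real (Suc i)) \<longlonglongrightarrow> 0"
      using tendsto_mult_right_zero[OF LIMSEQ_inverse_real_of_nat, of c]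
      unfolding divide_inverse .
    moreover have "c / real (Suc i) \<noteq> 0" for i using c by simp
    ultimately have "filterlim (\<lambda>i. c / real (Suc i)) (at 0) sequentially"
      unfolding filterlim_at by auto
    from filterlim_compose[OF lim[OF x, of v] this]
    show "(\<lambda>i. (G (a + v' i) x - G a x) /\<^sub>R (c / real (Suc i))) \<longlonglongrightarrow> D x v"
      by (simp only: v'_def)
  qed
  have bndD: "norm (D x v) \<le> 8 / R * norm v * g x" if x: "x \<in> space M" for x v
  proof (rule tendsto_upperbound[OF tendsto_norm[OF lim[OF x, of v]]])
    have "\<forall>\<^sub>F t in at 0. norm (t *\<^sub>R v) < R/4"
    proof (rule order_tendstoD)
      show "((\<lambda>t. norm (t *\<^sub>R v)) \<longlongrightarrow> 0) (at 0)"
        by (rule tendsto_eq_rhs[OF tendsto_norm[OF tendsto_scaleR[OF tendsto_ident_at tendsto_const]]]) simp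
    qed (use R in auto)
    then show "\<forall>\<^sub>F t in at 0. norm ((G (a + t *\<^sub>R v) x - G a x) /\<^sub>R t) \<le> 8 / R * norm v * g x"
      using eventually_neq_at_within[of 0 0 UNIV]
    proof eventually_elim
      case (elim t)
      have "norm (G (a + t *\<^sub>R v) x - G a x) \<le> (8 / R * norm v * g x) * \<bar>t\<bar>"
        using lip[OF x, of "t *\<^sub>R v"] elim by (simp add: mult_ac)
      with elim show ?case
        by (simp only: norm_scaleR abs_inverse divide_inverse_commute[symmetric] pos_divide_le_eq
            zero_less_abs_iff real_norm_def not_False_eq_True)
    qed
  qed auto
  have intD: "integrable M (\<lambda>x. D x v)" for v
  proof (rule Bochner_Integration.integrable_bound[OF _ measD])
    show "integrable M (\<lambda>x. 8 / R * norm v * g x)" using g by simp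
    show "AE x in M. norm (D x v) \<le> norm (8 / R * norm v * g x)"
      unfolding real_norm_def by (rule AE_I2) (rule order_trans[OF bndD abs_ge_self])
  qed
  define D' where "D' v = (\<integral>x. D x v \<partial>M)" for v
  have lin: "linear (D x)" if "x \<in> space M" for x
    using has_derivative_linear[OF D[OF that]] .
  have blD: "bounded_linear D'"
  proof (rule bounded_linear_intro[where K = "8 / R * (\<integral>x. g x \<partial>M)"])
    fix u v r
    have "D' (u + v) = (\<integral>x. D x u + D x v \<partial>M)"
      unfolding D'_def by (intro Bochner_Integration.integral_cong) (auto simp: lin linear_add)
    then show "D' (u + v) = D' u + D' v" by (simp add: D'_def intD)
    have "D' (r *\<^sub>R v) = (\<integral>x. r *\<^sub>R D x v \<partial>M)"
      unfolding D'_def by (intro Bochner_Integration.integral_cong) (auto simp: lin linear_scale)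
    then show "D' (r *\<^sub>R v) = r *\<^sub>R D' v" by (simp add: D'_def)
    have "norm (D' v) \<le> (\<integral>x. norm (D x v) \<partial>M)" unfolding D'_def by simp
    also have "\<dots> \<le> (\<integral>x. 8 / R * norm v * g x \<partial>M)"
      using intD g bndD by (intro integral_mono) auto
    finally show "norm (D' v) \<le> norm v * (8 / R * (\<integral>x. g x \<partial>M))" by (simp add: mult_ac)
  qed
  have "((\<lambda>h. norm ((\<integral>x. G (a + h) x \<partial>M) - (\<integral>x. G a x \<partial>M) - D' h) / norm h) \<longlongrightarrow> 0) (at 0)"
    unfolding tendsto_at_iff_sequentially
  proof (intro allI impI)
    fix polar_pt :: "nat \<Rightarrow> complex ^ 'm"
    assume polar_pt: "\<forall>i. polar_pt i \<in> UNIV - {0}" "polar_pt \<longlonglongrightarrow> 0"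
    have "\<forall>\<^sub>F i in sequentially. norm (polar_pt i) < R/4"
      by (rule order_tendstoD(2)[OF tendsto_norm_zero[OF polar_pt(2)]]) (use R in simp)
    then obtain i0 where i0: "\<And>i. i \<ge> i0 \<Longrightarrow> norm (polar_pt i) < R/4"
      by (auto simp: eventually_sequentially)
    \<comment> \<open>The shift by \<open>i0\<close> puts all increments into the ball of radius
      \<open>R/4\<close>, where \<open>lip\<close> holds; together with \<open>bndD\<close> it
      yields the majorant \<open>16 / R * g\<close>.\<close>
    let ?Y = "\<lambda>i. polar_pt (i + i0)"
    have "(\<lambda>i. \<integral>x. (G (a + ?Y i) x - G a x - D x (?Y i)) /\<^sub>R norm (?Y i) \<partial>M) \<longlonglongrightarrow> (\<integral>x. 0 \<partial>M)"
    proof (rule integral_dominated_convergence[where w = "\<lambda>x. 16 / R * g x"])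
      show "(\<lambda>x. (G (a + ?Y i) x - G a x - D x (?Y i)) /\<^sub>R norm (?Y i)) \<in> borel_measurable M" for i
        using meas[of a] meas[of "a + ?Y i"] measD[of "?Y i"] i0[of "i + i0"] R
        by (auto simp: dist_norm intro!: borel_measurable_scaleR borel_measurable_diff)
      show "integrable M (\<lambda>x. 16 / R * g x)" using g by simp
      show "AE x in M. (\<lambda>i. (G (a + ?Y i) x - G a x - D x (?Y i)) /\<^sub>R norm (?Y i)) \<longlonglongrightarrow> 0"
      proof (rule AE_I2)
        fix x assume x: "x \<in> space M"
        have "((\<lambda>h. norm (G (a + h) x - G a x - D x h) / norm h) \<longlongrightarrow> 0) (at 0)"
          using D[OF x] unfolding has_derivative_at by blast
        then have "(\<lambda>i. norm (G (a + polar_pt i) x - G a x - D x (polar_pt i)) / norm (polar_pt i)) \<longlonglongrightarrow> 0"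
          unfolding tendsto_at_iff_sequentially comp_def using polar_pt by blast
        from LIMSEQ_ignore_initial_segment[OF this, of i0]
        have "(\<lambda>i. norm ((G (a + ?Y i) x - G a x - D x (?Y i)) /\<^sub>R norm (?Y i))) \<longlonglongrightarrow> 0"
          by (simp add: divide_inverse mult.commute)
        then show "(\<lambda>i. (G (a + ?Y i) x - G a x - D x (?Y i)) /\<^sub>R norm (?Y i)) \<longlonglongrightarrow> 0"
          by (rule tendsto_norm_zero_cancel)
      qed
      show "AE x in M. norm ((G (a + ?Y i) x - G a x - D x (?Y i)) /\<^sub>R norm (?Y i)) \<le> 16 / R * g x" for i
      proof (rule AE_I2)
        fix x assume x: "x \<in> space M"
        have "norm (G (a + ?Y i) x - G a x - D x (?Y i)) \<le> 8 / R * norm (?Y i) * g x + 8 / R * norm (?Y i) * g x"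
          by (rule order_trans[OF norm_triangle_ineq4 add_mono])
             (use lip[OF x, of "?Y i"] i0[of "i + i0"] bndD[OF x, of "?Y i"] in auto)
        then have "norm (G (a + ?Y i) x - G a x - D x (?Y i)) \<le> (16 / R * g x) * norm (?Y i)"
          by (simp add: mult_ac)
        moreover have "norm (?Y i) > 0" using polar_pt(1) by auto
        ultimately show "norm ((G (a + ?Y i) x - G a x - D x (?Y i)) /\<^sub>R norm (?Y i)) \<le> 16 / R * g x"
          by (simp only: norm_scaleR abs_inverse divide_inverse_commute[symmetric] pos_divide_le_eq
              abs_norm_cancel)
      qed
    qed auto
    moreover have "(\<integral>x. (G (a + ?Y i) x - G a x - D x (?Y i)) /\<^sub>R norm (?Y i) \<partial>M)
        = ((\<integral>x. G (a + ?Y i) x \<partial>M) - (\<integral>x. G a x \<partial>M) - D' (?Y i)) /\<^sub>R norm (?Y i)" for i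
      using int[of a] int[of "a + ?Y i"] i0[of "i + i0"] R intD[of "?Y i"]
      by (simp add: D'_def dist_norm)
    ultimately have "(\<lambda>i. ((\<integral>x. G (a + ?Y i) x \<partial>M) - (\<integral>x. G a x \<partial>M) - D' (?Y i)) /\<^sub>R norm (?Y i)) \<longlonglongrightarrow> 0"
      by (simp only: Bochner_Integration.integral_zero)
    from tendsto_norm_zero[OF this]
    have "(\<lambda>i. norm (((\<integral>x. G (a + ?Y i) x \<partial>M) - (\<integral>x. G a x \<partial>M) - D' (?Y i)) /\<^sub>R norm (?Y i))) \<longlonglongrightarrow> 0" .
    then have "(\<lambda>i. norm ((\<integral>x. G (a + ?Y i) x \<partial>M) - (\<integral>x. G a x \<partial>M) - D' (?Y i)) / norm (?Y i)) \<longlonglongrightarrow> 0"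
      by (simp add: divide_inverse mult.commute)
    then show "((\<lambda>h. norm ((\<integral>x. G (a + h) x \<partial>M) - (\<integral>x. G a x \<partial>M) - D' h) / norm h) \<circ> polar_pt) \<longlonglongrightarrow> 0"
      unfolding comp_def by (rule LIMSEQ_offset)
  qed
  with blD have "((\<lambda>s. \<integral>x. G s x \<partial>M) has_derivative D') (at a)"
    unfolding has_derivative_at by simp
  moreover have "D' (c *s v) = c * D' v" for c v
  proof -
    have "D' (c *s v) = (\<integral>x. c * D x v \<partial>M)"
      unfolding D'_def by (intro Bochner_Integration.integral_cong) (auto simp: Dh)
    then show ?thesis by (simp add: D'_def)
  qed
  ultimately show ?thesis unfolding cdiff_def by blast
qed

section \<open>Families of uniformly bounded class C^n\<close>

definition unif_bdd :: "'p set \<Rightarrow> ('p \<Rightarrow> real \<Rightarrow> complex) \<Rightarrow> bool" where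
  "unif_bdd P h \<longleftrightarrow> (\<exists>C. \<forall>p\<in>P. \<forall>r\<in>{-1..1}. norm (h p r) \<le> C)"

definition fam_deriv :: "'p set \<Rightarrow> ('p \<Rightarrow> real \<Rightarrow> complex) \<Rightarrow> ('p \<Rightarrow> real \<Rightarrow> complex) \<Rightarrow> bool" where
  "fam_deriv P h h' \<longleftrightarrow> (\<forall>p\<in>P. \<forall>r\<in>{-1..1}. (h p has_vector_derivative h' p r) (at r within {-1..1}))"

text \<open>Class C^n on [-1,1] with bounds uniform over \<open>P\<close>. The derivative of order
  \<open>n\<close> is only asked to be bounded, which is enough for a Taylor remainder.
  \<open>P\<close> will hold exponents, base points, test functions and the other variable, so
  uniformity supplies the dominating functions.\<close>

primrec cn_bdd :: "nat \<Rightarrow> 'p set \<Rightarrow> ('p \<Rightarrow> real \<Rightarrow> complex) \<Rightarrow> bool" where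
  "cn_bdd 0 P h \<longleftrightarrow> unif_bdd P h"
| "cn_bdd (Suc n) P h \<longleftrightarrow> unif_bdd P h \<and> (\<exists>h'. fam_deriv P h h' \<and> cn_bdd n P h')"

lemma vderI: "(\<And>p r. p \<in> P \<Longrightarrow> r \<in> {-1..1} \<Longrightarrow> (h p has_vector_derivative h' p r) (at r within {-1..1})) \<Longrightarrow> fam_deriv P h h'"
  unfolding fam_deriv_def by blast

lemma vderD: "fam_deriv P h h' \<Longrightarrow> p \<in> P \<Longrightarrow> r \<in> {-1..1} \<Longrightarrow> (h p has_vector_derivative h' p r) (at r within {-1..1})"
  unfolding fam_deriv_def by blast

lemma cn_bdd_unif_bdd: "cn_bdd n P h \<Longrightarrow> unif_bdd P h"
  by (cases n) simp_all

lemma cn_bdd_SucI: "unif_bdd P h \<Longrightarrow> cn_bdd n P h' \<Longrightarrow> fam_deriv P h h' \<Longrightarrow> cn_bdd (Suc n) P h"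
  by auto

lemma cn_bdd_SucD: "cn_bdd (Suc n) P h \<Longrightarrow> cn_bdd n P h"
proof (induction n arbitrary: h)
  case (Suc n)
  from Suc.prems obtain h' where h': "fam_deriv P h h'" "cn_bdd (Suc n) P h'" "unif_bdd P h"
    unfolding cn_bdd.simps(2)[of "Suc n"] by blast
  show ?case by (rule cn_bdd_SucI[OF h'(3) Suc.IH[OF h'(2)] h'(1)])
qed simp

lemma cn_bdd_le: "cn_bdd (m + k) P h \<Longrightarrow> cn_bdd m P h"
proof (induction k)
  case (Suc k)
  from Suc.prems have "cn_bdd (m + k) P h" unfolding add_Suc_right by (rule cn_bdd_SucD)
  then show ?case by (rule Suc.IH)
qed simp

lemma cn_bdd_mono: "cn_bdd n P h \<Longrightarrow> m \<le> n \<Longrightarrow> cn_bdd m P h"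
  using cn_bdd_le[of m "n - m"] by simp

lemma unif_bdd_reparam: "unif_bdd P h \<Longrightarrow> g ` Q \<subseteq> P \<Longrightarrow> unif_bdd Q (\<lambda>q. h (g q))"
  unfolding unif_bdd_def by blast

lemma cn_bdd_SucE:
  assumes "cn_bdd (Suc n) P h"
  obtains h' where "fam_deriv P h h'" "cn_bdd n P h'" "unif_bdd P h"
  using assms unfolding cn_bdd.simps by blast

lemma cn_bdd_reparam: "cn_bdd n P h \<Longrightarrow> g ` Q \<subseteq> P \<Longrightarrow> cn_bdd n Q (\<lambda>q. h (g q))"
proof (induction n arbitrary: h)
  case (Suc n)
  from Suc.prems(1) obtain h' where h': "fam_deriv P h h'"
    "cn_bdd n P h'" "unif_bdd P h" by (rule cn_bdd_SucE)
  show ?case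
    by (rule cn_bdd_SucI[OF unif_bdd_reparam[OF h'(3) Suc.prems(2)] Suc.IH[OF h'(2) Suc.prems(2)]])
       (rule vderI, rule vderD[OF h'(1)], use Suc.prems(2) in auto)
qed (auto intro: unif_bdd_reparam)

lemma unif_bdd_cong:
  assumes "unif_bdd P k" "\<And>p r. p \<in> P \<Longrightarrow> r \<in> {-1..1} \<Longrightarrow> h p r = k p r"
  shows "unif_bdd P h"
proof -
  from assms(1) obtain C where C: "\<forall>p\<in>P. \<forall>r\<in>{-1..1}. norm (k p r) \<le> C" unfolding unif_bdd_def by blast
  have "\<forall>p\<in>P. \<forall>r\<in>{-1..1}. norm (h p r) \<le> C"
  proof (intro ballI)
    fix p and r :: real assume "p \<in> P" "r \<in> {-1..1}"
    then show "norm (h p r) \<le> C" unfolding assms(2)[OF \<open>p \<in> P\<close> \<open>r \<in> {-1..1}\<close>] using C by blast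
  qed
  then show ?thesis unfolding unif_bdd_def by blast
qed

lemma cn_bdd_cong:
  assumes "cn_bdd n P k" "\<And>p r. p \<in> P \<Longrightarrow> r \<in> {-1..1} \<Longrightarrow> h p r = k p r"
  shows "cn_bdd n P h"
proof (cases n)
  case 0
  then show ?thesis using assms(1) unif_bdd_cong[OF _ assms(2)] by simp
next
  case (Suc m)
  from assms(1)[unfolded Suc] obtain k' where k': "fam_deriv P k k'"
    "cn_bdd m P k'" "unif_bdd P k" by (rule cn_bdd_SucE)
  have "(h p has_vector_derivative k' p r) (at r within {-1..1})" if "p \<in> P" "r \<in> {-1..1}" for p r
    by (rule has_vector_derivative_transform[OF that(2) assms(2)[OF that(1)] vderD[OF k'(1) that]])
  then have "fam_deriv P h k'" by (rule vderI)
  with unif_bdd_cong[OF k'(3) assms(2)] k'(2) show ?thesis unfolding Suc by (rule cn_bdd_SucI)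
qed

lemma unif_bdd_add:
  assumes "unif_bdd P h" "unif_bdd P k" shows "unif_bdd P (\<lambda>p r. h p r + k p r)"
proof -
  from assms obtain C D where *: "\<And>p r. p\<in>P \<Longrightarrow> r\<in>{-1..1} \<Longrightarrow> norm (h p r) \<le> C" "\<And>p r. p\<in>P \<Longrightarrow> r\<in>{-1..1} \<Longrightarrow> norm (k p r) \<le> D"
    unfolding unif_bdd_def by blast
  show ?thesis unfolding unif_bdd_def
    by (intro exI[of _ "C + D"] ballI norm_triangle_mono *)
qed

lemma unif_bdd_mult:
  assumes "unif_bdd P h" "unif_bdd P k" shows "unif_bdd P (\<lambda>p r. h p r * k p r)"
proof -
  from assms obtain C D where *: "\<And>p r. p\<in>P \<Longrightarrow> r\<in>{-1..1} \<Longrightarrow> norm (h p r) \<le> C" "\<And>p r. p\<in>P \<Longrightarrow> r\<in>{-1..1} \<Longrightarrow> norm (k p r) \<le> D"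
    unfolding unif_bdd_def by blast
  have "norm (h p r * k p r) \<le> C * D" if "p \<in> P" "r \<in> {-1..1}" for p r
    unfolding norm_mult using *(1)[OF that] *(2)[OF that]
    by (rule mult_mono) (use order_trans[OF norm_ge_zero *(1)[OF that]] in auto)
  then show ?thesis unfolding unif_bdd_def by blast
qed

lemma unif_bdd_const: "(\<And>p. p \<in> P \<Longrightarrow> norm (c p) \<le> C) \<Longrightarrow> unif_bdd P (\<lambda>p r. c p)"
  unfolding unif_bdd_def by blast

lemma cn_bdd_const: "(\<And>p. p \<in> P \<Longrightarrow> norm (c p) \<le> C) \<Longrightarrow> cn_bdd n P (\<lambda>p r. c p)"
proof (induction n arbitrary: c C)
  case 0
  then show ?case unfolding cn_bdd.simps by (rule unif_bdd_const)
next
  case (Suc n)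
  have *: "cn_bdd n P (\<lambda>p r. 0)" by (rule Suc.IH[of "\<lambda>_. 0" 0]) simp
  have "unif_bdd P (\<lambda>p r. c p)" using Suc.prems by (rule unif_bdd_const)
  then show ?case using * by (rule cn_bdd_SucI) (auto intro: vderI)
qed

lemma cn_bdd_add: "cn_bdd n P h \<Longrightarrow> cn_bdd n P k \<Longrightarrow> cn_bdd n P (\<lambda>p r. h p r + k p r)"
proof (induction n arbitrary: h k)
  case (Suc n)
  from Suc.prems(1) obtain h' where h': "fam_deriv P h h'"
    "cn_bdd n P h'" "unif_bdd P h" by (rule cn_bdd_SucE)
  from Suc.prems(2) obtain k' where k': "fam_deriv P k k'"
    "cn_bdd n P k'" "unif_bdd P k" by (rule cn_bdd_SucE)
  show ?case
    by (rule cn_bdd_SucI[OF unif_bdd_add[OF h'(3) k'(3)] Suc.IH[OF h'(2) k'(2)]])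
       (intro vderI has_vector_derivative_add vderD[OF h'(1)] vderD[OF k'(1)])
qed (simp add: unif_bdd_add)

lemma cn_bdd_mult: "cn_bdd n P h \<Longrightarrow> cn_bdd n P k \<Longrightarrow> cn_bdd n P (\<lambda>p r. h p r * k p r)"
proof (induction n arbitrary: h k)
  case (Suc n)
  from Suc.prems(1) obtain h' where h': "fam_deriv P h h'"
    "cn_bdd n P h'" "unif_bdd P h" by (rule cn_bdd_SucE)
  from Suc.prems(2) obtain k' where k': "fam_deriv P k k'"
    "cn_bdd n P k'" "unif_bdd P k" by (rule cn_bdd_SucE)
  have "cn_bdd n P (\<lambda>p r. h p r * k' p r + h' p r * k p r)"
    by (rule cn_bdd_add[OF Suc.IH[OF cn_bdd_SucD[OF Suc.prems(1)] k'(2)] Suc.IH[OF h'(2) cn_bdd_SucD[OF Suc.prems(2)]]])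
  then show ?case
    by (rule cn_bdd_SucI[OF unif_bdd_mult[OF h'(3) k'(3)]]) (intro vderI has_vector_derivative_mult vderD[OF h'(1)] vderD[OF k'(1)])
qed (simp add: unif_bdd_mult)

lemma cn_bdd_sum:
  assumes "\<And>i. i \<in> A \<Longrightarrow> cn_bdd n P (h i)" shows "cn_bdd n P (\<lambda>p r. \<Sum>i\<in>A. h i p r)"
  using assms
proof (induction A rule: infinite_finite_induct)
  case (infinite A)
  then show ?case using cn_bdd_const[of P "\<lambda>_. 0" 0 n] by simp
next
  case empty
  then show ?case using cn_bdd_const[of P "\<lambda>_. 0" 0 n] by simp
next
  case (insert x F)
  then have "cn_bdd n P (\<lambda>p r. h x p r + (\<Sum>i\<in>F. h i p r))" by (intro cn_bdd_add) auto
  then show ?case using insert.hyps by simp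
qed

lemma cn_bdd_power:
  assumes "cn_bdd n P h" shows "cn_bdd n P (\<lambda>p r. h p r ^ k)"
proof (induction k)
  case 0
  show ?case using cn_bdd_const[of P "\<lambda>_. 1" 1 n] by simp
next
  case (Suc k)
  show ?case unfolding power_Suc by (rule cn_bdd_mult[OF assms Suc])
qed

lemma cn_bdd_cmult: "cn_bdd n P h \<Longrightarrow> (\<And>p. p \<in> P \<Longrightarrow> norm (c p) \<le> C) \<Longrightarrow> cn_bdd n P (\<lambda>p r. c p * h p r)"
  by (intro cn_bdd_mult cn_bdd_const)

section \<open>Entire functions and complex powers of such families\<close>

lemma cn_bdd_entire:
  assumes "g holomorphic_on UNIV" and c: "\<And>p. p \<in> P \<Longrightarrow> \<bar>c p\<bar> \<le> K"
  shows "cn_bdd n P (\<lambda>p r. g (of_real (c p * r)))"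
  using assms(1)
proof (induction n arbitrary: g)
  have ub: "unif_bdd P (\<lambda>p r. g (of_real (c p * r)))" if "g holomorphic_on UNIV" for g
  proof -
    have "compact (g ` cball 0 K)"
      using that by (intro compact_continuous_image holomorphic_on_imp_continuous_on)
        (auto intro: holomorphic_on_subset)
    then obtain C where C: "\<And>x. x \<in> cball 0 K \<Longrightarrow> norm (g x) \<le> C"
      by (metis (no_types, lifting) bounded_iff compact_imp_bounded imageI)
    have "complex_of_real (c p * r) \<in> cball 0 K" if "p \<in> P" "r \<in> {-1..1}" for p r
    proof -
      have "\<bar>c p\<bar> * \<bar>r\<bar> \<le> K * 1" using c[OF that(1)] that(2) by (intro mult_mono) auto
      then show ?thesis by (simp add: norm_mult)
    qed
    then show ?thesis unfolding unif_bdd_def using C by blast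
  qed
  {
    case 0
    then show ?case using ub by simp
  next
    case (Suc n)
    have hd: "deriv g holomorphic_on UNIV" using Suc.prems by (intro holomorphic_deriv) auto
    have "cn_bdd n P (\<lambda>p r. of_real (c p) * deriv g (of_real (c p * r)))"
      by (rule cn_bdd_cmult[OF Suc.IH[OF hd], where C = K]) (use c in auto)
    moreover have "((\<lambda>r. g (of_real (c p * r))) has_vector_derivative of_real (c p) * deriv g (of_real (c p * r))) (at r within {-1..1})" for p r
    proof -
      have 1: "((\<lambda>r. complex_of_real (c p * r)) has_vector_derivative of_real (c p)) (at r within {-1..1})"
        by (intro has_vector_derivative_of_real)
           (auto intro!: derivative_eq_intros simp flip: has_real_derivative_iff_has_vector_derivative)
      have 2: "(g has_field_derivative deriv g (of_real (c p * r))) (at (of_real (c p * r)) within ((\<lambda>r. complex_of_real (c p * r)) ` {-1..1}))"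
        by (rule has_field_derivative_at_within, rule holomorphic_derivI[OF Suc.prems]) auto
      from field_vector_diff_chain_within[OF 1 2] show ?thesis by (simp add: o_def)
    qed
    ultimately show ?case by (intro cn_bdd_SucI[OF ub[OF Suc.prems]] vderI)
  }
qed

text \<open>With the base bounded away from 0 every exponent is allowed, so the derivative
  \<open>B' * z * B powr (z - 1)\<close> is covered by the induction, which runs over all bounded
  families of exponents.\<close>

lemma cn_bdd_powr_pos:
  assumes B: "cn_bdd n P (\<lambda>p r. of_real (B p r))"
    and pos: "\<And>p r. p \<in> P \<Longrightarrow> r \<in> {-1..1} \<Longrightarrow> B p r \<ge> b" "b > 0"
    and z: "\<And>p. p \<in> P \<Longrightarrow> norm (z p) \<le> K"
  shows "cn_bdd n P (\<lambda>p r. of_real (B p r) powr z p)"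
  using B z
proof (induction n arbitrary: z K)
  have ub: "unif_bdd P (\<lambda>p r. of_real (B p r) powr z p)"
    if B: "cn_bdd n P (\<lambda>p r. of_real (B p r))" and z: "\<And>p. p \<in> P \<Longrightarrow> norm (z p) \<le> K" for z K and n :: nat
  proof -
    obtain C where C: "\<And>p r. p \<in> P \<Longrightarrow> r \<in> {-1..1} \<Longrightarrow> \<bar>B p r\<bar> \<le> C"
      using cn_bdd_unif_bdd[OF B] unfolding unif_bdd_def norm_of_real by blast
    have "norm (of_real (B p r) powr z p) \<le> exp (K * (\<bar>ln b\<bar> + \<bar>ln C\<bar>))"
      if "p \<in> P" "r \<in> {-1..1}" for p r
    proof -
      have Bp: "0 < B p r" "b \<le> B p r" "B p r \<le> C" using pos(1)[OF that] pos(2) C[OF that] by auto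
      then have "\<bar>ln (B p r)\<bar> \<le> \<bar>ln b\<bar> + \<bar>ln C\<bar>"
        using pos(2) by (smt (verit) ln_le_cancel_iff)
      then have "\<bar>Re (z p)\<bar> * \<bar>ln (B p r)\<bar> \<le> K * (\<bar>ln b\<bar> + \<bar>ln C\<bar>)"
        using z[OF that(1)] abs_Re_le_cmod[of "z p"] by (intro mult_mono) auto
      then have "Re (z p) * ln (B p r) \<le> K * (\<bar>ln b\<bar> + \<bar>ln C\<bar>)"
        unfolding abs_mult[symmetric] by (rule order_trans[OF abs_ge_self])
      then show ?thesis using Bp
        by (simp add: norm_powr_real_powr powr_def)
    qed
    then show ?thesis unfolding unif_bdd_def by blast
  qed
  {
    case 0
    show ?case unfolding cn_bdd.simps by (rule ub[OF 0])
  next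
    case (Suc n)
    then obtain B' where B': "fam_deriv P (\<lambda>p r. complex_of_real (B p r)) B'" "cn_bdd n P B'" by auto
    have "cn_bdd n P (\<lambda>p r. z p * of_real (B p r) powr (z p - 1))"
    proof (rule cn_bdd_cmult[OF Suc.IH])
      show "cn_bdd n P (\<lambda>p r. of_real (B p r))" using Suc.prems(1) by (rule cn_bdd_SucD)
      show "norm (z p - 1) \<le> K + 1" if "p \<in> P" for p
        using norm_triangle_ineq4[of "z p" 1] Suc.prems(2)[OF that] by simp
    qed (use Suc.prems in auto)
    from cn_bdd_mult[OF B'(2) this]
    have "cn_bdd n P (\<lambda>p r. B' p r * (z p * of_real (B p r) powr (z p - 1)))" .
    moreover have "((\<lambda>r. of_real (B p r) powr z p) has_vector_derivative B' p r * (z p * of_real (B p r) powr (z p - 1))) (at r within {-1..1})"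
      if "p \<in> P" "r \<in> {-1..1}" for p r
    proof -
      have 2: "((\<lambda>w. w powr z p) has_field_derivative z p * of_real (B p r) powr (z p - 1))
          (at (of_real (B p r)) within ((\<lambda>r. complex_of_real (B p r)) ` {-1..1}))"
      proof (rule has_field_derivative_at_within, rule has_field_derivative_powr)
        show "complex_of_real (B p r) \<notin> \<real>\<^sub>\<le>\<^sub>0" using pos(1)[OF that] pos(2) by simp
      qed
      show ?thesis
        using field_vector_diff_chain_within[OF vderD[OF B'(1) that] 2] by (simp add: o_def)
    qed
    ultimately show ?case by (intro cn_bdd_SucI[OF ub[OF Suc.prems]] vderI)
  }
qed

text \<open>The difference quotient at 0 has modulus \<open>w powr (Re z - 1)\<close>.\<close>

lemma powr_has_vector_derivative_zero:
  assumes "Re z > 1"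
  shows "((\<lambda>w. complex_of_real w powr z) has_vector_derivative 0) (at 0 within {0..})"
proof -
  have "((\<lambda>w. w powr (Re z - 1)) \<longlongrightarrow> 0) (at 0 within {0..})"
  proof -
    have "((\<lambda>w. w powr (Re z - 1)) \<longlongrightarrow> 0 powr (Re z - 1)) (at (0::real) within {0..})"
      by (rule tendsto_powr') (use assms in \<open>auto intro!: tendsto_eq_intros simp: eventually_at_topological\<close>)
    then show ?thesis by simp
  qed
  then have "((\<lambda>w. norm (of_real w powr z - of_real 0 powr z - (w - 0) *\<^sub>R 0) / norm (w - 0)) \<longlongrightarrow> 0) (at 0 within {0..})"
  proof (rule Lim_transform_eventually)
    show "\<forall>\<^sub>F w in at 0 within {0..}. w powr (Re z - 1) = norm (of_real w powr z - of_real 0 powr z - (w - 0) *\<^sub>R 0) / norm (w - 0)"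
      by (auto simp: eventually_at_filter norm_powr_real_powr powr_diff)
  qed
  then show ?thesis
    unfolding has_vector_derivative_def has_derivative_iff_norm by auto
qed

text \<open>Here the base may vanish. Each derivative lowers the exponent by one, so a real part
  above \<open>n\<close> is still positive after \<open>n\<close> of them. This is applied to
  \<open>Bq\<close> and dictates how large the cutoff exponent \<open>N\<close> must be.\<close>

lemma cn_bdd_powr_nonneg:
  assumes B: "cn_bdd n P (\<lambda>p r. of_real (B p r))"
    and pos: "\<And>p r. p \<in> P \<Longrightarrow> r \<in> {-1..1} \<Longrightarrow> B p r \<ge> 0"
    and z: "\<And>p. p \<in> P \<Longrightarrow> norm (z p) \<le> K" "\<And>p. p \<in> P \<Longrightarrow> Re (z p) > real n"
  shows "cn_bdd n P (\<lambda>p r. of_real (B p r) powr z p)"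
  using B z
proof (induction n arbitrary: z K)
  have ub: "unif_bdd P (\<lambda>p r. of_real (B p r) powr z p)"
    if B: "cn_bdd n P (\<lambda>p r. of_real (B p r))" and z: "\<And>p. p \<in> P \<Longrightarrow> norm (z p) \<le> K" 
      "\<And>p. p \<in> P \<Longrightarrow> Re (z p) > real n" for z K and n :: nat
  proof -
    obtain C where C: "\<And>p r. p \<in> P \<Longrightarrow> r \<in> {-1..1} \<Longrightarrow> \<bar>B p r\<bar> \<le> C"
      using cn_bdd_unif_bdd[OF B] unfolding unif_bdd_def norm_of_real by blast
    have "norm (of_real (B p r) powr z p) \<le> (max C 1) powr K"
      if "p \<in> P" "r \<in> {-1..1}" for p r
    proof -
      have "B p r powr Re (z p) \<le> (max C 1) powr Re (z p)"
        using pos[OF that] C[OF that] z(2)[OF that(1)] by (intro powr_mono2) auto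
      also have "\<dots> \<le> (max C 1) powr K"
        using z(1)[OF that(1)] complex_Re_le_cmod[of "z p"] by (intro powr_mono) auto
      finally show ?thesis using pos[OF that] by (simp add: norm_powr_real_powr)
    qed
    then show ?thesis unfolding unif_bdd_def by blast
  qed
  {
    case 0
    show ?case unfolding cn_bdd.simps by (rule ub[OF 0])
  next
    case (Suc n)
    then obtain B' where B': "fam_deriv P (\<lambda>p r. complex_of_real (B p r)) B'" "cn_bdd n P B'" by auto
    have "cn_bdd n P (\<lambda>p r. z p * of_real (B p r) powr (z p - 1))"
    proof (rule cn_bdd_cmult[OF Suc.IH])
      show "cn_bdd n P (\<lambda>p r. of_real (B p r))" using Suc.prems(1) by (rule cn_bdd_SucD)
      show "norm (z p - 1) \<le> K + 1" if "p \<in> P" for p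
        using norm_triangle_ineq4[of "z p" 1] Suc.prems(2)[OF that] by simp
      show "Re (z p - 1) > real n" if "p \<in> P" for p using Suc.prems(3)[OF that] by simp
    qed (use Suc.prems in auto)
    from cn_bdd_mult[OF B'(2) this]
    have "cn_bdd n P (\<lambda>p r. B' p r * (z p * of_real (B p r) powr (z p - 1)))" .
    moreover have "((\<lambda>r. of_real (B p r) powr z p) has_vector_derivative B' p r * (z p * of_real (B p r) powr (z p - 1))) (at r within {-1..1})"
      if pr: "p \<in> P" "r \<in> {-1..1}" for p r
    proof (cases "B p r = 0")
      case False
      have 2: "((\<lambda>w. w powr z p) has_field_derivative z p * of_real (B p r) powr (z p - 1))
          (at (of_real (B p r)) within ((\<lambda>r. complex_of_real (B p r)) ` {-1..1}))"
      proof (rule has_field_derivative_at_within, rule has_field_derivative_powr)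
        show "complex_of_real (B p r) \<notin> \<real>\<^sub>\<le>\<^sub>0" using pos[OF that] False by simp
      qed
      show ?thesis
        using field_vector_diff_chain_within[OF vderD[OF B'(1) that] 2] by (simp add: o_def)
    next
      case True
      have 1: "(B p has_vector_derivative Re (B' p r)) (at r within {-1..1})"
        using bounded_linear.has_vector_derivative[OF bounded_linear_Re vderD[OF B'(1) pr]] by simp
      \<comment> \<open>The formula predicts the derivative 0 here, because
        \<open>0 powr w = 0\<close>. As \<open>B\<close> is nonnegative, the one-sided derivative of
        the power at 0 suffices.\<close>
      have 2: "((\<lambda>w. complex_of_real w powr z p) has_vector_derivative 0) (at (B p r) within (B p ` {-1..1}))"
        unfolding True by (rule has_vector_derivative_within_subset[OF powr_has_vector_derivative_zero])
          (use Suc.prems(3)[OF pr(1)] pos[OF pr(1)] in auto)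
      show ?thesis
        using vector_diff_chain_within[OF 1 2] by (simp add: o_def True)
    qed
    ultimately show ?case by (intro cn_bdd_SucI[OF ub[OF Suc.prems]] vderI)
  }
qed

text \<open>Induction through the derivative: the expansion of \<open>h'\<close> is integrated by
  the mean value inequality, so a bound on the top derivative is enough. The coefficients may depend
  on \<open>p\<close> in any way; only \<open>C\<close> is uniform.\<close>

lemma cn_bdd_Taylor:
  assumes "cn_bdd n P h"
  shows "\<exists>C c. C \<ge> 0 \<and> (\<forall>p\<in>P. \<forall>r\<in>{-1..1}. norm (h p r - (\<Sum>i<n. c p i * of_real r ^ i)) \<le> C * \<bar>r\<bar> ^ n)"
  using assms
proof (induction n arbitrary: h)
  case 0
  then obtain C where "\<forall>p\<in>P. \<forall>r\<in>{-1..1}. norm (h p r) \<le> C" by (auto simp: unif_bdd_def)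
  then show ?case by (intro exI[of _ "max C 0"]) (auto simp: le_max_iff_disj)
next
  case (Suc n)
  then obtain h' where h': "fam_deriv P h h'" "cn_bdd n P h'" by auto
  from Suc.IH[OF h'(2)] obtain C c where C: "C \<ge> 0"
    "\<And>p r. p \<in> P \<Longrightarrow> r \<in> {-1..1} \<Longrightarrow> norm (h' p r - (\<Sum>i<n. c p i * of_real r ^ i)) \<le> C * \<bar>r\<bar> ^ n"
    by blast
  \<comment> \<open>Coefficients of the antiderivative, with value \<open>h p 0\<close> at 0, of the
    polynomial belonging to \<open>h'\<close>.\<close>
  define d where "d p i = (case i of 0 \<Rightarrow> h p 0 | Suc j \<Rightarrow> c p j / of_nat (Suc j))" for p i
  have "norm (h p r - (\<Sum>i<Suc n. d p i * of_real r ^ i)) \<le> C * \<bar>r\<bar> ^ Suc n"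
    if p: "p \<in> P" and r: "r \<in> {-1..1}" for p r
  proof -
    define e where "e r = h p r - (\<Sum>i<Suc n. d p i * of_real r ^ i)" for r
    have eq: "e r = h p r - (h p 0 + (\<Sum>i<n. c p i * of_real r ^ Suc i / of_nat (Suc i)))" for r
      unfolding e_def sum.lessThan_Suc_shift by (simp add: d_def)
    have sub: "closed_segment 0 r \<subseteq> {-1..1}"
      using r by (intro closed_segment_subset) auto
    have pw: "((\<lambda>r. c p i * of_real r ^ Suc i / of_nat (Suc i)) has_vector_derivative c p i * of_real x ^ i) (at x within S)" for i x S
    proof -
      have "((\<lambda>w. c p i * w ^ Suc i / of_nat (Suc i)) has_field_derivative c p i * of_real x ^ i) (at (of_real x) within of_real ` S)"
        using DERIV_cdivide[OF DERIV_cmult[OF DERIV_power[OF DERIV_ident, where n = "Suc i"], where c = "c p i"], where c = "of_nat (Suc i)"]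
        by (simp del: of_nat_Suc power_Suc)
      moreover have "(complex_of_real has_vector_derivative 1) (at x within S)"
        using bounded_linear.has_vector_derivative[OF bounded_linear_of_real has_vector_derivative_id] by simp
      ultimately show ?thesis
        using field_vector_diff_chain_within[of of_real 1 x S "\<lambda>w. c p i * w ^ Suc i / of_nat (Suc i)" "c p i * of_real x ^ i"]
        by (simp add: o_def)
    qed
    have "(e has_vector_derivative h' p x - (\<Sum>i<n. c p i * of_real x ^ i)) (at x within closed_segment 0 r)"
      if "x \<in> closed_segment 0 r" for x
    proof -
      have "(h p has_vector_derivative h' p x) (at x within closed_segment 0 r)"
        using sub that by (intro has_vector_derivative_within_subset[OF vderD[OF h'(1) p]]) auto
      then have "((\<lambda>r. h p r - (h p 0 + (\<Sum>i<n. c p i * of_real r ^ Suc i / of_nat (Suc i)))) has_vector_derivative h' p x - (0 + (\<Sum>i<n. c p i * of_real x ^ i))) (at x within closed_segment 0 r)"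
        by (intro has_vector_derivative_diff has_vector_derivative_add has_vector_derivative_const has_vector_derivative_sum pw)
      then show ?thesis unfolding eq[abs_def] by simp
    qed
    then have "norm (e r - e 0) \<le> C * \<bar>r\<bar> ^ n * norm (r - 0)"
      unfolding has_vector_derivative_def
    proof (rule differentiable_bound[OF convex_closed_segment])
      fix x assume x: "x \<in> closed_segment 0 r"
      have "norm (h' p x - (\<Sum>i<n. c p i * of_real x ^ i)) \<le> C * \<bar>x\<bar> ^ n"
        using sub x p by (intro C) auto
      also have "\<dots> \<le> C * \<bar>r\<bar> ^ n"
        using x C(1) by (intro mult_left_mono power_mono) (auto simp: closed_segment_eq_real_ivl split: if_splits)
      finally show "onorm (\<lambda>t. t *\<^sub>R (h' p x - (\<Sum>i<n. c p i * of_real x ^ i))) \<le> C * \<bar>r\<bar> ^ n"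
        using onorm_scaleR_left[OF bounded_linear_ident] by (simp add: onorm_scaleR_left onorm_id)
    qed auto
    moreover have "e 0 = 0" unfolding eq by simp
    ultimately show ?thesis unfolding e_def[symmetric] by (simp add: mult_ac)
  qed
  with C(1) show ?case by (intro exI[of _ C] exI[of _ d]) auto
qed

text \<open>With \<open>q\<close> acting as dilation by \<open>lam\<close>, \<open>dilop lam m\<close> is \<open>\<Prod>j<m. (q - lam^(2j))\<close> applied to the even
  part; it kills the even powers below \<open>2m\<close>.\<close>

definition dilpoly :: "real \<Rightarrow> nat \<Rightarrow> complex poly" where
  "dilpoly lam m = (\<Prod>j<m. [:- of_real (lam ^ (2 * j)), 1:])"

definition dilop :: "real \<Rightarrow> nat \<Rightarrow> (real \<Rightarrow> complex) \<Rightarrow> real \<Rightarrow> complex" where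
  "dilop lam m h r = (\<Sum>l\<le>degree (dilpoly lam m). coeff (dilpoly lam m) l * ((h (lam ^ l * r) + h (- (lam ^ l * r))) / 2))"

lemma poly_dilpoly: "poly (dilpoly lam m) w = (\<Prod>j<m. w - of_real (lam ^ (2 * j)))"
  by (simp add: dilpoly_def poly_prod)

definition dilnorm :: "real \<Rightarrow> nat \<Rightarrow> real" where
  "dilnorm lam m = (\<Sum>l\<le>degree (dilpoly lam m). norm (coeff (dilpoly lam m) l))"

lemma dilnorm_nonneg: "dilnorm lam m \<ge> 0"
  unfolding dilnorm_def by (intro sum_nonneg) auto

lemma norm_dilop_le:
  assumes "\<And>l s. s \<in> {1, -1} \<Longrightarrow> norm (h (s * (lam ^ l * r))) \<le> C"
  shows "norm (dilop lam m h r) \<le> dilnorm lam m * C"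
proof -
  have "norm ((h (lam ^ l * r) + h (- (lam ^ l * r))) / 2) \<le> C" for l
  proof -
    have "norm (h (lam ^ l * r) + h (- (lam ^ l * r))) \<le> C + C"
      using assms[of 1 l] assms[of "-1" l] by (intro norm_triangle_mono) auto
    then show ?thesis by (simp add: norm_divide)
  qed
  then show ?thesis
    unfolding dilop_def dilnorm_def sum_distrib_right
    by (intro sum_norm_le) (unfold norm_mult, rule mult_left_mono, assumption, simp)
qed

text \<open>On \<open>r^i\<close> with \<open>i\<close> even, dilation by \<open>lam\<close> acts as
  the scalar \<open>lam^i\<close>, so the operator acts as \<open>dilpoly\<close> evaluated there,
  which is 0 for \<open>i = 2 j\<close> with \<open>j < m\<close>. Odd powers cancel in the mean
  over both signs.\<close>

lemma dilop_poly: "dilop lam m (\<lambda>r. \<Sum>i<2*m. c i * of_real r ^ i) r = 0"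
proof -
  have "dilop lam m (\<lambda>r. \<Sum>i<2*m. c i * of_real r ^ i) r =
      (\<Sum>l\<le>degree (dilpoly lam m). \<Sum>i<2*m. c i * of_real r ^ i * ((1 + (-1) ^ i) / 2) * (coeff (dilpoly lam m) l * (of_real (lam ^ i)) ^ l))"
    unfolding dilop_def
  proof (intro sum.cong refl)
    fix l
    have *: "c i * complex_of_real (lam ^ l * r) ^ i + c i * complex_of_real (- (lam ^ l * r)) ^ i
        = c i * of_real r ^ i * (1 + (-1) ^ i) * (of_real (lam ^ i)) ^ l" for i
    proof -
      have 1: "complex_of_real (lam ^ l * r) ^ i = of_real r ^ i * of_real (lam ^ i) ^ l"
        by (simp add: power_mult_distrib power_mult[symmetric] mult.commute)
      have 2: "complex_of_real (- (lam ^ l * r)) ^ i = (-1) ^ i * complex_of_real (lam ^ l * r) ^ i"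
        by (subst power_mult_distrib[symmetric]) simp
      show ?thesis unfolding 2 1 by (simp only: distrib_left distrib_right mult_1_right mult_1_left mult_ac)
    qed
    show "coeff (dilpoly lam m) l * (((\<Sum>i<2*m. c i * complex_of_real (lam ^ l * r) ^ i) +
        (\<Sum>i<2*m. c i * complex_of_real (- (lam ^ l * r)) ^ i)) / 2) =
      (\<Sum>i<2*m. c i * of_real r ^ i * ((1 + (-1) ^ i) / 2) * (coeff (dilpoly lam m) l * (of_real (lam ^ i)) ^ l))"
      unfolding sum.distrib[symmetric] * sum_divide_distrib sum_distrib_left
      by (intro sum.cong refl) simp
  qed
  also have "\<dots> = (\<Sum>i<2*m. c i * of_real r ^ i * ((1 + (-1) ^ i) / 2) * poly (dilpoly lam m) (of_real (lam ^ i)))"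
    by (subst sum.swap) (simp add: poly_altdef sum_distrib_left)
  also have "\<dots> = 0"
  proof (intro sum.neutral ballI)
    fix i assume i: "i \<in> {..<2*m}"
    show "c i * of_real r ^ i * ((1 + (-1) ^ i) / 2) * poly (dilpoly lam m) (of_real (lam ^ i)) = 0"
    proof (cases "even i")
      case True
      then obtain j where "i = 2 * j" by blast
      with i show ?thesis by (auto simp: poly_dilpoly intro!: prod_zero)
    qed simp
  qed
  finally show ?thesis .
qed

lemma dilop_diff: "dilop lam m (\<lambda>r. h r - k r) r = dilop lam m h r - dilop lam m k r"
  unfolding dilop_def sum_subtractf[symmetric] by (intro sum.cong refl) (simp add: field_simps)

text \<open>For \<open>|r| <= 1\<close> all dilates stay in the interval, and subtracting the Taylor
  polynomial changes nothing. For \<open>|r| > 1\<close> plain boundedness suffices because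
  \<open>|r|^(2m) >= 1\<close>, so the jump of the extension by 0 does no harm.\<close>

lemma cn_bdd_dilop_bound:
  assumes "cn_bdd (2 * m) P h" and lam: "0 < lam" "lam < 1"
  shows "\<exists>C\<ge>0. \<forall>p\<in>P. \<forall>r. norm (dilop lam m (\<lambda>r. if \<bar>r\<bar> \<le> 1 then h p r else 0) r) \<le> C * \<bar>r\<bar> ^ (2 * m)"
proof -
  obtain C c where C: "C \<ge> 0"
    "\<And>p r. p \<in> P \<Longrightarrow> r \<in> {-1..1} \<Longrightarrow> norm (h p r - (\<Sum>i<2*m. c p i * of_real r ^ i)) \<le> C * \<bar>r\<bar> ^ (2*m)"
    using cn_bdd_Taylor[OF assms(1)] by blast
  obtain K where K: "\<And>p r. p \<in> P \<Longrightarrow> r \<in> {-1..1} \<Longrightarrow> norm (h p r) \<le> K"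
    using cn_bdd_unif_bdd[OF assms(1)] unfolding unif_bdd_def by blast
  define D where "D = max C \<bar>K\<bar>"
  have lamle: "\<bar>lam ^ l * r\<bar> \<le> \<bar>r\<bar>" for l r
  proof -
    have "lam ^ l * \<bar>r\<bar> \<le> 1 * \<bar>r\<bar>"
      using lam by (intro mult_right_mono power_le_one) auto
    then show ?thesis using lam by (simp add: abs_mult)
  qed
  have "norm (dilop lam m (\<lambda>r. if \<bar>r\<bar> \<le> 1 then h p r else 0) r) \<le> dilnorm lam m * (D * \<bar>r\<bar> ^ (2 * m))"
    if p: "p \<in> P" for p r
  proof (cases "\<bar>r\<bar> \<le> 1")
    case True
    let ?T = "\<lambda>r. \<Sum>i<2*m. c p i * of_real r ^ i"
    have "dilop lam m (\<lambda>r. if \<bar>r\<bar> \<le> 1 then h p r else 0) r = dilop lam m (\<lambda>r. (if \<bar>r\<bar> \<le> 1 then h p r else 0) - ?T r) r"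
      by (subst dilop_diff) (simp add: dilop_poly)
    also have "norm \<dots> \<le> dilnorm lam m * (D * \<bar>r\<bar> ^ (2 * m))"
    proof (rule norm_dilop_le)
      fix l and s :: real assume s: "s \<in> {1, -1}"
      have le: "\<bar>s * (lam ^ l * r)\<bar> \<le> \<bar>r\<bar>" using lamle[of l r] s by auto
      then have in1: "s * (lam ^ l * r) \<in> {-1..1}" using True by auto
      have "norm (h p (s * (lam ^ l * r)) - ?T (s * (lam ^ l * r))) \<le> C * \<bar>s * (lam ^ l * r)\<bar> ^ (2*m)"
        by (rule C(2)[OF p in1])
      also have "\<dots> \<le> D * \<bar>r\<bar> ^ (2*m)"
        using le C(1) unfolding D_def by (intro mult_mono power_mono) auto
      finally show "norm ((if \<bar>s * (lam ^ l * r)\<bar> \<le> 1 then h p (s * (lam ^ l * r)) else 0) - ?T (s * (lam ^ l * r))) \<le> D * \<bar>r\<bar> ^ (2*m)"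
        using in1 le True by simp
    qed
    finally show ?thesis .
  next
    case False
    show ?thesis
    proof (rule norm_dilop_le)
      fix l and s :: real
      have "norm (if \<bar>s * (lam ^ l * r)\<bar> \<le> 1 then h p (s * (lam ^ l * r)) else 0) \<le> D * 1"
      proof (cases "\<bar>s * (lam ^ l * r)\<bar> \<le> 1")
        case True
        then have "norm (h p (s * (lam ^ l * r))) \<le> K" by (intro K[OF p]) auto
        then show ?thesis using True unfolding D_def by simp
      next
        case False
        then show ?thesis using C(1) by (simp add: D_def le_max_iff_disj)
      qed
      also have "\<dots> \<le> D * \<bar>r\<bar> ^ (2*m)"
        using False C(1) unfolding D_def by (intro mult_left_mono one_le_power) auto
      finally show "norm (if \<bar>s * (lam ^ l * r)\<bar> \<le> 1 then h p (s * (lam ^ l * r)) else 0) \<le> D * \<bar>r\<bar> ^ (2*m)" .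
    qed
  qed
  moreover have "0 \<le> dilnorm lam m * D"
    using dilnorm_nonneg[of lam m] by (simp add: D_def C(1) le_max_iff_disj)
  ultimately show ?thesis
    by (intro exI[of _ "dilnorm lam m * D"]) (simp only: mult.assoc, blast)
qed

section \<open>Smoothness of the homogeneous extension\<close>

text \<open>Reduces smoothness to exhibiting a set of functions closed under directional
  derivatives. Agreement on the open set \<open>U\<close> is all that derivatives at points of
  \<open>U\<close> can see.\<close>

lemma iter_deriv_in_family:
  assumes U: "open U"
    and fam: "\<And>G. G \<in> \<G> \<Longrightarrow> \<exists>G'. (\<forall>v. G' v \<in> \<G>) \<and> (\<forall>x\<in>U. (G has_derivative (\<lambda>v. G' v x)) (at x))"
    and G: "G \<in> \<G>" and eq: "\<And>x. x \<in> U \<Longrightarrow> G0 x = G x"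
  shows "\<exists>H\<in>\<G>. \<forall>x\<in>U. iter_deriv vs G0 x = H x"
proof (induction vs)
  case Nil
  then show ?case using G eq by auto
next
  case (Cons v vs)
  then obtain H where H: "H \<in> \<G>" "\<And>x. x \<in> U \<Longrightarrow> iter_deriv vs G0 x = H x" by blast
  obtain H' where H': "\<And>v. H' v \<in> \<G>" "\<And>x. x \<in> U \<Longrightarrow> (H has_derivative (\<lambda>v. H' v x)) (at x)"
    using fam[OF H(1)] by blast
  have "iter_deriv (v # vs) G0 x = H' v x" if x: "x \<in> U" for x
  proof -
    have "(iter_deriv vs G0 has_derivative (\<lambda>v. H' v x)) (at x)"
      by (rule has_derivative_transform_within_open[OF H'(2)[OF x] U x]) (simp add: H(2))
    from frechet_derivative_at[OF this] show ?thesis by (simp add: fun_eq_iff)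
  qed
  then show ?case using H'(1) by blast
qed

lemma smooth_on_family:
  assumes U: "open U"
    and fam: "\<And>G. G \<in> \<G> \<Longrightarrow> \<exists>G'. (\<forall>v. G' v \<in> \<G>) \<and> (\<forall>x\<in>U. (G has_derivative (\<lambda>v. G' v x)) (at x))"
    and G: "G \<in> \<G>" and eq: "\<And>x. x \<in> U \<Longrightarrow> G0 x = G x"
  shows "smooth_on U G0"
  unfolding smooth_on_def
proof (intro allI ballI)
  fix vs x assume x: "x \<in> U"
  obtain H where H: "H \<in> \<G>" "\<And>x. x \<in> U \<Longrightarrow> iter_deriv vs G0 x = H x"
    using iter_deriv_in_family[of U \<G> G G0 vs, OF assms] by blast
  obtain H' where H': "\<And>x. x \<in> U \<Longrightarrow> (H has_derivative (\<lambda>v. H' v x)) (at x)"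
    using fam[OF H(1)] by blast
  have "(iter_deriv vs G0 has_derivative (\<lambda>v. H' v x)) (at x)"
    by (rule has_derivative_transform_within_open[OF H'[OF x] U x]) (simp add: H(2))
  then show "iter_deriv vs G0 differentiable at x" unfolding differentiable_def by blast
qed

definition nonzero3 :: "('n::finite) ambient3 set" where
  "nonzero3 = {x. fst x \<noteq> 0 \<and> fst (snd x) \<noteq> 0 \<and> snd (snd x) \<noteq> 0}"

lemma open_nonzero3: "open (nonzero3 :: ('n::finite) ambient3 set)"
proof -
  have "(nonzero3 :: 'n ambient3 set) = fst -` (- {0}) \<inter> (fst \<circ> snd) -` (- {0}) \<inter> (snd \<circ> snd) -` (- {0})"
    by (auto simp: nonzero3_def)
  moreover have "open \<dots>"
    by (intro open_Int open_vimage) (auto intro!: continuous_intros)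
  ultimately show ?thesis by (simp only:)
qed

lemma sphere3_subset_nonzero3: "sphere3 \<subseteq> nonzero3"
  by (auto simp: nonzero3_def)

text \<open>The form in which smoothness is used: it depends only on the values on
  \<open>sphere3\<close>, and its derivatives are the ones that \<open>test_tendsto\<close>
  compares.\<close>

definition hsmooth :: "(('n::finite) ambient3 \<Rightarrow> complex) \<Rightarrow> bool" where
  "hsmooth f \<longleftrightarrow> smooth_on nonzero3 (hom_ext f)"

definition sgn3 :: "('n::finite) ambient3 \<Rightarrow> 'n ambient3" where
  "sgn3 x = (sgn (fst x), sgn (fst (snd x)), sgn (snd (snd x)))"

lemma hom_ext_eq: "hom_ext f x = f (sgn3 x)"
  by (cases x) (auto simp: sgn3_def)

text \<open>An algebra closed under directional derivatives on \<open>nonzero3\<close> and containing \<open>hom_ext F\<close>.\<close>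

inductive_set homfam :: "(('n::finite) ambient3 \<Rightarrow> complex) \<Rightarrow> ('n ambient3 \<Rightarrow> complex) set" for F where
  homfam_const: "(\<lambda>x. c) \<in> homfam F"
| homfam_inner: "(\<lambda>x. of_real (x \<bullet> w)) \<in> homfam F"
| homfam_inv1: "(\<lambda>x. of_real (inverse (norm (fst x)))) \<in> homfam F"
| homfam_inv2: "(\<lambda>x. of_real (inverse (norm (fst (snd x))))) \<in> homfam F"
| homfam_inv3: "(\<lambda>x. of_real (inverse (norm (snd (snd x))))) \<in> homfam F"
| homfam_comp: "(\<lambda>x. iter_deriv vs F (sgn3 x)) \<in> homfam F"
| homfam_add: "G \<in> homfam F \<Longrightarrow> H \<in> homfam F \<Longrightarrow> (\<lambda>x. G x + H x) \<in> homfam F"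
| homfam_mult: "G \<in> homfam F \<Longrightarrow> H \<in> homfam F \<Longrightarrow> (\<lambda>x. G x * H x) \<in> homfam F"

lemma homfam_sum:
  assumes "\<And>i. i \<in> A \<Longrightarrow> G i \<in> homfam F" shows "(\<lambda>x. \<Sum>i\<in>A. G i x) \<in> homfam F"
  using assms
proof (induction A rule: infinite_finite_induct)
  case (insert x A)
  then have "(\<lambda>y. G x y + (\<Sum>i\<in>A. G i y)) \<in> homfam F" by (intro homfam_add) auto
  then show ?case using insert.hyps by simp
qed (simp_all add: homfam_const)

lemma inverse_norm_has_derivative:
  assumes "bounded_linear p" "p x \<noteq> (0::'b::real_inner)"
  shows "((\<lambda>x. complex_of_real (inverse (norm (p x)))) has_derivative
     (\<lambda>v. of_real (- (p x \<bullet> p v) * inverse (norm (p x)) ^ 3))) (at x)"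
proof -
  have "((\<lambda>x. norm (p x)) has_derivative (\<lambda>v. sgn (p x) \<bullet> p v)) (at x)"
    using has_derivative_compose[OF bounded_linear_imp_has_derivative[OF assms(1)], of norm "\<lambda>y. sgn (p x) \<bullet> y" x UNIV]
      has_derivative_norm[OF assms(2)] by (simp add: inner_commute)
  then have "((\<lambda>x. inverse (norm (p x))) has_derivative (\<lambda>v. - (inverse (norm (p x)) * (sgn (p x) \<bullet> p v) * inverse (norm (p x))))) (at x)"
    by (rule Deriv.has_derivative_inverse[rotated]) (use assms in simp)
  then have "((\<lambda>x. complex_of_real (inverse (norm (p x)))) has_derivative (\<lambda>v. of_real (- (inverse (norm (p x)) * (sgn (p x) \<bullet> p v) * inverse (norm (p x)))))) (at x)"
    by (rule bounded_linear.has_derivative[OF bounded_linear_of_real])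
  moreover have "- (inverse (norm (p x)) * (sgn (p x) \<bullet> p v) * inverse (norm (p x))) = - (p x \<bullet> p v) * inverse (norm (p x)) ^ 3" for v
    by (simp add: sgn_div_norm power3_eq_cube)
  ultimately show ?thesis by simp
qed

lemma sgn_comp_has_derivative:
  assumes "bounded_linear p" "p x \<noteq> (0::'b::real_inner)"
  shows "((\<lambda>x. sgn (p x)) has_derivative
     (\<lambda>v. inverse (norm (p x)) *\<^sub>R p v - ((p x \<bullet> p v) * inverse (norm (p x)) ^ 3) *\<^sub>R p x)) (at x)"
proof -
  have 0: "(p has_derivative p) (at x)" by (rule bounded_linear_imp_has_derivative[OF assms(1)])
  have 1: "((\<lambda>x. norm (p x)) has_derivative (\<lambda>v. sgn (p x) \<bullet> p v)) (at x)"
    using has_derivative_compose[OF bounded_linear_imp_has_derivative[OF assms(1)], of norm "\<lambda>y. sgn (p x) \<bullet> y" x UNIV]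
      has_derivative_norm[OF assms(2)] by (simp add: inner_commute)
  have 2: "((\<lambda>x. inverse (norm (p x))) has_derivative (\<lambda>v. - (inverse (norm (p x)) * (sgn (p x) \<bullet> p v) * inverse (norm (p x))))) (at x)"
    by (rule Deriv.has_derivative_inverse[OF _ 1]) (use assms in simp)
  show ?thesis unfolding sgn_div_norm
    by (rule has_derivative_eq_rhs[OF has_derivative_scaleR[OF 2 0]])
       (simp add: fun_eq_iff sgn_div_norm power3_eq_cube mult.assoc)
qed

lemma frechet_derivative_expand:
  fixes F :: "'a::euclidean_space \<Rightarrow> complex"
  assumes "F differentiable (at y)"
  shows "frechet_derivative F (at y) w = (\<Sum>b\<in>Basis. of_real (w \<bullet> b) * frechet_derivative F (at y) b)"
proof -
  have lin: "linear (frechet_derivative F (at y))"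
    using assms by (rule linear_frechet_derivative)
  have "frechet_derivative F (at y) w = frechet_derivative F (at y) (\<Sum>b\<in>Basis. (w \<bullet> b) *\<^sub>R b)"
    by (simp add: euclidean_representation)
  also have "\<dots> = (\<Sum>b\<in>Basis. (w \<bullet> b) *\<^sub>R frechet_derivative F (at y) b)"
    using lin by (simp add: linear_sum linear_scale)
  finally show ?thesis by (simp add: scaleR_conv_of_real)
qed

text \<open>\<open>e v\<close> is the block of \<open>v\<close> seen by \<open>p\<close>, padded
  with zeros, so that \<open>p x \<bullet> p v\<close> becomes a generator of the kind
  \<open>homfam_inner\<close>.\<close>

lemma homfam_inverse_norm_derivative:
  fixes F :: "('n::finite) ambient3 \<Rightarrow> complex" and p :: "'n ambient3 \<Rightarrow> 'b::real_inner"
  assumes p: "bounded_linear p" "\<And>x. x \<in> nonzero3 \<Longrightarrow> p x \<noteq> 0" "\<And>x v. p x \<bullet> p v = x \<bullet> e v"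
    and homfam: "(\<lambda>x. complex_of_real (inverse (norm (p x)))) \<in> homfam F"
  shows "\<exists>G'. (\<forall>v. G' v \<in> homfam F) \<and>
    (\<forall>x\<in>nonzero3. ((\<lambda>x. complex_of_real (inverse (norm (p x)))) has_derivative (\<lambda>v. G' v x)) (at x))"
proof (rule exI[of _ "\<lambda>v x. (- 1) * (complex_of_real (x \<bullet> e v) * (of_real (inverse (norm (p x))) * (of_real (inverse (norm (p x))) * of_real (inverse (norm (p x))))))"], intro conjI allI ballI)
  show "(\<lambda>x. (- 1) * (complex_of_real (x \<bullet> e v) * (of_real (inverse (norm (p x))) * (of_real (inverse (norm (p x))) * of_real (inverse (norm (p x))))))) \<in> homfam F" for v
    by (intro homfam_mult homfam_const homfam_inner homfam)
  fix x :: "'n ambient3" assume "x \<in> nonzero3"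
  from inverse_norm_has_derivative[OF p(1) p(2)[OF this]]
  show "((\<lambda>x. complex_of_real (inverse (norm (p x)))) has_derivative
     (\<lambda>v. (- 1) * (complex_of_real (x \<bullet> e v) * (of_real (inverse (norm (p x))) * (of_real (inverse (norm (p x))) * of_real (inverse (norm (p x)))))))) (at x)"
    by (simp add: p(3) power3_eq_cube mult.assoc)
qed

lemma normalized_derivative_inner:
  "complex_of_real ((inverse n *\<^sub>R v - ((x \<bullet> v) * inverse n ^ 3) *\<^sub>R x) \<bullet> b) =
    of_real (v \<bullet> b) * of_real (inverse n) + (- 1) * (of_real (x \<bullet> v) * (of_real (x \<bullet> b) *
      (of_real (inverse n) * (of_real (inverse n) * of_real (inverse n)))))"
  by (simp add: inner_diff_left power3_eq_cube)

lemma homfam_component: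
  assumes "(\<lambda>x. of_real (inverse (norm (p x)))) \<in> homfam F" "\<And>x v. p x \<bullet> v = x \<bullet> e v"
  shows "(\<lambda>x. of_real ((inverse (norm (p x)) *\<^sub>R v - ((p x \<bullet> v) * inverse (norm (p x)) ^ 3) *\<^sub>R p x) \<bullet> b)) \<in> homfam F"
  unfolding normalized_derivative_inner unfolding assms(2)
  by (rule homfam_add, rule homfam_mult, rule homfam_const, rule assms(1), rule homfam_mult, rule homfam_const,
      rule homfam_mult, rule homfam_inner, rule homfam_mult, rule homfam_inner, (rule homfam_mult assms(1))+)

lemma homfam_derivative:
  fixes F :: "('n::finite) ambient3 \<Rightarrow> complex"
  assumes F: "smooth_on U F" "sphere3 \<subseteq> U" and "G \<in> homfam F"
  shows "\<exists>G'. (\<forall>v. G' v \<in> homfam F) \<and> (\<forall>x\<in>nonzero3. (G has_derivative (\<lambda>v. G' v x)) (at x))"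
  using assms(3)
proof induction
  case (homfam_const c)
  show ?case by (rule exI[of _ "\<lambda>v x. 0"]) (auto intro: homfam.homfam_const)
next
  case (homfam_inner w)
  show ?case
    by (rule exI[of _ "\<lambda>v x. of_real (v \<bullet> w)"])
       (auto intro: homfam.homfam_const intro!: bounded_linear_imp_has_derivative
          bounded_linear_compose[OF bounded_linear_of_real bounded_linear_inner_left])
next
  case homfam_inv1
  show ?case
  proof (rule homfam_inverse_norm_derivative[where e = "\<lambda>v. (fst v, 0, 0)"])
    show "(\<lambda>x. complex_of_real (inverse (norm (fst x)))) \<in> homfam F" by (rule homfam.homfam_inv1)
  qed (auto simp: nonzero3_def inner_prod_def intro!: bounded_linear_intros)
next
  case homfam_inv2
  show ?case
  proof (rule homfam_inverse_norm_derivative[where e = "\<lambda>v. (0, fst (snd v), 0)"])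
    show "(\<lambda>x. complex_of_real (inverse (norm (fst (snd x))))) \<in> homfam F" by (rule homfam.homfam_inv2)
  qed (auto simp: nonzero3_def inner_prod_def intro!: bounded_linear_intros)
next
  case homfam_inv3
  show ?case
  proof (rule homfam_inverse_norm_derivative[where e = "\<lambda>v. (0, 0, snd (snd v))"])
    show "(\<lambda>x. complex_of_real (inverse (norm (snd (snd x))))) \<in> homfam F" by (rule homfam.homfam_inv3)
  qed (auto simp: nonzero3_def inner_prod_def intro!: bounded_linear_intros)
next
  case (homfam_comp vs)
  define D where "D v x = (
      inverse (norm (fst x)) *\<^sub>R fst v - ((fst x \<bullet> fst v) * inverse (norm (fst x)) ^ 3) *\<^sub>R fst x,
      inverse (norm (fst (snd x))) *\<^sub>R fst (snd v) - ((fst (snd x) \<bullet> fst (snd v)) * inverse (norm (fst (snd x))) ^ 3) *\<^sub>R fst (snd x),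
      inverse (norm (snd (snd x))) *\<^sub>R snd (snd v) - ((snd (snd x) \<bullet> snd (snd v)) * inverse (norm (snd (snd x))) ^ 3) *\<^sub>R snd (snd x))"
    for v x :: "'n ambient3"
  have D: "(sgn3 has_derivative (\<lambda>v. D v x)) (at x)" if "x \<in> nonzero3" for x
    unfolding D_def sgn3_def[abs_def]
  proof (intro has_derivative_Pair)
    show "((\<lambda>x. sgn (fst x)) has_derivative (\<lambda>v. inverse (norm (fst x)) *\<^sub>R fst v - ((fst x \<bullet> fst v) * inverse (norm (fst x)) ^ 3) *\<^sub>R fst x)) (at x)"
      using that by (intro sgn_comp_has_derivative bounded_linear_fst) (simp add: nonzero3_def)
    show "((\<lambda>x. sgn (fst (snd x))) has_derivative (\<lambda>v. inverse (norm (fst (snd x))) *\<^sub>R fst (snd v) - ((fst (snd x) \<bullet> fst (snd v)) * inverse (norm (fst (snd x))) ^ 3) *\<^sub>R fst (snd x))) (at x)"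
      using that by (intro sgn_comp_has_derivative[where p = "\<lambda>x. fst (snd x)"] bounded_linear_fst_comp bounded_linear_snd) (simp add: nonzero3_def)
    show "((\<lambda>x. sgn (snd (snd x))) has_derivative (\<lambda>v. inverse (norm (snd (snd x))) *\<^sub>R snd (snd v) - ((snd (snd x) \<bullet> snd (snd v)) * inverse (norm (snd (snd x))) ^ 3) *\<^sub>R snd (snd x))) (at x)"
      using that by (intro sgn_comp_has_derivative[where p = "\<lambda>x. snd (snd x)"] bounded_linear_snd_comp bounded_linear_snd) (simp add: nonzero3_def)
  qed
  have Db: "(\<lambda>x. of_real (D v x \<bullet> b)) \<in> homfam F" for v b
    unfolding D_def inner_prod_def fst_conv snd_conv of_real_add
  proof (intro homfam.homfam_add)
    show "(\<lambda>x. of_real ((inverse (norm (fst x)) *\<^sub>R fst v - ((fst x \<bullet> fst v) * inverse (norm (fst x)) ^ 3) *\<^sub>R fst x) \<bullet> fst b)) \<in> homfam F"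
      by (rule homfam_component[OF homfam_inv1, where e = "\<lambda>v. (v, 0, 0)"]) (simp add: inner_prod_def)
    show "(\<lambda>x. of_real ((inverse (norm (fst (snd x))) *\<^sub>R fst (snd v) - ((fst (snd x) \<bullet> fst (snd v)) * inverse (norm (fst (snd x))) ^ 3) *\<^sub>R fst (snd x)) \<bullet> fst (snd b))) \<in> homfam F"
      by (rule homfam_component[OF homfam_inv2, where e = "\<lambda>v. (0, v, 0)"]) (simp add: inner_prod_def)
    show "(\<lambda>x. of_real ((inverse (norm (snd (snd x))) *\<^sub>R snd (snd v) - ((snd (snd x) \<bullet> snd (snd v)) * inverse (norm (snd (snd x))) ^ 3) *\<^sub>R snd (snd x)) \<bullet> snd (snd b))) \<in> homfam F"
      by (rule homfam_component[OF homfam_inv3, where e = "\<lambda>v. (0, 0, v)"]) (simp add: inner_prod_def)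
  qed
  \<comment> \<open>Chain rule for \<open>iter_deriv vs F\<close> after \<open>sgn3\<close>,
    expanded in the basis: one more direction \<open>b\<close> is put in front of \<open>vs\<close>,
    with a component of the derivative of \<open>sgn3\<close> as coefficient.\<close>
  show ?case
  proof (rule exI[of _ "\<lambda>v x. \<Sum>b\<in>Basis. of_real (D v x \<bullet> b) * iter_deriv (b # vs) F (sgn3 x)"], intro conjI allI ballI)
    show "(\<lambda>x. \<Sum>b\<in>Basis. of_real (D v x \<bullet> b) * iter_deriv (b # vs) F (sgn3 x)) \<in> homfam F" for v
      by (intro homfam_sum homfam.homfam_mult Db homfam.homfam_comp)
    fix x :: "'n ambient3" assume x: "x \<in> nonzero3"
    then have "sgn3 x \<in> sphere3" by (auto simp: sgn3_def nonzero3_def norm_sgn)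
    with F(2) have "sgn3 x \<in> U" by (rule subsetD)
    then have diff: "iter_deriv vs F differentiable at (sgn3 x)"
      by (rule F(1)[unfolded smooth_on_def, rule_format])
    have "((\<lambda>x. iter_deriv vs F (sgn3 x)) has_derivative (\<lambda>v. frechet_derivative (iter_deriv vs F) (at (sgn3 x)) (D v x))) (at x)"
      using has_derivative_compose[OF D[OF x] diff[unfolded frechet_derivative_works]] .
    then show "((\<lambda>x. iter_deriv vs F (sgn3 x)) has_derivative
        (\<lambda>v. \<Sum>b\<in>Basis. of_real (D v x \<bullet> b) * iter_deriv (b # vs) F (sgn3 x))) (at x)"
      unfolding frechet_derivative_expand[OF diff, of "D _ x"] by simp
  qed
next
  case (homfam_add G H)
  then obtain G' H' where "\<And>v. G' v \<in> homfam F" "\<And>x. x \<in> nonzero3 \<Longrightarrow> (G has_derivative (\<lambda>v. G' v x)) (at x)"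
    "\<And>v. H' v \<in> homfam F" "\<And>x. x \<in> nonzero3 \<Longrightarrow> (H has_derivative (\<lambda>v. H' v x)) (at x)" by blast
  then show ?case
    by (intro exI[of _ "\<lambda>v x. G' v x + H' v x"] conjI allI ballI homfam.homfam_add has_derivative_add) auto
next
  case (homfam_mult G H)
  then obtain G' H' where *: "\<And>v. G' v \<in> homfam F" "\<And>x. x \<in> nonzero3 \<Longrightarrow> (G has_derivative (\<lambda>v. G' v x)) (at x)"
    "\<And>v. H' v \<in> homfam F" "\<And>x. x \<in> nonzero3 \<Longrightarrow> (H has_derivative (\<lambda>v. H' v x)) (at x)" by blast
  show ?case
  proof (rule exI[of _ "\<lambda>v x. G x * H' v x + G' v x * H x"], intro conjI allI ballI)
    show "(\<lambda>x. G x * H' v x + G' v x * H x) \<in> homfam F" for v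
      by (intro homfam.homfam_add homfam.homfam_mult * homfam_mult)
    show "((\<lambda>x. G x * H x) has_derivative (\<lambda>v. G x * H' v x + G' v x * H x)) (at x)" if "x \<in> nonzero3" for x
      by (rule has_derivative_mult[OF *(2)[OF that] *(4)[OF that]])
  qed
qed

lemma test_funs_hsmooth:
  assumes "f \<in> test_funs" shows "hsmooth f"
proof -
  from assms obtain U F where F: "sphere3 \<subseteq> U" "smooth_on U F" "\<And>x. x \<in> sphere3 \<Longrightarrow> f x = F x"
    unfolding test_funs_def by blast
  show ?thesis unfolding hsmooth_def
  proof (rule smooth_on_family[OF open_nonzero3 homfam_derivative[OF F(2,1)] homfam_comp[of "[]"]])
    fix x :: "'a ambient3" assume "x \<in> nonzero3"
    then have "sgn3 x \<in> sphere3" by (auto simp: sgn3_def nonzero3_def norm_sgn)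
    then show "hom_ext f x = iter_deriv [] F (sgn3 x)" using F(3) by (simp add: hom_ext_eq)
  qed
qed

lemma hsmooth_differentiable:
  "hsmooth f \<Longrightarrow> x \<in> nonzero3 \<Longrightarrow> iter_deriv vs (hom_ext f) differentiable (at x)"
  unfolding hsmooth_def smooth_on_def by blast

lemma hsmooth_lincomb:
  assumes "hsmooth f" "hsmooth g"
  shows "hsmooth (\<lambda>x. a * f x + b * g x)"
  unfolding hsmooth_def
proof (rule smooth_on_family[OF open_nonzero3, where \<G> = "{(\<lambda>x. a * iter_deriv vs (hom_ext f) x + b * iter_deriv ws (hom_ext g) x) | vs ws. True}"
      and G = "\<lambda>x. a * iter_deriv [] (hom_ext f) x + b * iter_deriv [] (hom_ext g) x"])
  fix G assume "G \<in> {(\<lambda>x. a * iter_deriv vs (hom_ext f) x + b * iter_deriv ws (hom_ext g) x) | vs ws. True}"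
  then obtain vs ws where G: "G = (\<lambda>x. a * iter_deriv vs (hom_ext f) x + b * iter_deriv ws (hom_ext g) x)" by blast
  show "\<exists>G'. (\<forall>v. G' v \<in> {(\<lambda>x. a * iter_deriv vs (hom_ext f) x + b * iter_deriv ws (hom_ext g) x) | vs ws. True}) \<and>
      (\<forall>x\<in>nonzero3. (G has_derivative (\<lambda>v. G' v x)) (at x))"
  proof (rule exI[of _ "\<lambda>v x. a * iter_deriv (v # vs) (hom_ext f) x + b * iter_deriv (v # ws) (hom_ext g) x"], intro conjI allI ballI)
    fix x :: "'a ambient3" assume x: "x \<in> nonzero3"
    show "(G has_derivative (\<lambda>v. a * iter_deriv (v # vs) (hom_ext f) x + b * iter_deriv (v # ws) (hom_ext g) x)) (at x)"
      unfolding G iter_deriv.simps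
      by (intro has_derivative_add has_derivative_mult_right)
         (use hsmooth_differentiable[OF assms(1) x] hsmooth_differentiable[OF assms(2) x] in
           \<open>simp_all only: frechet_derivative_works[symmetric]\<close>)
  qed blast
qed (blast, simp add: hom_ext_eq)

section \<open>Bounded families of test functions and their restriction to curves\<close>

lemma compact_sphere3: "compact (sphere3 :: ('n::finite) ambient3 set)"
  by (intro compact_Times compact_sphere)

lemma closed_sphere3: "closed (sphere3 :: ('n::finite) ambient3 set)"
  by (intro closed_Times closed_sphere)

lemma hsmooth_continuous_on: "hsmooth f \<Longrightarrow> continuous_on sphere3 (iter_deriv vs (hom_ext f))"
  using sphere3_subset_nonzero3
  by (intro continuous_at_imp_continuous_on ballI differentiable_imp_continuous_within hsmooth_differentiable) auto

text \<open>A bounded subset, indexed by \<open>P\<close>, of the Frechet space of test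
  functions.\<close>

definition dbounded :: "'p set \<Rightarrow> ('p \<Rightarrow> ('n::finite) ambient3 \<Rightarrow> complex) \<Rightarrow> bool" where
  "dbounded P f \<longleftrightarrow> (\<forall>p\<in>P. hsmooth (f p)) \<and>
     (\<forall>vs. \<exists>C. \<forall>p\<in>P. \<forall>x\<in>sphere3. norm (iter_deriv vs (hom_ext (f p)) x) \<le> C)"

lemma hsmooth_bounded:
  assumes "hsmooth (f :: ('n::finite) ambient3 \<Rightarrow> complex)"
  shows "\<exists>C. \<forall>x\<in>sphere3. norm (iter_deriv vs (hom_ext f) x) \<le> C"
proof -
  have "compact (iter_deriv vs (hom_ext f) ` sphere3)"
    by (intro compact_continuous_image hsmooth_continuous_on assms compact_sphere3)
  then have "bounded (iter_deriv vs (hom_ext f) ` sphere3)" by (rule compact_imp_bounded)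
  then show ?thesis unfolding bounded_iff by blast
qed

lemma dbounded_const: "hsmooth f \<Longrightarrow> dbounded P (\<lambda>_. f)"
  unfolding dbounded_def using hsmooth_bounded by blast

text \<open>A convergent sequence is bounded: the tail lies within 1 of the limit, and finitely many
  terms remain.\<close>

lemma dbounded_seq:
  assumes "\<And>i. hsmooth (f i)" "hsmooth g" "test_tendsto f g"
  shows "dbounded UNIV f"
  unfolding dbounded_def
proof (intro conjI ballI allI)
  fix vs
  obtain C0 where C0: "\<forall>x\<in>sphere3. norm (iter_deriv vs (hom_ext g) x) \<le> C0"
    using hsmooth_bounded[OF assms(2)] by blast
  have "\<forall>i. \<exists>C. \<forall>x\<in>sphere3. norm (iter_deriv vs (hom_ext (f i)) x) \<le> C"
    using hsmooth_bounded[OF assms(1)] by blast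
  then obtain C where C: "\<And>i x. x \<in> sphere3 \<Longrightarrow> norm (iter_deriv vs (hom_ext (f i)) x) \<le> C i" by metis
  have "uniform_limit sphere3 (\<lambda>i. iter_deriv vs (hom_ext (f i))) (iter_deriv vs (hom_ext g)) sequentially"
    using assms(3) unfolding test_tendsto_def by blast
  then have "\<forall>\<^sub>F i in sequentially. \<forall>x\<in>sphere3. dist (iter_deriv vs (hom_ext (f i)) x) (iter_deriv vs (hom_ext g) x) < 1"
    by (rule uniform_limitD) simp
  then obtain N where N: "\<And>i x. i \<ge> N \<Longrightarrow> x \<in> sphere3 \<Longrightarrow> dist (iter_deriv vs (hom_ext (f i)) x) (iter_deriv vs (hom_ext g) x) < 1"
    unfolding eventually_sequentially by blast
  have "norm (iter_deriv vs (hom_ext (f i)) x) \<le> \<bar>C0\<bar> + 1 + (\<Sum>j<N. \<bar>C j\<bar>)" if x: "x \<in> sphere3" for i x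
  proof (cases "i < N")
    case True
    have "norm (iter_deriv vs (hom_ext (f i)) x) \<le> \<bar>C i\<bar>" using C[OF x, of i] by linarith
    also have "\<dots> \<le> (\<Sum>j<N. \<bar>C j\<bar>)" using True by (intro member_le_sum) auto
    finally show ?thesis by linarith
  next
    case False
    have "norm (iter_deriv vs (hom_ext (f i)) x) \<le> norm (iter_deriv vs (hom_ext g) x) + dist (iter_deriv vs (hom_ext (f i)) x) (iter_deriv vs (hom_ext g) x)"
      unfolding dist_norm by (rule norm_triangle_sub)
    also have "\<dots> \<le> C0 + 1" using C0 x N[OF _ x, of i] False by (intro add_mono) (auto simp: less_imp_le)
    moreover have "0 \<le> (\<Sum>j<N. \<bar>C j\<bar>)" by (intro sum_nonneg) auto
    ultimately show ?thesis by linarith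
  qed
  then show "\<exists>C. \<forall>i\<in>UNIV. \<forall>x\<in>sphere3. norm (iter_deriv vs (hom_ext (f i)) x) \<le> C" by blast
qed (rule assms)

lemma sgn3_sphere3: "x \<in> sphere3 \<Longrightarrow> sgn3 x = x"
  by (cases x) (auto simp: sgn3_def sgn_div_norm)

lemma hom_ext_sphere3: "x \<in> sphere3 \<Longrightarrow> hom_ext f x = f x"
  by (simp add: hom_ext_eq sgn3_sphere3)

text \<open>The chain rule turns a derivative in \<open>r\<close> into one more direction
  \<open>b\<close> in front of \<open>vs\<close>, times a component of the velocity. Hence the
  induction is over all \<open>vs\<close> at once, and the regularity of the curve enters through
  its velocity.\<close>

lemma cn_bdd_curve:
  fixes f :: "'p \<Rightarrow> ('n::finite) ambient3 \<Rightarrow> complex"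
  assumes f: "dbounded P f"
    and on: "\<And>p r. p \<in> P \<Longrightarrow> r \<in> {-1..1} \<Longrightarrow> \<gamma> p r \<in> sphere3"
    and der: "\<And>p r. p \<in> P \<Longrightarrow> r \<in> {-1..1} \<Longrightarrow> (\<gamma> p has_vector_derivative \<gamma>' p r) (at r within {-1..1})"
    and sm: "\<And>b. b \<in> Basis \<Longrightarrow> cn_bdd n P (\<lambda>p r. of_real (\<gamma>' p r \<bullet> b))"
  shows "k \<le> n \<Longrightarrow> cn_bdd k P (\<lambda>p r. iter_deriv vs (hom_ext (f p)) (\<gamma> p r))"
proof (induction k arbitrary: vs)
  have ub: "unif_bdd P (\<lambda>p r. iter_deriv vs (hom_ext (f p)) (\<gamma> p r))" for vs
  proof -
    obtain C where "\<forall>p\<in>P. \<forall>x\<in>sphere3. norm (iter_deriv vs (hom_ext (f p)) x) \<le> C"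
      using f unfolding dbounded_def by blast
    then show ?thesis unfolding unif_bdd_def using on by blast
  qed
  {
    case 0
    show ?case unfolding cn_bdd.simps by (rule ub)
  next
    case (Suc k)
    have "cn_bdd k P (\<lambda>p r. \<Sum>b\<in>Basis. of_real (\<gamma>' p r \<bullet> b) * iter_deriv (b # vs) (hom_ext (f p)) (\<gamma> p r))"
      using Suc.prems by (intro cn_bdd_sum cn_bdd_mult Suc.IH cn_bdd_mono[OF sm]) auto
    then show ?case
    proof (rule cn_bdd_SucI[OF ub], intro vderI)
      fix p and r :: real assume pr: "p \<in> P" "r \<in> {-1..1}"
      have diff: "iter_deriv vs (hom_ext (f p)) differentiable at (\<gamma> p r)"
        using f on[OF pr] pr sphere3_subset_nonzero3 unfolding dbounded_def
        by (intro hsmooth_differentiable) auto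
      have "((\<lambda>r. iter_deriv vs (hom_ext (f p)) (\<gamma> p r)) has_derivative
          (\<lambda>t. frechet_derivative (iter_deriv vs (hom_ext (f p))) (at (\<gamma> p r)) (t *\<^sub>R \<gamma>' p r))) (at r within {-1..1})"
        using has_derivative_compose[OF der[OF pr, unfolded has_vector_derivative_def] diff[unfolded frechet_derivative_works]] .
      moreover have "frechet_derivative (iter_deriv vs (hom_ext (f p))) (at (\<gamma> p r)) (t *\<^sub>R \<gamma>' p r) =
          t *\<^sub>R (\<Sum>b\<in>Basis. of_real (\<gamma>' p r \<bullet> b) * iter_deriv (b # vs) (hom_ext (f p)) (\<gamma> p r))" for t
        unfolding iter_deriv.simps frechet_derivative_expand[OF diff, symmetric]
        using linear_frechet_derivative[OF diff] by (simp add: linear_scale)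
      ultimately show "((\<lambda>r. iter_deriv vs (hom_ext (f p)) (\<gamma> p r)) has_vector_derivative
          (\<Sum>b\<in>Basis. of_real (\<gamma>' p r \<bullet> b) * iter_deriv (b # vs) (hom_ext (f p)) (\<gamma> p r))) (at r within {-1..1})"
        unfolding has_vector_derivative_def by simp
    qed
  }
qed

section \<open>Mellin transforms and dilations\<close>

lemma lborel2_scale:
  fixes f :: "real \<times> real \<Rightarrow> complex"
  assumes "c1 \<noteq> 0" "c2 \<noteq> 0" "integrable lborel f"
  shows "integrable lborel (\<lambda>x. f (c1 * fst x, c2 * snd x))"
    and "(\<integral>x. f (c1 * fst x, c2 * snd x) \<partial>lborel) = (\<integral>x. f x \<partial>lborel) / of_real (\<bar>c1\<bar> * \<bar>c2\<bar>)"
proof -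
  define T where "T x = (c1 * fst x, c2 * snd x)" for x :: "real \<times> real"
  have B: "(Basis :: (real \<times> real) set) = {(1,0), (0,1)}" by (auto simp: Basis_prod_def)
  have *: "(lborel :: (real \<times> real) measure) = density (distr lborel borel T) (\<lambda>_. ennreal (\<bar>c1\<bar> * \<bar>c2\<bar>))"
  proof -
    define c where "c b = (if b = (1,0) then c1 else c2)" for b :: "real \<times> real"
    have c: "\<And>j. j \<in> Basis \<Longrightarrow> c j \<noteq> 0" using assms by (auto simp: c_def)
    have "T = (\<lambda>x. 0 + (\<Sum>j\<in>Basis. (c j * (x \<bullet> j)) *\<^sub>R j))"
      unfolding B by (auto simp: T_def c_def fun_eq_iff)
    moreover have "(\<Prod>j\<in>Basis. \<bar>c j\<bar>) = \<bar>c1\<bar> * \<bar>c2\<bar>" unfolding B by (simp add: c_def)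
    ultimately show ?thesis using lborel_affine_euclidean[where c = c and t = 0] c by simp
  qed
  have [measurable]: "T \<in> borel \<rightarrow>\<^sub>M borel" unfolding T_def[abs_def]
    by (intro borel_measurable_continuous_onI continuous_intros)
  have [measurable]: "f \<in> borel_measurable borel" using assms(3) by (auto dest: borel_measurable_integrable)
  have c0: "\<bar>c1\<bar> * \<bar>c2\<bar> > 0" using assms by simp
  have "integrable (density (distr lborel borel T) (\<lambda>_. ennreal (\<bar>c1\<bar> * \<bar>c2\<bar>))) f"
    using assms(3) by (subst (asm) *)
  then have "integrable lborel (\<lambda>x. (\<bar>c1\<bar> * \<bar>c2\<bar>) *\<^sub>R f (T x))"
    by (simp add: integrable_density integrable_distr_eq)
  then show "integrable lborel (\<lambda>x. f (c1 * fst x, c2 * snd x))"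
  proof -
    assume "integrable lborel (\<lambda>x. (\<bar>c1\<bar> * \<bar>c2\<bar>) *\<^sub>R f (T x))"
    from integrable_scaleR_right[OF this, of "inverse (\<bar>c1\<bar> * \<bar>c2\<bar>)"]
    moreover have "inverse (\<bar>c1\<bar> * \<bar>c2\<bar>) * (\<bar>c1\<bar> * \<bar>c2\<bar>) = 1" using c0 by (metis left_inverse less_irrefl)
    ultimately show ?thesis by (simp only: scaleR_scaleR scaleR_one T_def)
  qed
  have "(\<integral>x. f x \<partial>lborel) = (\<integral>x. f x \<partial>density (distr lborel borel T) (\<lambda>_. ennreal (\<bar>c1\<bar> * \<bar>c2\<bar>)))"
    by (subst *) simp
  also have "\<dots> = (\<bar>c1\<bar> * \<bar>c2\<bar>) *\<^sub>R (\<integral>x. f (T x) \<partial>lborel)"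
    by (simp add: integral_density integral_distr)
  finally show "(\<integral>x. f (c1 * fst x, c2 * snd x) \<partial>lborel) = (\<integral>x. f x \<partial>lborel) / of_real (\<bar>c1\<bar> * \<bar>c2\<bar>)"
    using c0 assms by (simp add: T_def scaleR_conv_of_real)
qed

definition mweight :: "complex \<Rightarrow> complex \<Rightarrow> real \<times> real \<Rightarrow> complex" where
  "mweight z1 z2 x = of_real \<bar>fst x\<bar> powr (z1 - 1) * of_real \<bar>snd x\<bar> powr (z2 - 1)"

definition dilop2 :: "real \<Rightarrow> nat \<Rightarrow> (real \<Rightarrow> real \<Rightarrow> complex) \<Rightarrow> real \<times> real \<Rightarrow> complex" where
  "dilop2 lam m h x = dilop lam m (\<lambda>r. dilop lam m (h r) (snd x)) (fst x)"

text \<open>Allows the two-variable operator to be estimated in either variable first.\<close>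

lemma dilop_swap: "dilop lam m (\<lambda>r. dilop lam m (h r) s) r = dilop lam m (\<lambda>s. dilop lam m (\<lambda>r. h r s) r) s"
proof -
  let ?c = "coeff (dilpoly lam m)" and ?A = "{..degree (dilpoly lam m)}"
  have "dilop lam m (\<lambda>r. dilop lam m (h r) s) r = (\<Sum>l\<in>?A. \<Sum>k\<in>?A. ?c l * ?c k *
      ((h (lam^l * r) (lam^k * s) + h (lam^l * r) (-(lam^k * s)) + h (-(lam^l * r)) (lam^k * s) + h (-(lam^l * r)) (-(lam^k * s))) / 4))"
    unfolding dilop_def sum.distrib[symmetric] sum_divide_distrib sum_distrib_left
    by (intro sum.cong refl) (simp add: field_simps)
  also have "\<dots> = (\<Sum>k\<in>?A. \<Sum>l\<in>?A. ?c l * ?c k *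
      ((h (lam^l * r) (lam^k * s) + h (lam^l * r) (-(lam^k * s)) + h (-(lam^l * r)) (lam^k * s) + h (-(lam^l * r)) (-(lam^k * s))) / 4))"
    by (rule sum.swap)
  also have "\<dots> = dilop lam m (\<lambda>s. dilop lam m (\<lambda>r. h r s) r) s"
    unfolding dilop_def sum.distrib[symmetric] sum_divide_distrib sum_distrib_left
    by (intro sum.cong refl) (simp add: field_simps)
  finally show ?thesis .
qed

lemma mweight_scale:
  assumes "c > 0" "d > 0" "s \<in> {1, -1}" "t \<in> {1, -1}"
  shows "mweight z1 z2 (fst x, snd x) = of_real c powr (1 - z1) * of_real d powr (1 - z2) * mweight z1 z2 (s * c * fst x, t * d * snd x)"
proof -
  have 1: "complex_of_real \<bar>y\<bar> powr (z - 1) = of_real c powr (1 - z) * of_real \<bar>s * c * y\<bar> powr (z - 1)"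
    if "c > 0" "s \<in> {1, -1}" for c s y z
  proof -
    have "of_real \<bar>s * c * y\<bar> powr (z - 1) = of_real c powr (z - 1) * complex_of_real \<bar>y\<bar> powr (z - 1)"
      using that by (auto simp: abs_mult powr_times_real)
    moreover have "complex_of_real c powr (1 - z) * of_real c powr (z - 1) = 1"
      using that by (simp add: powr_add[symmetric])
    ultimately show ?thesis by (simp add: mult.assoc[symmetric])
  qed
  show ?thesis unfolding mweight_def fst_conv snd_conv
    using 1[OF assms(1,3), of "fst x" z1] 1[OF assms(2,4), of "snd x" z2] by (simp add: mult_ac)
qed

lemma mellin_scale:
  assumes int: "integrable lborel (\<lambda>x. mweight z1 z2 x * h (fst x) (snd x))"
    and c: "c > 0" "d > 0" "s \<in> {1, -1}" "t \<in> {1, -1}"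
  shows "integrable lborel (\<lambda>x. mweight z1 z2 x * h (s * c * fst x) (t * d * snd x))"
    and "(\<integral>x. mweight z1 z2 x * h (s * c * fst x) (t * d * snd x) \<partial>lborel) =
      of_real c powr (- z1) * of_real d powr (- z2) * (\<integral>x. mweight z1 z2 x * h (fst x) (snd x) \<partial>lborel)"
proof -
  define F where "F x = mweight z1 z2 x * h (fst x) (snd x)" for x
  have nz: "s * c \<noteq> 0" "t * d \<noteq> 0" using c by auto
  have eq: "mweight z1 z2 x * h (s * c * fst x) (t * d * snd x) =
      of_real c powr (1 - z1) * of_real d powr (1 - z2) * F (s * c * fst x, t * d * snd x)" for x
    using mweight_scale[OF c, of z1 z2 x] by (simp add: F_def)
  note sc = lborel2_scale[OF nz int[folded F_def]]
  show "integrable lborel (\<lambda>x. mweight z1 z2 x * h (s * c * fst x) (t * d * snd x))"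
    unfolding eq by (intro integrable_mult_right sc)
  have p: "complex_of_real c powr (1 - z) = of_real c * of_real c powr (- z)" if "c > 0" for c z
    using that by (simp add: powr_diff powr_minus field_simps)
  have "\<bar>s * c\<bar> * \<bar>t * d\<bar> = c * d" using c by (auto simp: abs_mult)
  then show "(\<integral>x. mweight z1 z2 x * h (s * c * fst x) (t * d * snd x) \<partial>lborel) =
      of_real c powr (- z1) * of_real d powr (- z2) * (\<integral>x. mweight z1 z2 x * h (fst x) (snd x) \<partial>lborel)"
    unfolding eq using sc(2) c p[OF c(1)] p[OF c(2)] by (simp add: F_def)
qed

text \<open>This is \<open>D(z)\<close> of the overview.\<close>

definition dfac :: "real \<Rightarrow> nat \<Rightarrow> complex \<Rightarrow> complex" where
  "dfac lam m z = poly (dilpoly lam m) (of_real lam powr (- z))"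

text \<open>Dilating by \<open>c\<close> multiplies the Mellin integral by
  \<open>c powr (- z)\<close>, with either sign since the weight is even; the sums over dilations
  then add up to the polynomial at \<open>lam powr (- z)\<close>.\<close>

lemma mellin_dilop2:
  assumes int: "integrable lborel (\<lambda>x. mweight z1 z2 x * h (fst x) (snd x))" and lam: "lam > 0"
  shows "(\<integral>x. mweight z1 z2 x * dilop2 lam m h x \<partial>lborel) =
      dfac lam m z1 * dfac lam m z2 * (\<integral>x. mweight z1 z2 x * h (fst x) (snd x) \<partial>lborel)"
proof -
  let ?c = "coeff (dilpoly lam m)" and ?A = "{..degree (dilpoly lam m)}"
  let ?I = "\<integral>x. mweight z1 z2 x * h (fst x) (snd x) \<partial>lborel"
  define T where "T l k s t x = mweight z1 z2 x * h (s * lam^l * fst x) (t * lam^k * snd x)" for l k s t x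
  have T: "integrable lborel (T l k s t)" "(\<integral>x. T l k s t x \<partial>lborel) = (of_real lam powr (- z1))^l * (of_real lam powr (- z2))^k * ?I"
    if "s \<in> {1,-1}" "t \<in> {1,-1}" for l k s t
  proof -
    have p: "complex_of_real (lam ^ l) powr z = (of_real lam powr z) ^ l" for l z
      using lam by (induction l) (simp_all add: powr_times_real)
    show "integrable lborel (T l k s t)"
      unfolding T_def using mellin_scale(1)[OF int, of "lam^l" "lam^k" s t] lam that by simp
    show "(\<integral>x. T l k s t x \<partial>lborel) = (of_real lam powr (- z1))^l * (of_real lam powr (- z2))^k * ?I"
      unfolding T_def using mellin_scale(2)[OF int, of "lam^l" "lam^k" s t] lam that by (simp add: p del: of_real_power)
  qed
  have "mweight z1 z2 x * dilop2 lam m h x = (\<Sum>l\<in>?A. \<Sum>k\<in>?A. ?c l * ?c k *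
      ((T l k 1 1 x + T l k 1 (-1) x + T l k (-1) 1 x + T l k (-1) (-1) x) / 4))" for x
    unfolding dilop2_def dilop_def T_def sum.distrib[symmetric] sum_divide_distrib sum_distrib_left
    by (intro sum.cong refl) (simp add: field_simps)
  then have "(\<integral>x. mweight z1 z2 x * dilop2 lam m h x \<partial>lborel) = (\<integral>x. (\<Sum>l\<in>?A. \<Sum>k\<in>?A. ?c l * ?c k *
      ((T l k 1 1 x + T l k 1 (-1) x + T l k (-1) 1 x + T l k (-1) (-1) x) / 4)) \<partial>lborel)"
    by simp
  also have "\<dots> = (\<Sum>l\<in>?A. \<Sum>k\<in>?A. (\<integral>x. ?c l * ?c k *
      ((T l k 1 1 x + T l k 1 (-1) x + T l k (-1) 1 x + T l k (-1) (-1) x) / 4) \<partial>lborel))"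
  proof -
    have U: "integrable lborel (\<lambda>x. ?c l * ?c k * ((T l k 1 1 x + T l k 1 (-1) x + T l k (-1) 1 x + T l k (-1) (-1) x) / 4))" for l k
      by (intro integrable_mult_right integrable_divide_zero Bochner_Integration.integrable_add T) auto
    show ?thesis
      by (rule trans[OF Bochner_Integration.integral_sum sum.cong[OF refl Bochner_Integration.integral_sum]])
         (intro Bochner_Integration.integrable_sum U)+
  qed
  also have "\<dots> = (\<Sum>l\<in>?A. \<Sum>k\<in>?A. (?c l * (of_real lam powr (- z1))^l) * (?c k * (of_real lam powr (- z2))^k) * ?I)"
  proof (intro sum.cong refl)
    fix l k
    have "(\<integral>x. ?c l * ?c k * ((T l k 1 1 x + T l k 1 (-1) x + T l k (-1) 1 x + T l k (-1) (-1) x) / 4) \<partial>lborel)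
       = ?c l * ?c k * (((\<integral>x. T l k 1 1 x \<partial>lborel) + (\<integral>x. T l k 1 (-1) x \<partial>lborel) + (\<integral>x. T l k (-1) 1 x \<partial>lborel) + (\<integral>x. T l k (-1) (-1) x \<partial>lborel)) / 4)"
      by (simp add: T(1))
    then show "(\<integral>x. ?c l * ?c k * ((T l k 1 1 x + T l k 1 (-1) x + T l k (-1) 1 x + T l k (-1) (-1) x) / 4) \<partial>lborel)
      = (?c l * (of_real lam powr (- z1))^l) * (?c k * (of_real lam powr (- z2))^k) * ?I"
      by (simp add: T(2) mult_ac)
  qed
  also have "\<dots> = dfac lam m z1 * dfac lam m z2 * ?I"
  proof -
    have "dfac lam m z1 * dfac lam m z2 =
        (\<Sum>l\<in>?A. \<Sum>k\<in>?A. (?c l * (of_real lam powr (- z1))^l) * (?c k * (of_real lam powr (- z2))^k))"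
      unfolding dfac_def poly_altdef by (rule sum_product)
    then show ?thesis by (simp only: sum_distrib_right)
  qed
  finally show ?thesis .
qed

section \<open>The zeros of the Mellin factor\<close>

definition expm1_quot :: "complex \<Rightarrow> complex" where
  "expm1_quot w = (if w = 0 then 1 else (exp w - 1) / w)"

lemma expm1_quot_holomorphic: "expm1_quot holomorphic_on UNIV"
proof -
  have d: "deriv (\<lambda>w. exp w - 1) (0::complex) = 1"
    by (rule DERIV_imp_deriv) (auto intro!: derivative_eq_intros)
  show ?thesis
    by (rule pole_theorem_open_0[where g = "\<lambda>w. exp w - 1" and a = 0])
       (auto simp: d expm1_quot_def intro!: holomorphic_intros)
qed

lemma expm1_quot: "exp w - 1 = w * expm1_quot w"
  by (simp add: expm1_quot_def)

lemma expm1_quot_nonzero: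
  assumes "\<bar>Im w\<bar> < 2 * pi" shows "expm1_quot w \<noteq> 0"
proof
  assume "expm1_quot w = 0"
  then have w: "w \<noteq> 0" "exp w = 1" by (auto simp: expm1_quot_def split: if_splits)
  then obtain k :: int where k: "Re w = 0" "Im w = of_int (2 * k) * pi" by (auto simp: exp_eq_1)
  then have "k \<noteq> 0" using w(1) by (auto simp: complex_eq_iff)
  then have "1 \<le> \<bar>real_of_int k\<bar>" by linarith
  then have "2 * pi * 1 \<le> 2 * pi * \<bar>real_of_int k\<bar>" by (intro mult_left_mono) auto
  then show False using assms k(2) by (simp add: abs_mult)
qed

text \<open>What is left of \<open>D(z)\<close> after division by its zeros \<open>z = -2j\<close>.\<close>

definition dunit :: "real \<Rightarrow> nat \<Rightarrow> complex \<Rightarrow> complex" where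
  "dunit eps m z = (\<Prod>j<m. exp (- of_real (2 * real j * eps)) * (of_real eps * expm1_quot (of_real eps * (z + 2 * of_nat j))))"

text \<open>With \<open>lam = exp (- eps)\<close> the factor of index \<open>j\<close> is
  \<open>exp (- 2 j eps) * (exp (eps * (z + 2 j)) - 1)\<close>, and \<open>exp w - 1\<close> is
  \<open>w\<close> times an entire function.\<close>

lemma dfac_factor:
  assumes "eps > 0"
  shows "dfac (exp (- eps)) m z = dunit eps m z * (\<Prod>j<m. z + 2 * of_nat j)"
proof -
  have p: "complex_of_real (exp (- eps)) powr (- z) = exp (of_real eps * z)"
    by (simp add: powr_def flip: exp_of_real)
       (simp add: exp_minus Ln_exp mult.commute flip: of_real_minus exp_of_real)
  have "exp (of_real eps * z) - of_real (exp (- eps) ^ (2 * j)) =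
      exp (- of_real (2 * real j * eps)) * (of_real eps * expm1_quot (of_real eps * (z + 2 * of_nat j))) * (z + 2 * of_nat j)" for j
  proof -
    have "complex_of_real (exp (- eps) ^ (2 * j)) = exp (- of_real (2 * real j * eps))"
      by (simp add: exp_of_real[symmetric] exp_of_nat_mult[symmetric] mult_ac del: exp_of_real)
    then have "exp (of_real eps * z) - of_real (exp (- eps) ^ (2 * j)) =
       exp (- complex_of_real (2 * real j * eps)) * (exp (of_real eps * (z + 2 * of_nat j)) - 1)"
    proof -
      have "exp (of_real eps * (z + 2 * of_nat j)) = exp (of_real eps * z) * exp (complex_of_real (2 * real j * eps))"
        by (simp add: exp_add[symmetric] algebra_simps)
      moreover assume "complex_of_real (exp (- eps) ^ (2 * j)) = exp (- of_real (2 * real j * eps))"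
      ultimately show ?thesis by (simp only: right_diff_distrib) (simp add: exp_minus)
    qed
    then show ?thesis unfolding expm1_quot by (simp add: mult_ac)
  qed
  then show ?thesis
    unfolding dfac_def poly_dilpoly p dunit_def prod.distrib[symmetric] by (intro prod.cong refl) simp
qed

text \<open>The remaining zeros differ from the points \<open>-2j\<close> by nonzero multiples of
  \<open>2 pi i / eps\<close>, so a small \<open>eps\<close> pushes them out of a given
  strip.\<close>

lemma dunit_nonzero:
  assumes "eps > 0" "\<bar>Im z\<bar> * eps < 2 * pi" shows "dunit eps m z \<noteq> 0"
  unfolding dunit_def using assms
  by (auto intro!: expm1_quot_nonzero simp: abs_mult mult.commute)

lemma cdiff_dunit:
  assumes "cdiff F z" shows "cdiff (\<lambda>z. dunit eps m (F z)) z"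
  unfolding dunit_def
proof (intro cdiff_prod cdiff_mult cdiff_const)
  fix j
  show "cdiff (\<lambda>z. expm1_quot (of_real eps * (F z + 2 * of_nat j))) z"
    by (rule cdiff_compose[where g = expm1_quot, OF _ holomorphic_derivI[OF expm1_quot_holomorphic]])
       (auto intro!: cdiff_mult cdiff_add cdiff_const assms)
qed

section \<open>Polar coordinates on the sphere\<close>

lemma borel_measurable_indicator_cball [measurable]:
  "(indicator (cball a r) :: 'a::euclidean_space \<Rightarrow> ennreal) \<in> borel_measurable borel"
  by (rule borel_measurable_indicator) simp

lemma measurable_sgn_euclidean [measurable]:
  "(sgn :: 'a::euclidean_space \<Rightarrow> 'a) \<in> borel_measurable borel"
proof -
  have "(\<lambda>x :: 'a. x /\<^sub>R norm x) \<in> borel_measurable borel" by measurable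
  then show ?thesis by (simp add: sgn_div_norm[abs_def])
qed

abbreviation sm :: "(real ^ 'n) measure" where "sm \<equiv> sphere_measure"

lemma sets_sm: "sets sm = sets (restrict_space borel (sphere 0 1))"
  by (simp add: sphere_measure_def)

lemma space_sm: "space sm = sphere 0 1"
  using sets_eq_imp_space_eq[OF sets_sm] by (simp add: space_restrict_space)

lemma measurable_sm: "f \<in> measurable borel N \<Longrightarrow> f \<in> measurable sm N"
  using measurable_restrict_space1[of f borel N "sphere 0 1"] measurable_cong_sets[OF sets_sm refl] by blast

lemma nn_integral_sm:
  fixes g :: "real ^ 'n \<Rightarrow> ennreal"
  assumes [measurable]: "g \<in> borel_measurable borel"
  shows "(\<integral>\<^sup>+x. g x \<partial>sm) = of_nat CARD('n) * (\<integral>\<^sup>+x. indicator (cball 0 1) x * g (sgn x) \<partial>lborel)"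
proof -
  let ?R = "restrict_space lborel (cball 0 1 - {0}) :: (real ^ 'n) measure"
  have sgn: "sgn \<in> measurable ?R (restrict_space borel (sphere 0 1))"
    by (rule measurable_restrict_space2)
       (auto simp: space_restrict_space norm_sgn intro!: measurable_restrict_space1)
  have "(\<integral>\<^sup>+x. g x \<partial>sm) = ennreal (real CARD('n)) * (\<integral>\<^sup>+x. g (sgn x) \<partial>?R)"
  proof -
    have g: "g \<in> borel_measurable (restrict_space borel (sphere 0 1))"
      by (rule measurable_restrict_space1) simp
    then have "g \<in> borel_measurable (distr ?R (restrict_space borel (sphere 0 1)) sgn)"
      by (simp add: measurable_cong_sets[OF sets_distr refl])
    then show ?thesis
      unfolding sphere_measure_def by (simp add: nn_integral_scale_measure nn_integral_distr[OF sgn] g)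
  qed
  also have "(\<integral>\<^sup>+x. g (sgn x) \<partial>?R) = (\<integral>\<^sup>+x. g (sgn x) * indicator (cball 0 1 - {0}) x \<partial>lborel)"
    by (subst nn_integral_restrict_space) auto
  also have "\<dots> = (\<integral>\<^sup>+x. indicator (cball 0 1) x * g (sgn x) \<partial>lborel)"
  proof (rule nn_integral_cong_AE)
    have "AE x in lborel. x \<noteq> (0 :: real ^ 'n)" by (rule AE_lborel_singleton)
    then show "AE x in lborel. g (sgn x) * indicator (cball 0 1 - {0}) x = indicator (cball 0 1) x * g (sgn x)"
      by eventually_elim (auto simp: indicator_def)
  qed
  finally show ?thesis by (simp add: ennreal_of_nat_eq_real_of_nat)
qed

lemma emeasure_sm_space: "emeasure (sm :: (real ^ 'n) measure) (space sm) < \<infinity>"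
proof -
  have "(\<integral>\<^sup>+x. 1 \<partial>(sm :: (real ^ 'n) measure)) = of_nat CARD('n) * emeasure lborel (cball 0 1 :: (real ^ 'n) set)"
    by (subst nn_integral_sm) auto
  also have "\<dots> < \<infinity>"
    using emeasure_lborel_cball_finite[of "0 :: real ^ 'n" 1] by (simp add: ennreal_mult_less_top of_nat_less_top)
  finally show ?thesis by simp
qed

lemma finite_measure_sm: "finite_measure (sm :: (real ^ 'n) measure)"
  by (rule finite_measureI) (metis emeasure_sm_space less_irrefl)

section \<open>Orthogonal invariance of the surface measure\<close>

lemma sgn_orthogonal:
  assumes "orthogonal_transformation (R :: real ^ 'n \<Rightarrow> real ^ 'n)" shows "sgn (R x) = R (sgn x)"
  using assms by (simp add: sgn_div_norm orthogonal_transformation_norm linear_scale orthogonal_transformation_linear)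

text \<open>The uniqueness argument for translation-invariant measures: \<open>f (R x + y)\<close>
  is integrated over all \<open>x\<close> and over \<open>y\<close> in the unit ball, in both
  orders. Since \<open>R\<close> preserves the ball, its volume \<open>B\<close> comes out on both
  sides and cancels.\<close>

lemma lborel_orthogonal:
  fixes R :: "real ^ 'n \<Rightarrow> real ^ 'n"
  assumes R: "orthogonal_transformation R"
  shows "distr lborel borel R = lborel"
proof -
  have Rm[measurable]: "R \<in> borel_measurable borel"
    using R by (intro borel_measurable_continuous_onI linear_continuous_on)
      (simp add: orthogonal_transformation_linear linear_conv_bounded_linear[symmetric])
  let ?m = "distr lborel borel R"
  have tr: "(\<integral>\<^sup>+x. f (x + y) \<partial>lborel) = (\<integral>\<^sup>+x. f x \<partial>lborel)"
    if [measurable]: "f \<in> borel_measurable borel" for f :: "real ^ 'n \<Rightarrow> ennreal" and y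
  proof -
    have "(\<integral>\<^sup>+x. f x \<partial>lborel) = (\<integral>\<^sup>+x. f x \<partial>distr lborel borel ((+) y))"
      by (simp add: lborel_distr_plus)
    also have "\<dots> = (\<integral>\<^sup>+x. f (y + x) \<partial>lborel)" by (subst nn_integral_distr) simp_all
    finally show ?thesis by (simp add: add.commute)
  qed
  obtain R' where R': "\<And>y. R (R' y) = y"
    using orthogonal_transformation_surj[OF R] by (metis surj_f_inv_f)
  have mtr: "(\<integral>\<^sup>+x. f (R x + y) \<partial>lborel) = (\<integral>\<^sup>+x. f (R x) \<partial>lborel)"
    if [measurable]: "f \<in> borel_measurable borel" for f :: "real ^ 'n \<Rightarrow> ennreal" and y
  proof -
    have "R x + y = R (x + R' y)" for x
      using R by (simp add: R' linear_add orthogonal_transformation_linear)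
    then show ?thesis using tr[of "\<lambda>x. f (R x)" "R' y"] by simp
  qed
  define B where "B = (\<integral>\<^sup>+x. indicator (cball 0 1) (x :: real ^ 'n) \<partial>lborel)"
  have ind: "indicator (cball 0 1) (R x) = indicator (cball 0 1) x" for x
    using R by (simp add: orthogonal_transformation_norm indicator_def)
  have ind': "indicator (cball 0 1) (- x) = indicator (cball 0 1) x" for x :: "real ^ 'n"
    by (simp add: indicator_def)
  have B: "B \<noteq> 0" "B \<noteq> \<infinity>"
  proof -
    have B: "B = emeasure lborel (cball 0 1 :: (real ^ 'n) set)" by (simp add: B_def)
    show "B \<noteq> \<infinity>" using emeasure_lborel_cball_finite[of "0 :: real ^ 'n" 1] unfolding B by simp
    have "emeasure lborel (ball 0 1 :: (real ^ 'n) set) \<le> B"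
      unfolding B by (rule emeasure_mono) auto
    moreover have "emeasure lborel (ball 0 1 :: (real ^ 'n) set) > 0"
      by (simp add: emeasure_ball)
    ultimately show "B \<noteq> 0" by auto
  qed
  have eq: "(\<integral>\<^sup>+x. f (R x) \<partial>lborel) = (\<integral>\<^sup>+x. f x \<partial>lborel)"
    if [measurable]: "f \<in> borel_measurable borel" for f :: "real ^ 'n \<Rightarrow> ennreal"
  proof -
    let ?g = "indicator (cball 0 1) :: real ^ 'n \<Rightarrow> ennreal"
    have "(\<integral>\<^sup>+x. f (R x) \<partial>lborel) * B = (\<integral>\<^sup>+y. (\<integral>\<^sup>+x. f (R x) \<partial>lborel) * ?g y \<partial>lborel)"
      unfolding B_def by (rule nn_integral_cmult[symmetric]) simp
    also have "\<dots> = (\<integral>\<^sup>+y. (\<integral>\<^sup>+x. f (R x + y) \<partial>lborel) * ?g y \<partial>lborel)"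
      by (simp add: mtr)
    also have "\<dots> = (\<integral>\<^sup>+y. \<integral>\<^sup>+x. f (R x + y) * ?g y \<partial>lborel \<partial>lborel)"
      by (simp add: nn_integral_multc)
    also have "\<dots> = (\<integral>\<^sup>+x. \<integral>\<^sup>+y. f (R x + y) * ?g y \<partial>lborel \<partial>lborel)"
      by (rule lborel_pair.Fubini') measurable
    also have "\<dots> = (\<integral>\<^sup>+x. \<integral>\<^sup>+y. f y * ?g (R x - y) \<partial>lborel \<partial>lborel)"
    proof (rule nn_integral_cong)
      fix x
      show "(\<integral>\<^sup>+y. f (R x + y) * ?g y \<partial>lborel) = (\<integral>\<^sup>+y. f y * ?g (R x - y) \<partial>lborel)"
        using tr[of "\<lambda>y. f y * ?g (R x - y)" "R x"] by (simp add: ind' add.commute)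
    qed
    also have "\<dots> = (\<integral>\<^sup>+y. \<integral>\<^sup>+x. f y * ?g (R x - y) \<partial>lborel \<partial>lborel)"
      by (rule lborel_pair.Fubini') measurable
    also have "\<dots> = (\<integral>\<^sup>+y. f y * (\<integral>\<^sup>+x. ?g (R x - y) \<partial>lborel) \<partial>lborel)"
      by (simp add: nn_integral_cmult)
    also have "\<dots> = (\<integral>\<^sup>+y. f y * B \<partial>lborel)"
      using mtr[of ?g "- _"] by (simp add: ind B_def)
    also have "\<dots> = (\<integral>\<^sup>+y. f y \<partial>lborel) * B" by (rule nn_integral_multc) simp
    finally show ?thesis using B by (simp add: mult.commute[of _ B] ennreal_mult_cancel_left)
  qed
  show ?thesis
  proof (rule measure_eqI)
    fix A assume "A \<in> sets ?m"
    then have [measurable]: "A \<in> sets borel" by simp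
    have "emeasure ?m A = (\<integral>\<^sup>+x. indicator A x \<partial>?m)" by simp
    also have "\<dots> = (\<integral>\<^sup>+x. indicator A (R x) \<partial>lborel)" by (subst nn_integral_distr) simp_all
    also have "\<dots> = emeasure lborel A" by (subst eq) simp_all
    finally show "emeasure ?m A = emeasure lborel A" .
  qed simp
qed

lemma nn_integral_sm_orthogonal:
  fixes R :: "real ^ 'n \<Rightarrow> real ^ 'n"
  assumes R: "orthogonal_transformation R" and [measurable]: "g \<in> borel_measurable borel"
  shows "(\<integral>\<^sup>+x. g (R x) \<partial>sm) = (\<integral>\<^sup>+x. g x \<partial>sm)"
proof -
  have Rm[measurable]: "R \<in> borel_measurable borel"
    using R by (intro borel_measurable_continuous_onI linear_continuous_on)
      (simp add: orthogonal_transformation_linear linear_conv_bounded_linear[symmetric])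
  have "(\<integral>\<^sup>+x. indicator (cball 0 1) x * g (sgn x) \<partial>lborel) =
      (\<integral>\<^sup>+x. indicator (cball 0 1) x * g (sgn x) \<partial>distr lborel borel R)"
    by (simp add: lborel_orthogonal[OF R])
  also have "\<dots> = (\<integral>\<^sup>+x. indicator (cball 0 1) (R x) * g (sgn (R x)) \<partial>lborel)"
    by (subst nn_integral_distr) auto
  also have "\<dots> = (\<integral>\<^sup>+x. indicator (cball 0 1) x * g (R (sgn x)) \<partial>lborel)"
    using R by (simp add: sgn_orthogonal orthogonal_transformation_norm indicator_def)
  finally show ?thesis by (simp add: nn_integral_sm)
qed

section \<open>Decomposition along an axis\<close>

definition pr :: "real ^ 'n \<Rightarrow> real ^ 'n \<Rightarrow> real ^ 'n" where
  "pr e u = u - (u \<bullet> e) *\<^sub>R e"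

text \<open>Averaging over \<open>u\<close> in the whole sphere stands in for the uniform measure on
  the equator orthogonal to \<open>e\<close>, so no sphere of lower dimension has to be introduced.
  Where \<open>pr e u = 0\<close> the value is 0.\<close>

definition eta :: "real ^ 'n \<Rightarrow> real ^ 'n \<Rightarrow> real ^ 'n" where
  "eta e u = sgn (pr e u)"

lemma pr_measurable [measurable (raw)]:
  "f \<in> borel_measurable M \<Longrightarrow> g \<in> borel_measurable M \<Longrightarrow> (\<lambda>x. pr (f x) (g x)) \<in> borel_measurable M"
  unfolding pr_def by (intro borel_measurable_diff borel_measurable_scaleR borel_measurable_inner)

lemma eta_measurable [measurable (raw)]:
  "f \<in> borel_measurable M \<Longrightarrow> g \<in> borel_measurable M \<Longrightarrow> (\<lambda>x. eta (f x) (g x)) \<in> borel_measurable M"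
  unfolding eta_def by measurable

lemma pr_inner: "norm e = 1 \<Longrightarrow> pr e u \<bullet> e = 0"
  by (simp add: pr_def inner_diff_left dot_square_norm)

lemma eta_inner: "norm e = 1 \<Longrightarrow> eta e u \<bullet> e = 0"
  by (simp add: eta_def sgn_div_norm pr_inner)

lemma norm_eta: "pr e u \<noteq> 0 \<Longrightarrow> norm (eta e u) = 1"
  by (simp add: eta_def norm_sgn)

lemma norm_combination:
  assumes "norm e = 1" "s \<bullet> e = 0" "norm s = 1"
  shows "norm (k *\<^sub>R e + l *\<^sub>R s) = sqrt (k\<^sup>2 + l\<^sup>2)"
  using assms by (simp add: norm_eq_sqrt_inner inner_add_left inner_add_right inner_commute power2_eq_square)

text \<open>The map shifts along \<open>e\<close> and scales the orthogonal complement by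
  \<open>lam\<close>; with \<open>e\<close> a basis vector its linear part is diagonal with one
  entry 1.\<close>

lemma nn_integral_affine_pr:
  fixes H :: "real ^ 'n \<Rightarrow> ennreal"
  assumes e: "e \<in> Basis" and lam: "lam > 0" and [measurable]: "H \<in> borel_measurable borel"
  shows "(\<integral>\<^sup>+u. H u \<partial>lborel) = ennreal (lam ^ (CARD('n) - 1)) *
    (\<integral>\<^sup>+u. H ((u \<bullet> e + k) *\<^sub>R e + lam *\<^sub>R pr e u) \<partial>lborel)"
proof -
  define c where "c j = (if j = e then 1 else lam)" for j :: "real ^ 'n"
  have c: "c j \<noteq> 0" for j using lam by (simp add: c_def)
  have T: "k *\<^sub>R e + (\<Sum>j\<in>Basis. (c j * (u \<bullet> j)) *\<^sub>R j) = (u \<bullet> e + k) *\<^sub>R e + lam *\<^sub>R pr e u" for u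
  proof -
    have "(\<Sum>j\<in>Basis. (c j * (u \<bullet> j)) *\<^sub>R j) = (u \<bullet> e) *\<^sub>R e + (\<Sum>j\<in>Basis - {e}. (lam * (u \<bullet> j)) *\<^sub>R j)"
      by (subst sum.remove[OF finite_Basis e]) (simp add: c_def)
    also have "(\<Sum>j\<in>Basis - {e}. (lam * (u \<bullet> j)) *\<^sub>R j) = lam *\<^sub>R (\<Sum>j\<in>Basis - {e}. (u \<bullet> j) *\<^sub>R j)"
      by (simp add: scaleR_sum_right)
    also have "(\<Sum>j\<in>Basis - {e}. (u \<bullet> j) *\<^sub>R j) = pr e u"
      using euclidean_representation[of u] unfolding pr_def
      by (subst (asm) sum.remove[OF finite_Basis e]) (simp add: algebra_simps)
    finally show ?thesis by (simp add: algebra_simps)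
  qed
  have p: "(\<Prod>j\<in>Basis. \<bar>c j\<bar>) = lam ^ (CARD('n) - 1)"
  proof -
    have "(\<Prod>j\<in>Basis. \<bar>c j\<bar>) = (\<Prod>j\<in>Basis - {e}. lam)"
      by (subst prod.remove[OF finite_Basis e]) (use lam in \<open>simp add: c_def\<close>)
    then show ?thesis using e by (simp add: card_Diff_singleton)
  qed
  have "lborel = density (distr lborel borel (\<lambda>u. (u \<bullet> e + k) *\<^sub>R e + lam *\<^sub>R pr e u)) (\<lambda>_. ennreal (lam ^ (CARD('n) - 1)))"
    using lborel_affine_euclidean[of c "k *\<^sub>R e"] c unfolding T p by simp
  then have "(\<integral>\<^sup>+u. H u \<partial>lborel) = (\<integral>\<^sup>+u. H u \<partial>density (distr lborel borel (\<lambda>u. (u \<bullet> e + k) *\<^sub>R e + lam *\<^sub>R pr e u)) (\<lambda>_. ennreal (lam ^ (CARD('n) - 1))))"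
    by simp
  also have "\<dots> = ennreal (lam ^ (CARD('n) - 1)) *
    (\<integral>\<^sup>+u. H ((u \<bullet> e + k) *\<^sub>R e + lam *\<^sub>R pr e u) \<partial>lborel)"
    by (simp add: nn_integral_density nn_integral_distr nn_integral_cmult)
  finally show ?thesis .
qed

lemma AE_pr_nonzero:
  assumes "CARD('n) \<ge> 2"
  shows "AE u in lborel. pr e (u :: real ^ 'n) \<noteq> 0"
proof -
  have sub: "{u. pr e u = 0} \<subseteq> span {e}"
  proof clarify
    fix u assume "pr e u = 0"
    then have "u = (u \<bullet> e) *\<^sub>R e" by (simp add: pr_def)
    then show "u \<in> span {e}" by (metis span_base span_scale insertI1)
  qed
  have "dim (span {e}) < DIM(real ^ 'n)"
    using assms dim_le_card[of "{e}" "{e}"] by (simp add: span_base)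
  then have "negligible (span {e})" by (intro negligible_lowdim)
  then have "negligible {u. pr e u = 0}" by (rule negligible_subset[OF _ sub])
  then have "{u. pr e u = 0} \<in> null_sets lebesgue" by (simp add: negligible_iff_null_sets)
  moreover have "{u. pr e u = 0} \<in> sets borel"
  proof -
    have "closed (pr e -` {0})" unfolding pr_def[abs_def]
      by (intro closed_vimage continuous_intros closed_singleton)
    then show ?thesis by (simp add: vimage_def)
  qed
  ultimately have "{u. pr e u = 0} \<in> null_sets lborel" by (simp add: null_sets_completion_iff)
  then show ?thesis by (rule AE_I') auto
qed

text \<open>Comes from a scaling and a translation of the component of \<open>u\<close> orthogonal to \<open>e\<close>, without any
  induction on the dimension.\<close>

lemma nn_integral_cylindrical:
  fixes H phi :: "real ^ 'n \<Rightarrow> ennreal"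
  assumes e: "e \<in> Basis" and n: "CARD('n) = Suc d" "d \<ge> 1"
    and [measurable]: "H \<in> borel_measurable borel"
  defines "phi \<equiv> indicator (cball 0 1)"
  shows "(\<integral>\<^sup>+u. phi u * (\<integral>\<^sup>+l. \<integral>\<^sup>+k. ennreal (l ^ (d - 1)) * indicator {0<..} l * H (k *\<^sub>R e + l *\<^sub>R eta e u) \<partial>lborel \<partial>lborel) \<partial>lborel)
    = (\<integral>\<^sup>+m. \<integral>\<^sup>+k. indicator {0<..} m * ennreal (1 / m ^ (d + 1)) * (if sqrt (k\<^sup>2 + (1/m)\<^sup>2) \<le> 1 then 1 else 0) \<partial>lborel \<partial>lborel)
      * (\<integral>\<^sup>+u. H u \<partial>lborel)"
proof -
  have [measurable]: "phi \<in> borel_measurable borel" by (simp add: phi_def)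
  have ne: "norm e = 1" using e by simp
  have AE: "AE u in lborel. pr e u \<noteq> 0" by (rule AE_pr_nonzero) (use n in simp)
  let ?I = "\<lambda>l. indicator {0<..} l :: ennreal"
  \<comment> \<open>Replacing \<open>l\<close> by \<open>|pr e u| * l\<close> and \<open>k\<close>
    by \<open>u \<bullet> e + k\<close> turns the point into the image of \<open>u\<close> under the
    map of \<open>nn_integral_affine_pr\<close>.\<close>
  have A: "(\<integral>\<^sup>+l. \<integral>\<^sup>+k. ennreal (l ^ (d - 1)) * ?I l * H (k *\<^sub>R e + l *\<^sub>R eta e u) \<partial>lborel \<partial>lborel)
     = (\<integral>\<^sup>+l. \<integral>\<^sup>+k. ennreal (norm (pr e u) ^ d) * (ennreal (l ^ (d - 1)) * ?I l) * H ((u \<bullet> e + k) *\<^sub>R e + l *\<^sub>R pr e u) \<partial>lborel \<partial>lborel)"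
    if u: "pr e u \<noteq> 0" for u
  proof -
    let ?p = "norm (pr e u)"
    have "(\<integral>\<^sup>+l. \<integral>\<^sup>+k. ennreal (l ^ (d - 1)) * ?I l * H (k *\<^sub>R e + l *\<^sub>R eta e u) \<partial>lborel \<partial>lborel)
      = \<bar>?p\<bar> * (\<integral>\<^sup>+l. \<integral>\<^sup>+k. ennreal ((0 + ?p * l) ^ (d - 1)) * ?I (0 + ?p * l) * H (k *\<^sub>R e + (0 + ?p * l) *\<^sub>R eta e u) \<partial>lborel \<partial>lborel)"
      by (rule nn_integral_real_affine) (use u in auto)
    also have "\<dots> = (\<integral>\<^sup>+l. \<bar>?p\<bar> * (\<integral>\<^sup>+k. ennreal ((0 + ?p * l) ^ (d - 1)) * ?I (0 + ?p * l) * H (k *\<^sub>R e + (0 + ?p * l) *\<^sub>R eta e u) \<partial>lborel) \<partial>lborel)"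
      by (rule nn_integral_cmult[symmetric]) auto
    also have "\<dots> = (\<integral>\<^sup>+l. \<integral>\<^sup>+k. ennreal (norm (pr e u) ^ d) * (ennreal (l ^ (d - 1)) * ?I l) * H ((u \<bullet> e + k) *\<^sub>R e + l *\<^sub>R pr e u) \<partial>lborel \<partial>lborel)"
    proof (intro nn_integral_cong)
      fix l :: real
      have "(\<integral>\<^sup>+k. ennreal ((0 + ?p * l) ^ (d - 1)) * ?I (0 + ?p * l) * H (k *\<^sub>R e + (0 + ?p * l) *\<^sub>R eta e u) \<partial>lborel)
        = (\<integral>\<^sup>+k. ennreal ((?p * l) ^ (d - 1)) * ?I l * H ((u \<bullet> e + k) *\<^sub>R e + l *\<^sub>R pr e u) \<partial>lborel)"
      proof -
        have E: "(?p * l) *\<^sub>R eta e u = l *\<^sub>R pr e u" using u by (simp add: eta_def sgn_div_norm)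
        have I: "?I (?p * l) = ?I l" using u by (simp add: indicator_def zero_less_mult_iff)
        show ?thesis unfolding add_0_left E I
          by (subst nn_integral_real_affine[where c = 1 and t = "u \<bullet> e"]) simp_all
      qed
      also have "\<bar>?p\<bar> * \<dots> = (\<integral>\<^sup>+k. \<bar>?p\<bar> * (ennreal ((?p * l) ^ (d - 1)) * ?I l * H ((u \<bullet> e + k) *\<^sub>R e + l *\<^sub>R pr e u)) \<partial>lborel)"
        by (rule nn_integral_cmult[symmetric]) auto
      also have "\<dots> = (\<integral>\<^sup>+k. ennreal (norm (pr e u) ^ d) * (ennreal (l ^ (d - 1)) * ?I l) * H ((u \<bullet> e + k) *\<^sub>R e + l *\<^sub>R pr e u) \<partial>lborel)"
      proof (intro nn_integral_cong)
        fix k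
        have "ennreal \<bar>?p\<bar> * ennreal ((?p * l) ^ (d - 1)) * ?I l = ennreal (?p ^ d) * (ennreal (l ^ (d - 1)) * ?I l)"
        proof (cases "l > 0")
          case True
          have "?p * (?p * l) ^ (d - 1) = ?p ^ d * l ^ (d - 1)"
            using n(2) by (cases d) (auto simp: power_mult_distrib)
          then show ?thesis using True by (simp add: ennreal_mult[symmetric] del: One_nat_def)
        qed simp
        then show "\<bar>?p\<bar> * (ennreal ((?p * l) ^ (d - 1)) * ?I l * H ((u \<bullet> e + k) *\<^sub>R e + l *\<^sub>R pr e u)) =
            ennreal (norm (pr e u) ^ d) * (ennreal (l ^ (d - 1)) * ?I l) * H ((u \<bullet> e + k) *\<^sub>R e + l *\<^sub>R pr e u)"
          by (simp only: mult.assoc[symmetric])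
      qed
      finally show "\<bar>?p\<bar> * (\<integral>\<^sup>+k. ennreal ((0 + ?p * l) ^ (d - 1)) * ?I (0 + ?p * l) * H (k *\<^sub>R e + (0 + ?p * l) *\<^sub>R eta e u) \<partial>lborel) =
         (\<integral>\<^sup>+k. ennreal (norm (pr e u) ^ d) * (ennreal (l ^ (d - 1)) * ?I l) * H ((u \<bullet> e + k) *\<^sub>R e + l *\<^sub>R pr e u) \<partial>lborel)" .
    qed
    finally show ?thesis .
  qed
  have "(\<integral>\<^sup>+u. phi u * (\<integral>\<^sup>+l. \<integral>\<^sup>+k. ennreal (l ^ (d - 1)) * ?I l * H (k *\<^sub>R e + l *\<^sub>R eta e u) \<partial>lborel \<partial>lborel) \<partial>lborel)
     = (\<integral>\<^sup>+u. phi u * (\<integral>\<^sup>+l. \<integral>\<^sup>+k. ennreal (norm (pr e u) ^ d) * (ennreal (l ^ (d - 1)) * ?I l) * H ((u \<bullet> e + k) *\<^sub>R e + l *\<^sub>R pr e u) \<partial>lborel \<partial>lborel) \<partial>lborel)"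
    by (rule nn_integral_cong_AE, rule eventually_mono[OF AE]) (drule A, simp only:)
  also have "\<dots> = (\<integral>\<^sup>+u. \<integral>\<^sup>+l. \<integral>\<^sup>+k. phi u * (ennreal (norm (pr e u) ^ d) * (ennreal (l ^ (d - 1)) * ?I l) * H ((u \<bullet> e + k) *\<^sub>R e + l *\<^sub>R pr e u)) \<partial>lborel \<partial>lborel \<partial>lborel)"
    by (simp add: nn_integral_cmult)
  also have "\<dots> = (\<integral>\<^sup>+l. \<integral>\<^sup>+u. \<integral>\<^sup>+k. phi u * (ennreal (norm (pr e u) ^ d) * (ennreal (l ^ (d - 1)) * ?I l) * H ((u \<bullet> e + k) *\<^sub>R e + l *\<^sub>R pr e u)) \<partial>lborel \<partial>lborel \<partial>lborel)"
    by (rule lborel_pair.Fubini') measurable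
  also have "\<dots> = (\<integral>\<^sup>+l. \<integral>\<^sup>+k. \<integral>\<^sup>+u. phi u * (ennreal (norm (pr e u) ^ d) * (ennreal (l ^ (d - 1)) * ?I l) * H ((u \<bullet> e + k) *\<^sub>R e + l *\<^sub>R pr e u)) \<partial>lborel \<partial>lborel \<partial>lborel)"
    by (rule nn_integral_cong, rule lborel_pair.Fubini') measurable
  \<comment> \<open>For fixed \<open>l\<close> and \<open>k\<close> the variable is now the image
    \<open>w\<close> of \<open>u\<close>. The Jacobian contributes \<open>l^(-d)\<close> and
    \<open>|pr e u|^d\<close> another \<open>l^(-d)\<close>, which with \<open>l^(d-1)\<close> makes
    \<open>1 / l^(d+1)\<close>.\<close>
  also have "\<dots> = (\<integral>\<^sup>+l. \<integral>\<^sup>+k. \<integral>\<^sup>+w. ?I l * ennreal (1 / l ^ (d + 1)) * (phi ((w \<bullet> e - k) *\<^sub>R e + (1 / l) *\<^sub>R pr e w) * ennreal (norm (pr e w) ^ d) * H w) \<partial>lborel \<partial>lborel \<partial>lborel)"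
  proof (rule nn_integral_cong, rule nn_integral_cong)
    fix l k :: real
    show "(\<integral>\<^sup>+u. phi u * (ennreal (norm (pr e u) ^ d) * (ennreal (l ^ (d - 1)) * ?I l) * H ((u \<bullet> e + k) *\<^sub>R e + l *\<^sub>R pr e u)) \<partial>lborel)
       = (\<integral>\<^sup>+w. ?I l * ennreal (1 / l ^ (d + 1)) * (phi ((w \<bullet> e - k) *\<^sub>R e + (1 / l) *\<^sub>R pr e w) * ennreal (norm (pr e w) ^ d) * H w) \<partial>lborel)"
    proof (cases "l > 0")
      case l: True
      have "(\<integral>\<^sup>+w. ?I l * ennreal (1 / l ^ (d + 1)) * (phi ((w \<bullet> e - k) *\<^sub>R e + (1 / l) *\<^sub>R pr e w) * ennreal (norm (pr e w) ^ d) * H w) \<partial>lborel)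
        = ennreal (l ^ (CARD('n) - 1)) * (\<integral>\<^sup>+u. ?I l * ennreal (1 / l ^ (d + 1)) * (phi ((((u \<bullet> e + k) *\<^sub>R e + l *\<^sub>R pr e u) \<bullet> e - k) *\<^sub>R e + (1 / l) *\<^sub>R pr e ((u \<bullet> e + k) *\<^sub>R e + l *\<^sub>R pr e u)) * ennreal (norm (pr e ((u \<bullet> e + k) *\<^sub>R e + l *\<^sub>R pr e u)) ^ d) * H ((u \<bullet> e + k) *\<^sub>R e + l *\<^sub>R pr e u)) \<partial>lborel)"
        by (rule nn_integral_affine_pr[OF e l]) measurable
      also have "\<dots> = (\<integral>\<^sup>+u. phi u * (ennreal (norm (pr e u) ^ d) * (ennreal (l ^ (d - 1)) * ?I l) * H ((u \<bullet> e + k) *\<^sub>R e + l *\<^sub>R pr e u)) \<partial>lborel)"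
      proof (subst nn_integral_cmult[symmetric], measurable, intro nn_integral_cong)
        fix u :: "real ^ 'n"
        have 1: "((u \<bullet> e + k) *\<^sub>R e + l *\<^sub>R pr e u) \<bullet> e = u \<bullet> e + k"
          using ne by (simp add: inner_add_left pr_inner dot_square_norm)
        have 2: "pr e ((u \<bullet> e + k) *\<^sub>R e + l *\<^sub>R pr e u) = l *\<^sub>R pr e u"
          unfolding pr_def[of e "(u \<bullet> e + k) *\<^sub>R e + l *\<^sub>R pr e u"] 1 by simp
        have 3: "(u \<bullet> e + k - k) *\<^sub>R e + (1 / l) *\<^sub>R l *\<^sub>R pr e u = u"
          using l by (simp add: pr_def)
        have 5: "norm (l *\<^sub>R pr e u) = l * norm (pr e u)" using l by simp
        have "l ^ (CARD('n) - 1) * (1 / l ^ (d + 1)) * (l * norm (pr e u)) ^ d = norm (pr e u) ^ d * l ^ (d - 1)"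
          using l n by (cases d) (simp_all add: power_mult_distrib)
        then have 4: "ennreal (l ^ (CARD('n) - 1)) * ennreal (1 / l ^ (d + 1)) * ennreal ((l * norm (pr e u)) ^ d) = ennreal (norm (pr e u) ^ d) * ennreal (l ^ (d - 1))"
          using l by (simp add: ennreal_mult[symmetric] del: One_nat_def)
        have "ennreal (l ^ (CARD('n) - 1)) * (?I l * ennreal (1 / l ^ (d + 1)) * (phi u * ennreal ((l * norm (pr e u)) ^ d) * H ((u \<bullet> e + k) *\<^sub>R e + l *\<^sub>R pr e u)))
           = phi u * ?I l * (ennreal (l ^ (CARD('n) - 1)) * ennreal (1 / l ^ (d + 1)) * ennreal ((l * norm (pr e u)) ^ d)) * H ((u \<bullet> e + k) *\<^sub>R e + l *\<^sub>R pr e u)"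
          by (simp only: mult_ac)
        also have "\<dots> = phi u * (ennreal (norm (pr e u) ^ d) * (ennreal (l ^ (d - 1)) * ?I l) * H ((u \<bullet> e + k) *\<^sub>R e + l *\<^sub>R pr e u))"
          unfolding 4 by (simp only: mult_ac)
        finally show "ennreal (l ^ (CARD('n) - 1)) * (?I l * ennreal (1 / l ^ (d + 1)) * (phi ((((u \<bullet> e + k) *\<^sub>R e + l *\<^sub>R pr e u) \<bullet> e - k) *\<^sub>R e + (1 / l) *\<^sub>R pr e ((u \<bullet> e + k) *\<^sub>R e + l *\<^sub>R pr e u)) * ennreal (norm (pr e ((u \<bullet> e + k) *\<^sub>R e + l *\<^sub>R pr e u)) ^ d) * H ((u \<bullet> e + k) *\<^sub>R e + l *\<^sub>R pr e u)))
          = phi u * (ennreal (norm (pr e u) ^ d) * (ennreal (l ^ (d - 1)) * ?I l) * H ((u \<bullet> e + k) *\<^sub>R e + l *\<^sub>R pr e u))"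
          unfolding 1 2 3 5 .
      qed
      finally show ?thesis by simp
    qed simp
  qed
  also have "\<dots> = (\<integral>\<^sup>+l. \<integral>\<^sup>+w. \<integral>\<^sup>+k. ?I l * ennreal (1 / l ^ (d + 1)) * (phi ((w \<bullet> e - k) *\<^sub>R e + (1 / l) *\<^sub>R pr e w) * ennreal (norm (pr e w) ^ d) * H w) \<partial>lborel \<partial>lborel \<partial>lborel)"
    by (rule nn_integral_cong, rule lborel_pair.Fubini') measurable
  also have "\<dots> = (\<integral>\<^sup>+w. \<integral>\<^sup>+l. \<integral>\<^sup>+k. ?I l * ennreal (1 / l ^ (d + 1)) * (phi ((w \<bullet> e - k) *\<^sub>R e + (1 / l) *\<^sub>R pr e w) * ennreal (norm (pr e w) ^ d) * H w) \<partial>lborel \<partial>lborel \<partial>lborel)"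
    by (rule lborel_pair.Fubini') measurable
  also have "\<dots> = (\<integral>\<^sup>+w. (\<integral>\<^sup>+m. \<integral>\<^sup>+k. ?I m * ennreal (1 / m ^ (d + 1)) * (if sqrt (k\<^sup>2 + (1/m)\<^sup>2) \<le> 1 then 1 else 0) \<partial>lborel \<partial>lborel) * H w \<partial>lborel)"
  proof (rule nn_integral_cong_AE, rule eventually_mono[OF AE])
    fix w :: "real ^ 'n" assume w: "pr e w \<noteq> 0"
    let ?p = "norm (pr e w)"
    have in1: "(\<integral>\<^sup>+k. ?I l * ennreal (1 / l ^ (d + 1)) * (phi ((w \<bullet> e - k) *\<^sub>R e + (1 / l) *\<^sub>R pr e w) * ennreal (?p ^ d) * H w) \<partial>lborel)
      = (\<integral>\<^sup>+k. ?I l * ennreal (1 / l ^ (d + 1)) * (phi (k *\<^sub>R e + (1 / l) *\<^sub>R pr e w) * ennreal (?p ^ d) * H w) \<partial>lborel)" for l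
      by (subst nn_integral_real_affine[where c = "-1" and t = "w \<bullet> e"]) auto
    have "(\<integral>\<^sup>+l. \<integral>\<^sup>+k. ?I l * ennreal (1 / l ^ (d + 1)) * (phi ((w \<bullet> e - k) *\<^sub>R e + (1 / l) *\<^sub>R pr e w) * ennreal (?p ^ d) * H w) \<partial>lborel \<partial>lborel)
      = (\<integral>\<^sup>+l. \<integral>\<^sup>+k. ?I l * ennreal (1 / l ^ (d + 1)) * (phi (k *\<^sub>R e + (1 / l) *\<^sub>R pr e w) * ennreal (?p ^ d) * H w) \<partial>lborel \<partial>lborel)"
      by (simp only: in1)
    \<comment> \<open>Scaling \<open>l\<close> by \<open>|pr e w|\<close> removes \<open>w\<close>
      from everything but the factor \<open>H w\<close>, so what remains is a constant.\<close>
    also have "\<dots> = \<bar>?p\<bar> * (\<integral>\<^sup>+m. \<integral>\<^sup>+k. ?I (0 + ?p * m) * ennreal (1 / (0 + ?p * m) ^ (d + 1)) * (phi (k *\<^sub>R e + (1 / (0 + ?p * m)) *\<^sub>R pr e w) * ennreal (?p ^ d) * H w) \<partial>lborel \<partial>lborel)"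
      by (rule nn_integral_real_affine) (use w in auto)
    also have "\<dots> = (\<integral>\<^sup>+m. \<bar>?p\<bar> * (\<integral>\<^sup>+k. ?I (0 + ?p * m) * ennreal (1 / (0 + ?p * m) ^ (d + 1)) * (phi (k *\<^sub>R e + (1 / (0 + ?p * m)) *\<^sub>R pr e w) * ennreal (?p ^ d) * H w) \<partial>lborel) \<partial>lborel)"
      by (rule nn_integral_cmult[symmetric]) auto
    also have "\<dots> = (\<integral>\<^sup>+m. \<integral>\<^sup>+k. \<bar>?p\<bar> * (?I (0 + ?p * m) * ennreal (1 / (0 + ?p * m) ^ (d + 1)) * (phi (k *\<^sub>R e + (1 / (0 + ?p * m)) *\<^sub>R pr e w) * ennreal (?p ^ d) * H w)) \<partial>lborel \<partial>lborel)"
      by (intro nn_integral_cong nn_integral_cmult[symmetric]) auto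
    also have "\<dots> = (\<integral>\<^sup>+m. \<integral>\<^sup>+k. ?I m * ennreal (1 / m ^ (d + 1)) * (if sqrt (k\<^sup>2 + (1/m)\<^sup>2) \<le> 1 then 1 else 0) * H w \<partial>lborel \<partial>lborel)"
    proof (intro nn_integral_cong)
      fix m k :: real
      show "\<bar>?p\<bar> * (?I (0 + ?p * m) * ennreal (1 / (0 + ?p * m) ^ (d + 1)) * (phi (k *\<^sub>R e + (1 / (0 + ?p * m)) *\<^sub>R pr e w) * ennreal (?p ^ d) * H w))
         = ?I m * ennreal (1 / m ^ (d + 1)) * (if sqrt (k\<^sup>2 + (1/m)\<^sup>2) \<le> 1 then 1 else 0) * H w"
      proof (cases "m > 0")
        case m: True
        have "(1 / (?p * m)) *\<^sub>R pr e w = (1 / m) *\<^sub>R eta e w"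
          by (simp add: eta_def sgn_div_norm divide_inverse mult.commute)
        then have "norm (k *\<^sub>R e + (1 / (0 + ?p * m)) *\<^sub>R pr e w) = sqrt (k\<^sup>2 + (1/m)\<^sup>2)"
          using norm_combination[OF ne eta_inner[OF ne] norm_eta[OF w], of k "1/m"] by simp
        then have 1: "phi (k *\<^sub>R e + (1 / (0 + ?p * m)) *\<^sub>R pr e w) = (if sqrt (k\<^sup>2 + (1/m)\<^sup>2) \<le> 1 then 1 else 0)"
          by (simp add: phi_def indicator_def)
        have "?p * (1 / (0 + ?p * m) ^ (d + 1)) * ?p ^ d = 1 / m ^ (d + 1)"
          using w m by (simp add: power_mult_distrib)
        then have 2: "ennreal \<bar>?p\<bar> * ennreal (1 / (0 + ?p * m) ^ (d + 1)) * ennreal (?p ^ d) = ennreal (1 / m ^ (d + 1))"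
          using m by (simp add: ennreal_mult[symmetric])
        have 3: "?I (0 + ?p * m) = ?I m" using w by (simp add: indicator_def zero_less_mult_iff)
        show ?thesis unfolding 1 2[symmetric] 3 by (simp only: mult_ac)
      next
        case False
        then have "?I (0 + ?p * m) = 0" "?I m = 0" using w by (auto simp: indicator_def zero_less_mult_iff)
        then show ?thesis by simp
      qed
    qed
    also have "\<dots> = (\<integral>\<^sup>+m. \<integral>\<^sup>+k. ?I m * ennreal (1 / m ^ (d + 1)) * (if sqrt (k\<^sup>2 + (1/m)\<^sup>2) \<le> 1 then 1 else 0) \<partial>lborel \<partial>lborel) * H w"
      by (simp add: nn_integral_multc)
    finally show "(\<integral>\<^sup>+l. \<integral>\<^sup>+k. ?I l * ennreal (1 / l ^ (d + 1)) * (phi ((w \<bullet> e - k) *\<^sub>R e + (1 / l) *\<^sub>R pr e w) * ennreal (?p ^ d) * H w) \<partial>lborel \<partial>lborel)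
      = (\<integral>\<^sup>+m. \<integral>\<^sup>+k. ?I m * ennreal (1 / m ^ (d + 1)) * (if sqrt (k\<^sup>2 + (1/m)\<^sup>2) \<le> 1 then 1 else 0) \<partial>lborel \<partial>lborel) * H w" .
  qed
  also have "\<dots> = (\<integral>\<^sup>+m. \<integral>\<^sup>+k. ?I m * ennreal (1 / m ^ (d + 1)) * (if sqrt (k\<^sup>2 + (1/m)\<^sup>2) \<le> 1 then 1 else 0) \<partial>lborel \<partial>lborel) * (\<integral>\<^sup>+u. H u \<partial>lborel)"
    by (rule nn_integral_cmult) simp
  finally show ?thesis .
qed

text \<open>Polar coordinates in the half disc. At height \<open>l\<close> put
  \<open>k = l tan t\<close>: then \<open>k^2 + l^2 <= 1\<close> means \<open>l <= cos t\<close>,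
  and \<open>dk\<close> is \<open>l / cos^2 t dt\<close>. The integral of \<open>l^d\<close> over
  \<open>0 < l <= cos t\<close>, divided by \<open>cos^2 t\<close>, is the weight on the
  right.\<close>

lemma half_disc_integral:
  fixes F :: "real \<Rightarrow> real \<Rightarrow> ennreal" and G :: "real \<Rightarrow> ennreal"
  assumes F[measurable]: "(\<lambda>(k, l). F k l) \<in> borel_measurable (borel \<Otimes>\<^sub>M borel)" and G[measurable]: "G \<in> borel_measurable borel"
    and FG: "\<And>l t. 0 < l \<Longrightarrow> \<bar>t\<bar> < pi/2 \<Longrightarrow> F (l * tan t) l = G t" and d: "d \<ge> 1"
  shows "(\<integral>\<^sup>+l. \<integral>\<^sup>+k. ennreal (l ^ (d - 1)) * indicator {0<..} l * ((if sqrt (k\<^sup>2 + l\<^sup>2) \<le> 1 then 1 else 0) * F k l) \<partial>lborel \<partial>lborel)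
     = (\<integral>\<^sup>+t. indicator {-pi/2<..<pi/2} t * ennreal (cos t ^ (d - 1) / (d + 1)) * G t \<partial>lborel)"
proof -
  let ?J = "indicator {-pi/2<..<pi/2} :: real \<Rightarrow> ennreal"
  have in1: "(\<integral>\<^sup>+k. ennreal (l ^ (d - 1)) * indicator {0<..} l * ((if sqrt (k\<^sup>2 + l\<^sup>2) \<le> 1 then 1 else 0) * F k l) \<partial>lborel)
      = (\<integral>\<^sup>+t. indicator {0<..cos t} l * ennreal (l ^ d) * (?J t * ennreal (1 / (cos t)\<^sup>2) * G t) \<partial>lborel)"
    if l1: "l \<noteq> 1" for l
  proof (cases "0 < l \<and> l < 1")
    case False
    have K: "ennreal (l ^ (d - 1)) * indicator {0<..} l * ((if sqrt (k\<^sup>2 + l\<^sup>2) \<le> 1 then 1 else 0) * F k l) = 0" for k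
    proof (cases "0 < l")
      case True
      then have "1 < l" using False l1 by auto
      then have "1 < l\<^sup>2" by (simp add: one_less_power)
      then have "1 < k\<^sup>2 + l\<^sup>2" using zero_le_power2[of k] by linarith
      then show ?thesis by simp
    qed simp
    have I: "indicator {0<..cos t} l = (0 :: ennreal)" for t
    proof -
      have "l \<notin> {0<..cos t}"
      proof
        assume "l \<in> {0<..cos t}"
        then have "0 < l" "l \<le> cos t" by auto
        with cos_le_one[of t] have "0 < l" "l \<le> 1" by linarith+
        with False l1 show False by auto
      qed
      then show ?thesis by simp
    qed
    show ?thesis unfolding K I by simp
  next
    case True
    \<comment> \<open>The chord at height \<open>l\<close> corresponds to \<open>|t| <= b\<close>;
      for \<open>0 < l < 1\<close> this angle stays where \<open>tan\<close> is
      differentiable.\<close>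
    define b where "b = arccos l"
    have b: "0 < b" "b < pi/2" "cos b = l"
      using True arccos_less_arccos[of l 1] arccos_less_arccos[of 0 l] by (auto simp: b_def)
    have cospos: "cos t > 0" if "t \<in> {-b..b}" for t using that b by (intro cos_gt_zero_pi) auto
    have sinb: "l * tan b = sqrt (1 - l\<^sup>2)" "l * tan (- b) = - sqrt (1 - l\<^sup>2)"
      using True b sin_arccos[of l] by (auto simp: tan_def b_def)
    have "(\<integral>\<^sup>+k. F k l * indicator {l * tan (- b)..l * tan b} k \<partial>lborel) =
        (\<integral>\<^sup>+t. F (l * tan t) l * ennreal (l / (cos t)\<^sup>2) * indicator {-b..b} t \<partial>lborel)"
    proof (rule nn_integral_substitution_aux[where g = "\<lambda>t. l * tan t"])
      show "(\<lambda>k. F k l) \<in> borel_measurable borel" by measurable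
      show "((\<lambda>t. l * tan t) has_real_derivative l / (cos t)\<^sup>2) (at t)" if "t \<in> {-b..b}" for t
        using cospos[OF that] by (auto intro!: derivative_eq_intros simp: divide_inverse)
      show "continuous_on {-b..b} (\<lambda>t. l / (cos t)\<^sup>2)"
        using cospos by (intro continuous_intros) (force simp: less_le)
    qed (use b True in auto)
    also have "\<dots> = (\<integral>\<^sup>+t. indicator {0<..cos t} l * ennreal l * (?J t * ennreal (1 / (cos t)\<^sup>2) * G t) \<partial>lborel)"
    proof (rule nn_integral_cong)
      fix t :: real
      have "t \<in> {-b..b} \<longleftrightarrow> t \<in> {-pi/2<..<pi/2} \<and> l \<le> cos t"
      proof (cases "t \<in> {-pi/2<..<pi/2}")
        case t: True
        then have a: "\<bar>t\<bar> \<le> pi" using pi_gt_zero by (auto simp: abs_le_iff) 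
        have "t \<in> {-b..b} \<longleftrightarrow> \<bar>t\<bar> \<le> b" by auto
        also have "\<dots> \<longleftrightarrow> cos b \<le> cos \<bar>t\<bar>"
          using a b by (intro cos_mono_le_eq[symmetric]) auto
        finally show ?thesis using t b by simp
      qed (use b in auto)
      then show "F (l * tan t) l * ennreal (l / (cos t)\<^sup>2) * indicator {-b..b} t =
          indicator {0<..cos t} l * ennreal l * (?J t * ennreal (1 / (cos t)\<^sup>2) * G t)"
      proof -
        have E: "ennreal (l / (cos t)\<^sup>2) = ennreal l * ennreal (1 / (cos t)\<^sup>2)"
          using True by (simp add: ennreal_mult[symmetric])
        assume eq: "t \<in> {-b..b} \<longleftrightarrow> t \<in> {-pi/2<..<pi/2} \<and> l \<le> cos t"
        show ?thesis
        proof (cases "t \<in> {-b..b}")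
          case t: True
          then have m: "t \<in> {-pi/2<..<pi/2}" "l \<in> {0<..cos t}" using eq True by auto
          then have "F (l * tan t) l = G t" using True by (intro FG) auto
          then show ?thesis using t m by (simp only: E indicator_simps mult_1_right mult_1_left) (simp only: mult_ac)
        next
          case False
          then have "t \<notin> {-pi/2<..<pi/2} \<or> l \<notin> {0<..cos t}" using eq by auto
          then show ?thesis using False by auto
        qed
      qed
    qed
    finally have "(\<integral>\<^sup>+k. F k l * indicator {l * tan (- b)..l * tan b} k \<partial>lborel) = \<dots>" .
    moreover have "F k l * indicator {l * tan (- b)..l * tan b} k = (if sqrt (k\<^sup>2 + l\<^sup>2) \<le> 1 then 1 else 0) * F k l" for k
    proof -
      have "k \<in> {l * tan (- b)..l * tan b} \<longleftrightarrow> \<bar>k\<bar> \<le> sqrt (1 - l\<^sup>2)" unfolding sinb by auto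
      also have "\<dots> \<longleftrightarrow> k\<^sup>2 \<le> 1 - l\<^sup>2"
        using real_le_rsqrt[of "\<bar>k\<bar>" "1 - l\<^sup>2"] real_sqrt_le_mono[of "k\<^sup>2" "1 - l\<^sup>2"] True
        by (auto simp: power_mono_iff) (metis abs_ge_zero abs_square_le_1 power2_abs real_sqrt_abs real_sqrt_le_iff)
      finally show ?thesis by (auto simp: indicator_def)
    qed
    ultimately have 1: "(\<integral>\<^sup>+k. (if sqrt (k\<^sup>2 + l\<^sup>2) \<le> 1 then 1 else 0) * F k l \<partial>lborel) =
        (\<integral>\<^sup>+t. indicator {0<..cos t} l * ennreal l * (?J t * ennreal (1 / (cos t)\<^sup>2) * G t) \<partial>lborel)" by simp
    have "(\<integral>\<^sup>+k. ennreal (l ^ (d - 1)) * indicator {0<..} l * ((if sqrt (k\<^sup>2 + l\<^sup>2) \<le> 1 then 1 else 0) * F k l) \<partial>lborel)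
      = ennreal (l ^ (d - 1)) * (\<integral>\<^sup>+k. (if sqrt (k\<^sup>2 + l\<^sup>2) \<le> 1 then 1 else 0) * F k l \<partial>lborel)"
      using True by (subst nn_integral_cmult[symmetric]) auto
    also have "\<dots> = (\<integral>\<^sup>+t. ennreal (l ^ (d - 1)) * (indicator {0<..cos t} l * ennreal l * (?J t * ennreal (1 / (cos t)\<^sup>2) * G t)) \<partial>lborel)"
      unfolding 1 by (rule nn_integral_cmult[symmetric]) (simp add: indicator_def)
    also have "\<dots> = (\<integral>\<^sup>+t. indicator {0<..cos t} l * ennreal (l ^ d) * (?J t * ennreal (1 / (cos t)\<^sup>2) * G t) \<partial>lborel)"
    proof (rule nn_integral_cong)
      fix t
      have "l ^ (d - 1) * l = l ^ d" using d by (metis Suc_diff_1 power_Suc2 less_eq_Suc_le One_nat_def)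
      then have "ennreal (l ^ d) = ennreal (l ^ (d - 1)) * ennreal l"
        using True by (simp add: ennreal_mult[symmetric])
      then show "ennreal (l ^ (d - 1)) * (indicator {0<..cos t} l * ennreal l * (?J t * ennreal (1 / (cos t)\<^sup>2) * G t)) =
          indicator {0<..cos t} l * ennreal (l ^ d) * (?J t * ennreal (1 / (cos t)\<^sup>2) * G t)"
        by (simp only: mult_ac)
    qed
    finally show ?thesis .
  qed
  have "AE l in lborel. l \<noteq> (1::real)" by (rule AE_lborel_singleton)
  then have "(\<integral>\<^sup>+l. \<integral>\<^sup>+k. ennreal (l ^ (d - 1)) * indicator {0<..} l * ((if sqrt (k\<^sup>2 + l\<^sup>2) \<le> 1 then 1 else 0) * F k l) \<partial>lborel \<partial>lborel)
     = (\<integral>\<^sup>+l. \<integral>\<^sup>+t. indicator {0<..cos t} l * ennreal (l ^ d) * (?J t * ennreal (1 / (cos t)\<^sup>2) * G t) \<partial>lborel \<partial>lborel)"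
    by (intro nn_integral_cong_AE) (auto elim!: eventually_mono dest: in1)
  also have "\<dots> = (\<integral>\<^sup>+t. \<integral>\<^sup>+l. indicator {0<..cos t} l * ennreal (l ^ d) * (?J t * ennreal (1 / (cos t)\<^sup>2) * G t) \<partial>lborel \<partial>lborel)"
  proof (rule lborel_pair.Fubini')
    have "(\<lambda>(t, l). (if 0 < l \<and> l \<le> cos t then 1 else 0) * ennreal (l ^ d) * (?J t * ennreal (1 / (cos t)\<^sup>2) * G t))
        \<in> borel_measurable (lborel \<Otimes>\<^sub>M lborel)" by measurable
    then show "(\<lambda>(t, l). indicator {0<..cos t} l * ennreal (l ^ d) * (?J t * ennreal (1 / (cos t)\<^sup>2) * G t))
        \<in> borel_measurable (lborel \<Otimes>\<^sub>M lborel)" by (simp add: indicator_def)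
  qed
  also have "\<dots> = (\<integral>\<^sup>+t. ?J t * ennreal (cos t ^ (d - 1) / (d + 1)) * G t \<partial>lborel)"
  proof (rule nn_integral_cong)
    fix t :: real
    show "(\<integral>\<^sup>+l. indicator {0<..cos t} l * ennreal (l ^ d) * (?J t * ennreal (1 / (cos t)\<^sup>2) * G t) \<partial>lborel) = ?J t * ennreal (cos t ^ (d - 1) / (d + 1)) * G t"
    proof (cases "t \<in> {-pi/2<..<pi/2}")
      case True
      then have c: "cos t > 0" by (intro cos_gt_zero_pi) auto
      have "(\<integral>\<^sup>+l. indicator {0<..cos t} l * ennreal (l ^ d) * (?J t * ennreal (1 / (cos t)\<^sup>2) * G t) \<partial>lborel)
         = (\<integral>\<^sup>+l. ennreal (l ^ d) * indicator {0..cos t} l \<partial>lborel) * (?J t * ennreal (1 / (cos t)\<^sup>2) * G t)"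
      proof (subst nn_integral_multc[symmetric])
        show "(\<integral>\<^sup>+l. indicator {0<..cos t} l * ennreal (l ^ d) * (?J t * ennreal (1 / (cos t)\<^sup>2) * G t) \<partial>lborel) =
          (\<integral>\<^sup>+l. ennreal (l ^ d) * indicator {0..cos t} l * (?J t * ennreal (1 / (cos t)\<^sup>2) * G t) \<partial>lborel)"
          using d by (intro nn_integral_cong) (auto simp: indicator_def)
      qed simp
      also have "(\<integral>\<^sup>+l. ennreal (l ^ d) * indicator {0..cos t} l \<partial>lborel) = ennreal (cos t ^ (d+1) / (d+1) - 0 ^ (d+1) / (d+1))"
      proof (rule nn_integral_FTC_Icc)
        show "((\<lambda>l. l ^ (d+1) / real (d+1)) has_real_derivative x ^ d) (at x)" for x
          using DERIV_cdivide[OF DERIV_power[OF DERIV_ident, where n = "d+1"], where c = "real (d+1)"] by simp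
      qed (use c in auto)
      also have "\<dots> * (?J t * ennreal (1 / (cos t)\<^sup>2) * G t) = ?J t * ennreal (cos t ^ (d - 1) / (d + 1)) * G t"
      proof -
        have "cos t ^ (d+1) / (d+1) * (1 / (cos t)\<^sup>2) = cos t ^ (d - 1) / (d + 1)"
          using c d by (cases d) (auto simp: power2_eq_square)
        then have "ennreal (cos t ^ (d - 1) / (d + 1)) = ennreal (cos t ^ (d+1) / (d+1) - 0 ^ (d+1) / (d+1)) * ennreal (1 / (cos t)\<^sup>2)"
          using c by (simp add: ennreal_mult[symmetric])
        then show ?thesis by (simp only: mult_ac)
      qed
      finally show ?thesis .
    qed simp
  qed
  finally show ?thesis .
qed

lemma half_disc_const:
  assumes "d \<ge> 1"
  defines "D \<equiv> (\<integral>\<^sup>+l. \<integral>\<^sup>+k. ennreal (l ^ (d - 1)) * indicator {0<..} l * ((if sqrt (k\<^sup>2 + l\<^sup>2) \<le> 1 then 1 else 0) * 1) \<partial>lborel \<partial>lborel)"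
  shows "D \<noteq> 0" "D \<noteq> \<infinity>"
proof -
  have D: "D = (\<integral>\<^sup>+t. indicator {-pi/2<..<pi/2} t * ennreal (cos t ^ (d - 1) / (d + 1)) * 1 \<partial>lborel)"
    unfolding D_def by (rule half_disc_integral) (use assms in auto)
  have "D \<le> (\<integral>\<^sup>+t. indicator {-pi/2<..<pi/2} (t::real) \<partial>lborel)"
    unfolding D
  proof (rule nn_integral_mono)
    fix t :: real
    show "indicator {-pi/2<..<pi/2} t * ennreal (cos t ^ (d - 1) / (d + 1)) * 1 \<le> indicator {-pi/2<..<pi/2} t"
    proof (cases "t \<in> {-pi/2<..<pi/2}")
      case True
      then have "cos t > 0" by (intro cos_gt_zero_pi) auto
      then have "cos t ^ (d - 1) \<le> 1" by (intro power_le_one) auto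
      then have "cos t ^ (d - 1) / (d + 1) \<le> 1" by (simp add: divide_le_eq)
      then show ?thesis using True by (simp add: ennreal_le_1)
    qed simp
  qed
  then show "D \<noteq> \<infinity>" by (auto simp: top_unique)
  have pos: "0 < cos t ^ (d - 1) / (d + 1)" if "t \<in> {-pi/2<..<pi/2}" for t
    using that cos_gt_zero_pi[of t] by auto
  show "D \<noteq> 0"
  proof
    assume "D = 0"
    then have "AE t in lborel. indicator {-pi/2<..<pi/2} t * ennreal (cos t ^ (d - 1) / (d + 1)) * 1 = 0"
      unfolding D by (subst (asm) nn_integral_0_iff_AE) auto
    then have "AE t in lborel. t \<notin> {-pi/2<..<pi/2}"
    proof (rule eventually_mono)
      fix t :: real assume "indicator {-pi/2<..<pi/2} t * ennreal (cos t ^ (d - 1) / (d + 1)) * 1 = 0"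
      then show "t \<notin> {-pi/2<..<pi/2}" using pos[of t] by (auto simp: indicator_def ennreal_eq_0_iff)
    qed
    then have "emeasure lborel {-pi/2<..<pi/2::real} = 0"
      by (subst (asm) AE_iff_measurable[where N = "{-pi/2<..<pi/2}"]) auto
    then show False by simp
  qed
qed

section \<open>Spherical polar coordinates\<close>

lemma eta_uminus: "eta e (- u) = - eta e u"
  by (simp add: eta_def pr_def sgn_minus[symmetric])

lemma eta_sgn: "eta e (sgn u) = eta e u"
proof (cases "u = 0")
  case False
  have "pr e (sgn u) = inverse (norm u) *\<^sub>R pr e u" by (simp add: pr_def sgn_div_norm scaleR_diff_right)
  then show ?thesis unfolding eta_def using False by (simp add: sgn_scaleR)
qed simp

lemma orthogonal_uminus: "orthogonal_transformation (uminus :: real ^ 'n \<Rightarrow> real ^ 'n)"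
  by (simp add: orthogonal_transformation_def linear_uminus)

text \<open>The cylindrical formula is used twice: for the indicator of the ball it identifies its
  unknown constant with \<open>D\<close>, and for that indicator times \<open>g (sgn u)\<close> it
  becomes the formula on the sphere.\<close>

lemma nn_integral_sphere_polar_Basis:
  fixes e :: "real ^ 'n" and g :: "real ^ 'n \<Rightarrow> ennreal"
  assumes e: "e \<in> Basis" and n: "CARD('n) = Suc d" "d \<ge> 1" and g[measurable]: "g \<in> borel_measurable borel"
  defines "D \<equiv> (\<integral>\<^sup>+l. \<integral>\<^sup>+k. ennreal (l ^ (d - 1)) * indicator {0<..} l * ((if sqrt (k\<^sup>2 + l\<^sup>2) \<le> 1 then 1 else 0) * 1) \<partial>lborel \<partial>lborel)"
  shows "D * (\<integral>\<^sup>+x. g x \<partial>sm) = (\<integral>\<^sup>+t. indicator {-pi/2<..<pi/2} t * ennreal (cos t ^ (d - 1) / (d + 1)) *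
     (\<integral>\<^sup>+u. g (sin t *\<^sub>R e + cos t *\<^sub>R eta e u) \<partial>sm) \<partial>lborel)"
proof -
  let ?phi = "indicator (cball 0 1) :: real ^ 'n \<Rightarrow> ennreal"
  let ?w = "\<lambda>t. indicator {-pi/2<..<pi/2} t * ennreal (cos t ^ (d - 1) / (d + 1))"
  have ne: "norm e = 1" using e by simp
  have AE: "AE u in lborel. pr e u \<noteq> 0" by (rule AE_pr_nonzero) (use n in simp)
  define C where "C = (\<integral>\<^sup>+m. \<integral>\<^sup>+k. indicator {0<..} m * ennreal (1 / m ^ (d + 1)) * (if sqrt (k\<^sup>2 + (1/m)\<^sup>2) \<le> 1 then 1 else 0) \<partial>lborel \<partial>lborel)"
  have cyl: "(\<integral>\<^sup>+u. ?phi u * (\<integral>\<^sup>+l. \<integral>\<^sup>+k. ennreal (l ^ (d - 1)) * indicator {0<..} l * H (k *\<^sub>R e + l *\<^sub>R eta e u) \<partial>lborel \<partial>lborel) \<partial>lborel) = C * (\<integral>\<^sup>+u. H u \<partial>lborel)"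
    if "H \<in> borel_measurable borel" for H
    unfolding C_def by (rule nn_integral_cylindrical[OF e n that])
  have phi: "?phi (k *\<^sub>R e + l *\<^sub>R eta e u) = (if sqrt (k\<^sup>2 + l\<^sup>2) \<le> 1 then 1 else 0)" if "pr e u \<noteq> 0" for k l u
    using norm_combination[OF ne eta_inner[OF ne] norm_eta[OF that], of k l] by (simp add: indicator_def)
  define B where "B = (\<integral>\<^sup>+u. ?phi u \<partial>lborel)"
  have B: "B \<noteq> 0" "B \<noteq> \<infinity>"
  proof -
    have B: "B = emeasure lborel (cball 0 1 :: (real ^ 'n) set)" by (simp add: B_def)
    show "B \<noteq> \<infinity>" using emeasure_lborel_cball_finite[of "0 :: real ^ 'n" 1] unfolding B by simp
    have "emeasure lborel (ball 0 1 :: (real ^ 'n) set) \<le> B"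
      unfolding B by (rule emeasure_mono) auto
    moreover have "emeasure lborel (ball 0 1 :: (real ^ 'n) set) > 0"
      by (simp add: emeasure_ball)
    ultimately show "B \<noteq> 0" by auto
  qed
  have "C * B = (\<integral>\<^sup>+u. ?phi u * (\<integral>\<^sup>+l. \<integral>\<^sup>+k. ennreal (l ^ (d - 1)) * indicator {0<..} l * ?phi (k *\<^sub>R e + l *\<^sub>R eta e u) \<partial>lborel \<partial>lborel) \<partial>lborel)"
    unfolding B_def by (rule cyl[symmetric]) simp
  also have "\<dots> = (\<integral>\<^sup>+u. ?phi u * D \<partial>lborel)"
    unfolding D_def by (rule nn_integral_cong_AE, rule eventually_mono[OF AE]) (simp only: phi mult_1_right not_False_eq_True)
  also have "\<dots> = B * D" unfolding B_def by (rule nn_integral_multc) simp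
  finally have "B * C = B * D" by (simp only: mult.commute)
  then have CD: "C = D" using B by (simp add: ennreal_mult_cancel_left)
  have "C * (\<integral>\<^sup>+u. ?phi u * g (sgn u) \<partial>lborel) =
     (\<integral>\<^sup>+u. ?phi u * (\<integral>\<^sup>+l. \<integral>\<^sup>+k. ennreal (l ^ (d - 1)) * indicator {0<..} l * (?phi (k *\<^sub>R e + l *\<^sub>R eta e u) * g (sgn (k *\<^sub>R e + l *\<^sub>R eta e u))) \<partial>lborel \<partial>lborel) \<partial>lborel)"
    by (rule cyl[symmetric]) measurable
  also have "\<dots> = (\<integral>\<^sup>+u. ?phi u * (\<integral>\<^sup>+t. ?w t * g (sin t *\<^sub>R e + cos t *\<^sub>R eta e u) \<partial>lborel) \<partial>lborel)"
  proof (rule nn_integral_cong_AE, rule eventually_mono[OF AE])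
    fix u :: "real ^ 'n" assume u: "pr e u \<noteq> 0"
    have "(\<integral>\<^sup>+l. \<integral>\<^sup>+k. ennreal (l ^ (d - 1)) * indicator {0<..} l * ((if sqrt (k\<^sup>2 + l\<^sup>2) \<le> 1 then 1 else 0) * g (sgn (k *\<^sub>R e + l *\<^sub>R eta e u))) \<partial>lborel \<partial>lborel)
       = (\<integral>\<^sup>+t. ?w t * g (sin t *\<^sub>R e + cos t *\<^sub>R eta e u) \<partial>lborel)"
    proof (rule half_disc_integral[OF _ _ _ n(2)])
      fix l t :: real assume l: "0 < l" and t: "\<bar>t\<bar> < pi/2"
      then have c: "cos t > 0" by (intro cos_gt_zero_pi) auto
      have "(l * tan t) *\<^sub>R e + l *\<^sub>R eta e u = (l / cos t) *\<^sub>R (sin t *\<^sub>R e + cos t *\<^sub>R eta e u)"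
        using c by (simp add: scaleR_add_right tan_def)
      moreover have "norm (sin t *\<^sub>R e + cos t *\<^sub>R eta e u) = 1"
        using norm_combination[OF ne eta_inner[OF ne] norm_eta[OF u], of "sin t" "cos t"] by simp
      ultimately show "g (sgn ((l * tan t) *\<^sub>R e + l *\<^sub>R eta e u)) = g (sin t *\<^sub>R e + cos t *\<^sub>R eta e u)"
        using l c by (simp add: sgn_scaleR) (simp add: sgn_div_norm)
    qed measurable
    then show "?phi u * (\<integral>\<^sup>+l. \<integral>\<^sup>+k. ennreal (l ^ (d - 1)) * indicator {0<..} l * (?phi (k *\<^sub>R e + l *\<^sub>R eta e u) * g (sgn (k *\<^sub>R e + l *\<^sub>R eta e u))) \<partial>lborel \<partial>lborel) =
        ?phi u * (\<integral>\<^sup>+t. ?w t * g (sin t *\<^sub>R e + cos t *\<^sub>R eta e u) \<partial>lborel)"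
      by (simp only: phi[OF u])
  qed
  also have "\<dots> = (\<integral>\<^sup>+u. \<integral>\<^sup>+t. ?phi u * (?w t * g (sin t *\<^sub>R e + cos t *\<^sub>R eta e u)) \<partial>lborel \<partial>lborel)"
    by (rule nn_integral_cong, rule nn_integral_cmult[symmetric]) measurable
  also have "\<dots> = (\<integral>\<^sup>+t. \<integral>\<^sup>+u. ?phi u * (?w t * g (sin t *\<^sub>R e + cos t *\<^sub>R eta e u)) \<partial>lborel \<partial>lborel)"
    by (rule lborel_pair.Fubini') measurable
  also have "\<dots> = (\<integral>\<^sup>+t. ?w t * (\<integral>\<^sup>+u. ?phi u * g (sin t *\<^sub>R e + cos t *\<^sub>R eta e u) \<partial>lborel) \<partial>lborel)"
  proof (rule nn_integral_cong)
    fix t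
    have "(\<integral>\<^sup>+u. ?phi u * (?w t * g (sin t *\<^sub>R e + cos t *\<^sub>R eta e u)) \<partial>lborel) = (\<integral>\<^sup>+u. ?w t * (?phi u * g (sin t *\<^sub>R e + cos t *\<^sub>R eta e u)) \<partial>lborel)"
      by (simp only: mult_ac)
    also have "\<dots> = ?w t * (\<integral>\<^sup>+u. ?phi u * g (sin t *\<^sub>R e + cos t *\<^sub>R eta e u) \<partial>lborel)"
      by (rule nn_integral_cmult) measurable
    finally show "(\<integral>\<^sup>+u. ?phi u * (?w t * g (sin t *\<^sub>R e + cos t *\<^sub>R eta e u)) \<partial>lborel) = \<dots>" .
  qed
  finally have "of_nat CARD('n) * (D * (\<integral>\<^sup>+u. ?phi u * g (sgn u) \<partial>lborel)) =
      of_nat CARD('n) * (\<integral>\<^sup>+t. ?w t * (\<integral>\<^sup>+u. ?phi u * g (sin t *\<^sub>R e + cos t *\<^sub>R eta e u) \<partial>lborel) \<partial>lborel)"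
    by (simp only: CD)
  also have "\<dots> = (\<integral>\<^sup>+t. of_nat CARD('n) * (?w t * (\<integral>\<^sup>+u. ?phi u * g (sin t *\<^sub>R e + cos t *\<^sub>R eta e u) \<partial>lborel)) \<partial>lborel)"
    by (rule nn_integral_cmult[symmetric]) measurable
  also have "\<dots> = (\<integral>\<^sup>+t. ?w t * (\<integral>\<^sup>+u. g (sin t *\<^sub>R e + cos t *\<^sub>R eta e u) \<partial>sm) \<partial>lborel)"
  proof (rule nn_integral_cong)
    fix t
    have "(\<integral>\<^sup>+u. g (sin t *\<^sub>R e + cos t *\<^sub>R eta e u) \<partial>sm) = of_nat CARD('n) * (\<integral>\<^sup>+u. ?phi u * g (sin t *\<^sub>R e + cos t *\<^sub>R eta e u) \<partial>lborel)"
      by (subst nn_integral_sm) (simp_all add: eta_sgn)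
    then show "of_nat CARD('n) * (?w t * (\<integral>\<^sup>+u. ?phi u * g (sin t *\<^sub>R e + cos t *\<^sub>R eta e u) \<partial>lborel)) = ?w t * (\<integral>\<^sup>+u. g (sin t *\<^sub>R e + cos t *\<^sub>R eta e u) \<partial>sm)"
      by (simp only: mult_ac)
  qed
  finally show ?thesis by (simp add: nn_integral_sm mult_ac)
qed

text \<open>The surface measure lives on a subspace sigma-algebra of the sphere; \<open>sb\<close> is its image in the
  whole space.\<close>

definition sb :: "(real ^ 'n) measure" where
  "sb = distr sphere_measure borel (\<lambda>x. x)"

lemma sets_sb [simp, measurable_cong]: "sets sb = sets borel"
  by (simp add: sb_def)

lemma space_sb [simp]: "space sb = UNIV"
  by (simp add: sb_def)

lemma nn_integral_sb: "g \<in> borel_measurable borel \<Longrightarrow> (\<integral>\<^sup>+x. g x \<partial>sb) = (\<integral>\<^sup>+x. g x \<partial>sm)"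
  unfolding sb_def by (subst nn_integral_distr) (auto intro: measurable_sm)

lemma finite_measure_sb: "finite_measure (sb :: (real ^ 'n) measure)"
  unfolding sb_def by (rule finite_measure.finite_measure_distr[OF finite_measure_sm]) (rule measurable_sm, simp)

lemma sigma_finite_sb: "sigma_finite_measure (sb :: (real ^ 'n) measure)"
  by (rule finite_measure.axioms(1)[OF finite_measure_sb])

lemma AE_sb_norm: "AE x in sb. norm x = 1"
  unfolding sb_def
  by (subst AE_distr_iff) (auto intro!: measurable_sm simp: space_sm)

lemma AE_sb_pr:
  assumes "CARD('n) \<ge> 2" shows "AE u in sb. pr e (u :: real ^ 'n) \<noteq> 0"
proof -
  have AE: "AE u in lborel. pr e (u :: real ^ 'n) \<noteq> 0" by (rule AE_pr_nonzero[OF assms])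
  have [measurable]: "{u. pr e u = 0} \<in> sets borel"
  proof -
    have "closed (pr e -` {0})" unfolding pr_def[abs_def]
      by (intro closed_vimage continuous_intros closed_singleton)
    then show ?thesis by (simp add: vimage_def)
  qed
  have "emeasure sb {u. pr e u = 0} = (\<integral>\<^sup>+u. indicator {u. pr e u = 0} u \<partial>sb)" by simp
  also have "\<dots> = of_nat CARD('n) * (\<integral>\<^sup>+u. indicator (cball 0 1) u * indicator {u. pr e u = 0} (sgn u) \<partial>lborel)"
    by (subst nn_integral_sb, simp, rule nn_integral_sm) simp
  also have "(\<integral>\<^sup>+u. indicator (cball 0 1) u * indicator {u. pr e u = 0} (sgn u) \<partial>lborel) = (\<integral>\<^sup>+u. 0 \<partial>(lborel :: (real ^ 'n) measure))"
  proof (rule nn_integral_cong_AE, rule eventually_mono[OF AE])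
    fix u :: "real ^ 'n" assume u: "pr e u \<noteq> 0"
    then have "eta e u \<noteq> 0" using norm_eta[OF u] by auto
    then have "pr e (sgn u) \<noteq> 0" using eta_sgn[of e u] by (auto simp: eta_def)
    then show "indicator (cball 0 1) u * indicator {u. pr e u = 0} (sgn u) = (0 :: ennreal)" by simp
  qed
  finally show ?thesis by (intro AE_I[where N = "{u. pr e u = 0}"]) auto
qed

definition polar_pt :: "real ^ 'n \<Rightarrow> real ^ 'n \<Rightarrow> real \<Rightarrow> real ^ 'n" where
  "polar_pt e u t = cos t *\<^sub>R e + sin t *\<^sub>R eta e u"

lemma polar_pt_measurable [measurable (raw)]:
  assumes [measurable]: "f \<in> borel_measurable M" "g \<in> borel_measurable M" "h \<in> borel_measurable M"
  shows "(\<lambda>x. polar_pt (f x) (g x) (h x)) \<in> borel_measurable M"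
  unfolding polar_pt_def by measurable

text \<open>Latitude is replaced by the angle from \<open>e\<close>, ranging over (0, pi), and this
  interval by [-pi, pi]: changing the sign of the angle amounts to replacing \<open>u\<close> by
  \<open>-u\<close>, which the surface measure does not see.\<close>

lemma sphere_polar_Basis:
  fixes e :: "real ^ 'n"
  assumes e: "e \<in> Basis" and n: "CARD('n) = Suc d" "d \<ge> 1"
  obtains c :: real where "c > 0" and "\<And>g :: real ^ 'n \<Rightarrow> ennreal. g \<in> borel_measurable borel \<Longrightarrow> (\<integral>\<^sup>+x. g x \<partial>sb) = ennreal c *
     (\<integral>\<^sup>+t. indicator {-pi..pi} t * ennreal (\<bar>sin t\<bar> ^ (d - 1)) * (\<integral>\<^sup>+u. g (polar_pt e u t) \<partial>sb) \<partial>lborel)"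
proof -
  define D where "D = (\<integral>\<^sup>+l. \<integral>\<^sup>+k. ennreal (l ^ (d - 1)) * indicator {0<..} l * ((if sqrt (k\<^sup>2 + l\<^sup>2) \<le> 1 then 1 else 0) * 1) \<partial>lborel \<partial>lborel)"
  have "D \<noteq> 0" "D \<noteq> \<infinity>" unfolding D_def using half_disc_const[OF n(2)] by blast+
  then obtain Dr where Dr: "D = ennreal Dr" "Dr > 0" by (cases D) (auto simp: less_le)
  \<comment> \<open>The factors undo \<open>D\<close>, come from the weight of the half disc, and
    compensate for covering the sphere twice.\<close>
  define c where "c = 1 / Dr * (1 / (d + 1)) * (1 / 2)"
  have "(\<integral>\<^sup>+x. g x \<partial>sb) = ennreal c *
     (\<integral>\<^sup>+t. indicator {-pi..pi} t * ennreal (\<bar>sin t\<bar> ^ (d - 1)) * (\<integral>\<^sup>+u. g (polar_pt e u t) \<partial>sb) \<partial>lborel)"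
    if g[measurable]: "g \<in> borel_measurable borel" for g :: "real ^ 'n \<Rightarrow> ennreal"
  proof -
    interpret sb: sigma_finite_measure "sb :: (real ^ 'n) measure" by (rule sigma_finite_sb)
    define A where "A t = (\<integral>\<^sup>+u. g (polar_pt e u t) \<partial>sb)" for t
    have [measurable]: "A \<in> borel_measurable borel" unfolding A_def by measurable
    have Aminus: "A (- t) = A t" for t
    proof -
      have "A (- t) = (\<integral>\<^sup>+u. g (polar_pt e (- u) t) \<partial>sm)"
        unfolding A_def by (subst nn_integral_sb) (simp_all add: polar_pt_def eta_uminus)
      also have "\<dots> = (\<integral>\<^sup>+u. g (polar_pt e u t) \<partial>sm)"
        by (rule nn_integral_sm_orthogonal[OF orthogonal_uminus, where g = "\<lambda>u. g (polar_pt e u t)"]) measurable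
      finally show ?thesis unfolding A_def by (subst nn_integral_sb) simp_all
    qed
    define f where "f t = indicator {0<..<pi} t * ennreal (sin t ^ (d - 1)) * A t" for t
    have [measurable]: "f \<in> borel_measurable borel" unfolding f_def by measurable
    have "D * (\<integral>\<^sup>+x. g x \<partial>sb) = (\<integral>\<^sup>+t. indicator {-pi/2<..<pi/2} t * ennreal (cos t ^ (d - 1) / (d + 1)) *
        (\<integral>\<^sup>+u. g (sin t *\<^sub>R e + cos t *\<^sub>R eta e u) \<partial>sm) \<partial>lborel)"
      using nn_integral_sphere_polar_Basis[OF e n g] by (simp add: nn_integral_sb D_def)
    also have "\<dots> = (\<integral>\<^sup>+t. indicator {-pi/2<..<pi/2} t * ennreal (cos t ^ (d - 1) / (d + 1)) * A (pi/2 - t) \<partial>lborel)"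
      unfolding A_def polar_pt_def by (subst nn_integral_sb) (simp_all add: cos_diff sin_diff)
    also have "\<dots> = \<bar>-1::real\<bar> * (\<integral>\<^sup>+t. indicator {-pi/2<..<pi/2} (pi/2 + -1 * t) * ennreal (cos (pi/2 + -1 * t) ^ (d - 1) / (d + 1)) * A (pi/2 - (pi/2 + -1 * t)) \<partial>lborel)"
      by (rule nn_integral_real_affine) auto
    also have "\<dots> = (\<integral>\<^sup>+t. ennreal (1 / (d + 1)) * f t \<partial>lborel)"
    proof -
      have "indicator {-pi/2<..<pi/2} (pi/2 + -1 * t) * ennreal (cos (pi/2 + -1 * t) ^ (d - 1) / (d + 1)) * A (pi/2 - (pi/2 + -1 * t)) = ennreal (1 / (d + 1)) * f t" for t
      proof (cases "t \<in> {0<..<pi}")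
        case True
        then have s: "sin t > 0" by (intro sin_gt_zero) auto
        have "pi/2 + -1 * t \<in> {-pi/2<..<pi/2}" using True by (simp add: field_simps)
        moreover have "cos (pi/2 + -1 * t) = sin t" by (simp add: cos_diff)
        moreover have "ennreal (sin t ^ (d - 1) / (d + 1)) = ennreal (1 / (d + 1)) * ennreal (sin t ^ (d - 1))"
          using s by (simp add: ennreal_mult[symmetric])
        ultimately show ?thesis using True by (simp add: f_def mult.assoc)
      next
        case False
        then have "pi/2 + -1 * t \<notin> {-pi/2<..<pi/2}" by (auto simp: field_simps)
        then show ?thesis using False by (simp add: f_def)
      qed
      then show ?thesis by simp
    qed
    also have "\<dots> = ennreal (1 / (d + 1)) * (\<integral>\<^sup>+t. f t \<partial>lborel)"
      by (rule nn_integral_cmult) simp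
    finally have 1: "D * (\<integral>\<^sup>+x. g x \<partial>sb) = ennreal (1 / (d + 1)) * (\<integral>\<^sup>+t. f t \<partial>lborel)" .
    have f2: "(\<integral>\<^sup>+t. f (- t) \<partial>lborel) = (\<integral>\<^sup>+t. f t \<partial>lborel)"
      using nn_integral_real_affine[of f "-1" 0] by simp
    have "AE t in lborel. t \<noteq> (0::real)" "AE t in lborel. t \<noteq> pi" "AE t in lborel. t \<noteq> -pi"
      by (rule AE_lborel_singleton)+
    then have "AE t in lborel. indicator {-pi..pi} t * ennreal (\<bar>sin t\<bar> ^ (d - 1)) * A t = f t + f (- t)"
    proof eventually_elim
      case (elim t)
      consider "t \<in> {0<..<pi}" | "- t \<in> {0<..<pi}" | "\<bar>t\<bar> > pi" using elim
        by (smt (verit) greaterThanLessThan_iff)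
      then show ?case
      proof cases
        case 1
        then have "sin t > 0" by (intro sin_gt_zero) auto
        then show ?thesis using 1 by (simp add: f_def)
      next
        case 2
        then have "sin (- t) > 0" by (intro sin_gt_zero) auto
        then show ?thesis using 2 by (simp add: f_def Aminus)
      next
        case 3
        then have "t \<notin> {-pi..pi}" "t \<notin> {0<..<pi}" "- t \<notin> {0<..<pi}" by (auto simp: abs_if split: if_splits)
        then show ?thesis by (simp add: f_def)
      qed
    qed
    then have "(\<integral>\<^sup>+t. indicator {-pi..pi} t * ennreal (\<bar>sin t\<bar> ^ (d - 1)) * A t \<partial>lborel) = (\<integral>\<^sup>+t. f t + f (- t) \<partial>lborel)"
      by (rule nn_integral_cong_AE)
    also have "\<dots> = 2 * (\<integral>\<^sup>+t. f t \<partial>lborel)"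
      by (subst nn_integral_add) (simp_all add: f2 mult_2)
    finally have 2: "(\<integral>\<^sup>+t. indicator {-pi..pi} t * ennreal (\<bar>sin t\<bar> ^ (d - 1)) * A t \<partial>lborel) = 2 * (\<integral>\<^sup>+t. f t \<partial>lborel)" .
    have "(\<integral>\<^sup>+x. g x \<partial>sb) = ennreal (1 / Dr) * (D * (\<integral>\<^sup>+x. g x \<partial>sb))"
      using Dr by (simp add: mult.assoc[symmetric] ennreal_mult[symmetric])
    also have "\<dots> = ennreal c * (2 * (\<integral>\<^sup>+t. f t \<partial>lborel))"
    proof -
      have "ennreal (1 / Dr) * ennreal (1 / (d + 1)) = ennreal c * 2"
      proof -
        have "1 / Dr * (1 / (d + 1)) = c * 2" by (simp add: c_def)
        then have "ennreal (1 / Dr * (1 / (d + 1))) = ennreal (c * 2)" by (simp only:)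
        then show ?thesis using Dr(2) by (simp only: ennreal_mult'' ennreal_mult' ennreal_numeral zero_le_divide_1_iff less_imp_le of_nat_0_le_iff zero_le_numeral)
      qed
      then show ?thesis unfolding 1 by (simp only: mult.assoc[symmetric])
    qed
    finally show ?thesis unfolding 2[symmetric] A_def .
  qed
  moreover have "c > 0" using Dr by (simp add: c_def)
  ultimately show ?thesis using that by blast
qed

text \<open>An orthogonal map takes a basis vector to \<open>e\<close> and commutes with the
  construction, so the same \<open>c\<close> serves every \<open>e\<close>.\<close>

lemma sphere_polar:
  assumes n: "CARD('n) = Suc d" "d \<ge> 1"
  obtains c :: real where "c > 0" and "\<And>(e :: real ^ 'n) (g :: real ^ 'n \<Rightarrow> ennreal). norm e = 1 \<Longrightarrow> g \<in> borel_measurable borel \<Longrightarrow> (\<integral>\<^sup>+x. g x \<partial>sb) = ennreal c *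
     (\<integral>\<^sup>+t. indicator {-pi..pi} t * ennreal (\<bar>sin t\<bar> ^ (d - 1)) * (\<integral>\<^sup>+u. g (polar_pt e u t) \<partial>sb) \<partial>lborel)"
proof -
  obtain e0 :: "real ^ 'n" where e0: "e0 \<in> Basis" using nonempty_Basis by blast
  obtain c :: real where c: "c > 0" and polar: "\<And>g :: real ^ 'n \<Rightarrow> ennreal. g \<in> borel_measurable borel \<Longrightarrow> (\<integral>\<^sup>+x. g x \<partial>sb) = ennreal c *
     (\<integral>\<^sup>+t. indicator {-pi..pi} t * ennreal (\<bar>sin t\<bar> ^ (d - 1)) * (\<integral>\<^sup>+u. g (polar_pt e0 u t) \<partial>sb) \<partial>lborel)"
    using sphere_polar_Basis[OF e0 n] by blast
  have "(\<integral>\<^sup>+x. g x \<partial>sb) = ennreal c *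
     (\<integral>\<^sup>+t. indicator {-pi..pi} t * ennreal (\<bar>sin t\<bar> ^ (d - 1)) * (\<integral>\<^sup>+u. g (polar_pt e u t) \<partial>sb) \<partial>lborel)"
    if e: "norm e = 1" and g[measurable]: "g \<in> borel_measurable borel" for e :: "real ^ 'n" and g :: "real ^ 'n \<Rightarrow> ennreal"
  proof -
    obtain R :: "real ^ 'n \<Rightarrow> real ^ 'n" where R: "orthogonal_transformation R" "R e0 = e"
      using orthogonal_transformation_exists_1[of e0 e] e e0 by auto
    have lin: "linear R" using R(1) by (rule orthogonal_transformation_linear)
    have Rm[measurable]: "R \<in> borel_measurable borel"
      using lin by (intro borel_measurable_continuous_onI linear_continuous_on)
        (simp add: linear_conv_bounded_linear[symmetric])
    have inv: "(\<integral>\<^sup>+x. h (R x) \<partial>sb) = (\<integral>\<^sup>+x. h x \<partial>sb)" if [measurable]: "h \<in> borel_measurable borel" for h :: "real ^ 'n \<Rightarrow> ennreal"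
      using nn_integral_sm_orthogonal[OF R(1), of h] by (simp add: nn_integral_sb)
    have pr: "R (pr e0 u) = pr e (R u)" for u
      using R(1) unfolding pr_def R(2)[symmetric] 
      by (simp add: linear_diff[OF lin] linear_scale[OF lin] orthogonal_transformation_def)
    have polar_pt: "R (polar_pt e0 u t) = polar_pt e (R u) t" for u t
      unfolding polar_pt_def eta_def pr[symmetric] sgn_orthogonal[OF R(1)]
      by (simp add: linear_add[OF lin] linear_scale[OF lin] R(2))
    have "(\<integral>\<^sup>+x. g x \<partial>sb) = (\<integral>\<^sup>+x. g (R x) \<partial>sb)" by (rule inv[symmetric]) simp
    also have "\<dots> = ennreal c *
     (\<integral>\<^sup>+t. indicator {-pi..pi} t * ennreal (\<bar>sin t\<bar> ^ (d - 1)) * (\<integral>\<^sup>+u. g (R (polar_pt e0 u t)) \<partial>sb) \<partial>lborel)"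
      by (rule polar) measurable
    also have "(\<lambda>t. \<integral>\<^sup>+u. g (R (polar_pt e0 u t)) \<partial>sb) = (\<lambda>t. \<integral>\<^sup>+u. g (polar_pt e u t) \<partial>sb)"
      unfolding polar_pt by (rule ext, rule inv) measurable
    finally show ?thesis by simp
  qed
  with c that show ?thesis by blast
qed

abbreviation sb3 :: "(('n::finite) ambient3) measure" where "sb3 \<equiv> sb \<Otimes>\<^sub>M (sb \<Otimes>\<^sub>M sb)"

lemma sets_sb3 [simp]: "sets (sb3 :: ('n::finite) ambient3 measure) = sets borel"
proof -
  have "sets (sb3 :: 'n ambient3 measure) = sets (borel \<Otimes>\<^sub>M (borel \<Otimes>\<^sub>M borel))"
    by (intro sets_pair_measure_cong sets_sb)
  then show ?thesis by (simp only: borel_prod)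
qed

lemma measurable_fst_borel [measurable]:
  "(fst :: 'a::second_countable_topology \<times> 'b::second_countable_topology \<Rightarrow> 'a) \<in> borel_measurable borel"
  by (intro borel_measurable_continuous_onI continuous_intros)

lemma measurable_snd_borel [measurable]:
  "(snd :: 'a::second_countable_topology \<times> 'b::second_countable_topology \<Rightarrow> 'b) \<in> borel_measurable borel"
  by (intro borel_measurable_continuous_onI continuous_intros)

section \<open>The sector in polar coordinates\<close>

text \<open>Triples whose two directions \<open>eta\<close> are genuine unit vectors; these are
  almost all triples (\<open>AE_sb3_good\<close>).\<close>

definition good :: "('n::finite) ambient3 \<Rightarrow> bool" where
  "good z \<longleftrightarrow> norm (fst z) = 1 \<and> pr (fst z) (fst (snd z)) \<noteq> 0 \<and> pr (fst z) (snd (snd z)) \<noteq> 0"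

text \<open>The angles take both signs, so the sphere is covered twice; the orthogonal directions are
  taken from auxiliary points \<open>fst (snd z)\<close>, \<open>snd (snd z)\<close> of the sphere, projected off \<open>fst z\<close>.\<close>

definition polar_map :: "('n::finite) ambient3 \<Rightarrow> real \<times> real \<Rightarrow> 'n ambient3" where
  "polar_map z q = (fst z, polar_pt (fst z) (fst (snd z)) (pi * fst q * snd q), polar_pt (fst z) (snd (snd z)) (pi * fst q))"

text \<open>On unit vectors this says \<open>|x1 - x2| <= |x1 - x3|\<close>; in angles around
  \<open>x1\<close> it compares two cosines.\<close>

definition sector :: "('n::finite) ambient3 \<Rightarrow> bool" where
  "sector x \<longleftrightarrow> fst x \<bullet> snd (snd x) \<le> fst x \<bullet> fst (snd x)"

definition box1 :: "(real \<times> real) set" where "box1 = {-1..1} \<times> {-1..1}"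

text \<open>The factors are the Jacobian \<open>pi\<close> of \<open>t3 = pi r\<close>, the Jacobian
  \<open>pi |r|\<close> of \<open>t2 = t3 s\<close>, and the polar densities of the two
  angles.\<close>

definition qweight :: "nat \<Rightarrow> real \<times> real \<Rightarrow> real" where
  "qweight d q = pi * (pi * \<bar>fst q\<bar>) * (\<bar>sin (pi * fst q * snd q)\<bar> ^ (d - 1) * \<bar>sin (pi * fst q)\<bar> ^ (d - 1))"

lemma nn_integral_sb3:
  assumes [measurable]: "G \<in> borel_measurable borel"
  shows "(\<integral>\<^sup>+x. G x \<partial>(sb3 :: ('n::finite) ambient3 measure)) = (\<integral>\<^sup>+x1. \<integral>\<^sup>+x2. \<integral>\<^sup>+x3. G (x1, x2, x3) \<partial>sb \<partial>sb \<partial>sb)"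
proof -
  interpret sb: sigma_finite_measure "sb :: (real ^ 'n) measure" by (rule sigma_finite_sb)
  interpret P: pair_sigma_finite "sb :: (real ^ 'n) measure" "sb :: (real ^ 'n) measure" by unfold_locales
  have m: "G \<in> borel_measurable sb3" using assms by (simp add: measurable_cong_sets[OF sets_sb3 refl])
  have "(\<integral>\<^sup>+x. G x \<partial>sb3) = (\<integral>\<^sup>+x1. \<integral>\<^sup>+y. G (x1, y) \<partial>(sb \<Otimes>\<^sub>M sb) \<partial>sb)"
    by (rule sigma_finite_measure.nn_integral_fst[OF P.P.sigma_finite_measure_axioms m, symmetric])
  also have "\<dots> = (\<integral>\<^sup>+x1. \<integral>\<^sup>+x2. \<integral>\<^sup>+x3. G (x1, x2, x3) \<partial>sb \<partial>sb \<partial>sb)"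
  proof (rule nn_integral_cong)
    fix x1 :: "real ^ 'n"
    have "(\<lambda>y. G (x1, y)) \<in> borel_measurable (sb \<Otimes>\<^sub>M sb)"
      by (rule measurable_compose[OF _ m]) simp
    from sb.nn_integral_fst[OF this, symmetric]
    show "(\<integral>\<^sup>+y. G (x1, y) \<partial>(sb \<Otimes>\<^sub>M sb)) = (\<integral>\<^sup>+x2. \<integral>\<^sup>+x3. G (x1, x2, x3) \<partial>sb \<partial>sb)" .
  qed
  finally show ?thesis .
qed

lemma AE_sb3_good:
  assumes "CARD('n) \<ge> 2" shows "AE z in (sb3 :: ('n::finite) ambient3 measure). good z"
proof -
  interpret sb: sigma_finite_measure "sb :: (real ^ 'n) measure" by (rule sigma_finite_sb)
  interpret P: pair_sigma_finite "sb :: (real ^ 'n) measure" "sb :: (real ^ 'n) measure" by unfold_locales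
  interpret PP: pair_sigma_finite "sb :: (real ^ 'n) measure" "sb \<Otimes>\<^sub>M sb :: ((real ^ 'n) \<times> (real ^ 'n)) measure" by unfold_locales
  have gm: "Measurable.pred borel (\<lambda>z::'n ambient3. good z)" unfolding good_def by measurable
  have gm2: "Measurable.pred (sb \<Otimes>\<^sub>M sb) (\<lambda>y. good (x, y))" for x :: "real ^ 'n"
    unfolding good_def by measurable
  have "AE y in sb \<Otimes>\<^sub>M sb. good (x, y)" if x: "norm x = 1" for x :: "real ^ 'n"
  proof (rule P.AE_pair_measure)
    show "{y \<in> space (sb \<Otimes>\<^sub>M sb). good (x, y)} \<in> sets (sb \<Otimes>\<^sub>M sb)" using gm2[of x] by (simp add: pred_def)
    have "AE v in sb. good (x, u, v)" if u: "pr x u \<noteq> 0" for u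
      by (rule eventually_mono[OF AE_sb_pr[OF assms, of x]]) (use u x in \<open>simp add: good_def\<close>)
    then show "AE u in sb. AE v in sb. good (x, u, v)"
      by (rule eventually_mono[OF AE_sb_pr[OF assms, of x]])
  qed
  then have "AE x in sb. AE y in sb \<Otimes>\<^sub>M sb. good (x :: real ^ 'n, y)"
    by (rule eventually_mono[OF AE_sb_norm])
  then show ?thesis
  proof (rule PP.AE_pair_measure[rotated])
    have "{z \<in> space sb3. good z} = {z \<in> space borel. good (z :: 'n ambient3)}" by (simp add: space_pair_measure)
    moreover have "{z \<in> space borel. good (z :: 'n ambient3)} \<in> sets borel" using gm by (simp only: pred_def)
    ultimately show "{z \<in> space sb3. good (z :: 'n ambient3)} \<in> sets sb3" by (simp only: sets_sb3)
  qed
qed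

lemma polar_pt_inner: "norm e = 1 \<Longrightarrow> e \<bullet> polar_pt e u t = cos t"
  by (simp add: polar_pt_def inner_add_right eta_inner inner_commute[of e] dot_square_norm)

lemma abs_le_pi_iff: "x \<in> {-pi..pi} \<longleftrightarrow> \<bar>x\<bar> \<le> pi"
  by auto

text \<open>Both points are put in polar coordinates around \<open>x1\<close>. The sector becomes
  \<open>|t2| <= |t3|\<close>, whatever the directions, and \<open>t3 = pi r\<close>,
  \<open>t2 = pi r s\<close> parametrizes it by \<open>box1\<close>. The constant of
  \<open>sphere_polar\<close> enters once for each point, hence squared.\<close>

lemma sector_formula:
  assumes n: "CARD('n) = Suc d" "d \<ge> 1"
  obtains c :: real where "c > 0" and "\<And>G :: ('n::finite) ambient3 \<Rightarrow> ennreal. G \<in> borel_measurable borel \<Longrightarrow>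
     (\<integral>\<^sup>+x. indicator {x. sector x} x * G x \<partial>sb3) =
     (\<integral>\<^sup>+q. ennreal (c * qweight d q) * indicator box1 q * (\<integral>\<^sup>+z. G (polar_map z q) \<partial>sb3) \<partial>lborel)"
proof -
  obtain c :: real where c: "c > 0" and polar: "\<And>(e :: real ^ 'n) (g :: real ^ 'n \<Rightarrow> ennreal). norm e = 1 \<Longrightarrow> g \<in> borel_measurable borel \<Longrightarrow> (\<integral>\<^sup>+x. g x \<partial>sb) = ennreal c *
     (\<integral>\<^sup>+t. indicator {-pi..pi} t * ennreal (\<bar>sin t\<bar> ^ (d - 1)) * (\<integral>\<^sup>+u. g (polar_pt e u t) \<partial>sb) \<partial>lborel)"
    using sphere_polar[OF n] by blast
  interpret sb: sigma_finite_measure "sb :: (real ^ 'n) measure" by (rule sigma_finite_sb)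
  interpret P: pair_sigma_finite "sb :: (real ^ 'n) measure" "sb :: (real ^ 'n) measure" by unfold_locales
  interpret Q: pair_sigma_finite "sb :: (real ^ 'n) measure" "lborel :: real measure" by unfold_locales
  define w where "w t = indicator {-pi..pi} t * ennreal (\<bar>sin t\<bar> ^ (d - 1))" for t :: real
  have [measurable]: "w \<in> borel_measurable borel" unfolding w_def by measurable
  have "(\<integral>\<^sup>+x. indicator {x. sector x} x * G x \<partial>sb3) =
     (\<integral>\<^sup>+q. ennreal (c * c * qweight d q) * indicator box1 q * (\<integral>\<^sup>+z. G (polar_map z q) \<partial>sb3) \<partial>lborel)"
    if G[measurable]: "G \<in> borel_measurable borel" for G :: "'n ambient3 \<Rightarrow> ennreal"
  proof -
    define F where "F x = (if sector x then G x else 0)" for x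
    have F[measurable]: "F \<in> borel_measurable borel" unfolding F_def sector_def by measurable
    have Gt[measurable]: "(\<lambda>x. G (f x, g x, h x)) \<in> borel_measurable M"
      if [measurable]: "f \<in> borel_measurable M" "g \<in> borel_measurable M" "h \<in> borel_measurable M" for f g h and M :: "'z measure"
      by (rule measurable_compose[OF _ G]) (simp add: borel_prod[symmetric])
    have Ft[measurable]: "(\<lambda>x. F (f x, g x, h x)) \<in> borel_measurable M"
      if [measurable]: "f \<in> borel_measurable M" "g \<in> borel_measurable M" "h \<in> borel_measurable M" for f g h and M :: "'z measure"
      by (rule measurable_compose[OF _ F]) (simp add: borel_prod[symmetric])
    define K where "K t2 t3 x1 = (\<integral>\<^sup>+u. \<integral>\<^sup>+v. F (x1, polar_pt x1 u t2, polar_pt x1 v t3) \<partial>sb \<partial>sb)" for t2 t3 x1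
    have Km[measurable]: "(\<lambda>x. K (f x) (g x) (h x)) \<in> borel_measurable M"
      if [measurable]: "f \<in> borel_measurable M" "g \<in> borel_measurable M" "h \<in> borel_measurable M" for f g h and M :: "'z measure"
      unfolding K_def by measurable
    have in1: "(\<integral>\<^sup>+x2. \<integral>\<^sup>+x3. F (x1, x2, x3) \<partial>sb \<partial>sb) = ennreal c * ennreal c * (\<integral>\<^sup>+t3. \<integral>\<^sup>+t2. w t2 * w t3 * K t2 t3 x1 \<partial>lborel \<partial>lborel)"
      if x1: "norm x1 = 1" for x1
    proof -
      have "(\<integral>\<^sup>+x2. \<integral>\<^sup>+x3. F (x1, x2, x3) \<partial>sb \<partial>sb) = ennreal c * (\<integral>\<^sup>+t2. w t2 * (\<integral>\<^sup>+u. \<integral>\<^sup>+x3. F (x1, polar_pt x1 u t2, x3) \<partial>sb \<partial>sb) \<partial>lborel)"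
        unfolding w_def by (rule polar[OF x1, of "\<lambda>x2. \<integral>\<^sup>+x3. F (x1, x2, x3) \<partial>sb"]) measurable
      also have "(\<lambda>t2. \<integral>\<^sup>+u. \<integral>\<^sup>+x3. F (x1, polar_pt x1 u t2, x3) \<partial>sb \<partial>sb) = (\<lambda>t2. ennreal c * (\<integral>\<^sup>+t3. w t3 * K t2 t3 x1 \<partial>lborel))"
      proof
        fix t2
        have "(\<integral>\<^sup>+u. \<integral>\<^sup>+x3. F (x1, polar_pt x1 u t2, x3) \<partial>sb \<partial>sb) = (\<integral>\<^sup>+u. ennreal c * (\<integral>\<^sup>+t3. w t3 * (\<integral>\<^sup>+v. F (x1, polar_pt x1 u t2, polar_pt x1 v t3) \<partial>sb) \<partial>lborel) \<partial>sb)"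
          unfolding w_def by (rule nn_integral_cong, rule polar[OF x1]) measurable
        also have "\<dots> = ennreal c * (\<integral>\<^sup>+u. \<integral>\<^sup>+t3. w t3 * (\<integral>\<^sup>+v. F (x1, polar_pt x1 u t2, polar_pt x1 v t3) \<partial>sb) \<partial>lborel \<partial>sb)"
          by (rule nn_integral_cmult) measurable
        also have "(\<integral>\<^sup>+u. \<integral>\<^sup>+t3. w t3 * (\<integral>\<^sup>+v. F (x1, polar_pt x1 u t2, polar_pt x1 v t3) \<partial>sb) \<partial>lborel \<partial>sb) = (\<integral>\<^sup>+t3. \<integral>\<^sup>+u. w t3 * (\<integral>\<^sup>+v. F (x1, polar_pt x1 u t2, polar_pt x1 v t3) \<partial>sb) \<partial>sb \<partial>lborel)"
          by (rule Q.Fubini'[symmetric]) measurable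
        also have "\<dots> = (\<integral>\<^sup>+t3. w t3 * K t2 t3 x1 \<partial>lborel)"
          unfolding K_def by (rule nn_integral_cong, rule nn_integral_cmult) measurable
        finally show "(\<integral>\<^sup>+u. \<integral>\<^sup>+x3. F (x1, polar_pt x1 u t2, x3) \<partial>sb \<partial>sb) = ennreal c * (\<integral>\<^sup>+t3. w t3 * K t2 t3 x1 \<partial>lborel)" .
      qed
      also have "(\<integral>\<^sup>+t2. w t2 * (ennreal c * (\<integral>\<^sup>+t3. w t3 * K t2 t3 x1 \<partial>lborel)) \<partial>lborel) = (\<integral>\<^sup>+t2. ennreal c * (\<integral>\<^sup>+t3. w t2 * w t3 * K t2 t3 x1 \<partial>lborel) \<partial>lborel)"
      proof (rule nn_integral_cong)
        fix t2
        have "(\<integral>\<^sup>+t3. w t2 * w t3 * K t2 t3 x1 \<partial>lborel) = w t2 * (\<integral>\<^sup>+t3. w t3 * K t2 t3 x1 \<partial>lborel)"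
          unfolding mult.assoc by (rule nn_integral_cmult) measurable
        then show "w t2 * (ennreal c * (\<integral>\<^sup>+t3. w t3 * K t2 t3 x1 \<partial>lborel)) = ennreal c * (\<integral>\<^sup>+t3. w t2 * w t3 * K t2 t3 x1 \<partial>lborel)"
          by (simp only: mult_ac)
      qed
      also have "\<dots> = ennreal c * (\<integral>\<^sup>+t2. \<integral>\<^sup>+t3. w t2 * w t3 * K t2 t3 x1 \<partial>lborel \<partial>lborel)"
        by (rule nn_integral_cmult) measurable
      also have "(\<integral>\<^sup>+t2. \<integral>\<^sup>+t3. w t2 * w t3 * K t2 t3 x1 \<partial>lborel \<partial>lborel) = (\<integral>\<^sup>+t3. \<integral>\<^sup>+t2. w t2 * w t3 * K t2 t3 x1 \<partial>lborel \<partial>lborel)"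
        by (rule lborel_pair.Fubini') measurable
      finally show ?thesis by (simp only: mult.assoc)
    qed
    define K' where "K' t2 t3 = (\<integral>\<^sup>+z. G (fst z, polar_pt (fst z) (fst (snd z)) t2, polar_pt (fst z) (snd (snd z)) t3) \<partial>sb3)" for t2 t3
    have K'eq: "K' t2 t3 = (\<integral>\<^sup>+x1. \<integral>\<^sup>+u. \<integral>\<^sup>+v. G (x1, polar_pt x1 u t2, polar_pt x1 v t3) \<partial>sb \<partial>sb \<partial>sb)" for t2 t3
      unfolding K'_def by (subst nn_integral_sb3) (simp_all, measurable)
    have K'm[measurable]: "(\<lambda>x. K' (f x) (g x)) \<in> borel_measurable M"
      if [measurable]: "f \<in> borel_measurable M" "g \<in> borel_measurable M" for f g and M :: "'z measure"
      unfolding K'eq by measurable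
    \<comment> \<open>By \<open>polar_pt_inner\<close> the sector condition reads
      \<open>cos t3 <= cos t2\<close>, and cosine decreases on [0, pi].\<close>
    have KK': "(\<integral>\<^sup>+x1. w t2 * w t3 * K t2 t3 x1 \<partial>sb) = w t2 * w t3 * (indicator {t. \<bar>t\<bar> \<le> \<bar>t3\<bar>} t2 * K' t2 t3)" for t2 t3
    proof (cases "t2 \<in> {-pi..pi} \<and> t3 \<in> {-pi..pi}")
      case True
      have cos: "cos t3 \<le> cos t2 \<longleftrightarrow> \<bar>t2\<bar> \<le> \<bar>t3\<bar>"
        using True cos_mono_le_eq[of "\<bar>t3\<bar>" "\<bar>t2\<bar>"] by (auto simp: abs_le_iff)
      have "(\<integral>\<^sup>+x1. w t2 * w t3 * K t2 t3 x1 \<partial>sb) = w t2 * w t3 * (\<integral>\<^sup>+x1. K t2 t3 x1 \<partial>sb)"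
        by (rule nn_integral_cmult) measurable
      also have "(\<integral>\<^sup>+x1. K t2 t3 x1 \<partial>sb) = (\<integral>\<^sup>+x1. indicator {t. \<bar>t\<bar> \<le> \<bar>t3\<bar>} t2 * (\<integral>\<^sup>+u. \<integral>\<^sup>+v. G (x1, polar_pt x1 u t2, polar_pt x1 v t3) \<partial>sb \<partial>sb) \<partial>sb)"
      proof (rule nn_integral_cong_AE, rule eventually_mono[OF AE_sb_norm])
        fix x1 :: "real ^ 'n" assume x1: "norm x1 = 1"
        then have "F (x1, polar_pt x1 u t2, polar_pt x1 v t3) = indicator {t. \<bar>t\<bar> \<le> \<bar>t3\<bar>} t2 * G (x1, polar_pt x1 u t2, polar_pt x1 v t3)" for u v
          using cos by (simp add: F_def sector_def polar_pt_inner indicator_def)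
        then show "K t2 t3 x1 = indicator {t. \<bar>t\<bar> \<le> \<bar>t3\<bar>} t2 * (\<integral>\<^sup>+u. \<integral>\<^sup>+v. G (x1, polar_pt x1 u t2, polar_pt x1 v t3) \<partial>sb \<partial>sb)"
          unfolding K_def by (simp add: nn_integral_cmult indicator_def)
      qed
      also have "\<dots> = indicator {t. \<bar>t\<bar> \<le> \<bar>t3\<bar>} t2 * K' t2 t3"
        unfolding K'eq by (rule nn_integral_cmult) measurable
      finally show ?thesis .
    next
      case False
      then have w0: "w t2 * w t3 = 0" by (auto simp: w_def)
      show ?thesis unfolding w0 by simp
    qed
    have "(\<integral>\<^sup>+x. indicator {x. sector x} x * G x \<partial>sb3) = (\<integral>\<^sup>+x. F x \<partial>sb3)"
      by (intro nn_integral_cong) (simp add: F_def)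
    also have "\<dots> = (\<integral>\<^sup>+x1. \<integral>\<^sup>+x2. \<integral>\<^sup>+x3. F (x1, x2, x3) \<partial>sb \<partial>sb \<partial>sb)"
      by (rule nn_integral_sb3) simp
    also have "\<dots> = (\<integral>\<^sup>+x1. ennreal c * ennreal c * (\<integral>\<^sup>+t3. \<integral>\<^sup>+t2. w t2 * w t3 * K t2 t3 x1 \<partial>lborel \<partial>lborel) \<partial>sb)"
      by (rule nn_integral_cong_AE, rule eventually_mono[OF AE_sb_norm]) (rule in1)
    also have "\<dots> = ennreal c * ennreal c * (\<integral>\<^sup>+x1. \<integral>\<^sup>+t3. \<integral>\<^sup>+t2. w t2 * w t3 * K t2 t3 x1 \<partial>lborel \<partial>lborel \<partial>sb)"
      by (rule nn_integral_cmult) measurable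
    also have "(\<integral>\<^sup>+x1. \<integral>\<^sup>+t3. \<integral>\<^sup>+t2. w t2 * w t3 * K t2 t3 x1 \<partial>lborel \<partial>lborel \<partial>sb) = (\<integral>\<^sup>+t3. \<integral>\<^sup>+x1. \<integral>\<^sup>+t2. w t2 * w t3 * K t2 t3 x1 \<partial>lborel \<partial>sb \<partial>lborel)"
      by (rule Q.Fubini'[symmetric]) measurable
    also have "\<dots> = (\<integral>\<^sup>+t3. \<integral>\<^sup>+t2. \<integral>\<^sup>+x1. w t2 * w t3 * K t2 t3 x1 \<partial>sb \<partial>lborel \<partial>lborel)"
      by (rule nn_integral_cong, rule Q.Fubini'[symmetric]) measurable
    also have "\<dots> = (\<integral>\<^sup>+t3. \<integral>\<^sup>+t2. w t2 * w t3 * (indicator {t. \<bar>t\<bar> \<le> \<bar>t3\<bar>} t2 * K' t2 t3) \<partial>lborel \<partial>lborel)"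
      by (simp only: KK')
    also have "\<dots> = (\<integral>\<^sup>+t3. \<integral>\<^sup>+t2. w t2 * w t3 * ((if \<bar>t2\<bar> \<le> \<bar>t3\<bar> then 1 else 0) * K' t2 t3) \<partial>lborel \<partial>lborel)"
      by (rule nn_integral_cong, rule nn_integral_cong) (auto simp: indicator_def)
    also have "\<dots> = \<bar>pi\<bar> * (\<integral>\<^sup>+r. \<integral>\<^sup>+t2. w t2 * w (0 + pi * r) * ((if \<bar>t2\<bar> \<le> \<bar>0 + pi * r\<bar> then 1 else 0) * K' t2 (0 + pi * r)) \<partial>lborel \<partial>lborel)"
      by (rule nn_integral_real_affine) auto
    also have "\<dots> = (\<integral>\<^sup>+r. \<bar>pi\<bar> * (\<integral>\<^sup>+t2. w t2 * w (0 + pi * r) * ((if \<bar>t2\<bar> \<le> \<bar>0 + pi * r\<bar> then 1 else 0) * K' t2 (0 + pi * r)) \<partial>lborel) \<partial>lborel)"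
      by (rule nn_integral_cmult[symmetric]) measurable
    also have "\<dots> = (\<integral>\<^sup>+r. \<integral>\<^sup>+s. ennreal (qweight d (r, s)) * indicator box1 (r, s) * K' (pi * r * s) (pi * r) \<partial>lborel \<partial>lborel)"
    proof (rule nn_integral_cong_AE, rule eventually_mono[OF AE_lborel_singleton[of 0]])
        \<comment> \<open>The substitution \<open>t2 = pi r s\<close> degenerates only at
          \<open>r = 0\<close>.\<close>
        fix r :: real assume r: "r \<noteq> 0"
        have A: "(\<integral>\<^sup>+t2. w t2 * w (0 + pi * r) * ((if \<bar>t2\<bar> \<le> \<bar>0 + pi * r\<bar> then 1 else 0) * K' t2 (0 + pi * r)) \<partial>lborel) =
          \<bar>pi * r\<bar> * (\<integral>\<^sup>+s. w (0 + pi * r * s) * w (0 + pi * r) * ((if \<bar>0 + pi * r * s\<bar> \<le> \<bar>0 + pi * r\<bar> then 1 else 0) * K' (0 + pi * r * s) (0 + pi * r)) \<partial>lborel)"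
          by (rule nn_integral_real_affine) (use r in auto)
        have "\<bar>pi\<bar> * (\<integral>\<^sup>+t2. w t2 * w (0 + pi * r) * ((if \<bar>t2\<bar> \<le> \<bar>0 + pi * r\<bar> then 1 else 0) * K' t2 (0 + pi * r)) \<partial>lborel) = ennreal (\<bar>pi\<bar> * \<bar>pi * r\<bar>) * (\<integral>\<^sup>+s. w (0 + pi * r * s) * w (0 + pi * r) * ((if \<bar>0 + pi * r * s\<bar> \<le> \<bar>0 + pi * r\<bar> then 1 else 0) * K' (0 + pi * r * s) (0 + pi * r)) \<partial>lborel)"
        proof -
          have P: "ennreal (\<bar>pi\<bar> * \<bar>pi * r\<bar>) = ennreal \<bar>pi\<bar> * ennreal \<bar>pi * r\<bar>"
            by (rule ennreal_mult) simp_all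
          show ?thesis unfolding A P by (rule mult.assoc[symmetric])
        qed
        also have "\<dots> = (\<integral>\<^sup>+s. ennreal (\<bar>pi\<bar> * \<bar>pi * r\<bar>) * (w (0 + pi * r * s) * w (0 + pi * r) * ((if \<bar>0 + pi * r * s\<bar> \<le> \<bar>0 + pi * r\<bar> then 1 else 0) * K' (0 + pi * r * s) (0 + pi * r))) \<partial>lborel)"
          by (rule nn_integral_cmult[symmetric]) measurable
        also have "\<dots> = (\<integral>\<^sup>+s. ennreal (qweight d (r, s)) * indicator box1 (r, s) * K' (pi * r * s) (pi * r) \<partial>lborel)"
        proof (rule nn_integral_cong)
          fix s :: real
          show "ennreal (\<bar>pi\<bar> * \<bar>pi * r\<bar>) * (w (0 + pi * r * s) * w (0 + pi * r) * ((if \<bar>0 + pi * r * s\<bar> \<le> \<bar>0 + pi * r\<bar> then 1 else 0) * K' (0 + pi * r * s) (0 + pi * r)))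
            = ennreal (qweight d (r, s)) * indicator box1 (r, s) * K' (pi * r * s) (pi * r)"
          proof (cases "(r, s) \<in> box1")
            case True
            then have rs: "\<bar>r\<bar> \<le> 1" "\<bar>s\<bar> \<le> 1" by (auto simp: box1_def)
            have 1: "\<bar>pi * r * s\<bar> \<le> \<bar>pi * r\<bar>" using rs(2) by (simp add: abs_mult mult_left_le)
            have 2: "\<bar>pi * r\<bar> \<le> pi" using rs(1) by (simp add: abs_mult)
            have 3: "pi * r * s \<in> {-pi..pi}" "pi * r \<in> {-pi..pi}" using 1 2 unfolding abs_le_pi_iff by linarith+
            have "qweight d (r, s) = (\<bar>pi\<bar> * \<bar>pi * r\<bar>) * (\<bar>sin (pi * r * s)\<bar> ^ (d - 1) * \<bar>sin (pi * r)\<bar> ^ (d - 1))"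
              by (simp add: qweight_def abs_mult)
            then have "ennreal (qweight d (r, s)) = ennreal (\<bar>pi\<bar> * \<bar>pi * r\<bar>) * (w (pi * r * s) * w (pi * r))"
              unfolding w_def using 3 by (simp only: indicator_simps mult_1_left ennreal_mult[symmetric] zero_le_power abs_ge_zero mult_nonneg_nonneg)
            then show ?thesis using 1 True by (simp add: mult.assoc)
          next
            case False
            then consider "\<bar>r\<bar> > 1" | "\<bar>s\<bar> > 1" by (auto simp: box1_def abs_le_iff not_le)
            then have "w (pi * r) = 0 \<or> \<not> \<bar>pi * r * s\<bar> \<le> \<bar>pi * r\<bar>"
            proof cases
              case 1
              then have "pi * 1 < pi * \<bar>r\<bar>" by (intro mult_strict_left_mono) auto
              then have "pi < \<bar>pi * r\<bar>" by (simp add: abs_mult)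
              then have "pi * r \<notin> {-pi..pi}" unfolding abs_le_pi_iff by linarith
              then show ?thesis by (simp add: w_def)
            next
              case 2
              then have "\<bar>pi * r\<bar> * 1 < \<bar>pi * r\<bar> * \<bar>s\<bar>" using r by (intro mult_strict_left_mono) auto
              then show ?thesis by (simp add: abs_mult)
            qed
            then show ?thesis using False by auto
          qed
        qed
        finally show "\<bar>pi\<bar> * (\<integral>\<^sup>+t2. w t2 * w (0 + pi * r) * ((if \<bar>t2\<bar> \<le> \<bar>0 + pi * r\<bar> then 1 else 0) * K' t2 (0 + pi * r)) \<partial>lborel) =
         (\<integral>\<^sup>+s. ennreal (qweight d (r, s)) * indicator box1 (r, s) * K' (pi * r * s) (pi * r) \<partial>lborel)" .
    qed
    also have "\<dots> = (\<integral>\<^sup>+q. ennreal (qweight d q) * indicator box1 q * K' (pi * fst q * snd q) (pi * fst q) \<partial>lborel)"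
    proof -
      have [measurable]: "box1 \<in> sets borel" unfolding box1_def by (intro borel_closed closed_Times) auto
      have "(\<lambda>q. ennreal (qweight d q) * indicator box1 q * K' (pi * fst q * snd q) (pi * fst q)) \<in> borel_measurable (lborel \<Otimes>\<^sub>M lborel)"
        unfolding qweight_def lborel_prod by measurable
      from lborel.nn_integral_fst[OF this] show ?thesis by (simp add: lborel_prod)
    qed
    also have "ennreal c * ennreal c * \<dots> = (\<integral>\<^sup>+q. ennreal c * ennreal c * (ennreal (qweight d q) * indicator box1 q * K' (pi * fst q * snd q) (pi * fst q)) \<partial>lborel)"
    proof (rule nn_integral_cmult[symmetric])
      have [measurable]: "box1 \<in> sets borel" unfolding box1_def by (intro borel_closed closed_Times) auto
      show "(\<lambda>q. ennreal (qweight d q) * indicator box1 q * K' (pi * fst q * snd q) (pi * fst q)) \<in> borel_measurable lborel"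
        unfolding qweight_def by measurable
    qed
    also have "\<dots> = (\<integral>\<^sup>+q. ennreal (c * c * qweight d q) * indicator box1 q * (\<integral>\<^sup>+z. G (polar_map z q) \<partial>sb3) \<partial>lborel)"
    proof (rule nn_integral_cong)
      fix q :: "real \<times> real"
      have "0 \<le> qweight d q" by (simp add: qweight_def)
      then have "ennreal (c * c * qweight d q) = ennreal c * ennreal c * ennreal (qweight d q)"
        using c by (simp add: ennreal_mult)
      then show "ennreal c * ennreal c * (ennreal (qweight d q) * indicator box1 q * K' (pi * fst q * snd q) (pi * fst q)) =
         ennreal (c * c * qweight d q) * indicator box1 q * (\<integral>\<^sup>+z. G (polar_map z q) \<partial>sb3)"
        by (simp add: K'_def polar_map_def mult.assoc)
    qed
    finally show ?thesis .
  qed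
  moreover have "c * c > 0" using c by simp
  ultimately show ?thesis using that by blast
qed

section \<open>The density of the kernel in polar coordinates\<close>

definition sinc :: "real \<Rightarrow> real" where
  "sinc t = (if t = 0 then 1 else sin t / t)"

definition csinc :: "complex \<Rightarrow> complex" where
  "csinc w = (if w = 0 then 1 else sin w / w)"

lemma csinc_holomorphic: "csinc holomorphic_on UNIV"
proof -
  have d: "deriv sin (0::complex) = 1"
    by (rule DERIV_imp_deriv) (auto intro!: derivative_eq_intros)
  show ?thesis
    by (rule pole_theorem_open_0[where g = sin and a = 0])
       (auto simp: d csinc_def intro!: holomorphic_intros)
qed

lemma of_real_sinc: "complex_of_real (sinc t) = csinc (of_real t)"
  by (simp add: sinc_def csinc_def sin_of_real)

lemma sin_sinc: "sin t = t * sinc t"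
  by (simp add: sinc_def)

lemma sinc_pos: "\<bar>t\<bar> < pi \<Longrightarrow> sinc t > 0"
proof -
  assume t: "\<bar>t\<bar> < pi"
  consider "t = 0" | "t > 0" | "t < 0" by linarith
  then show "sinc t > 0"
  proof cases
    case 2
    then show ?thesis using t sin_gt_zero[of t] by (simp add: sinc_def)
  next
    case 3
    then have "sin (- t) > 0" using t by (intro sin_gt_zero) auto
    then show ?thesis using 3 by (simp add: sinc_def divide_neg_neg)
  qed (simp add: sinc_def)
qed

lemma sinc_nonneg: "\<bar>t\<bar> \<le> pi \<Longrightarrow> sinc t \<ge> 0"
proof (cases "\<bar>t\<bar> = pi")
  case True
  then have "t = pi \<or> t = - pi" by linarith
  then have "sin t = 0" by auto
  then show ?thesis by (simp add: sinc_def)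
qed (use sinc_pos[of t] in auto)

lemma continuous_on_sinc: "continuous_on UNIV sinc"
proof -
  have "continuous_on UNIV (\<lambda>t. Re (csinc (of_real t)))"
    by (intro continuous_intros continuous_on_compose2[OF holomorphic_on_imp_continuous_on[OF csinc_holomorphic]]) auto
  then show ?thesis by (simp flip: of_real_sinc)
qed

lemma sinc_measurable [measurable]: "sinc \<in> borel_measurable borel"
  by (rule borel_measurable_continuous_onI[OF continuous_on_sinc])

lemma sinc_lower_bound: obtains b where "b > 0" "\<And>t. \<bar>t\<bar> \<le> pi/2 \<Longrightarrow> sinc t \<ge> b"
proof -
  have "\<exists>x\<in>{-pi/2..pi/2}. \<forall>y\<in>{-pi/2..pi/2}. sinc x \<le> sinc y"
    by (rule continuous_attains_inf) (auto intro: continuous_on_subset[OF continuous_on_sinc])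
  then obtain x where x: "x \<in> {-pi/2..pi/2}" "\<And>y. y \<in> {-pi/2..pi/2} \<Longrightarrow> sinc x \<le> sinc y" by blast
  have "\<bar>x\<bar> \<le> pi / 2" using x(1) by (intro abs_leI) auto
  then have "\<bar>x\<bar> < pi" using pi_gt_zero by linarith
  then have "sinc x > 0" by (rule sinc_pos)
  moreover have "sinc x \<le> sinc t" if "\<bar>t\<bar> \<le> pi/2" for t
    using that by (intro x(2)) auto
  ultimately show ?thesis using that by blast
qed

text \<open>\<open>|x2 - x3|\<^sup>2 = (pi r)\<^sup>2 Bq\<close> and \<open>cos (pi s r) - cos (pi r) = pi r Cq\<close>; \<open>Pq\<close> is the denominator of the
  cutoff without its factor \<open>|pi r|^(2N)\<close>.\<close>

definition Cq :: "real \<Rightarrow> real \<Rightarrow> real" where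
  "Cq r s = pi / 2 * (r * (sinc (pi / 2 * r) ^ 2 - s ^ 2 * sinc (pi / 2 * s * r) ^ 2))"

definition Bq :: "('n::finite) ambient3 \<Rightarrow> real \<Rightarrow> real \<Rightarrow> real" where
  "Bq z r s = Cq r s ^ 2 + s ^ 2 * sinc (pi * s * r) ^ 2 + sinc (pi * r) ^ 2
     - 2 * (eta (fst z) (fst (snd z)) \<bullet> eta (fst z) (snd (snd z))) * (s * (sinc (pi * s * r) * sinc (pi * r)))"

definition Pq :: "nat \<Rightarrow> ('n::finite) ambient3 \<Rightarrow> real \<Rightarrow> real \<Rightarrow> real" where
  "Pq N z r s = (s * sinc (pi / 2 * s * r)) ^ (2 * N) + sinc (pi / 2 * r) ^ (2 * N) + Bq z r s ^ N"

text \<open>What is left of Jacobian, kernel, cutoff and function after powers of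
  \<open>|r|\<close>, \<open>|s|\<close> and pi are extracted (\<open>kernel_polar_map\<close>). The
  term \<open>N\<close> in the exponent of \<open>Bq\<close> is the numerator of the cutoff; its
  denominator is written as a power so that \<open>cn_bdd_powr_pos\<close> applies.\<close>

definition profile :: "nat \<Rightarrow> nat \<Rightarrow> complex ^ 3 \<Rightarrow> (('n::finite) ambient3 \<Rightarrow> complex) \<Rightarrow> 'n ambient3 \<Rightarrow> real \<Rightarrow> real \<Rightarrow> complex" where
  "profile d N e \<phi> z r s = of_real (sinc (pi / 2 * s * r)) powr (e $ 3) * of_real (sinc (pi / 2 * r)) powr (e $ 2) *
     of_real (Bq z r s) powr (e $ 1 / 2 + of_nat N) * of_real (Pq N z r s) powr (- 1) *
     (of_real (sinc (pi * s * r)) * of_real (sinc (pi * r))) ^ (d - 1) * \<phi> (polar_map z (r, s))"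

lemma norm_eta_good: "good z \<Longrightarrow> norm (eta (fst z) (fst (snd z))) = 1" "good z \<Longrightarrow> norm (eta (fst z) (snd (snd z))) = 1"
  by (simp_all add: good_def norm_eta)

lemma norm_polar_pt: "norm e = 1 \<Longrightarrow> pr e u \<noteq> 0 \<Longrightarrow> norm (polar_pt e u t) = 1"
  unfolding polar_pt_def by (subst norm_combination) (simp_all add: eta_inner norm_eta)

lemma polar_map_sphere3: "good z \<Longrightarrow> polar_map z q \<in> sphere3"
  by (simp add: polar_map_def good_def norm_polar_pt)

lemma eta_inner_le: "good z \<Longrightarrow> \<bar>eta (fst z) (fst (snd z)) \<bullet> eta (fst z) (snd (snd z))\<bar> \<le> 1"
  using Cauchy_Schwarz_ineq2[of "eta (fst z) (fst (snd z))" "eta (fst z) (snd (snd z))"] by (simp add: norm_eta_good)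

text \<open>The sum of squares shows nonnegativity, while the expanded form in the definition is the
  one assembled from functions of class C^n.\<close>

lemma Bq_eq:
  assumes "good z"
  shows "Bq z r s = Cq r s ^ 2 + norm ((s * sinc (pi * s * r)) *\<^sub>R eta (fst z) (fst (snd z)) - sinc (pi * r) *\<^sub>R eta (fst z) (snd (snd z))) ^ 2"
proof -
  let ?a = "eta (fst z) (fst (snd z))" and ?b = "eta (fst z) (snd (snd z))"
  have "?a \<bullet> ?a = 1" "?b \<bullet> ?b = 1" using norm_eta_good[OF assms] by (simp_all add: dot_square_norm)
  then show ?thesis unfolding Bq_def power2_norm_eq_inner
    by (simp add: inner_diff_left inner_diff_right inner_commute[of ?b ?a] power2_eq_square algebra_simps)
qed

lemma Bq_nonneg: "good z \<Longrightarrow> Bq z r s \<ge> 0"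
  unfolding Bq_eq by (intro add_nonneg_nonneg zero_le_power2)

lemma half_angle_le:
  assumes "r \<in> {-1..1}" "s \<in> {-1..1}"
  shows "\<bar>pi / 2 * r\<bar> \<le> pi / 2" "\<bar>pi / 2 * s * r\<bar> \<le> pi / 2" "\<bar>pi * r\<bar> \<le> pi" "\<bar>pi * s * r\<bar> \<le> pi"
proof -
  have r: "\<bar>r\<bar> \<le> 1" and s: "\<bar>s\<bar> \<le> 1" using assms by auto
  have sr: "\<bar>s\<bar> * \<bar>r\<bar> \<le> 1" using mult_mono[OF s r] by simp
  show "\<bar>pi / 2 * r\<bar> \<le> pi / 2" "\<bar>pi * r\<bar> \<le> pi" using r by (simp_all add: abs_mult)
  have "\<bar>pi * s * r\<bar> = pi * (\<bar>s\<bar> * \<bar>r\<bar>)" by (simp add: abs_mult)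
  also have "\<dots> \<le> pi * 1" using sr by (intro mult_left_mono) auto
  finally show 1: "\<bar>pi * s * r\<bar> \<le> pi" by simp
  have "\<bar>pi / 2 * s * r\<bar> = \<bar>pi * s * r\<bar> / 2" by (simp add: abs_mult)
  then show "\<bar>pi / 2 * s * r\<bar> \<le> pi / 2" using 1 by simp
qed

text \<open>The middle term of \<open>Pq\<close> comes from \<open>|x1 - x3|\<close>, whose half
  angle stays within \<open>pi/2\<close>; so the denominator is bounded below even where the other
  two terms vanish.\<close>

lemma Pq_lower_bound:
  assumes b: "b > 0" "\<And>t. \<bar>t\<bar> \<le> pi/2 \<Longrightarrow> sinc t \<ge> b" and "good z" "r \<in> {-1..1}" "s \<in> {-1..1}"
  shows "Pq N z r s \<ge> b ^ (2 * N)"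
proof -
  have "b ^ (2 * N) \<le> sinc (pi / 2 * r) ^ (2 * N)"
    using b half_angle_le[OF assms(4,5)] by (intro power_mono) auto
  moreover have "0 \<le> (s * sinc (pi / 2 * s * r)) ^ (2 * N)" by (simp add: power_mult)
  moreover have "0 \<le> Bq z r s ^ N" by (intro zero_le_power Bq_nonneg assms)
  ultimately show ?thesis unfolding Pq_def by linarith
qed

lemma cn_bdd_id: "cn_bdd n P (\<lambda>p r. of_real r)"
  using cn_bdd_entire[of "\<lambda>w. w" P "\<lambda>_. 1" 1 n] by (simp add: holomorphic_on_ident)

lemma cn_bdd_sinc: "(\<And>p. p \<in> P \<Longrightarrow> \<bar>c p\<bar> \<le> K) \<Longrightarrow> cn_bdd n P (\<lambda>p r. of_real (sinc (c p * r)))"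
  unfolding of_real_sinc by (rule cn_bdd_entire[OF csinc_holomorphic])

lemma cn_bdd_cos: "(\<And>p. p \<in> P \<Longrightarrow> \<bar>c p\<bar> \<le> K) \<Longrightarrow> cn_bdd n P (\<lambda>p r. of_real (cos (c p * r)))"
  unfolding cos_of_real[symmetric] by (rule cn_bdd_entire) (auto intro!: holomorphic_intros)

lemma cn_bdd_sin: "(\<And>p. p \<in> P \<Longrightarrow> \<bar>c p\<bar> \<le> K) \<Longrightarrow> cn_bdd n P (\<lambda>p r. of_real (sin (c p * r)))"
  unfolding sin_of_real[symmetric] by (rule cn_bdd_entire) (auto intro!: holomorphic_intros)

lemma cn_bdd_diff: "cn_bdd n P h \<Longrightarrow> cn_bdd n P k \<Longrightarrow> cn_bdd n P (\<lambda>p r. h p r - k p r)"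
  using cn_bdd_add[of n P h "\<lambda>p r. (-1) * k p r"] cn_bdd_cmult[of n P k "\<lambda>_. -1" 1] by simp

text \<open>Both the dependence on the first and on the second polar variable are instances of the
  following situation, in which each variable is either the variable of the family or a parameter.\<close>

lemma cn_bdd_profile:
  fixes R S :: "'p \<Rightarrow> real \<Rightarrow> real" and zz :: "'p \<Rightarrow> ('n::finite) ambient3" and ee :: "'p \<Rightarrow> complex ^ 3"
  assumes R: "cn_bdd n P (\<lambda>p r. of_real (R p r))" and S: "cn_bdd n P (\<lambda>p r. of_real (S p r))"
    and RS: "\<And>p r. p \<in> P \<Longrightarrow> r \<in> {-1..1} \<Longrightarrow> R p r \<in> {-1..1}" "\<And>p r. p \<in> P \<Longrightarrow> r \<in> {-1..1} \<Longrightarrow> S p r \<in> {-1..1}"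
    and snc1: "cn_bdd n P (\<lambda>p r. of_real (sinc (pi / 2 * S p r * R p r)))" "cn_bdd n P (\<lambda>p r. of_real (sinc (pi / 2 * R p r)))"
    and snc2: "cn_bdd n P (\<lambda>p r. of_real (sinc (pi * S p r * R p r)))" "cn_bdd n P (\<lambda>p r. of_real (sinc (pi * R p r)))"
    and z: "\<And>p. p \<in> P \<Longrightarrow> good (zz p)"
    and e: "\<And>p. p \<in> P \<Longrightarrow> norm (ee p) \<le> K" "\<And>p. p \<in> P \<Longrightarrow> Re (ee p $ 1) / 2 + real N > real n"
    and phi: "cn_bdd n P (\<lambda>p r. ph p (polar_map (zz p) (R p r, S p r)))"
  shows "cn_bdd n P (\<lambda>p r. profile d N (ee p) (ph p) (zz p) (R p r) (S p r))"
proof -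
  obtain b where b: "b > 0" "\<And>t. \<bar>t\<bar> \<le> pi/2 \<Longrightarrow> sinc t \<ge> b" using sinc_lower_bound by blast
  have ek: "norm (ee p $ i) \<le> K" if "p \<in> P" for p i
    using e(1)[OF that] Finite_Cartesian_Product.norm_nth_le[of "ee p" i] by linarith
  have C: "cn_bdd n P (\<lambda>p r. of_real (Cq (R p r) (S p r)))"
    unfolding Cq_def of_real_mult of_real_diff of_real_power
    by (intro cn_bdd_mult cn_bdd_diff cn_bdd_power R S snc1 cn_bdd_const[where C = "pi/2"]) simp
  have B: "cn_bdd n P (\<lambda>p r. of_real (Bq (zz p) (R p r) (S p r)))"
    unfolding Bq_def of_real_mult of_real_diff of_real_power of_real_add
  proof (intro cn_bdd_diff cn_bdd_add cn_bdd_mult cn_bdd_power C S snc2)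
    show "cn_bdd n P (\<lambda>p r. complex_of_real 2)" by (rule cn_bdd_const[where C = 2]) simp
    show "cn_bdd n P (\<lambda>p r. complex_of_real (eta (fst (zz p)) (fst (snd (zz p))) \<bullet> eta (fst (zz p)) (snd (snd (zz p)))))"
      by (rule cn_bdd_const[where C = 1]) (simp add: eta_inner_le z)
  qed
  have Pp: "cn_bdd n P (\<lambda>p r. of_real (Pq N (zz p) (R p r) (S p r)))"
    unfolding Pq_def of_real_add of_real_power of_real_mult
    by (intro cn_bdd_add cn_bdd_power cn_bdd_mult S snc1 B)
  show ?thesis unfolding profile_def
  proof (intro cn_bdd_mult cn_bdd_power snc2 phi)
    show "cn_bdd n P (\<lambda>p r. of_real (sinc (pi / 2 * S p r * R p r)) powr (ee p $ 3))"
    proof (rule cn_bdd_powr_pos[OF snc1(1) _ b(1) ek])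
      show "sinc (pi / 2 * S p r * R p r) \<ge> b" if "p \<in> P" "r \<in> {-1..1}" for p r
        by (intro b(2) half_angle_le RS that)
    qed
    show "cn_bdd n P (\<lambda>p r. of_real (sinc (pi / 2 * R p r)) powr (ee p $ 2))"
    proof (rule cn_bdd_powr_pos[OF snc1(2) _ b(1) ek])
      show "sinc (pi / 2 * R p r) \<ge> b" if "p \<in> P" "r \<in> {-1..1}" for p r
        by (intro b(2) half_angle_le(1)[OF RS(1)[OF that] RS(2)[OF that]])
    qed
    show "cn_bdd n P (\<lambda>p r. of_real (Bq (zz p) (R p r) (S p r)) powr (ee p $ 1 / 2 + of_nat N))"
    proof (rule cn_bdd_powr_nonneg[OF B])
      show "Bq (zz p) (R p r) (S p r) \<ge> 0" if "p \<in> P" for p r by (intro Bq_nonneg z that)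
      show "norm (ee p $ 1 / 2 + of_nat N) \<le> K / 2 + real N" if "p \<in> P" for p
        using norm_triangle_ineq[of "ee p $ 1 / 2" "of_nat N"] ek[OF that, of 1] by (simp add: norm_divide)
      show "real n < Re (ee p $ 1 / 2 + of_nat N)" if "p \<in> P" for p using e(2)[OF that] by simp
    qed
    show "cn_bdd n P (\<lambda>p r. of_real (Pq N (zz p) (R p r) (S p r)) powr (- 1))"
    proof (rule cn_bdd_powr_pos[OF Pp, where b = "b ^ (2 * N)" and K = 1])
      show "Pq N (zz p) (R p r) (S p r) \<ge> b ^ (2 * N)" if "p \<in> P" "r \<in> {-1..1}" for p r
        by (intro Pq_lower_bound b z RS that)
    qed (use b in auto)
  qed
qed

section \<open>Test functions and profiles along coordinate lines\<close>

definition good_map :: "(('n::finite) ambient3 \<Rightarrow> 'n ambient3) \<Rightarrow> bool" where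
  "good_map \<tau> \<longleftrightarrow> linear \<tau> \<and> (\<forall>x\<in>sphere3. \<tau> x \<in> sphere3)"

lemma good_mapD: "good_map \<tau> \<Longrightarrow> x \<in> sphere3 \<Longrightarrow> \<tau> x \<in> sphere3"
  unfolding good_map_def by (elim conjE) (erule bspec)

lemma polar_pt_has_vector_derivative:
  assumes "(t has_real_derivative t') (at r within A)"
  shows "((\<lambda>r. polar_pt e u (t r)) has_vector_derivative t' *\<^sub>R (cos (t r) *\<^sub>R eta e u - sin (t r) *\<^sub>R e)) (at r within A)"
proof -
  have c: "((\<lambda>r. cos (t r)) has_real_derivative - sin (t r) * t') (at r within A)"
    and s: "((\<lambda>r. sin (t r)) has_real_derivative cos (t r) * t') (at r within A)"
    using assms by (auto intro!: derivative_eq_intros)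
  have "((\<lambda>r. cos (t r) *\<^sub>R e + sin (t r) *\<^sub>R eta e u) has_vector_derivative
      (cos (t r) *\<^sub>R 0 + (- sin (t r) * t') *\<^sub>R e) + (sin (t r) *\<^sub>R 0 + (cos (t r) * t') *\<^sub>R eta e u)) (at r within A)"
    by (intro has_vector_derivative_add has_vector_derivative_scaleR has_vector_derivative_const c s)
  then show ?thesis unfolding polar_pt_def by (simp add: algebra_simps scaleR_diff_right)
qed

text \<open>The third angle has an offset because the lemma serves both variables:
  \<open>a = pi s\<close>, \<open>a' = pi\<close>, \<open>c = 0\<close> lets \<open>r\<close> vary,
  and \<open>a = pi r\<close>, \<open>a' = 0\<close>, \<open>c = pi r\<close> lets \<open>s\<close>
  vary.\<close>

lemma cn_bdd_test_curve:
  fixes f :: "'p \<Rightarrow> ('n::finite) ambient3 \<Rightarrow> complex"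
  assumes f: "dbounded P f" and tau: "good_map \<tau>" and z: "\<And>p. p \<in> P \<Longrightarrow> good (zz p)"
    and ab: "\<And>p. p \<in> P \<Longrightarrow> \<bar>a p\<bar> \<le> pi" "\<And>p. p \<in> P \<Longrightarrow> \<bar>a' p\<bar> \<le> pi"
      and cb: "\<And>p. p \<in> P \<Longrightarrow> \<bar>c p\<bar> \<le> pi"
  shows "cn_bdd n P (\<lambda>p r. f p (\<tau> (fst (zz p), polar_pt (fst (zz p)) (fst (snd (zz p))) (a p * r), polar_pt (fst (zz p)) (snd (snd (zz p))) (c p + a' p * r))))"
proof -
  define g where "g p r = (fst (zz p), polar_pt (fst (zz p)) (fst (snd (zz p))) (a p * r), polar_pt (fst (zz p)) (snd (snd (zz p))) (c p + a' p * r))" for p r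
  define g' where "g' p r = (0 :: real ^ 'n,
      a p *\<^sub>R (cos (a p * r) *\<^sub>R eta (fst (zz p)) (fst (snd (zz p))) - sin (a p * r) *\<^sub>R fst (zz p)),
      a' p *\<^sub>R (cos (c p + a' p * r) *\<^sub>R eta (fst (zz p)) (snd (snd (zz p))) - sin (c p + a' p * r) *\<^sub>R fst (zz p)))" for p r
  have lin: "linear \<tau>" using tau by (simp add: good_map_def)
  then have bl: "bounded_linear \<tau>" by (simp add: linear_conv_bounded_linear)
  have on: "\<tau> (g p r) \<in> sphere3" if "p \<in> P" for p r
  proof -
    have "g p r \<in> sphere3" using z[OF that] by (simp add: g_def good_def norm_polar_pt)
    then show ?thesis by (rule good_mapD[OF tau])
  qed
  have der: "(g p has_vector_derivative g' p r) (at r within {-1..1})" for p r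
    unfolding g_def g'_def
    by (intro has_vector_derivative_Pair polar_pt_has_vector_derivative has_vector_derivative_const)
       (auto intro!: derivative_eq_intros)
  have in1: "\<bar>w \<bullet> x\<bar> \<le> norm x" if "norm w = 1" for w x :: "real ^ 'n"
    using Cauchy_Schwarz_ineq2[of w x] that by simp
  have part: "cn_bdd n P (\<lambda>p r. of_real ((k p *\<^sub>R (cos (q p + k p * r) *\<^sub>R E p - sin (q p + k p * r) *\<^sub>R fst (zz p))) \<bullet> w))"
    if k: "\<And>p. p \<in> P \<Longrightarrow> \<bar>k p\<bar> \<le> pi" and E: "\<And>p. p \<in> P \<Longrightarrow> norm (E p) = 1" for k q and E :: "'p \<Rightarrow> real ^ 'n" and w
  proof -
    \<comment> \<open>The addition theorems move the phase \<open>q p\<close> into coefficients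
      independent of \<open>r\<close>, leaving sine and cosine of \<open>k p * r\<close>.\<close>
    have tr: "complex_of_real ((k p *\<^sub>R (cos (q p + k p * r) *\<^sub>R E p - sin (q p + k p * r) *\<^sub>R fst (zz p))) \<bullet> w) =
       of_real (k p) * ((of_real (cos (q p)) * of_real (cos (k p * r)) - of_real (sin (q p)) * of_real (sin (k p * r))) * of_real (E p \<bullet> w)
        - (of_real (sin (q p)) * of_real (cos (k p * r)) + of_real (cos (q p)) * of_real (sin (k p * r))) * of_real (fst (zz p) \<bullet> w))" for p r
      by (simp add: cos_add sin_add inner_diff_left)
    have 1: "cn_bdd n P (\<lambda>p r. complex_of_real (k p))" by (rule cn_bdd_const[where C = pi]) (simp add: k)
    have 2: "cn_bdd n P (\<lambda>p r. complex_of_real (cos (q p)))" by (rule cn_bdd_const[where C = 1]) simp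
    have 3: "cn_bdd n P (\<lambda>p r. complex_of_real (sin (q p)))" by (rule cn_bdd_const[where C = 1]) simp
    have 4: "cn_bdd n P (\<lambda>p r. complex_of_real (E p \<bullet> w))" by (rule cn_bdd_const[where C = "norm w"]) (simp add: in1 E)
    have 5: "cn_bdd n P (\<lambda>p r. complex_of_real (fst (zz p) \<bullet> w))"
      by (rule cn_bdd_const[where C = "norm w"]) (use z in \<open>simp add: in1 good_def\<close>)
    show ?thesis unfolding tr
      by (intro cn_bdd_mult cn_bdd_diff cn_bdd_add cn_bdd_cos[OF k] cn_bdd_sin[OF k] 1 2 3 4 5)
  qed
  have g'b: "cn_bdd n P (\<lambda>p r. of_real (g' p r \<bullet> b))" for b
  proof -
    have "cn_bdd n P (\<lambda>p r. of_real ((a p *\<^sub>R (cos (0 + a p * r) *\<^sub>R eta (fst (zz p)) (fst (snd (zz p))) - sin (0 + a p * r) *\<^sub>R fst (zz p))) \<bullet> fst (snd b))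
       + of_real ((a' p *\<^sub>R (cos (c p + a' p * r) *\<^sub>R eta (fst (zz p)) (snd (snd (zz p))) - sin (c p + a' p * r) *\<^sub>R fst (zz p))) \<bullet> snd (snd b)))"
      by (rule cn_bdd_add[OF part[where k = a and q = "\<lambda>_. 0" and E = "\<lambda>p. eta (fst (zz p)) (fst (snd (zz p)))"]
            part[where k = a' and q = c and E = "\<lambda>p. eta (fst (zz p)) (snd (snd (zz p)))"]])
         (simp_all add: ab norm_eta_good z)
    then show ?thesis unfolding g'_def inner_prod_def by simp
  qed
  have "cn_bdd n P (\<lambda>p r. iter_deriv [] (hom_ext (f p)) (\<tau> (g p r)))"
  proof (rule cn_bdd_curve[OF f on _ _ order_refl])
    show "((\<lambda>r. \<tau> (g p r)) has_vector_derivative \<tau> (g' p r)) (at r within {-1..1})" for p r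
      by (rule bounded_linear.has_vector_derivative[OF bl der])
    show "cn_bdd n P (\<lambda>p r. of_real (\<tau> (g' p r) \<bullet> b))" for b
    proof -
      have ex: "\<tau> x \<bullet> b = (\<Sum>b'\<in>Basis. (x \<bullet> b') * (\<tau> b' \<bullet> b))" for x
      proof -
        have "\<tau> x = \<tau> (\<Sum>b'\<in>Basis. (x \<bullet> b') *\<^sub>R b')" by (simp only: euclidean_representation)
        also have "\<dots> = (\<Sum>b'\<in>Basis. (x \<bullet> b') *\<^sub>R \<tau> b')" by (subst linear_sum[OF lin]) (simp only: linear_scale[OF lin])
        finally show ?thesis by (simp only: inner_sum_left inner_scaleR_left)
      qed
      have eq: "complex_of_real (\<tau> x \<bullet> b) = (\<Sum>b'\<in>Basis. of_real (x \<bullet> b') * of_real (\<tau> b' \<bullet> b))" for x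
        unfolding ex[of x] of_real_sum of_real_mult ..
      have "cn_bdd n P (\<lambda>p r. complex_of_real (\<tau> b' \<bullet> b))" for b'
        by (rule cn_bdd_const[where C = "\<bar>\<tau> b' \<bullet> b\<bar>"]) simp
      then have "cn_bdd n P (\<lambda>p r. \<Sum>b'\<in>Basis. of_real (g' p r \<bullet> b') * of_real (\<tau> b' \<bullet> b))"
        by (intro cn_bdd_sum cn_bdd_mult g'b)
      then show ?thesis by (rule cn_bdd_cong) (rule eq)
    qed
  qed auto
  then show ?thesis
  proof (rule cn_bdd_cong)
    fix p and r :: real assume "p \<in> P"
    from on[OF this, of r] show "f p (\<tau> (fst (zz p), polar_pt (fst (zz p)) (fst (snd (zz p))) (a p * r), polar_pt (fst (zz p)) (snd (snd (zz p))) (c p + a' p * r))) =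
       iter_deriv [] (hom_ext (f p)) (\<tau> (g p r))"
      by (simp add: hom_ext_sphere3 g_def)
  qed
qed

lemma cn_bdd_profile_fst:
  fixes f :: "'k \<Rightarrow> ('n::finite) ambient3 \<Rightarrow> complex" and A :: "(complex ^ 3) set"
  assumes f: "dbounded K f" and tau: "good_map \<tau>"
    and A: "\<And>e. e \<in> A \<Longrightarrow> norm e \<le> C" "\<And>e. e \<in> A \<Longrightarrow> Re (e $ 1) / 2 + real N > real n"
  shows "cn_bdd n {(k, e, z, s). k \<in> K \<and> e \<in> A \<and> good z \<and> s \<in> {-1..1}}
    (\<lambda>(k, e, z, s) r. profile d N e (\<lambda>x. f k (\<tau> x)) z r s)"
proof -
  let ?P = "{(k, e, z, s). k \<in> K \<and> e \<in> A \<and> good z \<and> s \<in> {-1..1}} :: ('k \<times> (complex ^ 3) \<times> 'n ambient3 \<times> real) set"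
  have bd: "\<bar>pi * snd (snd (snd p))\<bar> \<le> pi" "\<bar>pi / 2 * snd (snd (snd p))\<bar> \<le> pi" if "p \<in> ?P" for p
    using that half_angle_le(3)[of "snd (snd (snd p))" 0] half_angle_le(1)[of "snd (snd (snd p))" 0] pi_gt_zero by auto
  have "cn_bdd n ?P (\<lambda>p r. profile d N (fst (snd p)) (\<lambda>x. f (fst p) (\<tau> x)) (fst (snd (snd p))) r (snd (snd (snd p))))"
  proof (rule cn_bdd_profile[where R = "\<lambda>p r. r" and S = "\<lambda>p r. snd (snd (snd p))" and K = C])
    show "cn_bdd n ?P (\<lambda>p r. complex_of_real r)" by (rule cn_bdd_id)
    show "cn_bdd n ?P (\<lambda>p r. complex_of_real (snd (snd (snd p))))" by (rule cn_bdd_const[where C = 1]) auto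
    show "cn_bdd n ?P (\<lambda>p r. complex_of_real (sinc (pi / 2 * snd (snd (snd p)) * r)))" by (rule cn_bdd_sinc[OF bd(2)])
    show "cn_bdd n ?P (\<lambda>p r. complex_of_real (sinc (pi / 2 * r)))" by (rule cn_bdd_sinc[where K = pi]) simp
    show "cn_bdd n ?P (\<lambda>p r. complex_of_real (sinc (pi * snd (snd (snd p)) * r)))" by (rule cn_bdd_sinc[OF bd(1)])
    show "cn_bdd n ?P (\<lambda>p r. complex_of_real (sinc (pi * r)))" by (rule cn_bdd_sinc[where K = pi]) simp
    have "dbounded ?P (\<lambda>p. f (fst p))" using f unfolding dbounded_def by force
    then have "cn_bdd n ?P (\<lambda>p r. f (fst p) (\<tau> (fst (fst (snd (snd p))), polar_pt (fst (fst (snd (snd p)))) (fst (snd (fst (snd (snd p))))) ((pi * snd (snd (snd p))) * r),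
          polar_pt (fst (fst (snd (snd p)))) (snd (snd (fst (snd (snd p))))) (0 + pi * r))))"
      by (rule cn_bdd_test_curve[OF _ tau]) (use bd in auto)
    then show "cn_bdd n ?P (\<lambda>p r. f (fst p) (\<tau> (polar_map (fst (snd (snd p))) (r, snd (snd (snd p))))))"
      by (simp add: polar_map_def mult_ac)
  qed (use A in auto)
  then show ?thesis by (simp add: case_prod_beta')
qed

lemma cn_bdd_profile_snd:
  fixes f :: "'k \<Rightarrow> ('n::finite) ambient3 \<Rightarrow> complex" and A :: "(complex ^ 3) set"
  assumes f: "dbounded K f" and tau: "good_map \<tau>"
    and A: "\<And>e. e \<in> A \<Longrightarrow> norm e \<le> C" "\<And>e. e \<in> A \<Longrightarrow> Re (e $ 1) / 2 + real N > real n"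
  shows "cn_bdd n {(k, e, z, r). k \<in> K \<and> e \<in> A \<and> good z \<and> r \<in> {-1..1}}
    (\<lambda>(k, e, z, r) s. profile d N e (\<lambda>x. f k (\<tau> x)) z r s)"
proof -
  let ?P = "{(k, e, z, r). k \<in> K \<and> e \<in> A \<and> good z \<and> r \<in> {-1..1}} :: ('k \<times> (complex ^ 3) \<times> 'n ambient3 \<times> real) set"
  have bd: "\<bar>pi * snd (snd (snd p))\<bar> \<le> pi" "\<bar>pi / 2 * snd (snd (snd p))\<bar> \<le> pi" if "p \<in> ?P" for p
    using that half_angle_le(3)[of "snd (snd (snd p))" 0] half_angle_le(1)[of "snd (snd (snd p))" 0] pi_gt_zero by auto
  have cst: "cn_bdd n ?P (\<lambda>p r. complex_of_real (sinc (k * snd (snd (snd p)))))" for k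
  proof -
    have "cn_bdd n ?P (\<lambda>p r. complex_of_real (sinc (k * r)))" by (rule cn_bdd_sinc[where K = "\<bar>k\<bar>"]) simp
    then obtain C where "\<forall>p\<in>?P. \<forall>r\<in>{-1..1}. norm (complex_of_real (sinc (k * r))) \<le> C"
      using cn_bdd_unif_bdd unfolding unif_bdd_def by blast
    then show ?thesis by (intro cn_bdd_const[where C = C]) auto
  qed
  have "cn_bdd n ?P (\<lambda>p s. profile d N (fst (snd p)) (\<lambda>x. f (fst p) (\<tau> x)) (fst (snd (snd p))) (snd (snd (snd p))) s)"
  proof (rule cn_bdd_profile[where S = "\<lambda>p r. r" and R = "\<lambda>p r. snd (snd (snd p))" and K = C])
    show "cn_bdd n ?P (\<lambda>p r. complex_of_real r)" by (rule cn_bdd_id)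
    show "cn_bdd n ?P (\<lambda>p r. complex_of_real (snd (snd (snd p))))" by (rule cn_bdd_const[where C = 1]) auto
    have "cn_bdd n ?P (\<lambda>p s. complex_of_real (sinc ((pi / 2 * snd (snd (snd p))) * s)))" by (rule cn_bdd_sinc[OF bd(2)])
    then show "cn_bdd n ?P (\<lambda>p s. complex_of_real (sinc (pi / 2 * s * snd (snd (snd p)))))" by (simp add: mult_ac)
    have "cn_bdd n ?P (\<lambda>p s. complex_of_real (sinc ((pi * snd (snd (snd p))) * s)))" by (rule cn_bdd_sinc[OF bd(1)])
    then show "cn_bdd n ?P (\<lambda>p s. complex_of_real (sinc (pi * s * snd (snd (snd p)))))" by (simp add: mult_ac)
    have "dbounded ?P (\<lambda>p. f (fst p))" using f unfolding dbounded_def by force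
    then have "cn_bdd n ?P (\<lambda>p r. f (fst p) (\<tau> (fst (fst (snd (snd p))), polar_pt (fst (fst (snd (snd p)))) (fst (snd (fst (snd (snd p))))) ((pi * snd (snd (snd p))) * r),
          polar_pt (fst (fst (snd (snd p)))) (snd (snd (fst (snd (snd p))))) (pi * snd (snd (snd p)) + 0 * r))))"
      by (rule cn_bdd_test_curve[OF _ tau]) (use bd in auto)
    then show "cn_bdd n ?P (\<lambda>p s. f (fst p) (\<tau> (polar_map (fst (snd (snd p))) (snd (snd (snd p)), s))))"
      by (simp add: polar_map_def mult_ac)
    show "cn_bdd n ?P (\<lambda>p s. complex_of_real (sinc (pi / 2 * snd (snd (snd p)))))" by (rule cst)
    show "cn_bdd n ?P (\<lambda>p s. complex_of_real (sinc (pi * snd (snd (snd p)))))" by (rule cst)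
  qed (use A in auto)
  then show ?thesis by (simp add: case_prod_beta')
qed

section \<open>The sector integral as a Mellin integral\<close>

text \<open>On this space the estimates for good triples hold at every point, which is how
  \<open>cdiff_integral\<close> asks for them.\<close>

definition good_measure :: "('n::finite) ambient3 measure" where
  "good_measure = restrict_space sb3 {z. good z}"

lemma good_sets [measurable]: "{z :: ('n::finite) ambient3. good z} \<in> sets borel"
proof -
  have "Measurable.pred borel (\<lambda>z::'n ambient3. good z)" unfolding good_def by measurable
  then show ?thesis by (simp add: pred_def)
qed

lemma space_good_measure: "space good_measure = {z. good z}"
  by (simp add: good_measure_def space_restrict_space space_pair_measure)

lemma measurable_good_measure: "f \<in> measurable borel N \<Longrightarrow> f \<in> measurable good_measure N"
  unfolding good_measure_def by (intro measurable_restrict_space1) (simp add: measurable_cong_sets[OF sets_sb3 refl])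

lemma finite_measure_sb3: "finite_measure (sb3 :: ('n::finite) ambient3 measure)"
  by (intro finite_measure_pair_measure finite_measure_sb)

lemma space_sb3: "space (sb3 :: ('n::finite) ambient3 measure) = UNIV"
  by (simp add: space_pair_measure)

lemma good_sets_sb3: "{z :: ('n::finite) ambient3. good z} \<inter> space sb3 \<in> sets sb3"
  unfolding sets_sb3 space_sb3 using good_sets by simp

lemma good_sets_sb3': "{z :: ('n::finite) ambient3. good z} \<in> sets sb3"
  unfolding sets_sb3 by (rule good_sets)

lemma finite_measure_good_measure: "finite_measure (good_measure :: ('n::finite) ambient3 measure)"
  unfolding good_measure_def by (rule finite_measure_restrict_space[OF finite_measure_sb3 good_sets_sb3'])

lemma nn_integral_good_measure:
  assumes "CARD('n) \<ge> 2" and [measurable]: "G \<in> borel_measurable borel"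
  shows "(\<integral>\<^sup>+z. G z \<partial>good_measure) = (\<integral>\<^sup>+z. G z \<partial>(sb3 :: ('n::finite) ambient3 measure))"
proof -
  have "(\<integral>\<^sup>+z. G z \<partial>good_measure) = (\<integral>\<^sup>+z. G z * indicator {z. good z} z \<partial>sb3)"
    unfolding good_measure_def by (rule nn_integral_restrict_space[OF good_sets_sb3])
  also have "\<dots> = (\<integral>\<^sup>+z. G z \<partial>sb3)"
    by (rule nn_integral_cong_AE, rule eventually_mono[OF AE_sb3_good[OF assms(1)]]) simp
  finally show ?thesis .
qed

lemma polar_map_measurable_borel: "(\<lambda>p. polar_map (snd p) (fst p)) \<in> borel_measurable (borel \<Otimes>\<^sub>M borel)"
  unfolding polar_map_def borel_prod[symmetric, where 'a = "real ^ 'n" and 'b = "(real ^ 'n) \<times> (real ^ 'n)"]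
  by (intro measurable_Pair) (simp_all add: borel_prod[symmetric], measurable)

lemma measurable_good_measure_id: "(\<lambda>z. z) \<in> borel_measurable (good_measure :: ('n::finite) ambient3 measure)"
  by (rule measurable_good_measure) simp

lemma polar_map_measurable [measurable]:
  "(\<lambda>p. polar_map (snd p) (fst p)) \<in> borel_measurable (lborel \<Otimes>\<^sub>M (good_measure :: ('n::finite) ambient3 measure))"
proof -
  have "(\<lambda>p. (fst p, snd p)) \<in> measurable (lborel \<Otimes>\<^sub>M (good_measure :: 'n ambient3 measure)) (borel \<Otimes>\<^sub>M borel)"
    by (intro measurable_Pair measurable_compose[OF measurable_snd measurable_good_measure_id])
       (simp add: measurable_lborel1[symmetric] del: measurable_lborel1)
  from measurable_compose[OF this polar_map_measurable_borel] show ?thesis by simp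
qed

lemma box1_sets [measurable]: "box1 \<in> sets borel"
  unfolding box1_def by (intro borel_closed closed_Times) auto

lemma qweight_nonneg: "qweight d q \<ge> 0"
  by (simp add: qweight_def)

lemma qweight_measurable [measurable]: "qweight d \<in> borel_measurable borel"
  unfolding qweight_def[abs_def] by measurable

lemma sector_sets [measurable]: "{x :: ('n::finite) ambient3. sector x} \<in> sets borel"
proof -
  have "Measurable.pred borel (\<lambda>x::'n ambient3. sector x)" unfolding sector_def by measurable
  then show ?thesis by (simp add: pred_def)
qed

lemma integrable_fst_finite:
  fixes g :: "'a \<Rightarrow> real"
  assumes "sigma_finite_measure M" "finite_measure N" "integrable M g"
  shows "integrable (M \<Otimes>\<^sub>M N) (\<lambda>p. g (fst p))"
proof -
  interpret N: finite_measure N by fact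
  interpret M: sigma_finite_measure M by fact
  interpret pair_sigma_finite M N by unfold_locales
  have [measurable]: "g \<in> borel_measurable M" using assms(3) by simp
  show ?thesis
  proof (rule Fubini_integrable)
    show "integrable M (\<lambda>x. \<integral>y. norm (g (fst (x, y))) \<partial>N)"
      using assms(3) by simp
  qed simp_all
qed

text \<open>Passes from nonnegative to complex integrands. For indicators,
  \<open>sector_formula\<close> says that the surface measure on the sector is the image under
  \<open>polar_map\<close> of a measure with a density; a majorant depending on \<open>q\<close>
  alone then permits Fubini.\<close>

lemma sector_integral:
  assumes n: "CARD('n) = Suc d" "d \<ge> 1"
  obtains c :: real where "c > 0" and
    "\<And>(F :: ('n::finite) ambient3 \<Rightarrow> complex) g. F \<in> borel_measurable borel \<Longrightarrow> integrable lborel g \<Longrightarrow>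
      (\<And>z q. good z \<Longrightarrow> q \<in> box1 \<Longrightarrow> qweight d q * norm (F (polar_map z q)) \<le> g q) \<Longrightarrow>
      integrable sb3 (\<lambda>x. indicator {x. sector x} x *\<^sub>R F x) \<and>
      (\<integral>x. indicator {x. sector x} x *\<^sub>R F x \<partial>sb3) =
      (\<integral>q. (c * qweight d q * indicator box1 q) *\<^sub>R (\<integral>z. F (polar_map z q) \<partial>good_measure) \<partial>lborel)"
proof -
  obtain c :: real where c: "c > 0" and homfam: "\<And>G :: 'n ambient3 \<Rightarrow> ennreal. G \<in> borel_measurable borel \<Longrightarrow>
     (\<integral>\<^sup>+x. indicator {x. sector x} x * G x \<partial>sb3) =
     (\<integral>\<^sup>+q. ennreal (c * qweight d q) * indicator box1 q * (\<integral>\<^sup>+z. G (polar_map z q) \<partial>sb3) \<partial>lborel)"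
    using sector_formula[OF n] by blast
  have n2: "CARD('n) \<ge> 2" using n by simp
  interpret Z: finite_measure "good_measure :: 'n ambient3 measure" by (rule finite_measure_good_measure)
  interpret LZ: pair_sigma_finite "lborel :: (real \<times> real) measure" "good_measure :: 'n ambient3 measure" by unfold_locales
  define W where "W q = c * qweight d q * indicator box1 q" for q
  have Wm[measurable]: "W \<in> borel_measurable borel" unfolding W_def by measurable
  have W0: "W q \<ge> 0" for q using c qweight_nonneg by (simp add: W_def)
  define N1 :: "'n ambient3 measure" where "N1 = density sb3 (\<lambda>x. ennreal (indicator {x. sector x} x))"
  define N0 :: "((real \<times> real) \<times> 'n ambient3) measure" where "N0 = density (lborel \<Otimes>\<^sub>M good_measure) (\<lambda>p. ennreal (W (fst p)))"
  have gm: "(\<lambda>p. polar_map (snd p) (fst p)) \<in> borel_measurable N0"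
    unfolding N0_def using polar_map_measurable by simp
  have s3: "borel_measurable (sb3 :: 'n ambient3 measure) = borel_measurable borel"
    by (rule measurable_cong_sets[OF sets_sb3 refl])
  have N12: "N1 = distr N0 borel (\<lambda>p. polar_map (snd p) (fst p))"
  proof (rule measure_eqI)
    show "sets N1 = sets (distr N0 borel (\<lambda>p. polar_map (snd p) (fst p)))"
      unfolding N1_def sets_density sets_distr by (rule sets_sb3)
    fix A assume "A \<in> sets N1"
    then have A[measurable]: "A \<in> sets borel" by (simp only: N1_def sets_density sets_sb3)
    have "emeasure N1 A = (\<integral>\<^sup>+x. ennreal (indicator {x. sector x} x) * indicator A x \<partial>sb3)"
      unfolding N1_def by (rule emeasure_density) (simp_all only: s3 sets_sb3 A, measurable)
    also have "\<dots> = (\<integral>\<^sup>+x. indicator {x. sector x} x * indicator A x \<partial>sb3)"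
      by (intro nn_integral_cong) (auto simp: indicator_def)
    also have "\<dots> = (\<integral>\<^sup>+q. ennreal (c * qweight d q) * indicator box1 q * (\<integral>\<^sup>+z. indicator A (polar_map z q) \<partial>sb3) \<partial>lborel)"
      by (rule homfam) simp
    also have "\<dots> = (\<integral>\<^sup>+q. \<integral>\<^sup>+z. ennreal (W q) * indicator A (polar_map z q) \<partial>good_measure \<partial>lborel)"
    proof (rule nn_integral_cong)
      fix q :: "real \<times> real"
      have Gq: "(\<lambda>z. polar_map z q) \<in> borel_measurable (borel :: 'n ambient3 measure)"
        using measurable_compose[OF measurable_Pair1' polar_map_measurable_borel, of q] by simp
      have 1: "(\<lambda>z. indicator A (polar_map z q) :: ennreal) \<in> borel_measurable borel"
        by (rule measurable_compose[OF Gq]) simp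
      have "(\<integral>\<^sup>+z. ennreal (W q) * indicator A (polar_map z q) \<partial>good_measure) = ennreal (W q) * (\<integral>\<^sup>+z. indicator A (polar_map z q) \<partial>good_measure)"
        by (rule nn_integral_cmult) (rule measurable_good_measure[OF 1])
      also have "\<dots> = ennreal (W q) * (\<integral>\<^sup>+z. indicator A (polar_map z q) \<partial>sb3)"
        unfolding nn_integral_good_measure[OF n2 1] ..
      finally show "ennreal (c * qweight d q) * indicator box1 q * (\<integral>\<^sup>+z. indicator A (polar_map z q) \<partial>sb3) = (\<integral>\<^sup>+z. ennreal (W q) * indicator A (polar_map z q) \<partial>good_measure)"
        by (auto simp: W_def indicator_def)
    qed
    also have "\<dots> = (\<integral>\<^sup>+p. ennreal (W (fst p)) * indicator A (polar_map (snd p) (fst p)) \<partial>(lborel \<Otimes>\<^sub>M good_measure))"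
    proof -
      have "(\<lambda>p. ennreal (W (fst p)) * indicator A (polar_map (snd p) (fst p))) \<in> borel_measurable (lborel \<Otimes>\<^sub>M (good_measure :: 'n ambient3 measure))"
        by measurable
      from Z.nn_integral_fst[OF this] show ?thesis by simp
    qed
    also have "\<dots> = (\<integral>\<^sup>+p. ennreal (W (fst p)) * indicator ((\<lambda>p. polar_map (snd p) (fst p)) -` A \<inter> space N0) p \<partial>(lborel \<Otimes>\<^sub>M good_measure))"
      by (intro nn_integral_cong) (auto simp: N0_def indicator_def)
    also have "\<dots> = emeasure N0 ((\<lambda>p. polar_map (snd p) (fst p)) -` A \<inter> space N0)"
      unfolding N0_def by (rule emeasure_density[symmetric]) (use measurable_sets[OF gm A] in \<open>simp_all add: N0_def\<close>)
    also have "\<dots> = emeasure (distr N0 borel (\<lambda>p. polar_map (snd p) (fst p))) A"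
      by (rule emeasure_distr[OF gm A, symmetric])
    finally show "emeasure N1 A = emeasure (distr N0 borel (\<lambda>p. polar_map (snd p) (fst p))) A" .
  qed
  have "integrable sb3 (\<lambda>x. indicator {x. sector x} x *\<^sub>R F x) \<and>
      (\<integral>x. indicator {x. sector x} x *\<^sub>R F x \<partial>sb3) =
      (\<integral>q. (c * qweight d q * indicator box1 q) *\<^sub>R (\<integral>z. F (polar_map z q) \<partial>good_measure) \<partial>lborel)"
    if F[measurable]: "F \<in> borel_measurable borel" and g: "integrable lborel g"
      and bnd: "\<And>z q. good z \<Longrightarrow> q \<in> box1 \<Longrightarrow> qweight d q * norm (F (polar_map z q)) \<le> g q"
    for F :: "'n ambient3 \<Rightarrow> complex" and g
  proof -
    have FG[measurable]: "(\<lambda>p. F (polar_map (snd p) (fst p))) \<in> borel_measurable (lborel \<Otimes>\<^sub>M (good_measure :: 'n ambient3 measure))"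
      by (rule measurable_compose[OF polar_map_measurable F])
    have int: "integrable (lborel \<Otimes>\<^sub>M (good_measure :: 'n ambient3 measure)) (\<lambda>p. W (fst p) *\<^sub>R F (polar_map (snd p) (fst p)))"
    proof (rule Bochner_Integration.integrable_bound)
      show "integrable (lborel \<Otimes>\<^sub>M (good_measure :: 'n ambient3 measure)) (\<lambda>p. c * g (fst p))"
        by (intro integrable_mult_right integrable_fst_finite[OF _ _ g]) unfold_locales
      show "(\<lambda>p. W (fst p) *\<^sub>R F (polar_map (snd p) (fst p))) \<in> borel_measurable (lborel \<Otimes>\<^sub>M (good_measure :: 'n ambient3 measure))"
        by measurable
      show "AE p in lborel \<Otimes>\<^sub>M good_measure. norm (W (fst p) *\<^sub>R F (polar_map (snd p) (fst p))) \<le> norm (c * g (fst p))"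
      proof (rule AE_I2)
        fix p :: "(real \<times> real) \<times> 'n ambient3" assume "p \<in> space (lborel \<Otimes>\<^sub>M good_measure)"
        then have gd: "good (snd p)" by (auto simp: space_pair_measure space_good_measure)
        have "norm (W (fst p) *\<^sub>R F (polar_map (snd p) (fst p))) = c * (qweight d (fst p) * norm (F (polar_map (snd p) (fst p)))) * indicator box1 (fst p)"
          using c qweight_nonneg[of d "fst p"] by (simp add: W_def abs_mult)
        also have "\<dots> \<le> \<bar>c * g (fst p)\<bar>"
        proof (cases "fst p \<in> box1")
          case True
          have "c * (qweight d (fst p) * norm (F (polar_map (snd p) (fst p)))) \<le> c * g (fst p)"
            using bnd[OF gd True] c by (intro mult_left_mono) auto
          then show ?thesis using True by simp
        qed simp
        finally show "norm (W (fst p) *\<^sub>R F (polar_map (snd p) (fst p))) \<le> norm (c * g (fst p))" by simp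
      qed
    qed
    have "integrable N0 (\<lambda>p. F (polar_map (snd p) (fst p)))"
      unfolding N0_def using int W0 by (subst integrable_density) auto
    then have "integrable (distr N0 borel (\<lambda>p. polar_map (snd p) (fst p))) F"
      by (subst integrable_distr_eq[OF gm F])
    then have i1: "integrable N1 F" by (simp only: N12)
    have sm: "(indicator {x. sector x} :: 'n ambient3 \<Rightarrow> real) \<in> borel_measurable sb3" "F \<in> borel_measurable sb3"
      unfolding s3 by measurable
    have i2: "integrable sb3 (\<lambda>x. indicator {x. sector x} x *\<^sub>R F x)"
      using i1 unfolding N1_def by (subst (asm) integrable_density[OF sm(2,1)]) auto
    have "(\<integral>x. indicator {x. sector x} x *\<^sub>R F x \<partial>sb3) = (\<integral>x. F x \<partial>N1)"
      unfolding N1_def by (rule integral_density[OF sm(2,1), symmetric]) auto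
    also have "\<dots> = (\<integral>p. F (polar_map (snd p) (fst p)) \<partial>N0)"
      unfolding N12 by (rule integral_distr[OF gm F])
    also have "\<dots> = (\<integral>p. W (fst p) *\<^sub>R F (polar_map (snd p) (fst p)) \<partial>(lborel \<Otimes>\<^sub>M good_measure))"
      unfolding N0_def using W0 by (subst integral_density) auto
    also have "\<dots> = (\<integral>q. (\<integral>z. W q *\<^sub>R F (polar_map z q) \<partial>good_measure) \<partial>lborel)"
      using LZ.integral_fst[of "\<lambda>q z. W q *\<^sub>R F (polar_map z q)"] int by (simp add: case_prod_beta')
    finally show ?thesis using i2 by (simp add: W_def)
  qed
  with c that show ?thesis by blast
qed

section \<open>Powers on the square and the kernel in polar coordinates\<close>

lemma integrable_abs_powr:
  assumes "a > -1" shows "integrable lborel (\<lambda>r::real. \<bar>r\<bar> powr a * indicator {-1..1} r)"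
proof -
  have "((\<lambda>x. x powr a) has_integral (1 powr (a + 1) / (a + 1))) {0..1::real}"
    by (rule has_integral_powr_from_0) (use assms in auto)
  then have "(\<lambda>x. x powr a) absolutely_integrable_on {0..1::real}"
    by (intro nonnegative_absolutely_integrable_1) (auto simp: integrable_on_def)
  then have "set_integrable lborel {0..1} (\<lambda>x::real. x powr a)"
    by (simp add: set_integrable_def integrable_completion)
  then have 1: "integrable lborel (\<lambda>x::real. x powr a * indicator {0..1} x)"
    by (simp add: set_integrable_def mult.commute)
  have 2: "integrable lborel (\<lambda>x::real. (0 + -1 * x) powr a * indicator {0..1} (0 + -1 * x))"
    by (rule lborel_integrable_real_affine[OF 1]) simp
  have "integrable lborel (\<lambda>x::real. x powr a * indicator {0..1} x + (0 + -1 * x) powr a * indicator {0..1} (0 + -1 * x))"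
    using 1 2 by (rule Bochner_Integration.integrable_add)
  moreover have "x powr a * indicator {0..1} x + (0 + -1 * x) powr a * indicator {0..1} (0 + -1 * x) = \<bar>x\<bar> powr a * indicator {-1..1} x" for x :: real
    by (cases "x = 0"; cases "x > 0") (auto simp: indicator_def)
  ultimately show ?thesis by simp
qed

lemma integrable_box_powr:
  assumes "a > -1" "b > -1"
  shows "integrable lborel (\<lambda>q. \<bar>fst q\<bar> powr a * \<bar>snd q\<bar> powr b * indicator box1 q)"
proof -
  let ?f = "\<lambda>r::real. \<bar>r\<bar> powr a * indicator {-1..1} r" and ?g = "\<lambda>r::real. \<bar>r\<bar> powr b * indicator {-1..1} r"
  have "integrable (lborel \<Otimes>\<^sub>M lborel) (\<lambda>(r, s). ?f r * ?g s)"
  proof (rule lborel_pair.Fubini_integrable)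
    show "integrable lborel (\<lambda>r. \<integral>s. norm (case (r, s) of (r, s) \<Rightarrow> ?f r * ?g s) \<partial>lborel)"
      using integrable_mult_left[OF integrable_abs_powr[OF assms(1)], of "\<integral>s. ?g s \<partial>lborel"]
      by (simp add: abs_mult)
    show "AE r in lborel. integrable lborel (\<lambda>s. case (r, s) of (r, s) \<Rightarrow> ?f r * ?g s)"
      using integrable_mult_right[OF integrable_abs_powr[OF assms(2)]] by (intro AE_I2) simp
  qed measurable
  moreover have "(\<lambda>(r, s). ?f r * ?g s) = (\<lambda>q. \<bar>fst q\<bar> powr a * \<bar>snd q\<bar> powr b * indicator box1 q)"
    by (auto simp: fun_eq_iff box1_def indicator_def)
  ultimately show ?thesis by (simp add: lborel_prod)
qed

definition kerN :: "nat \<Rightarrow> complex ^ 3 \<Rightarrow> ('n::finite) ambient3 \<Rightarrow> complex" where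
  "kerN N e x = of_real (norm (fst (snd x) - snd (snd x))) powr (e $ 1) * of_real (norm (snd (snd x) - fst x)) powr (e $ 2) *
     of_real (norm (fst x - fst (snd x))) powr (e $ 3) *
     of_real (norm (fst (snd x) - snd (snd x)) ^ (2 * N) / (norm (fst x - fst (snd x)) ^ (2 * N) + norm (snd (snd x) - fst x) ^ (2 * N) + norm (fst (snd x) - snd (snd x)) ^ (2 * N)))"

text \<open>With exponents \<open>-\<rho> + \<alpha>\<close> and \<open>\<rho> = d / 2\<close> these
  are \<open>z1\<close> and \<open>z2\<close> of the overview; the Jacobian contributes
  \<open>2 d = 4 \<rho>\<close> and \<open>d = 2 \<rho>\<close>.\<close>

definition ze1 :: "nat \<Rightarrow> complex ^ 3 \<Rightarrow> complex" where "ze1 d e = e $ 1 + e $ 2 + e $ 3 + 2 * of_nat d"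
definition ze2 :: "nat \<Rightarrow> complex ^ 3 \<Rightarrow> complex" where "ze2 d e = e $ 3 + of_nat d"

lemma one_minus_cos: "1 - cos t = t ^ 2 / 2 * sinc (t / 2) ^ 2"
proof -
  have "cos t = 1 - 2 * sin (t / 2) ^ 2" using cos_double_sin[of "t / 2"] by simp
  also have "sin (t / 2) ^ 2 = (t / 2) ^ 2 * sinc (t / 2) ^ 2" by (simp only: sin_sinc[of "t / 2"] power_mult_distrib)
  finally show ?thesis by (simp add: power_divide)
qed

text \<open>The chord length \<open>2 |sin (t / 2)|\<close>, written with the factor
  \<open>|t|\<close> split off.\<close>

lemma norm_minus_polar_pt:
  assumes "norm e = 1" "pr e u \<noteq> 0" "\<bar>t\<bar> \<le> pi"
  shows "norm (e - polar_pt e u t) = \<bar>t\<bar> * sinc (t / 2)"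
proof -
  have "norm (e - polar_pt e u t) ^ 2 = norm e ^ 2 + norm (polar_pt e u t) ^ 2 - 2 * (e \<bullet> polar_pt e u t)"
  proof -
    have "d = b + c - 2 * a" if "a = (b + c - d) / 2" for a b c d :: real using that by simp
    then show ?thesis by this (rule dot_norm_neg)
  qed
  also have "\<dots> = 2 * (1 - cos t)" using assms by (simp add: norm_polar_pt polar_pt_inner)
  also have "\<dots> = (\<bar>t\<bar> * sinc (t / 2)) ^ 2" unfolding one_minus_cos by (simp add: power_mult_distrib)
  finally have q: "norm (e - polar_pt e u t) ^ 2 = (\<bar>t\<bar> * sinc (t / 2)) ^ 2" .
  have "0 \<le> sinc (t / 2)" using assms(3) by (intro sinc_nonneg) simp
  then have "0 \<le> \<bar>t\<bar> * sinc (t / 2)" by simp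
  with q norm_ge_zero show ?thesis by (rule power2_eq_imp_eq)
qed

text \<open>Every component of the difference carries a factor \<open>pi r\<close>: the sines
  visibly, and the difference of cosines because \<open>1 - cos\<close> is quadratic. The rest is
  split orthogonally along \<open>fst z\<close>, as in \<open>Bq_eq\<close>.\<close>

lemma norm_polar_pt_minus_polar_pt:
  assumes z: "good z"
  shows "norm (polar_pt (fst z) (fst (snd z)) (pi * s * r) - polar_pt (fst z) (snd (snd z)) (pi * r)) = pi * \<bar>r\<bar> * sqrt (Bq z r s)"
proof -
  let ?e = "fst z" and ?a = "eta (fst z) (fst (snd z))" and ?b = "eta (fst z) (snd (snd z))"
  have ne: "norm ?e = 1" using z by (simp add: good_def)
  have C: "cos (pi * s * r) - cos (pi * r) = pi * r * Cq r s"
    using one_minus_cos[of "pi * s * r"] one_minus_cos[of "pi * r"]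
    by (simp add: Cq_def power2_eq_square algebra_simps)
  have "polar_pt ?e (fst (snd z)) (pi * s * r) - polar_pt ?e (snd (snd z)) (pi * r) =
     (pi * r) *\<^sub>R (Cq r s *\<^sub>R ?e + ((s * sinc (pi * s * r)) *\<^sub>R ?a - sinc (pi * r) *\<^sub>R ?b))"
  proof -
    have "polar_pt ?e (fst (snd z)) (pi * s * r) - polar_pt ?e (snd (snd z)) (pi * r) =
       (cos (pi * s * r) - cos (pi * r)) *\<^sub>R ?e + (sin (pi * s * r) *\<^sub>R ?a - sin (pi * r) *\<^sub>R ?b)"
      by (simp add: polar_pt_def algebra_simps)
    then show ?thesis unfolding C sin_sinc by (simp add: scaleR_add_right scaleR_diff_right mult_ac)
  qed
  moreover have "norm (Cq r s *\<^sub>R ?e + ((s * sinc (pi * s * r)) *\<^sub>R ?a - sinc (pi * r) *\<^sub>R ?b)) = sqrt (Bq z r s)"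
  proof -
    have orth: "?e \<bullet> ((s * sinc (pi * s * r)) *\<^sub>R ?a - sinc (pi * r) *\<^sub>R ?b) = 0"
      using eta_inner[OF ne] by (simp add: inner_diff_right inner_commute)
    have pyth: "norm (k *\<^sub>R ?e + w) ^ 2 = k ^ 2 + norm w ^ 2" if "?e \<bullet> w = 0" for k w
      using norm_add_Pythagorean[of "k *\<^sub>R ?e" w] that ne by (simp add: orthogonal_def)
    have "norm (Cq r s *\<^sub>R ?e + ((s * sinc (pi * s * r)) *\<^sub>R ?a - sinc (pi * r) *\<^sub>R ?b)) ^ 2 = Bq z r s"
      unfolding Bq_eq[OF z] by (rule pyth[OF orth])
    then show ?thesis by (metis norm_ge_zero real_sqrt_unique)
  qed
  ultimately show ?thesis by (simp add: abs_mult)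
qed

lemma qweight_eq:
  assumes "d \<ge> 1" "r \<in> {-1..1}" "s \<in> {-1..1}"
  shows "qweight d (r, s) = pi * (pi * \<bar>r\<bar>) ^ (2 * d - 1) * \<bar>s\<bar> ^ (d - 1) * (sinc (pi * s * r) * sinc (pi * r)) ^ (d - 1)"
proof -
  obtain k where d: "d = Suc k" using assms(1) by (cases d) auto
  have 1: "\<bar>sin (pi * r * s)\<bar> = pi * \<bar>r\<bar> * \<bar>s\<bar> * sinc (pi * s * r)"
    using sinc_nonneg[OF half_angle_le(4)[OF assms(2,3)]] sin_sinc[of "pi * s * r"] by (simp add: abs_mult mult_ac)
  have 2: "\<bar>sin (pi * r)\<bar> = pi * \<bar>r\<bar> * sinc (pi * r)"
    using sinc_nonneg[OF half_angle_le(3)[OF assms(2,3)]] sin_sinc[of "pi * r"] by (simp add: abs_mult)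
  have "2 * d - 1 = Suc (k + k)" "d - 1 = k" using d by auto
  then show ?thesis unfolding qweight_def fst_conv snd_conv 1 2
    by (simp add: power_mult_distrib power_add mult_ac)
qed

lemma powr_nat_shift:
  assumes "x \<ge> 0" shows "complex_of_real x ^ k * of_real x powr w = (if x = 0 then 0 else of_real x powr (w + of_nat k))"
proof (cases "x = 0")
  case False
  then show ?thesis using assms by (simp add: powr_add powr_nat mult.commute) 
qed simp

text \<open>The cutoff is homogeneous of degree 0 in the distances, so it leaves no power of
  \<open>r\<close>, only \<open>Bq^N / Pq\<close>. The distances give \<open>|r|\<close> the sum of
  the three exponents and the Jacobian adds \<open>2 d - 1\<close>; for \<open>|s|\<close> these are
  the third exponent and \<open>d - 1\<close>.\<close>

lemma kernel_polar_map:
  assumes z: "good z" and d: "d \<ge> 1" and r: "r \<in> {-1..1}" and s: "s \<in> {-1..1}"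
  shows "of_real (qweight d (r, s)) * (kerN N e (polar_map z (r, s)) * \<phi> (polar_map z (r, s))) =
    of_real pi powr (ze1 d e) * (mweight (ze1 d e) (ze2 d e) (r, s) * profile d N e \<phi> z r s)"
proof (cases "r = 0 \<or> s = 0")
  \<comment> \<open>On the axes \<open>x1 = x2\<close>, and both sides are 0 by the convention
    \<open>0 powr w = 0\<close>.\<close>
  case True
  then have "kerN N e (polar_map z (r, s)) = 0"
    using z norm_minus_polar_pt[of "fst z" "fst (snd z)" 0] by (auto simp: kerN_def polar_map_def good_def)
  moreover have "mweight (ze1 d e) (ze2 d e) (r, s) = 0" using True by (auto simp: mweight_def)
  ultimately show ?thesis by simp
next
  case False
  let ?R = "pi * \<bar>r\<bar>" and ?S = "\<bar>s\<bar>"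
  let ?s2 = "sinc (pi / 2 * s * r)" and ?s3 = "sinc (pi / 2 * r)" and ?B = "Bq z r s"
  have pos: "?R > 0" "?S > 0" using False by auto
  have h: "\<bar>pi / 2 * r\<bar> < pi" "\<bar>pi / 2 * s * r\<bar> < pi"
    using half_angle_le(1,2)[OF r s] pi_gt_zero by linarith+
  have s2: "?s2 > 0" "?s3 > 0" using sinc_pos[OF h(2)] sinc_pos[OF h(1)] by auto
  have B: "?B \<ge> 0" by (rule Bq_nonneg[OF z])
  have g: "norm (fst z) = 1" "pr (fst z) (fst (snd z)) \<noteq> 0" "pr (fst z) (snd (snd z)) \<noteq> 0" using z by (auto simp: good_def)
  have D12: "norm (fst z - polar_pt (fst z) (fst (snd z)) (pi * r * s)) = ?R * (?S * ?s2)"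
    using norm_minus_polar_pt[OF g(1,2), of "pi * r * s"] half_angle_le(4)[OF r s] by (simp add: abs_mult mult_ac)
  have D13: "norm (polar_pt (fst z) (snd (snd z)) (pi * r) - fst z) = ?R * ?s3"
    using norm_minus_polar_pt[OF g(1,3), of "pi * r"] half_angle_le(3)[OF r s] by (simp add: abs_mult norm_minus_commute)
  have D23: "norm (polar_pt (fst z) (fst (snd z)) (pi * r * s) - polar_pt (fst z) (snd (snd z)) (pi * r)) = ?R * sqrt ?B"
    using norm_polar_pt_minus_polar_pt[OF z, of s r] by (simp add: mult_ac)
  have sq: "sqrt ?B ^ (2 * N) = ?B ^ N" using B by (simp add: power_mult)
  have even2N: "even (2 * N)" by simp
  have P: "(?R * sqrt ?B) ^ (2 * N) / ((?R * (?S * ?s2)) ^ (2 * N) + (?R * ?s3) ^ (2 * N) + (?R * sqrt ?B) ^ (2 * N)) = ?B ^ N / Pq N z r s"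
  proof -
    have D: "(?R * sqrt ?B) ^ (2 * N) = ?R ^ (2 * N) * ?B ^ N"
      by (simp only: power_mult_distrib sq)
    have A: "(?R * (?S * ?s2)) ^ (2 * N) + (?R * ?s3) ^ (2 * N) + (?R * sqrt ?B) ^ (2 * N) = ?R ^ (2 * N) * Pq N z r s"
      unfolding Pq_def power_mult_distrib[of ?R] power_mult_distrib[of ?S] power_mult_distrib[of s] sq power_even_abs[OF even2N]
      by (simp only: distrib_left)
    have "?R ^ (2 * N) \<noteq> 0" using zero_less_power[OF pos(1), of "2 * N"] by (metis less_irrefl)
    then show ?thesis unfolding A unfolding D by (rule nonzero_mult_divide_mult_cancel_left)
  qed
  have Ppos: "Pq N z r s > 0"
  proof -
    obtain b where b: "b > 0" "\<And>t. \<bar>t\<bar> \<le> pi/2 \<Longrightarrow> sinc t \<ge> b" using sinc_lower_bound by blast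
    have "0 < b ^ (2 * N)" using b by simp
    also have "\<dots> \<le> Pq N z r s" by (rule Pq_lower_bound[OF b z r s])
    finally show ?thesis .
  qed
  have Bp: "of_real (sqrt ?B) powr (e $ 1) * of_real (?B ^ N) = of_real ?B powr (e $ 1 / 2 + of_nat N)"
  proof (cases "?B = 0")
    case False
    then have Bpos: "?B > 0" using B by simp
    have "complex_of_real (sqrt ?B) powr (e $ 1) = of_real ?B powr (e $ 1 / 2)"
      using Bpos by (simp add: powr_def Ln_of_real ln_sqrt)
    then show ?thesis using Bpos by (simp add: powr_add powr_nat)
  qed simp
  have K: "kerN N e (polar_map z (r, s)) = of_real ?R powr (e $ 1 + e $ 2 + e $ 3) * of_real ?S powr (e $ 3) *
     (of_real ?s2 powr (e $ 3) * of_real ?s3 powr (e $ 2) * of_real ?B powr (e $ 1 / 2 + of_nat N) * of_real (Pq N z r s) powr (- 1))"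
  proof -
    have "kerN N e (polar_map z (r, s)) = of_real (?R * sqrt ?B) powr (e $ 1) * of_real (?R * ?s3) powr (e $ 2) * of_real (?R * (?S * ?s2)) powr (e $ 3) * of_real (?B ^ N / Pq N z r s)"
      unfolding kerN_def polar_map_def fst_conv snd_conv D12 D13 D23 P ..
    also have "\<dots> = (of_real ?R powr (e $ 1) * of_real ?R powr (e $ 2) * of_real ?R powr (e $ 3)) * of_real ?S powr (e $ 3) *
      (of_real ?s2 powr (e $ 3) * of_real ?s3 powr (e $ 2) * (of_real (sqrt ?B) powr (e $ 1) * of_real (?B ^ N)) * inverse (of_real (Pq N z r s)))"
    proof -
      have pw: "complex_of_real (x * y) powr w = of_real x powr w * of_real y powr w" if "x \<ge> 0" "y \<ge> 0" for x y w
        using that by (simp add: powr_times_real)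
      have nn: "?R \<ge> 0" "?S \<ge> 0" "?s2 \<ge> 0" "?s3 \<ge> 0" "sqrt ?B \<ge> 0" "?S * ?s2 \<ge> 0" using pos s2 B by simp_all
      show ?thesis
        unfolding pw[OF nn(1,5)] pw[OF nn(1,4)] pw[OF nn(1,6)] pw[OF nn(2,3)] of_real_divide[of "?B ^ N"] divide_inverse[of "complex_of_real (?B ^ N)"] by (simp only: mult_ac)
    qed
    also have "of_real ?R powr (e $ 1) * of_real ?R powr (e $ 2) * of_real ?R powr (e $ 3) = complex_of_real ?R powr (e $ 1 + e $ 2 + e $ 3)"
      by (simp only: powr_add)
    also have "inverse (complex_of_real (Pq N z r s)) = of_real (Pq N z r s) powr (- 1)"
      using Ppos by (simp add: powr_minus)
    finally show ?thesis unfolding Bp .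
  qed
  have Q: "complex_of_real (qweight d (r, s)) = of_real pi * (of_real ?R ^ (2 * d - 1) * of_real ?S ^ (d - 1) * (of_real (sinc (pi * s * r)) * of_real (sinc (pi * r))) ^ (d - 1))"
    unfolding qweight_eq[OF d r s] by simp
  \<comment> \<open>One further factor pi from the Jacobian gives pi the exponent \<open>z1\<close>,
    while \<open>|r|\<close> has \<open>z1 - 1\<close>.\<close>
  have e1: "of_real pi * (of_real ?R ^ (2 * d - 1) * of_real ?R powr (e $ 1 + e $ 2 + e $ 3)) = of_real pi powr (ze1 d e) * of_real \<bar>r\<bar> powr (ze1 d e - 1)"
  proof -
    have "complex_of_real ?R ^ (2 * d - 1) * of_real ?R powr (e $ 1 + e $ 2 + e $ 3) = of_real ?R powr (ze1 d e - 1)"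
      using pos(1) d by (subst powr_nat_shift) (auto simp: ze1_def of_nat_diff algebra_simps)
    also have "\<dots> = of_real pi powr (ze1 d e - 1) * of_real \<bar>r\<bar> powr (ze1 d e - 1)"
      by (simp add: powr_times_real)
    moreover have "of_real pi * complex_of_real pi powr (ze1 d e - 1) = of_real pi powr (ze1 d e)"
      by (simp add: powr_diff)
    ultimately show ?thesis by (simp add: mult.assoc[symmetric])
  qed
  have e2: "of_real ?S ^ (d - 1) * of_real ?S powr (e $ 3) = of_real ?S powr (ze2 d e - 1)"
    using pos(2) d by (subst powr_nat_shift) (auto simp: ze2_def of_nat_diff algebra_simps)
  have "of_real (qweight d (r, s)) * (kerN N e (polar_map z (r, s)) * \<phi> (polar_map z (r, s))) =
     (of_real pi * (of_real ?R ^ (2 * d - 1) * of_real ?R powr (e $ 1 + e $ 2 + e $ 3))) * (of_real ?S ^ (d - 1) * of_real ?S powr (e $ 3)) * profile d N e \<phi> z r s"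
    unfolding K Q profile_def by (simp only: mult_ac)
  also have "\<dots> = of_real pi powr (ze1 d e) * (mweight (ze1 d e) (ze2 d e) (r, s) * profile d N e \<phi> z r s)"
    unfolding e1 e2 mweight_def by (simp only: fst_conv snd_conv mult_ac)
  finally show ?thesis .
qed

lemma complex_powr_measurable [measurable (raw)]:
  fixes f g :: "'a \<Rightarrow> complex"
  assumes [measurable]: "f \<in> borel_measurable M" "g \<in> borel_measurable M"
  shows "(\<lambda>x. f x powr g x) \<in> borel_measurable M"
  unfolding powr_def by measurable

text \<open>Test functions are arbitrary off \<open>sphere3\<close>; setting them to 0 there makes
  them Borel measurable on the whole space.\<close>

definition sphext :: "(('n::finite) ambient3 \<Rightarrow> complex) \<Rightarrow> 'n ambient3 \<Rightarrow> complex" where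
  "sphext f x = (if x \<in> sphere3 then f x else 0)"

lemma hsmooth_sphext_measurable:
  assumes "hsmooth (f :: ('n::finite) ambient3 \<Rightarrow> complex)" shows "sphext f \<in> borel_measurable borel"
proof -
  have "continuous_on sphere3 f"
    using hsmooth_continuous_on[OF assms, of "[]"] by (rule continuous_on_eq) (simp add: hom_ext_sphere3)
  then have "(\<lambda>x. indicator sphere3 x *\<^sub>R f x) \<in> borel_measurable borel"
    by (intro borel_measurable_continuous_on_indicator borel_closed closed_sphere3)
  moreover have "(\<lambda>x. indicator sphere3 x *\<^sub>R f x) = sphext f" by (auto simp: sphext_def fun_eq_iff indicator_def)
  ultimately show ?thesis by simp
qed

lemma good_map_measurable: "good_map \<tau> \<Longrightarrow> \<tau> \<in> borel_measurable borel"
  unfolding good_map_def by (intro borel_measurable_continuous_onI linear_continuous_on) (simp add: linear_conv_bounded_linear)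

lemma profile_cong: "\<phi> (polar_map z (r, s)) = \<psi> (polar_map z (r, s)) \<Longrightarrow> profile d N e \<phi> z r s = profile d N e \<psi> z r s"
  by (simp add: profile_def)

lemma profile_sphext:
  "good_map \<tau> \<Longrightarrow> good z \<Longrightarrow> profile d N e (\<lambda>x. sphext f (\<tau> x)) z r s = profile d N e (\<lambda>x. f (\<tau> x)) z r s"
  by (rule profile_cong) (simp add: sphext_def good_mapD polar_map_sphere3 del: mem_Times_iff)

lemma profile_measurable:
  fixes \<phi> :: "('n::finite) ambient3 \<Rightarrow> complex"
  assumes [measurable]: "\<phi> \<in> borel_measurable borel"
    and [measurable]: "Z \<in> borel_measurable M" "R \<in> borel_measurable M" "S \<in> borel_measurable M"
  shows "(\<lambda>x. profile d N e \<phi> (Z x) (R x) (S x)) \<in> borel_measurable M"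
proof -
  have B[measurable]: "(\<lambda>x. Bq (Z x) (R x) (S x)) \<in> borel_measurable M"
    unfolding Bq_def Cq_def by measurable
  have P[measurable]: "(\<lambda>x. Pq N (Z x) (R x) (S x)) \<in> borel_measurable M"
    unfolding Pq_def by measurable
  have g: "(\<lambda>x. (fst (Z x), polar_pt (fst (Z x)) (fst (snd (Z x))) (pi * R x * S x), polar_pt (fst (Z x)) (snd (snd (Z x))) (pi * R x))) \<in> measurable M (borel \<Otimes>\<^sub>M (borel \<Otimes>\<^sub>M borel))"
    by measurable
  have [measurable]: "(\<lambda>x. \<phi> (polar_map (Z x) (R x, S x))) \<in> borel_measurable M"
    by (rule measurable_compose[OF _ assms(1)]) (use g in \<open>simp add: polar_map_def borel_prod\<close>)
  show ?thesis unfolding profile_def by measurable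
qed

text \<open>Extended by 0, so that dilations act and the Mellin integral can be taken over the whole
  plane.\<close>

definition box_profile :: "nat \<Rightarrow> nat \<Rightarrow> complex ^ 3 \<Rightarrow> (('n::finite) ambient3 \<Rightarrow> complex) \<Rightarrow> 'n ambient3 \<Rightarrow> real \<Rightarrow> real \<Rightarrow> complex" where
  "box_profile d N e \<phi> z r s = (if \<bar>r\<bar> \<le> 1 \<and> \<bar>s\<bar> \<le> 1 then profile d N e \<phi> z r s else 0)"

text \<open>This average over the auxiliary triples is the function \<open>h\<close> of the
  overview.\<close>

definition mean_profile :: "nat \<Rightarrow> nat \<Rightarrow> complex ^ 3 \<Rightarrow> (('n::finite) ambient3 \<Rightarrow> complex) \<Rightarrow> real \<Rightarrow> real \<Rightarrow> complex" where
  "mean_profile d N e \<phi> r s = (\<integral>z. box_profile d N e \<phi> z r s \<partial>good_measure)"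

section \<open>Dilations in two variables\<close>

lemma dilop_integral:
  assumes "\<And>r. integrable M (\<lambda>z. h z r)"
  shows "dilop lam m (\<lambda>r. \<integral>z. h z r \<partial>M) r = (\<integral>z. dilop lam m (h z) r \<partial>M)"
    and "integrable M (\<lambda>z. dilop lam m (h z) r)"
  unfolding dilop_def by (simp_all add: assms Bochner_Integration.integral_sum Bochner_Integration.integral_add)

lemma dilop2_integral:
  assumes "\<And>r s. integrable M (\<lambda>z. h z r s)"
  shows "dilop2 lam m (\<lambda>r s. \<integral>z. h z r s \<partial>M) q = (\<integral>z. dilop2 lam m (h z) q \<partial>M)"
    and "integrable M (\<lambda>z. dilop2 lam m (h z) q)"
proof -
  have 1: "dilop lam m (\<lambda>s. \<integral>z. h z r s \<partial>M) (snd q) = (\<integral>z. dilop lam m (h z r) (snd q) \<partial>M)"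
    "integrable M (\<lambda>z. dilop lam m (h z r) (snd q))" for r
    using dilop_integral[of M "\<lambda>z. h z r" lam m "snd q"] assms by auto
  show "dilop2 lam m (\<lambda>r s. \<integral>z. h z r s \<partial>M) q = (\<integral>z. dilop2 lam m (h z) q \<partial>M)"
    unfolding dilop2_def 1(1) by (rule dilop_integral(1)[OF 1(2)])
  show "integrable M (\<lambda>z. dilop2 lam m (h z) q)"
    unfolding dilop2_def by (rule dilop_integral(2)[OF 1(2)])
qed

text \<open>The smaller of \<open>a^(2m)\<close> and \<open>b^(2m)\<close> is at most
  \<open>a^m b^m\<close>: two one-variable estimates replace a joint expansion with mixed
  derivatives.\<close>

lemma min_power_le:
  fixes a b x C :: real
  assumes "0 \<le> a" "0 \<le> b" "0 \<le> C" "x \<le> C * a ^ (2 * m)" "x \<le> C * b ^ (2 * m)"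
  shows "x \<le> C * (a ^ m * b ^ m)"
proof (cases "a \<le> b")
  case True
  have "x \<le> C * a ^ (2 * m)" by fact
  also have "\<dots> = C * (a ^ m * a ^ m)" by (simp add: mult_2 power_add)
  also have "\<dots> \<le> C * (a ^ m * b ^ m)" using assms True by (intro mult_left_mono power_mono) auto
  finally show ?thesis .
next
  case False
  have "x \<le> C * b ^ (2 * m)" by fact
  also have "\<dots> = C * (b ^ m * b ^ m)" by (simp add: mult_2 power_add)
  also have "\<dots> \<le> C * (a ^ m * b ^ m)" using assms False by (intro mult_left_mono mult_right_mono power_mono) auto
  finally show ?thesis .
qed

lemma dilop_zero: "(\<And>l s. l \<le> degree (dilpoly lam m) \<Longrightarrow> s \<in> {1, -1} \<Longrightarrow> h (s * (lam ^ l * r)) = 0) \<Longrightarrow> dilop lam m h r = 0"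
  unfolding dilop_def by (intro sum.neutral ballI) (use insertI1 in force)

lemma lam_power_outside:
  assumes "0 < lam" "lam < (1::real)" "l \<le> k" "(1 / lam) ^ k < \<bar>r\<bar>" "s \<in> {1, -1}"
  shows "\<not> \<bar>s * (lam ^ l * r)\<bar> \<le> 1"
proof -
  have "1 = lam ^ k * (1 / lam) ^ k" using assms(1) by (simp add: power_divide)
  also have "\<dots> < lam ^ k * \<bar>r\<bar>" using assms by (intro mult_strict_left_mono) auto
  also have "\<dots> \<le> lam ^ l * \<bar>r\<bar>" using assms by (intro mult_right_mono power_decreasing) auto
  finally show ?thesis using assms(1,5) by (auto simp: abs_mult)
qed

text \<open>Contains the support of \<open>dilop2 lam m h\<close> when \<open>h\<close> lives on the
  square: \<open>dilop\<close> reads a function at \<open>lam^l r\<close> with \<open>l\<close> up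
  to the degree of \<open>dilpoly\<close>.\<close>

definition dbox :: "real \<Rightarrow> nat \<Rightarrow> (real \<times> real) set" where
  "dbox lam m = {q. \<bar>fst q\<bar> \<le> (1 / lam) ^ degree (dilpoly lam m) \<and> \<bar>snd q\<bar> \<le> (1 / lam) ^ degree (dilpoly lam m)}"

lemma dbox_sets [measurable]: "dbox lam m \<in> sets borel"
proof -
  have "Measurable.pred borel (\<lambda>q::real \<times> real. \<bar>fst q\<bar> \<le> (1 / lam) ^ degree (dilpoly lam m) \<and> \<bar>snd q\<bar> \<le> (1 / lam) ^ degree (dilpoly lam m))" by measurable
  then show ?thesis by (simp add: pred_def dbox_def)
qed

lemma integrable_dbox: "integrable lborel (\<lambda>q. K * indicator (dbox lam m) q :: real)"
proof -
  let ?L = "(1 / lam) ^ degree (dilpoly lam m)"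
  have "dbox lam m \<subseteq> cbox (- ?L, - ?L) (?L, ?L)" by (auto simp: dbox_def cbox_Pair_eq abs_le_iff)
  then have "emeasure lborel (dbox lam m) < \<infinity>"
    using emeasure_mono[of "dbox lam m" "cbox (- ?L, - ?L) (?L, ?L)" lborel] emeasure_lborel_cbox_finite[of "(- ?L, - ?L)" "(?L, ?L)"]
    by (simp add: order_le_less_trans)
  then show ?thesis by (intro integrable_mult_right integrable_real_indicator) auto
qed

text \<open>Dilating in one variable gives \<open>|r|^(2m)\<close> or \<open>|s|^(2m)\<close>, and
  the second dilation costs only the factor \<open>dilnorm\<close>. With both orders available,
  \<open>min_power_le\<close> applies.\<close>

lemma cn_bdd_dilop2_bound:
  fixes h :: "'p \<Rightarrow> real \<Rightarrow> real \<Rightarrow> complex"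
  assumes sm: "cn_bdd (2 * m) (P \<times> {-1..1}) (\<lambda>ps r. h (fst ps) r (snd ps))" "cn_bdd (2 * m) (P \<times> {-1..1}) (\<lambda>pr s. h (fst pr) (snd pr) s)"
    and lam: "0 < lam" "lam < 1"
  shows "\<exists>C\<ge>0. \<forall>p\<in>P. \<forall>q. norm (dilop2 lam m (\<lambda>r s. if \<bar>r\<bar> \<le> 1 \<and> \<bar>s\<bar> \<le> 1 then h p r s else 0) q) \<le>
     C * (\<bar>fst q\<bar> ^ m * \<bar>snd q\<bar> ^ m) * indicator (dbox lam m) q"
proof -
  let ?h = "\<lambda>p r s. if \<bar>r\<bar> \<le> 1 \<and> \<bar>s\<bar> \<le> 1 then h p r s else 0"
  let ?k = "degree (dilpoly lam m)"
  let ?L = "(1 / lam) ^ ?k"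
  obtain C1 where C1: "C1 \<ge> 0" "\<forall>ps\<in>P \<times> {-1..1}. \<forall>r. norm (dilop lam m (\<lambda>r. if \<bar>r\<bar> \<le> 1 then h (fst ps) r (snd ps) else 0) r) \<le> C1 * \<bar>r\<bar> ^ (2 * m)"
    using cn_bdd_dilop_bound[OF sm(1) lam] by blast
  have C1': "norm (dilop lam m (\<lambda>r. if \<bar>r\<bar> \<le> 1 then h p r s else 0) r) \<le> C1 * \<bar>r\<bar> ^ (2 * m)" if "p \<in> P" "s \<in> {-1..1}" for p s r
    using C1(2)[rule_format, of "(p, s)" r] that unfolding fst_conv snd_conv by blast
  obtain C2 where C2: "C2 \<ge> 0" "\<forall>pr\<in>P \<times> {-1..1}. \<forall>s. norm (dilop lam m (\<lambda>s. if \<bar>s\<bar> \<le> 1 then h (fst pr) (snd pr) s else 0) s) \<le> C2 * \<bar>s\<bar> ^ (2 * m)"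
    using cn_bdd_dilop_bound[OF sm(2) lam] by blast
  have C2': "norm (dilop lam m (\<lambda>s. if \<bar>s\<bar> \<le> 1 then h p r s else 0) s) \<le> C2 * \<bar>s\<bar> ^ (2 * m)" if "p \<in> P" "r \<in> {-1..1}" for p s r
    using C2(2)[rule_format, of "(p, r)" s] that unfolding fst_conv snd_conv by blast
  have d0: "dilop lam m (\<lambda>r. 0) r = 0" for r by (simp add: dilop_def)
  have c1: "norm (dilop lam m (\<lambda>r. ?h p r s) r) \<le> C1 * \<bar>r\<bar> ^ (2 * m)" if p: "p \<in> P" for p r s
    using C1'[OF p, of s r] C1(1) by (cases "\<bar>s\<bar> \<le> 1") (auto simp: d0 abs_le_iff)
  have c2: "norm (dilop lam m (?h p r) s) \<le> C2 * \<bar>s\<bar> ^ (2 * m)" if p: "p \<in> P" for p r s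
    using C2'[OF p, of r s] C2(1) by (cases "\<bar>r\<bar> \<le> 1") (auto simp: d0 abs_le_iff)
  define C where "C = dilnorm lam m * max C1 C2"
  have C0: "C \<ge> 0" using C1(1) by (simp add: C_def dilnorm_nonneg)
  have b2: "norm (dilop2 lam m (?h p) (r, s)) \<le> C * \<bar>s\<bar> ^ (2 * m)" if p: "p \<in> P" for p r s
  proof -
    have "norm (dilop2 lam m (?h p) (r, s)) \<le> dilnorm lam m * (C2 * \<bar>s\<bar> ^ (2 * m))"
      unfolding dilop2_def fst_conv snd_conv by (rule norm_dilop_le) (rule c2[OF p])
    also have "\<dots> \<le> C * \<bar>s\<bar> ^ (2 * m)"
      unfolding C_def mult.assoc by (intro mult_left_mono mult_right_mono dilnorm_nonneg) auto
    finally show ?thesis .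
  qed
  have b1: "norm (dilop2 lam m (?h p) (r, s)) \<le> C * \<bar>r\<bar> ^ (2 * m)" if p: "p \<in> P" for p r s
  proof -
    have "norm (dilop2 lam m (?h p) (r, s)) \<le> dilnorm lam m * (C1 * \<bar>r\<bar> ^ (2 * m))"
      unfolding dilop2_def fst_conv snd_conv dilop_swap[of lam m "?h p"] by (rule norm_dilop_le) (rule c1[OF p])
    also have "\<dots> \<le> C * \<bar>r\<bar> ^ (2 * m)"
      unfolding C_def mult.assoc by (intro mult_left_mono mult_right_mono dilnorm_nonneg) auto
    finally show ?thesis .
  qed
  have z1: "dilop2 lam m (?h p) (r, s) = 0" if "\<bar>r\<bar> > ?L" for p r s
  proof -
    have "?h p (t * (lam ^ l * r)) s' = 0" if "l \<le> ?k" "t \<in> {1, -1}" for l t s'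
      using lam_power_outside[OF lam that(1) \<open>\<bar>r\<bar> > ?L\<close> that(2)] by simp
    then show ?thesis unfolding dilop2_def fst_conv snd_conv by (intro dilop_zero)
  qed
  have z2: "dilop2 lam m (?h p) (r, s) = 0" if "\<bar>s\<bar> > ?L" for p r s
  proof -
    have "?h p r' (t * (lam ^ l * s)) = 0" if "l \<le> ?k" "t \<in> {1, -1}" for l t r'
      using lam_power_outside[OF lam that(1) \<open>\<bar>s\<bar> > ?L\<close> that(2)] by simp
    then have "dilop lam m (?h p r') s = 0" for r' by (intro dilop_zero)
    then show ?thesis unfolding dilop2_def fst_conv snd_conv by (simp add: d0)
  qed
  show ?thesis
  proof (intro exI[of _ C] conjI ballI allI C0)
    fix p and q :: "real \<times> real" assume p: "p \<in> P"
    obtain r s where q: "q = (r, s)" by (cases q)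
    show "norm (dilop2 lam m (?h p) q) \<le> C * (\<bar>fst q\<bar> ^ m * \<bar>snd q\<bar> ^ m) * indicator (dbox lam m) q"
    proof (cases "\<bar>r\<bar> > ?L \<or> \<bar>s\<bar> > ?L")
      case True
      then have "dilop2 lam m (?h p) q = 0" unfolding q using z1[of r p s] z2[of s p r] by blast
      then show ?thesis using C0 by (simp add: indicator_def)
    next
      case False
      then have "indicator (dbox lam m) q = (1::real)" by (auto simp: q dbox_def)
      moreover have "norm (dilop2 lam m (?h p) q) \<le> C * (\<bar>r\<bar> ^ m * \<bar>s\<bar> ^ m)"
        unfolding q by (rule min_power_le[OF abs_ge_zero abs_ge_zero C0 b1[OF p] b2[OF p]])
      ultimately show ?thesis by (simp add: q)
    qed
  qed
qed

lemma cdiff_profile: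
  assumes "\<And>i. cdiff (\<lambda>x. (E x :: complex ^ 3) $ i) a"
  shows "cdiff (\<lambda>x. profile d N (E x) \<phi> z r s) a"
  unfolding profile_def by (intro cdiff_mult cdiff_powr cdiff_const cdiff_add cdiff_divide assms) simp

lemma cdiff_dilop2:
  assumes "\<And>r s. cdiff (\<lambda>e. h e r s) a" shows "cdiff (\<lambda>e. dilop2 lam m (h e) q) a"
  unfolding dilop2_def dilop_def
  by (intro cdiff_sum cdiff_mult cdiff_add cdiff_const cdiff_divide assms) auto

lemma cdiff_mweight: "cdiff (\<lambda>e. mweight (ze1 d e) (ze2 d e) q) a"
  unfolding mweight_def ze1_def ze2_def
  by (intro cdiff_mult cdiff_powr cdiff_diff cdiff_add cdiff_nth cdiff_const)

lemma mweight_dilop_bound: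
  assumes L: "L \<ge> 1" "\<bar>r\<bar> \<le> L" and a: "0 \<le> Re z - 1 + real m" "Re z - 1 + real m \<le> J"
  shows "norm (complex_of_real \<bar>r\<bar> powr (z - 1)) * \<bar>r\<bar> ^ m \<le> L powr J"
proof (cases "r = 0")
  case False
  have "norm (complex_of_real \<bar>r\<bar> powr (z - 1)) = \<bar>r\<bar> powr (Re z - 1)"
    by (subst norm_powr_real_powr) auto
  then have "norm (complex_of_real \<bar>r\<bar> powr (z - 1)) * \<bar>r\<bar> ^ m = \<bar>r\<bar> powr (Re z - 1 + real m)"
    using False by (simp add: powr_add powr_realpow)
  also have "\<dots> \<le> L powr (Re z - 1 + real m)" using L a by (intro powr_mono2) auto
  also have "\<dots> \<le> L powr J" using L a by (intro powr_mono) auto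
  finally show ?thesis .
qed simp

lemma norm_mweight: "norm (mweight z1 z2 q) = \<bar>fst q\<bar> powr (Re z1 - 1) * \<bar>snd q\<bar> powr (Re z2 - 1)"
  unfolding mweight_def norm_mult by (simp add: norm_powr_real_powr)

lemma mweight_measurable [measurable]: "mweight z1 z2 \<in> borel_measurable borel"
  unfolding mweight_def[abs_def] by measurable

lemma dilop2_measurable:
  assumes [measurable]: "(\<lambda>q. h (fst q) (snd q)) \<in> borel_measurable (borel :: (real \<times> real) measure)"
  shows "dilop2 lam m h \<in> borel_measurable borel"
proof -
  have [measurable]: "(\<lambda>q. h (f q) (g q)) \<in> borel_measurable borel"
    if [measurable]: "f \<in> borel_measurable borel" "g \<in> borel_measurable borel" for f g :: "real \<times> real \<Rightarrow> real"
  proof -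
    have "(\<lambda>q. (f q, g q)) \<in> measurable borel (borel \<Otimes>\<^sub>M borel)" using that by (rule measurable_Pair)
    then have "(\<lambda>q. (f q, g q)) \<in> measurable borel borel" unfolding borel_prod .
    from measurable_compose[OF this assms] show ?thesis by simp
  qed
  show ?thesis unfolding dilop2_def[abs_def] dilop_def by measurable
qed

text \<open>\<open>A\<close> is a set of exponent vectors on which everything is uniform. Its second
  bound makes the power of \<open>Bq\<close> of class C^(2m); the bounds on \<open>m\<close> keep
  \<open>|r|^(Re z1 - 1 + m)\<close> and \<open>|s|^(Re z2 - 1 + m)\<close> bounded near 0.\<close>

locale sector_family =
  fixes d N m :: nat and lam :: real and A :: "(complex ^ 3) set"
    and K :: "'k set" and f :: "'k \<Rightarrow> ('n::finite) ambient3 \<Rightarrow> complex" and \<tau> :: "'n ambient3 \<Rightarrow> 'n ambient3" and CA :: real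
  assumes f: "dbounded K f" and tau: "good_map \<tau>" and lam: "0 < lam" "lam < 1"
    and A: "\<And>e. e \<in> A \<Longrightarrow> norm e \<le> CA" "\<And>e. e \<in> A \<Longrightarrow> Re (e $ 1) / 2 + real N > real (2 * m)"
    and m: "\<And>e. e \<in> A \<Longrightarrow> 0 \<le> Re (ze1 d e) - 1 + real m" "\<And>e. e \<in> A \<Longrightarrow> 0 \<le> Re (ze2 d e) - 1 + real m"
begin

definition phi :: "'k \<Rightarrow> 'n ambient3 \<Rightarrow> complex" where "phi k x = sphext (f k) (\<tau> x)"

lemma hsmooth_index: "k \<in> K \<Longrightarrow> hsmooth (f k)" using f by (simp add: dbounded_def)

lemma phi_measurable: "k \<in> K \<Longrightarrow> phi k \<in> borel_measurable borel"
  unfolding phi_def by (rule measurable_compose[OF good_map_measurable[OF tau] hsmooth_sphext_measurable[OF hsmooth_index]])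

lemma profile_phi: "good z \<Longrightarrow> profile d N e (phi k) z r s = profile d N e (\<lambda>x. f k (\<tau> x)) z r s"
  unfolding phi_def[abs_def] by (rule profile_sphext[OF tau])

lemma cn_bdd_phi:
  "cn_bdd (2 * m) ((K \<times> A \<times> {z. good z}) \<times> {-1..1}) (\<lambda>ps r. profile d N (fst (snd (fst ps))) (phi (fst (fst ps))) (snd (snd (fst ps))) r (snd ps))"
  "cn_bdd (2 * m) ((K \<times> A \<times> {z. good z}) \<times> {-1..1}) (\<lambda>pr s. profile d N (fst (snd (fst pr))) (phi (fst (fst pr))) (snd (snd (fst pr))) (snd pr) s)"
proof -
  let ?Q = "(K \<times> A \<times> {z :: 'n ambient3. good z}) \<times> {-1..1::real}"
  let ?g = "\<lambda>ps. (fst (fst ps), fst (snd (fst ps)), snd (snd (fst ps)), snd ps)"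
  have 1: "cn_bdd (2 * m) ?Q (\<lambda>q. (\<lambda>(k, e, z, s) r. profile d N e (\<lambda>x. f k (\<tau> x)) z r s) (?g q))"
    by (rule cn_bdd_reparam[OF cn_bdd_profile_fst[OF f tau A]]) auto
  show "cn_bdd (2 * m) ?Q (\<lambda>ps r. profile d N (fst (snd (fst ps))) (phi (fst (fst ps))) (snd (snd (fst ps))) r (snd ps))"
    by (rule cn_bdd_cong[OF 1]) (auto simp: profile_phi)
  have 2: "cn_bdd (2 * m) ?Q (\<lambda>q. (\<lambda>(k, e, z, r) s. profile d N e (\<lambda>x. f k (\<tau> x)) z r s) (?g q))"
    by (rule cn_bdd_reparam[OF cn_bdd_profile_snd[OF f tau A]]) auto
  show "cn_bdd (2 * m) ?Q (\<lambda>pr s. profile d N (fst (snd (fst pr))) (phi (fst (fst pr))) (snd (snd (fst pr))) (snd pr) s)"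
    by (rule cn_bdd_cong[OF 2]) (auto simp: profile_phi)
qed

lemma box_profile_bounded: "\<exists>C\<ge>0. \<forall>k\<in>K. \<forall>e\<in>A. \<forall>z. good z \<longrightarrow> (\<forall>r s. norm (box_profile d N e (phi k) z r s) \<le> C)"
proof -
  obtain C where C: "\<And>p r. p \<in> (K \<times> A \<times> {z. good z}) \<times> {-1..1} \<Longrightarrow> r \<in> {-1..1} \<Longrightarrow>
     norm (profile d N (fst (snd (fst p))) (phi (fst (fst p))) (snd (snd (fst p))) r (snd p)) \<le> C"
    using cn_bdd_unif_bdd[OF cn_bdd_phi(1)] unfolding unif_bdd_def by blast
  have "norm (box_profile d N e (phi k) z r s) \<le> max C 0" if "k \<in> K" "e \<in> A" "good z" for k e z r s
    using C[of "((k, e, z), s)" r] that by (auto simp: box_profile_def abs_le_iff)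
  then show ?thesis by (intro exI[of _ "max C 0"]) auto
qed

lemma box_profile_measurable:
  assumes k: "k \<in> K"
  shows "(\<lambda>p. box_profile d N e (phi k) (snd p) (fst (fst p)) (snd (fst p))) \<in> borel_measurable ((borel :: (real \<times> real) measure) \<Otimes>\<^sub>M (good_measure :: 'n ambient3 measure))"
proof -
  have z: "(\<lambda>p. snd p) \<in> borel_measurable ((borel :: (real \<times> real) measure) \<Otimes>\<^sub>M (good_measure :: 'n ambient3 measure))"
    by (rule measurable_compose[OF measurable_snd measurable_good_measure_id])
  have [measurable]: "(\<lambda>p. profile d N e (phi k) (snd p) (fst (fst p)) (snd (fst p))) \<in> borel_measurable ((borel :: (real \<times> real) measure) \<Otimes>\<^sub>M (good_measure :: 'n ambient3 measure))"
    by (rule profile_measurable[OF phi_measurable[OF k] z]) measurable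
  show ?thesis unfolding box_profile_def by measurable
qed

lemma box_profile_measurable': "k \<in> K \<Longrightarrow> (\<lambda>z. box_profile d N e (phi k) z r s) \<in> borel_measurable (good_measure :: 'n ambient3 measure)"
  using measurable_compose[OF measurable_Pair1' box_profile_measurable, of "(r, s)" k e] by simp

lemma integrable_box_profile: "k \<in> K \<Longrightarrow> e \<in> A \<Longrightarrow> integrable good_measure (\<lambda>z. box_profile d N e (phi k) z r s)"
proof -
  assume k: "k \<in> K" and e: "e \<in> A"
  interpret Z: finite_measure "good_measure :: 'n ambient3 measure" by (rule finite_measure_good_measure)
  obtain C where "\<forall>k\<in>K. \<forall>e\<in>A. \<forall>z. good z \<longrightarrow> (\<forall>r s. norm (box_profile d N e (phi k) z r s) \<le> C)" using box_profile_bounded by blast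
  then show ?thesis using k e by (intro Z.integrable_const_bound[where B = C] box_profile_measurable' AE_I2) (auto simp: space_good_measure)
qed

lemma mean_profile_measurable:
  assumes k: "k \<in> K" shows "(\<lambda>q. mean_profile d N e (phi k) (fst q) (snd q)) \<in> borel_measurable (borel :: (real \<times> real) measure)"
proof -
  interpret Z: finite_measure "good_measure :: 'n ambient3 measure" by (rule finite_measure_good_measure)
  show ?thesis unfolding mean_profile_def
    by (rule Z.borel_measurable_lebesgue_integral) (use box_profile_measurable[OF k, of e] in \<open>simp add: case_prod_beta'\<close>)
qed

lemma mean_profile_bounded: "\<exists>C\<ge>0. \<forall>k\<in>K. \<forall>e\<in>A. \<forall>r s. norm (mean_profile d N e (phi k) r s) \<le> C * indicator box1 (r, s)"
proof -
  interpret Z: finite_measure "good_measure :: 'n ambient3 measure" by (rule finite_measure_good_measure)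
  obtain C where C: "C \<ge> 0" "\<And>k e z r s. k\<in>K \<Longrightarrow> e\<in>A \<Longrightarrow> good z \<Longrightarrow> norm (box_profile d N e (phi k) z r s) \<le> C" using box_profile_bounded by blast
  have "norm (mean_profile d N e (phi k) r s) \<le> (C * measure good_measure (space (good_measure :: 'n ambient3 measure))) * indicator box1 (r, s)" if "k \<in> K" "e \<in> A" for k e r s
  proof (cases "(r, s) \<in> box1")
    case True
    have "norm (mean_profile d N e (phi k) r s) \<le> (\<integral>z. C \<partial>(good_measure :: 'n ambient3 measure))"
      unfolding mean_profile_def by (rule Bochner_Integration.integral_norm_bound_integral[OF integrable_box_profile[OF that]]) (auto simp: space_good_measure C that)
    then show ?thesis using True by (simp add: mult.commute)
  next
    case False
    then have "box_profile d N e (phi k) z r s = 0" for z by (auto simp: box_profile_def box1_def abs_le_iff)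
    then show ?thesis by (simp add: mean_profile_def False)
  qed
  then show ?thesis using C(1) by (intro exI[of _ "C * measure good_measure (space (good_measure :: 'n ambient3 measure))"]) auto
qed

lemma dilop2_mean_profile:
  "k \<in> K \<Longrightarrow> e \<in> A \<Longrightarrow> dilop2 lam m (mean_profile d N e (phi k)) q = (\<integral>z. dilop2 lam m (box_profile d N e (phi k) z) q \<partial>good_measure)"
  "k \<in> K \<Longrightarrow> e \<in> A \<Longrightarrow> integrable good_measure (\<lambda>z. dilop2 lam m (box_profile d N e (phi k) z) q)"
  unfolding mean_profile_def[abs_def] by (rule dilop2_integral; rule integrable_box_profile; assumption)+

definition mellin_integrand :: "complex ^ 3 \<Rightarrow> 'k \<Rightarrow> real \<times> real \<Rightarrow> complex" where
  "mellin_integrand e k q = mweight (ze1 d e) (ze2 d e) q * dilop2 lam m (mean_profile d N e (phi k)) q"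

text \<open>The factors \<open>|r|^m\<close> and \<open>|s|^m\<close> gained by the dilations absorb
  the singular weight, and a constant is integrable over the bounded set
  \<open>dbox lam m\<close>.\<close>

lemma mellin_integrand_bound: "\<exists>C. \<forall>k\<in>K. \<forall>e\<in>A. \<forall>q. norm (mellin_integrand e k q) \<le> C * indicator (dbox lam m) q"
proof -
  interpret Z: finite_measure "good_measure :: 'n ambient3 measure" by (rule finite_measure_good_measure)
  obtain C where C: "C \<ge> 0" "\<And>p q. p \<in> K \<times> A \<times> {z. good z} \<Longrightarrow> norm (dilop2 lam m (\<lambda>r s. if \<bar>r\<bar> \<le> 1 \<and> \<bar>s\<bar> \<le> 1 then profile d N (fst (snd p)) (phi (fst p)) (snd (snd p)) r s else 0) q)
    \<le> C * (\<bar>fst q\<bar> ^ m * \<bar>snd q\<bar> ^ m) * indicator (dbox lam m) q"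
    using cn_bdd_dilop2_bound[OF cn_bdd_phi lam] by blast
  let ?W = "measure good_measure (space (good_measure :: 'n ambient3 measure))"
  define L where "L = (1 / lam) ^ degree (dilpoly lam m)"
  have L: "L \<ge> 1" unfolding L_def using lam by (intro one_le_power) simp
  \<comment> \<open>An upper bound for \<open>Re z - 1 + m\<close> on \<open>A\<close>, for both
    \<open>z1\<close> and \<open>z2\<close>; it controls the weight towards the far edge of
    \<open>dbox lam m\<close>.\<close>
  define J where "J = 3 * CA + 2 * real d + real m"
  have dc: "norm (dilop2 lam m (mean_profile d N e (phi k)) q) \<le> (C * (\<bar>fst q\<bar> ^ m * \<bar>snd q\<bar> ^ m) * indicator (dbox lam m) q) * ?W"
    if "k \<in> K" "e \<in> A" for k e q
  proof -
    have "norm (dilop2 lam m (mean_profile d N e (phi k)) q) \<le> (\<integral>z. C * (\<bar>fst q\<bar> ^ m * \<bar>snd q\<bar> ^ m) * indicator (dbox lam m) q \<partial>(good_measure :: 'n ambient3 measure))"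
      unfolding dilop2_mean_profile(1)[OF that]
    proof (rule Bochner_Integration.integral_norm_bound_integral[OF dilop2_mean_profile(2)[OF that]])
      fix z :: "'n ambient3" assume "z \<in> space good_measure"
      then show "norm (dilop2 lam m (box_profile d N e (phi k) z) q) \<le> C * (\<bar>fst q\<bar> ^ m * \<bar>snd q\<bar> ^ m) * indicator (dbox lam m) q"
        using C(2)[of "(k, e, z)" q, unfolded fst_conv snd_conv] that unfolding box_profile_def[abs_def] space_good_measure by simp
    qed simp
    then show ?thesis by (simp add: mult.commute)
  qed
  have "norm (mellin_integrand e k q) \<le> (C * ?W * (L powr J * L powr J)) * indicator (dbox lam m) q" if ke: "k \<in> K" "e \<in> A" for k e q
  proof (cases "q \<in> dbox lam m")
    case True
    then have q: "\<bar>fst q\<bar> \<le> L" "\<bar>snd q\<bar> \<le> L" by (auto simp: dbox_def L_def)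
    have nth: "\<bar>Re (e $ i)\<bar> \<le> CA" for i
      using abs_Re_le_cmod[of "e $ i"] Finite_Cartesian_Product.norm_nth_le[of e i] A(1)[OF ke(2)] by linarith
    have J: "Re (ze1 d e) - 1 + real m \<le> J" "Re (ze2 d e) - 1 + real m \<le> J"
      using nth[of 1] nth[of 2] nth[of 3] by (simp_all add: ze1_def ze2_def J_def)
    have "norm (mellin_integrand e k q) \<le> norm (mweight (ze1 d e) (ze2 d e) q) * ((C * (\<bar>fst q\<bar> ^ m * \<bar>snd q\<bar> ^ m) * indicator (dbox lam m) q) * ?W)"
      unfolding mellin_integrand_def norm_mult by (intro mult_left_mono dc[OF ke]) simp
    also have "\<dots> = C * ?W * ((norm (complex_of_real \<bar>fst q\<bar> powr (ze1 d e - 1)) * \<bar>fst q\<bar> ^ m) * (norm (complex_of_real \<bar>snd q\<bar> powr (ze2 d e - 1)) * \<bar>snd q\<bar> ^ m))"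
      using True unfolding mweight_def norm_mult by simp
    also have "\<dots> \<le> C * ?W * (L powr J * L powr J)"
      using C(1) by (intro mult_left_mono mult_mono mweight_dilop_bound L q m ke J) auto
    finally show ?thesis using True by simp
  next
    case False
    then have "norm (dilop2 lam m (mean_profile d N e (phi k)) q) \<le> 0" using dc[OF ke, of q] by simp
    then show ?thesis using False by (simp add: mellin_integrand_def)
  qed
  then show ?thesis by blast
qed

lemma mellin_integrand_measurable: "k \<in> K \<Longrightarrow> mellin_integrand e k \<in> borel_measurable lborel"
  using dilop2_measurable[OF mean_profile_measurable, of k] unfolding mellin_integrand_def[abs_def] by simp

text \<open>Converges for all exponents in \<open>A\<close>; where the sector integral converges as
  well, it is that integral times \<open>D(z1) D(z2)\<close>, up to a constant and a power of pi
  (\<open>sector_term\<close>).\<close>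

definition Psi :: "complex ^ 3 \<Rightarrow> 'k \<Rightarrow> complex" where "Psi e k = (\<integral>q. mellin_integrand e k q \<partial>lborel)"

lemma cdiff_mean_profile:
  assumes a: "ball a R \<subseteq> A" "R > 0" and k: "k \<in> K"
  shows "cdiff (\<lambda>e. mean_profile d N e (phi k) r s) a"
proof -
  interpret Z: finite_measure "good_measure :: 'n ambient3 measure" by (rule finite_measure_good_measure)
  obtain C where C: "\<And>k e z r s. k\<in>K \<Longrightarrow> e\<in>A \<Longrightarrow> good z \<Longrightarrow> norm (box_profile d N e (phi k) z r s) \<le> C" using box_profile_bounded by blast
  show ?thesis unfolding mean_profile_def
  proof (rule cdiff_integral[OF a(2)])
    show "cdiff (\<lambda>e. box_profile d N e (phi k) z r s) e" for z e
    proof (cases "\<bar>r\<bar> \<le> 1 \<and> \<bar>s\<bar> \<le> 1")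
      case True
      then show ?thesis unfolding box_profile_def by (simp add: cdiff_profile cdiff_nth)
    next
      case False
      show ?thesis unfolding box_profile_def if_not_P[OF False] by (rule cdiff_const)
    qed
    show "(\<lambda>z. box_profile d N e (phi k) z r s) \<in> borel_measurable good_measure" for e by (rule box_profile_measurable'[OF k])
    show "norm (box_profile d N e (phi k) z r s) \<le> C" if "z \<in> space good_measure" "e \<in> ball a R" for z e
      using that a(1) by (intro C k) (auto simp: space_good_measure)
    show "integrable (good_measure :: 'n ambient3 measure) (\<lambda>z. C)" by simp
  qed
qed

text \<open>Differentiation under the integral sign twice: over the auxiliary triples, then over the
  plane.\<close>

lemma cdiff_Psi:
  assumes a: "ball a R \<subseteq> A" "R > 0" and k: "k \<in> K"
  shows "cdiff (\<lambda>e. Psi e k) a"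
proof -
  obtain C where C: "\<And>k e q. k\<in>K \<Longrightarrow> e\<in>A \<Longrightarrow> norm (mellin_integrand e k q) \<le> C * indicator (dbox lam m) q" using mellin_integrand_bound by blast
  show ?thesis unfolding Psi_def
  proof (rule cdiff_integral[OF a(2)])
    show "cdiff (\<lambda>e. mellin_integrand e k q) b" if b: "b \<in> ball a R" for b q
    proof -
      obtain R' where R': "R' > 0" "ball b R' \<subseteq> ball a R" by (rule openE[OF open_ball b])
      have "cdiff (\<lambda>e. mean_profile d N e (phi k) r s) b" for r s
        by (rule cdiff_mean_profile[OF subset_trans[OF R'(2) a(1)] R'(1) k])
      then show ?thesis unfolding mellin_integrand_def by (intro cdiff_mult cdiff_mweight cdiff_dilop2)
    qed
    show "mellin_integrand e k \<in> borel_measurable lborel" for e by (rule mellin_integrand_measurable[OF k])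
    show "norm (mellin_integrand e k q) \<le> C * indicator (dbox lam m) q" if "e \<in> ball a R" for e q
      using that a(1) by (intro C k) auto
    show "integrable lborel (\<lambda>q. C * indicator (dbox lam m) q :: real)" by (rule integrable_dbox)
  qed
qed

text \<open>Pointwise convergence of the test functions suffices, since boundedness of the family
  over \<open>K\<close> has already provided majorants independent of the index.\<close>

lemma Psi_tendsto:
  fixes ks :: "nat \<Rightarrow> 'k"
  assumes ks: "\<And>i. ks i \<in> K" and k: "k \<in> K" and e: "e \<in> A"
    and lim: "\<And>x. x \<in> sphere3 \<Longrightarrow> (\<lambda>i. f (ks i) x) \<longlonglongrightarrow> f k x"
  shows "(\<lambda>i. Psi e (ks i)) \<longlonglongrightarrow> Psi e k"
proof -
  interpret Z: finite_measure "good_measure :: 'n ambient3 measure" by (rule finite_measure_good_measure)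
  obtain C where C: "\<And>k e q. k\<in>K \<Longrightarrow> e\<in>A \<Longrightarrow> norm (mellin_integrand e k q) \<le> C * indicator (dbox lam m) q" using mellin_integrand_bound by blast
  obtain B where B: "\<And>k e z r s. k\<in>K \<Longrightarrow> e\<in>A \<Longrightarrow> good z \<Longrightarrow> norm (box_profile d N e (phi k) z r s) \<le> B" using box_profile_bounded by blast
  have "(\<lambda>i. box_profile d N e (phi (ks i)) z r s) \<longlonglongrightarrow> box_profile d N e (phi k) z r s" if z: "good z" for z r s
  proof -
    have "(\<lambda>i. phi (ks i) (polar_map z (r, s))) \<longlonglongrightarrow> phi k (polar_map z (r, s))"
      unfolding phi_def sphext_def using good_mapD[OF tau polar_map_sphere3[OF z, of "(r, s)"]] by (auto intro: lim)
    then show ?thesis unfolding box_profile_def profile_def by (auto intro!: tendsto_mult_left)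
  qed
  then have "(\<lambda>i. mean_profile d N e (phi (ks i)) r s) \<longlonglongrightarrow> mean_profile d N e (phi k) r s" for r s
    unfolding mean_profile_def
    by (intro integral_dominated_convergence[where w = "\<lambda>_. B"] box_profile_measurable' ks k AE_I2) (auto simp: space_good_measure B ks e)
  then have "(\<lambda>i. mellin_integrand e (ks i) q) \<longlonglongrightarrow> mellin_integrand e k q" for q
    unfolding mellin_integrand_def dilop2_def dilop_def by (intro tendsto_intros) simp_all
  then show ?thesis
    unfolding Psi_def
    by (intro integral_dominated_convergence[where w = "\<lambda>q. C * indicator (dbox lam m) q"] mellin_integrand_measurable ks k AE_I2 integrable_dbox C e)
qed

lemma mellin_bound:
  obtains C where "C \<ge> 0" "\<And>k e z q. k \<in> K \<Longrightarrow> e \<in> A \<Longrightarrow> good z \<Longrightarrow> q \<in> box1 \<Longrightarrow>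
     norm (mweight (ze1 d e) (ze2 d e) q * profile d N e (phi k) z (fst q) (snd q)) \<le> C * (\<bar>fst q\<bar> powr (Re (ze1 d e) - 1) * \<bar>snd q\<bar> powr (Re (ze2 d e) - 1) * indicator box1 q)"
proof -
  obtain B where B: "B \<ge> 0" "\<And>k e z r s. k\<in>K \<Longrightarrow> e\<in>A \<Longrightarrow> good z \<Longrightarrow> norm (box_profile d N e (phi k) z r s) \<le> B" using box_profile_bounded by blast
  show thesis
  proof (rule that[OF B(1)])
    fix k e and z :: "'n ambient3" and q :: "real \<times> real" assume *: "k \<in> K" "e \<in> A" "good z" "q \<in> box1"
    then have "box_profile d N e (phi k) z (fst q) (snd q) = profile d N e (phi k) z (fst q) (snd q)"
      by (auto simp: box_profile_def box1_def abs_le_iff)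
    with B(2)[OF *(1-3), of "fst q" "snd q"] have "norm (profile d N e (phi k) z (fst q) (snd q)) \<le> B" by simp
    then have "norm (mweight (ze1 d e) (ze2 d e) q) * norm (profile d N e (phi k) z (fst q) (snd q)) \<le> norm (mweight (ze1 d e) (ze2 d e) q) * B"
      by (intro mult_left_mono) auto
    then show "norm (mweight (ze1 d e) (ze2 d e) q * profile d N e (phi k) z (fst q) (snd q)) \<le> B * (\<bar>fst q\<bar> powr (Re (ze1 d e) - 1) * \<bar>snd q\<bar> powr (Re (ze2 d e) - 1) * indicator box1 q)"
      using *(4) by (simp add: norm_mult norm_mweight mult_ac)
  qed
qed

text \<open>The first hypothesis is the conclusion of \<open>sector_integral\<close>. Positive real
  parts of \<open>z1\<close> and \<open>z2\<close> make
  \<open>|r|^(Re z1 - 1) |s|^(Re z2 - 1)\<close> integrable on the square, so the undilated Mellin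
  integral exists and \<open>mellin_dilop2\<close> applies.\<close>

lemma sector_term:
  assumes c: "\<And>(F :: 'n ambient3 \<Rightarrow> complex) g. F \<in> borel_measurable borel \<Longrightarrow> integrable lborel g \<Longrightarrow>
      (\<And>z q. good z \<Longrightarrow> q \<in> box1 \<Longrightarrow> qweight d q * norm (F (polar_map z q)) \<le> g q) \<Longrightarrow>
      integrable sb3 (\<lambda>x. indicator {x. sector x} x *\<^sub>R F x) \<and>
      (\<integral>x. indicator {x. sector x} x *\<^sub>R F x \<partial>sb3) =
      (\<integral>q. (c * qweight d q * indicator box1 q) *\<^sub>R (\<integral>z. F (polar_map z q) \<partial>good_measure) \<partial>lborel)"
    and k: "k \<in> K" and e: "e \<in> A" "Re (ze1 d e) > 0" "Re (ze2 d e) > 0" and d: "d \<ge> 1"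
  shows "integrable sb3 (\<lambda>x. indicator {x. sector x} x *\<^sub>R (kerN N e x * phi k x))"
    and "dfac lam m (ze1 d e) * dfac lam m (ze2 d e) * (\<integral>x. indicator {x. sector x} x *\<^sub>R (kerN N e x * phi k x) \<partial>sb3) =
      of_real c * of_real pi powr (ze1 d e) * Psi e k"
proof -
  interpret Z: finite_measure "good_measure :: 'n ambient3 measure" by (rule finite_measure_good_measure)
  obtain C where C: "C \<ge> 0" "\<And>k e z q. k \<in> K \<Longrightarrow> e \<in> A \<Longrightarrow> good z \<Longrightarrow> q \<in> box1 \<Longrightarrow>
     norm (mweight (ze1 d e) (ze2 d e) q * profile d N e (phi k) z (fst q) (snd q)) \<le> C * (\<bar>fst q\<bar> powr (Re (ze1 d e) - 1) * \<bar>snd q\<bar> powr (Re (ze2 d e) - 1) * indicator box1 q)"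
    using mellin_bound by blast
  define g where "g q = \<bar>fst q\<bar> powr (Re (ze1 d e) - 1) * \<bar>snd q\<bar> powr (Re (ze2 d e) - 1) * indicator box1 q" for q :: "real \<times> real"
  have g: "integrable lborel g" unfolding g_def by (rule integrable_box_powr) (use e in auto)
  let ?F = "\<lambda>x. kerN N e x * phi k x"
  let ?pi = "complex_of_real pi powr (ze1 d e)"
  have Fm: "?F \<in> borel_measurable borel"
  proof -
    have [measurable]: "phi k \<in> borel_measurable borel" by (rule phi_measurable[OF k])
    show ?thesis unfolding kerN_def by measurable
  qed
  have FG: "of_real (qweight d q) * ?F (polar_map z q) = ?pi * (mweight (ze1 d e) (ze2 d e) q * profile d N e (phi k) z (fst q) (snd q))"
    if "good z" "q \<in> box1" for z q
    using kernel_polar_map[OF that(1) d, of "fst q" "snd q" N e "phi k"] that(2) by (auto simp: box1_def)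
  have bnd: "qweight d q * norm (?F (polar_map z q)) \<le> (norm ?pi * C) * g q" if "good z" "q \<in> box1" for z q
  proof -
    have "qweight d q * norm (?F (polar_map z q)) = norm (of_real (qweight d q) * ?F (polar_map z q))"
      using qweight_nonneg[of d q] by (simp add: norm_mult)
    also have "\<dots> = norm ?pi * norm (mweight (ze1 d e) (ze2 d e) q * profile d N e (phi k) z (fst q) (snd q))"
      unfolding FG[OF that] by (rule norm_mult)
    also have "\<dots> \<le> norm ?pi * (C * g q)"
      unfolding g_def by (intro mult_left_mono C(2) k e that) simp
    finally show ?thesis by (simp only: mult.assoc)
  qed
  note cc = c[OF Fm integrable_mult_right[OF g] bnd]
  show "integrable sb3 (\<lambda>x. indicator {x. sector x} x *\<^sub>R ?F x)" using cc by blast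
  have "(\<integral>x. indicator {x. sector x} x *\<^sub>R ?F x \<partial>sb3) = (\<integral>q. (c * qweight d q * indicator box1 q) *\<^sub>R (\<integral>z. ?F (polar_map z q) \<partial>good_measure) \<partial>lborel)"
    using cc by blast
  also have "\<dots> = (\<integral>q. (of_real c * ?pi) * (mweight (ze1 d e) (ze2 d e) q * mean_profile d N e (phi k) (fst q) (snd q)) \<partial>lborel)"
  proof (rule Bochner_Integration.integral_cong[OF refl])
    fix q :: "real \<times> real"
    show "(c * qweight d q * indicator box1 q) *\<^sub>R (\<integral>z. ?F (polar_map z q) \<partial>good_measure) = (of_real c * ?pi) * (mweight (ze1 d e) (ze2 d e) q * mean_profile d N e (phi k) (fst q) (snd q))"
    proof (cases "q \<in> box1")
      case True
      have "of_real (qweight d q) * (\<integral>z. ?F (polar_map z q) \<partial>good_measure) = (\<integral>z. of_real (qweight d q) * ?F (polar_map z q) \<partial>good_measure)" by simp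
      also have "\<dots> = (\<integral>z. (?pi * mweight (ze1 d e) (ze2 d e) q) * box_profile d N e (phi k) z (fst q) (snd q) \<partial>good_measure)"
      proof (rule Bochner_Integration.integral_cong[OF refl])
        fix z :: "'n ambient3" assume "z \<in> space good_measure"
        then have "good z" by (simp add: space_good_measure)
        moreover have "box_profile d N e (phi k) z (fst q) (snd q) = profile d N e (phi k) z (fst q) (snd q)"
          using True by (auto simp: box_profile_def box1_def abs_le_iff)
        ultimately show "of_real (qweight d q) * ?F (polar_map z q) = (?pi * mweight (ze1 d e) (ze2 d e) q) * box_profile d N e (phi k) z (fst q) (snd q)"
          using FG[OF _ True, of z] by (simp only: mult.assoc)
      qed
      also have "\<dots> = (?pi * mweight (ze1 d e) (ze2 d e) q) * mean_profile d N e (phi k) (fst q) (snd q)"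
        unfolding mean_profile_def by simp
      finally have "of_real c * (of_real (qweight d q) * (\<integral>z. ?F (polar_map z q) \<partial>good_measure)) = of_real c * ((?pi * mweight (ze1 d e) (ze2 d e) q) * mean_profile d N e (phi k) (fst q) (snd q))"
        by (simp only:)
      then show ?thesis using True by (simp add: scaleR_conv_of_real mult_ac)
    next
      case False
      then have "box_profile d N e (phi k) z (fst q) (snd q) = 0" for z by (cases q) (auto simp: box_profile_def box1_def abs_le_iff)
      then show ?thesis using False by (simp add: mean_profile_def)
    qed
  qed
  also have "\<dots> = (of_real c * ?pi) * (\<integral>q. mweight (ze1 d e) (ze2 d e) q * mean_profile d N e (phi k) (fst q) (snd q) \<partial>lborel)" by simp
  finally have eq: "(\<integral>x. indicator {x. sector x} x *\<^sub>R ?F x \<partial>sb3) = \<dots>" .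
  have int: "integrable lborel (\<lambda>q. mweight (ze1 d e) (ze2 d e) q * mean_profile d N e (phi k) (fst q) (snd q))"
  proof -
    obtain B where B: "B \<ge> 0" "\<And>r s. norm (mean_profile d N e (phi k) r s) \<le> B * indicator box1 (r, s)" using mean_profile_bounded k e by blast
    have [measurable]: "(\<lambda>q. mean_profile d N e (phi k) (fst q) (snd q)) \<in> borel_measurable borel" by (rule mean_profile_measurable[OF k])
    show ?thesis
    proof (rule Bochner_Integration.integrable_bound[OF integrable_mult_right[OF g, of B]])
      show "AE q in lborel. norm (mweight (ze1 d e) (ze2 d e) q * mean_profile d N e (phi k) (fst q) (snd q)) \<le> norm (B * g q)"
      proof (rule AE_I2)
        fix q :: "real \<times> real"
        have "norm (mweight (ze1 d e) (ze2 d e) q) * norm (mean_profile d N e (phi k) (fst q) (snd q)) \<le> norm (mweight (ze1 d e) (ze2 d e) q) * (B * indicator box1 (fst q, snd q))"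
          by (intro mult_left_mono B) simp
        then show "norm (mweight (ze1 d e) (ze2 d e) q * mean_profile d N e (phi k) (fst q) (snd q)) \<le> norm (B * g q)"
          using B(1) by (simp add: norm_mult norm_mweight g_def mult_ac abs_mult)
      qed
    qed measurable
  qed
  have "Psi e k = dfac lam m (ze1 d e) * dfac lam m (ze2 d e) * (\<integral>q. mweight (ze1 d e) (ze2 d e) q * mean_profile d N e (phi k) (fst q) (snd q) \<partial>lborel)"
    unfolding Psi_def mellin_integrand_def by (rule mellin_dilop2[OF int lam(1)])
  then show "dfac lam m (ze1 d e) * dfac lam m (ze2 d e) * (\<integral>x. indicator {x. sector x} x *\<^sub>R ?F x \<partial>sb3) =
      of_real c * ?pi * Psi e k" unfolding eq by (simp only: mult_ac)
qed

end

section \<open>Decomposition of the kernel distribution into six sectors\<close>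

definition rot :: "('n::finite) ambient3 \<Rightarrow> 'n ambient3" where
  "rot x = (fst (snd x), snd (snd x), fst x)"

definition swp :: "('n::finite) ambient3 \<Rightarrow> 'n ambient3" where
  "swp x = (fst x, snd (snd x), fst (snd x))"

definition preserves :: "(('n::finite) ambient3 \<Rightarrow> 'n ambient3) \<Rightarrow> bool" where
  "preserves \<tau> \<longleftrightarrow> good_map \<tau> \<and> (\<forall>G\<in>borel_measurable borel. (\<integral>\<^sup>+x. G (\<tau> x) \<partial>sb3) = (\<integral>\<^sup>+x. G x \<partial>(sb3 :: 'n ambient3 measure)))"

lemma preservesD:
  "preserves (\<tau> :: ('n::finite) ambient3 \<Rightarrow> 'n ambient3) \<Longrightarrow> G \<in> borel_measurable borel \<Longrightarrow> (\<integral>\<^sup>+x. G (\<tau> x) \<partial>sb3) = (\<integral>\<^sup>+x. G x \<partial>sb3)"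
  unfolding preserves_def by (elim conjE) (erule bspec)

lemma preserves_comp:
  assumes "preserves \<sigma>" "preserves \<tau>" shows "preserves (\<lambda>x. \<sigma> (\<tau> x))"
  unfolding preserves_def
proof (intro conjI ballI)
  show "good_map (\<lambda>x. \<sigma> (\<tau> x))"
    unfolding good_map_def
  proof (intro conjI ballI)
    show "linear (\<lambda>x. \<sigma> (\<tau> x))"
      using assms linear_compose[of \<tau> \<sigma>] unfolding preserves_def good_map_def by (simp add: o_def)
    show "\<sigma> (\<tau> x) \<in> sphere3" if "x \<in> sphere3" for x
    proof -
      have "good_map \<sigma>" "good_map \<tau>" using assms unfolding preserves_def by blast+
      then show ?thesis using good_mapD[OF _ good_mapD[OF _ that]] by blast
    qed
  qed
  fix G :: "'a ambient3 \<Rightarrow> ennreal" assume G: "G \<in> borel_measurable borel"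
  have m: "\<sigma> \<in> borel_measurable borel" using assms(1) by (simp add: preserves_def good_map_measurable)
  have "(\<lambda>x. G (\<sigma> x)) \<in> borel_measurable borel" by (rule measurable_compose[OF m G])
  then have "(\<integral>\<^sup>+x. G (\<sigma> (\<tau> x)) \<partial>sb3) = (\<integral>\<^sup>+x. G (\<sigma> x) \<partial>sb3)" by (rule preservesD[OF assms(2)])
  also have "\<dots> = (\<integral>\<^sup>+x. G x \<partial>sb3)" using assms(1) G unfolding preserves_def by blast
  finally show "(\<integral>\<^sup>+x. G (\<sigma> (\<tau> x)) \<partial>sb3) = (\<integral>\<^sup>+x. G x \<partial>sb3)" .
qed

lemma preserves_id: "preserves (\<lambda>x. x)"
  unfolding preserves_def good_map_def by (simp add: linear_ident)

lemma good_map_rot: "good_map rot" and good_map_swp: "good_map swp"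
  unfolding good_map_def rot_def[abs_def] swp_def[abs_def] by (auto intro!: linearI)

lemma preserves_swp: "preserves (swp :: ('n::finite) ambient3 \<Rightarrow> 'n ambient3)"
  unfolding preserves_def
proof (intro conjI ballI good_map_swp)
  fix G :: "'n ambient3 \<Rightarrow> ennreal" assume G: "G \<in> borel_measurable borel"
  interpret sb: sigma_finite_measure "sb :: (real ^ 'n) measure" by (rule sigma_finite_sb)
  interpret P: pair_sigma_finite "sb :: (real ^ 'n) measure" "sb :: (real ^ 'n) measure" by unfold_locales
  have Gt[measurable]: "(\<lambda>x. G (f x, g x, h x)) \<in> borel_measurable M"
    if [measurable]: "f \<in> borel_measurable M" "g \<in> borel_measurable M" "h \<in> borel_measurable M" for f g h and M :: "'z measure"
    by (rule measurable_compose[OF _ G]) (simp add: borel_prod[symmetric])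
  have "(\<integral>\<^sup>+x. G (swp x) \<partial>sb3) = (\<integral>\<^sup>+x1. \<integral>\<^sup>+x2. \<integral>\<^sup>+x3. G (x1, x3, x2) \<partial>sb \<partial>sb \<partial>sb)"
    using nn_integral_sb3[OF measurable_compose[OF good_map_measurable[OF good_map_swp] G]] by (simp add: swp_def)
  also have "\<dots> = (\<integral>\<^sup>+x1. \<integral>\<^sup>+x3. \<integral>\<^sup>+x2. G (x1, x3, x2) \<partial>sb \<partial>sb \<partial>sb)"
    by (rule nn_integral_cong, rule P.Fubini') measurable
  also have "\<dots> = (\<integral>\<^sup>+x. G x \<partial>sb3)" by (rule nn_integral_sb3[OF G, symmetric])
  finally show "(\<integral>\<^sup>+x. G (swp x) \<partial>sb3) = (\<integral>\<^sup>+x. G x \<partial>sb3)" .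
qed

lemma preserves_rot: "preserves (rot :: ('n::finite) ambient3 \<Rightarrow> 'n ambient3)"
  unfolding preserves_def
proof (intro conjI ballI good_map_rot)
  fix G :: "'n ambient3 \<Rightarrow> ennreal" assume G: "G \<in> borel_measurable borel"
  interpret sb: sigma_finite_measure "sb :: (real ^ 'n) measure" by (rule sigma_finite_sb)
  interpret P: pair_sigma_finite "sb :: (real ^ 'n) measure" "sb :: (real ^ 'n) measure" by unfold_locales
  have Gt[measurable]: "(\<lambda>x. G (f x, g x, h x)) \<in> borel_measurable M"
    if [measurable]: "f \<in> borel_measurable M" "g \<in> borel_measurable M" "h \<in> borel_measurable M" for f g h and M :: "'z measure"
    by (rule measurable_compose[OF _ G]) (simp add: borel_prod[symmetric])
  have "(\<integral>\<^sup>+x. G (rot x) \<partial>sb3) = (\<integral>\<^sup>+x1. \<integral>\<^sup>+x2. \<integral>\<^sup>+x3. G (x2, x3, x1) \<partial>sb \<partial>sb \<partial>sb)"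
    using nn_integral_sb3[OF measurable_compose[OF good_map_measurable[OF good_map_rot] G]] by (simp add: rot_def)
  also have "\<dots> = (\<integral>\<^sup>+x2. \<integral>\<^sup>+x1. \<integral>\<^sup>+x3. G (x2, x3, x1) \<partial>sb \<partial>sb \<partial>sb)"
    by (rule P.Fubini') measurable
  also have "\<dots> = (\<integral>\<^sup>+x2. \<integral>\<^sup>+x3. \<integral>\<^sup>+x1. G (x2, x3, x1) \<partial>sb \<partial>sb \<partial>sb)"
    by (rule nn_integral_cong, rule P.Fubini') measurable
  also have "\<dots> = (\<integral>\<^sup>+x. G x \<partial>sb3)" by (rule nn_integral_sb3[OF G, symmetric])
  finally show "(\<integral>\<^sup>+x. G (rot x) \<partial>sb3) = (\<integral>\<^sup>+x. G x \<partial>sb3)" .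
qed

lemma sb3_borel_measurable: "borel_measurable (sb3 :: ('n::finite) ambient3 measure) = borel_measurable borel"
  by (rule measurable_cong_sets[OF sets_sb3 refl])

lemma preserves_distr:
  assumes "preserves (\<tau> :: ('n::finite) ambient3 \<Rightarrow> 'n ambient3)" shows "distr sb3 sb3 \<tau> = sb3"
proof (rule measure_eqI)
  have m: "\<tau> \<in> measurable sb3 sb3"
    using assms good_map_measurable[of \<tau>] unfolding preserves_def by (simp add: measurable_cong_sets[OF sets_sb3 sets_sb3] del: sets_sb3)
  fix B assume "B \<in> sets (distr sb3 sb3 \<tau>)"
  then have B: "B \<in> sets sb3" by (simp only: sets_distr)
  then have B': "B \<in> sets borel" by (simp only: sets_sb3)
  have "emeasure (distr sb3 sb3 \<tau>) B = (\<integral>\<^sup>+x. indicator B x \<partial>distr sb3 sb3 \<tau>)" using B by (subst nn_integral_indicator) (simp_all only: sets_distr)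
  also have "\<dots> = (\<integral>\<^sup>+x. indicator B (\<tau> x) \<partial>sb3)"
    by (rule nn_integral_distr[OF m]) (simp only: measurable_distr_eq1 borel_measurable_indicator[OF B])
  also have "\<dots> = (\<integral>\<^sup>+x. indicator B x \<partial>sb3)"
    by (rule preservesD[OF assms borel_measurable_indicator[OF B']])
  also have "\<dots> = emeasure sb3 B" by (rule nn_integral_indicator[OF B])
  finally show "emeasure (distr sb3 sb3 \<tau>) B = emeasure sb3 B" .
qed simp

lemma preserves_integral:
  fixes F :: "('n::finite) ambient3 \<Rightarrow> complex"
  assumes t: "preserves \<tau>" and F: "F \<in> borel_measurable borel"
  shows "(\<integral>x. F (\<tau> x) \<partial>sb3) = (\<integral>x. F x \<partial>sb3)" "integrable sb3 (\<lambda>x. F (\<tau> x)) \<longleftrightarrow> integrable sb3 F"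
proof -
  have m: "\<tau> \<in> measurable sb3 sb3"
    using t good_map_measurable[of \<tau>] unfolding preserves_def by (simp add: measurable_cong_sets[OF sets_sb3 sets_sb3] del: sets_sb3)
  have F': "F \<in> borel_measurable sb3" unfolding sb3_borel_measurable by (rule F)
  show "(\<integral>x. F (\<tau> x) \<partial>sb3) = (\<integral>x. F x \<partial>sb3)"
    using integral_distr[OF m F'] unfolding preserves_distr[OF t] by simp
  show "integrable sb3 (\<lambda>x. F (\<tau> x)) \<longleftrightarrow> integrable sb3 F"
    using integrable_distr_eq[OF m F'] unfolding preserves_distr[OF t] by simp
qed

lemma preserves_AE:
  assumes t: "preserves (\<tau> :: ('n::finite) ambient3 \<Rightarrow> 'n ambient3)" and "AE x in sb3. P x"
  shows "AE x in sb3. P (\<tau> x)"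
proof -
  have m: "\<tau> \<in> measurable sb3 sb3"
    using t good_map_measurable[of \<tau>] unfolding preserves_def by (simp add: measurable_cong_sets[OF sets_sb3 sets_sb3] del: sets_sb3)
  have "AE x in distr sb3 sb3 \<tau>. P x" unfolding preserves_distr[OF t] by fact
  then show ?thesis by (rule AE_distrD[OF m])
qed

text \<open>The polar formula for the sector is applied to the set of ties itself: in these
  coordinates a tie means equal cosines, that is \<open>|s| = 1\<close> or \<open>r = 0\<close>,
  which is null in the square.\<close>

lemma AE_sb3_no_tie:
  assumes n: "CARD('n) = Suc d" "d \<ge> 1"
  shows "AE x in (sb3 :: ('n::finite) ambient3 measure). fst x \<bullet> fst (snd x) \<noteq> fst x \<bullet> snd (snd x)"
proof -
  let ?T = "{x :: 'n ambient3. fst x \<bullet> fst (snd x) = fst x \<bullet> snd (snd x)}"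
  have n2: "CARD('n) \<ge> 2" using n by simp
  have T: "?T \<in> sets borel"
  proof -
    have "Measurable.pred borel (\<lambda>x::'n ambient3. fst x \<bullet> fst (snd x) = fst x \<bullet> snd (snd x))" by measurable
    then show ?thesis by (simp add: pred_def)
  qed
  obtain c :: real where "\<And>G :: 'n ambient3 \<Rightarrow> ennreal. G \<in> borel_measurable borel \<Longrightarrow>
     (\<integral>\<^sup>+x. indicator {x. sector x} x * G x \<partial>sb3) =
     (\<integral>\<^sup>+q. ennreal (c * qweight d q) * indicator box1 q * (\<integral>\<^sup>+z. G (polar_map z q) \<partial>sb3) \<partial>lborel)"
    using sector_formula[OF n] by blast
  from this[of "indicator ?T"] T have
    "(\<integral>\<^sup>+x. indicator {x. sector x} x * indicator ?T x \<partial>sb3) =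
     (\<integral>\<^sup>+q. ennreal (c * qweight d q) * indicator box1 q * (\<integral>\<^sup>+z. indicator ?T (polar_map z q) \<partial>(sb3 :: 'n ambient3 measure)) \<partial>lborel)"
    by (simp add: borel_measurable_indicator)
  also have "\<dots> = (\<integral>\<^sup>+q. 0 \<partial>(lborel :: (real \<times> real) measure))"
  proof (rule nn_integral_cong_AE)
    have null: "AE q in (lborel :: (real \<times> real) measure). fst q \<noteq> 0 \<and> snd q \<noteq> 1 \<and> snd q \<noteq> - 1"
    proof -
      have "AE q in (lborel :: real measure) \<Otimes>\<^sub>M (lborel :: real measure). fst q \<noteq> 0 \<and> snd q \<noteq> 1 \<and> snd q \<noteq> - 1"
      proof (rule lborel_pair.AE_pair_measure)
        show "{x \<in> space (lborel \<Otimes>\<^sub>M lborel). fst x \<noteq> (0::real) \<and> snd x \<noteq> (1::real) \<and> snd x \<noteq> - 1} \<in> sets (lborel \<Otimes>\<^sub>M lborel)"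
          by measurable
        have "AE y in lborel. fst (x, y) \<noteq> (0::real) \<and> snd (x, y) \<noteq> (1::real) \<and> snd (x, y) \<noteq> - 1" if "x \<noteq> 0" for x
          by (rule eventually_mono[OF AE_conjI[OF AE_lborel_singleton[of 1] AE_lborel_singleton[of "-1"]]]) (use that in simp)
        then show "AE x in lborel. AE y in lborel. fst (x, y) \<noteq> (0::real) \<and> snd (x, y) \<noteq> (1::real) \<and> snd (x, y) \<noteq> - 1"
          by (rule eventually_mono[OF AE_lborel_singleton[of "0::real"]])
      qed
      then show ?thesis by (simp only: lborel_prod)
    qed
    show "AE q in lborel. ennreal (c * qweight d q) * indicator box1 q * (\<integral>\<^sup>+z. indicator ?T (polar_map z q) \<partial>(sb3 :: 'n ambient3 measure)) = 0"
    proof (rule eventually_mono[OF null])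
      fix q :: "real \<times> real" assume q: "fst q \<noteq> 0 \<and> snd q \<noteq> 1 \<and> snd q \<noteq> - 1"
      show "ennreal (c * qweight d q) * indicator box1 q * (\<integral>\<^sup>+z. indicator ?T (polar_map z q) \<partial>(sb3 :: 'n ambient3 measure)) = 0"
      proof (cases "q \<in> box1")
        case True
        then have rs: "fst q \<in> {-1..1}" "snd q \<in> {-1..1}" by (auto simp: box1_def)
        have ne: "cos (pi * fst q * snd q) \<noteq> cos (pi * fst q)"
        proof
          assume "cos (pi * fst q * snd q) = cos (pi * fst q)"
          then have "cos \<bar>pi * snd q * fst q\<bar> = cos \<bar>pi * fst q\<bar>" by (simp add: mult_ac)
          with abs_ge_zero half_angle_le(4)[OF rs] abs_ge_zero half_angle_le(3)[OF rs]
          have "\<bar>pi * snd q * fst q\<bar> = \<bar>pi * fst q\<bar>"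
            by (rule cos_inj_pi)
          then have "\<bar>snd q\<bar> = 1" using q by (simp add: abs_mult)
          then show False using q by auto
        qed
        have "(\<integral>\<^sup>+z. indicator ?T (polar_map z q) \<partial>(sb3 :: 'n ambient3 measure)) = (\<integral>\<^sup>+z. 0 \<partial>(sb3 :: 'n ambient3 measure))"
        proof (rule nn_integral_cong_AE, rule eventually_mono[OF AE_sb3_good[OF n2]])
          fix z :: "'n ambient3" assume "good z"
          then have "polar_map z q \<notin> ?T" using ne by (simp add: polar_map_def good_def polar_pt_inner)
          then show "indicator ?T (polar_map z q) = (0 :: ennreal)" by simp
        qed
        then show ?thesis by simp
      qed simp
    qed
  qed
  also have "\<dots> = 0" by simp
  finally have z: "(\<integral>\<^sup>+x. indicator {x. sector x} x * indicator ?T x \<partial>sb3) = (0 :: ennreal)" .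
  have "(\<integral>\<^sup>+x. indicator ?T x \<partial>(sb3 :: 'n ambient3 measure)) = (\<integral>\<^sup>+x. indicator {x. sector x} x * indicator ?T x \<partial>sb3)"
    by (rule nn_integral_cong) (auto simp: indicator_def sector_def)
  then have "(\<integral>\<^sup>+x. indicator ?T x \<partial>(sb3 :: 'n ambient3 measure)) = 0" using z by simp
  then have "emeasure (sb3 :: 'n ambient3 measure) ?T = 0"
    using nn_integral_indicator[of ?T "sb3 :: 'n ambient3 measure"] T by (simp only: sets_sb3)
  then have "AE x in (sb3 :: 'n ambient3 measure). x \<notin> ?T"
    using T by (intro AE_not_in null_setsI) (simp_all only: sets_sb3)
  then show ?thesis by simp
qed

section \<open>The cutoff and the six relabellings\<close>

definition K3 :: "complex ^ 3 \<Rightarrow> ('n::finite) ambient3 \<Rightarrow> complex" where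
  "K3 e x = of_real (norm (fst (snd x) - snd (snd x))) powr (e $ 1) * of_real (norm (snd (snd x) - fst x)) powr (e $ 2) *
     of_real (norm (fst x - fst (snd x))) powr (e $ 3)"

text \<open>The weight of the vertex \<open>x1\<close> is carried by the opposite edge. It is
  symmetric in \<open>x2\<close> and \<open>x3\<close>, and off the triple diagonal the weights of
  the three vertices sum to 1.\<close>

definition chi :: "nat \<Rightarrow> ('n::finite) ambient3 \<Rightarrow> real" where
  "chi N x = norm (fst (snd x) - snd (snd x)) ^ (2 * N) / (norm (fst x - fst (snd x)) ^ (2 * N) + norm (snd (snd x) - fst x) ^ (2 * N) + norm (fst (snd x) - snd (snd x)) ^ (2 * N))"

lemma kerN_eq: "kerN N e x = K3 e x * of_real (chi N x)"
  by (simp only: kerN_def K3_def chi_def)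

definition exv :: "real \<Rightarrow> complex ^ 3 \<Rightarrow> 3 \<times> 3 \<times> 3 \<Rightarrow> complex ^ 3" where
  "exv \<rho> \<alpha> j = vector [- of_real \<rho> + \<alpha> $ fst j, - of_real \<rho> + \<alpha> $ fst (snd j), - of_real \<rho> + \<alpha> $ snd (snd j)]"

definition perm_maps :: "(('n::finite) ambient3 \<Rightarrow> 'n ambient3) list" where
  "perm_maps = [\<lambda>x. x, swp, rot, \<lambda>x. rot (swp x), \<lambda>x. rot (rot x), \<lambda>x. rot (rot (swp x))]"

text \<open>Pulling the kernel back along \<open>perm_maps ! p\<close> permutes its exponents by \<open>perm_idx ! p\<close>.\<close>

definition perm_idx :: "(3 \<times> 3 \<times> 3) list" where
  "perm_idx = [(1, 2, 3), (1, 3, 2), (3, 1, 2), (3, 2, 1), (2, 3, 1), (2, 1, 3)]"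

lemma less_6: "p < 6 \<longleftrightarrow> p \<in> {0, 1, 2, 3, 4, 5 :: nat}"
  by auto

lemma perms_preserves: "p < 6 \<Longrightarrow> preserves (perm_maps ! p)"
  unfolding less_6 perm_maps_def
  by (auto intro: preserves_id preserves_swp preserves_rot preserves_comp[OF preserves_rot preserves_swp] preserves_comp[OF preserves_rot preserves_rot] preserves_comp[OF preserves_rot preserves_comp[OF preserves_rot preserves_swp]])

lemma perms_kernel: "p < 6 \<Longrightarrow> kernel \<rho> \<alpha> ((perm_maps ! p) x) = K3 (exv \<rho> \<alpha> (perm_idx ! p)) x"
  unfolding less_6 perm_maps_def perm_idx_def K3_def exv_def
  by (cases x) (auto simp: rot_def swp_def norm_minus_commute vector_3 mult_ac)

lemma kernel_measurable [measurable]: "kernel \<rho> \<alpha> \<in> borel_measurable (borel :: ('n::finite) ambient3 measure)"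
proof -
  have "kernel \<rho> \<alpha> = (K3 (exv \<rho> \<alpha> (1, 2, 3)) :: 'n ambient3 \<Rightarrow> complex)"
    by (auto simp: fun_eq_iff K3_def exv_def vector_3)
  moreover have "(K3 (exv \<rho> \<alpha> (1, 2, 3)) :: 'n ambient3 \<Rightarrow> complex) \<in> borel_measurable borel"
    unfolding K3_def[abs_def] by measurable
  ultimately show ?thesis by simp
qed

text \<open>Passes from the product of measures on the sphere to its image in the ambient space,
  where \<open>sphext\<close> supplies a measurable integrand.\<close>

lemma kernel_distr_sb3:
  fixes f :: "('n::finite) ambient3 \<Rightarrow> complex"
  assumes f: "hsmooth f"
  shows "kernel_distr \<rho> \<alpha> f = (\<integral>x. kernel \<rho> \<alpha> x * sphext f x \<partial>sb3)"
proof -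
  let ?S = "sphere_measure :: (real ^ 'n) measure"
  have id: "(\<lambda>x. x) \<in> measurable ?S borel" by (rule measurable_sm) simp
  interpret S: finite_measure ?S by (rule finite_measure_sm)
  have homfam: "sigma_finite_measure (distr ?S borel (\<lambda>x. x))" using sigma_finite_sb by (simp add: sb_def)
  have sfin: "sigma_finite_measure ((sb :: (real ^ 'n) measure) \<Otimes>\<^sub>M (sb :: (real ^ 'n) measure))"
    by (intro sigma_finite_pair_measure sigma_finite_sb)
  have 1: "sb \<Otimes>\<^sub>M sb = distr (?S \<Otimes>\<^sub>M ?S) (borel \<Otimes>\<^sub>M borel) (\<lambda>(x, y). (x, y))"
    unfolding sb_def by (rule pair_measure_distr[OF id id homfam])
  have id2: "(\<lambda>(x, y). (x, y)) \<in> measurable (?S \<Otimes>\<^sub>M ?S) (borel \<Otimes>\<^sub>M borel)"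
    using measurable_Pair[OF measurable_compose[OF measurable_fst id] measurable_compose[OF measurable_snd id]] by (simp add: case_prod_beta')
  have 2: "sb3 = distr (?S \<Otimes>\<^sub>M (?S \<Otimes>\<^sub>M ?S)) (borel \<Otimes>\<^sub>M (borel \<Otimes>\<^sub>M borel)) (\<lambda>(x, y). (x, (\<lambda>(x, y). (x, y)) y))"
    unfolding 1 unfolding sb_def by (rule pair_measure_distr[OF id id2]) (rule sfin[unfolded 1])
  have id3: "(\<lambda>(x, y). (x, (\<lambda>(x, y). (x, y)) y)) \<in> measurable (?S \<Otimes>\<^sub>M (?S \<Otimes>\<^sub>M ?S)) (borel \<Otimes>\<^sub>M (borel \<Otimes>\<^sub>M borel))"
    using measurable_Pair[OF measurable_compose[OF measurable_fst id] measurable_compose[OF measurable_snd id2]] by (simp add: case_prod_beta')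
  have Fm: "(\<lambda>x. kernel \<rho> \<alpha> x * sphext f x) \<in> borel_measurable (borel :: 'n ambient3 measure)"
    by (intro borel_measurable_times kernel_measurable hsmooth_sphext_measurable f)
  have Fm': "(\<lambda>x. kernel \<rho> \<alpha> x * sphext f x) \<in> borel_measurable (borel \<Otimes>\<^sub>M (borel \<Otimes>\<^sub>M borel) :: 'n ambient3 measure)"
    unfolding borel_prod by (rule Fm)
  have "(\<integral>x. kernel \<rho> \<alpha> x * sphext f x \<partial>sb3) = (\<integral>x. kernel \<rho> \<alpha> x * sphext f x \<partial>(?S \<Otimes>\<^sub>M (?S \<Otimes>\<^sub>M ?S)))"
    unfolding 2 integral_distr[OF id3 Fm'] by (simp add: case_prod_beta')
  also have "\<dots> = kernel_distr \<rho> \<alpha> f"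
    unfolding kernel_distr_def
    by (intro Bochner_Integration.integral_cong refl) (auto simp: sphext_def space_pair_measure space_sm)
  finally show ?thesis ..
qed

text \<open>The two orderings of the other points around a vertex share the weight
  \<open>chi\<close>, and apart from ties their sectors cover everything once; then the three
  weights sum to 1. The maps are, in this order, the inverses of \<open>perm_maps\<close>.\<close>

lemma partition_ae:
  assumes n: "CARD('n) = Suc d" "d \<ge> 1"
  shows "AE x in (sb3 :: ('n::finite) ambient3 measure). (\<Sum>\<sigma>\<leftarrow>[\<lambda>x. x, swp, \<lambda>x. rot (rot x), \<lambda>x. rot (swp x), rot, \<lambda>x. rot (rot (swp x))]. indicator {x. sector x} (\<sigma> x) * chi N (\<sigma> x)) = (1 :: real)"
proof -
  note nt = AE_sb3_no_tie[OF n]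
  have nt2: "AE x in (sb3 :: 'n ambient3 measure). fst (rot x) \<bullet> fst (snd (rot x)) \<noteq> fst (rot x) \<bullet> snd (snd (rot x))"
    by (rule preserves_AE[OF preserves_rot nt])
  have nt3: "AE x in (sb3 :: 'n ambient3 measure). fst (rot (rot x)) \<bullet> fst (snd (rot (rot x))) \<noteq> fst (rot (rot x)) \<bullet> snd (snd (rot (rot x)))"
    by (rule preserves_AE[OF preserves_rot nt2])
  show ?thesis
  proof (rule eventually_mono[OF AE_conjI[OF nt AE_conjI[OF nt2 nt3]]])
    fix x :: "'n ambient3"
    obtain x1 x2 x3 where x: "x = (x1, x2, x3)" by (cases x)
    assume "fst x \<bullet> fst (snd x) \<noteq> fst x \<bullet> snd (snd x) \<and> fst (rot x) \<bullet> fst (snd (rot x)) \<noteq> fst (rot x) \<bullet> snd (snd (rot x)) \<and>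
      fst (rot (rot x)) \<bullet> fst (snd (rot (rot x))) \<noteq> fst (rot (rot x)) \<bullet> snd (snd (rot (rot x)))"
    then have t: "x1 \<bullet> x2 \<noteq> x1 \<bullet> x3" "x2 \<bullet> x3 \<noteq> x2 \<bullet> x1" "x3 \<bullet> x1 \<noteq> x3 \<bullet> x2" by (simp_all add: x rot_def)
    define a b c where "a = norm (x1 - x2) ^ (2 * N)" and "b = norm (x3 - x1) ^ (2 * N)" and "c = norm (x2 - x3) ^ (2 * N)"
    \<comment> \<open>The absence of ties makes the common denominator of the weights
      nonzero.\<close>
    have "x1 \<noteq> x2" using t(3) by auto
    then have "a > 0" by (simp add: a_def)
    moreover have "b \<ge> 0" "c \<ge> 0" by (simp_all add: b_def c_def)
    ultimately have s: "a + b + c > 0" by linarith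
    have abc: "norm (x2 - x1) ^ (2 * N) = a" "norm (x1 - x3) ^ (2 * N) = b" "norm (x3 - x2) ^ (2 * N) = c"
      by (simp_all add: a_def b_def c_def norm_minus_commute)
    have one: "indicator {x. sector x} (u, v, w) + indicator {x. sector x} (u, w, v) = (1::real)" if "u \<bullet> v \<noteq> u \<bullet> w" for u v w :: "real ^ 'n"
      using that by (auto simp: sector_def indicator_def)
    have c1: "chi N (x1, x2, x3) = c / (a + b + c)" "chi N (x1, x3, x2) = c / (a + b + c)"
      "chi N (x3, x1, x2) = a / (a + b + c)" "chi N (x3, x2, x1) = a / (a + b + c)"
      "chi N (x2, x3, x1) = b / (a + b + c)" "chi N (x2, x1, x3) = b / (a + b + c)"
      unfolding chi_def fst_conv snd_conv abc a_def[symmetric] b_def[symmetric] c_def[symmetric]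
      by (simp_all add: add_ac)
    have "(\<Sum>\<sigma>\<leftarrow>[\<lambda>x. x, swp, \<lambda>x. rot (rot x), \<lambda>x. rot (swp x), rot, \<lambda>x. rot (rot (swp x))]. indicator {x. sector x} (\<sigma> x) * chi N (\<sigma> x)) =
      (indicator {x. sector x} (x1, x2, x3) + indicator {x. sector x} (x1, x3, x2)) * (c / (a + b + c)) +
      (indicator {x. sector x} (x3, x1, x2) + indicator {x. sector x} (x3, x2, x1)) * (a / (a + b + c)) +
      (indicator {x. sector x} (x2, x3, x1) + indicator {x. sector x} (x2, x1, x3)) * (b / (a + b + c))"
      unfolding list.map sum_list.Cons sum_list.Nil x rot_def swp_def fst_conv snd_conv c1 by (simp only: distrib_right add_ac add_0_right)
    also have "\<dots> = 1"
      unfolding one[OF t(1)] one[OF t(2)] one[OF t(3)] using s by (simp add: add_divide_distrib[symmetric] add_ac)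
    finally show "(\<Sum>\<sigma>\<leftarrow>[\<lambda>x. x, swp, \<lambda>x. rot (rot x), \<lambda>x. rot (swp x), rot, \<lambda>x. rot (rot (swp x))]. indicator {x. sector x} (\<sigma> x) * chi N (\<sigma> x)) = (1 :: real)" .
  qed
qed

text \<open>The integrand is multiplied by the partition of unity, and the term of index
  \<open>p\<close> is pulled back along \<open>perm_maps ! p\<close>; this undoes the relabelling in
  the weight and permutes the exponents instead.\<close>

lemma kernel_distr_decomposition:
  fixes f :: "('n::finite) ambient3 \<Rightarrow> complex"
  assumes n: "CARD('n) = Suc d" "d \<ge> 1" and f: "hsmooth f"
    and int: "\<And>p. p < 6 \<Longrightarrow> integrable sb3 (\<lambda>x. indicator {x. sector x} x *\<^sub>R (kerN N (exv \<rho> \<alpha> (perm_idx ! p)) x * sphext f ((perm_maps ! p) x)))"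
  shows "kernel_distr \<rho> \<alpha> f = (\<Sum>p<6. \<integral>x. indicator {x. sector x} x *\<^sub>R (kerN N (exv \<rho> \<alpha> (perm_idx ! p)) x * sphext f ((perm_maps ! p) x)) \<partial>sb3)"
proof -
  let ?F = "\<lambda>x. kernel \<rho> \<alpha> x * sphext f x"
  let ?S = "[\<lambda>x. x, swp, \<lambda>x. rot (rot x), \<lambda>x. rot (swp x), rot, \<lambda>x. rot (rot (swp x))] :: ('n ambient3 \<Rightarrow> 'n ambient3) list"
  define w where "w x = indicator {x. sector x} x * chi N x" for x :: "'n ambient3"
  have wm[measurable]: "w \<in> borel_measurable borel" unfolding w_def chi_def by measurable
  have Sm: "(?S ! p) \<in> borel_measurable borel" if "p < 6" for p
  proof -
    have "\<forall>s\<in>set ?S. preserves s"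
      by (simp add: preserves_id preserves_swp preserves_rot preserves_comp[OF preserves_rot preserves_swp] preserves_comp[OF preserves_rot preserves_rot] preserves_comp[OF preserves_rot preserves_comp[OF preserves_rot preserves_swp]])
    moreover have "?S ! p \<in> set ?S" by (rule nth_mem) (use that in \<open>simp add: eval_nat_numeral\<close>)
    ultimately have "preserves (?S ! p)" by (rule bspec)
    then show ?thesis by (simp add: preserves_def good_map_measurable)
  qed
  have gen: "(\<Sum>p<6. g (?S ! p)) = (\<Sum>\<sigma>\<leftarrow>?S. g \<sigma>)" for g :: "('n ambient3 \<Rightarrow> 'n ambient3) \<Rightarrow> real"
    by (simp add: eval_nat_numeral lessThan_Suc add_ac)
  have Fm: "?F \<in> borel_measurable (borel :: 'n ambient3 measure)"
    by (intro borel_measurable_times kernel_measurable hsmooth_sphext_measurable f)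
  have inv: "(?S ! p) ((perm_maps ! p) x) = x" if "p < 6" for p x
  proof -
    have "p \<in> {0, 1, 2, 3, 4, 5}" using that by auto
    then show ?thesis by (auto simp: perm_maps_def rot_def swp_def)
  qed
  have G: "of_real (w ((?S ! p) ((perm_maps ! p) x))) * ?F ((perm_maps ! p) x) = indicator {x. sector x} x *\<^sub>R (kerN N (exv \<rho> \<alpha> (perm_idx ! p)) x * sphext f ((perm_maps ! p) x))" if "p < 6" for p x
    unfolding inv[OF that] perms_kernel[OF that] by (simp add: w_def kerN_eq scaleR_conv_of_real mult_ac)
  have Hm: "(\<lambda>x. of_real (w ((?S ! p) x)) * ?F x) \<in> borel_measurable borel" if "p < 6" for p
    by (intro borel_measurable_times Fm measurable_compose[OF measurable_compose[OF Sm[OF that] wm]]) simp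
  have i: "integrable sb3 (\<lambda>x. of_real (w ((?S ! p) x)) * ?F x)"
    "(\<integral>x. of_real (w ((?S ! p) x)) * ?F x \<partial>sb3) = (\<integral>x. indicator {x. sector x} x *\<^sub>R (kerN N (exv \<rho> \<alpha> (perm_idx ! p)) x * sphext f ((perm_maps ! p) x)) \<partial>sb3)"
    if "p < 6" for p
    using preserves_integral[OF perms_preserves[OF that] Hm[OF that]] int[OF that] unfolding G[OF that] by simp_all
  have "kernel_distr \<rho> \<alpha> f = (\<integral>x. ?F x \<partial>sb3)" by (rule kernel_distr_sb3[OF f])
  also have "\<dots> = (\<integral>x. (\<Sum>p<6. of_real (w ((?S ! p) x)) * ?F x) \<partial>sb3)"
  proof (rule integral_cong_AE)
    show "?F \<in> borel_measurable sb3" unfolding sb3_borel_measurable by (rule Fm)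
    show "(\<lambda>x. \<Sum>p<6. of_real (w ((?S ! p) x)) * ?F x) \<in> borel_measurable sb3"
      unfolding sb3_borel_measurable by (intro borel_measurable_sum Hm) simp
    show "AE x in sb3. ?F x = (\<Sum>p<6. of_real (w ((?S ! p) x)) * ?F x)"
    proof (rule eventually_mono[OF partition_ae[OF n, of N]])
      fix x :: "'n ambient3"
      assume s: "(\<Sum>\<sigma>\<leftarrow>?S. indicator {x. sector x} (\<sigma> x) * chi N (\<sigma> x)) = (1 :: real)"
      have "(\<Sum>p<6. w ((?S ! p) x)) = 1"
        unfolding w_def by (rule trans[OF gen[of "\<lambda>\<sigma>. indicator {x. sector x} (\<sigma> x) * chi N (\<sigma> x)"] s])
      then have "(\<Sum>p<6. complex_of_real (w ((?S ! p) x))) = 1"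
        by (simp only: of_real_sum[symmetric] of_real_1)
      then show "?F x = (\<Sum>p<6. of_real (w ((?S ! p) x)) * ?F x)"
        unfolding sum_distrib_right[symmetric] by simp
    qed
  qed
  also have "\<dots> = (\<Sum>p<6. \<integral>x. of_real (w ((?S ! p) x)) * ?F x \<partial>sb3)"
    by (rule Bochner_Integration.integral_sum) (simp add: i)
  also have "\<dots> = (\<Sum>p<6. \<integral>x. indicator {x. sector x} x *\<^sub>R (kerN N (exv \<rho> \<alpha> (perm_idx ! p)) x * sphext f ((perm_maps ! p) x)) \<partial>sb3)"
    by (rule sum.cong) (simp_all add: i)
  finally show ?thesis .
qed

section \<open>Assembling the continuation\<close>

lemma norm_complex3_le: "norm (e :: complex ^ 3) \<le> norm (e $ 1) + norm (e $ 2) + norm (e $ 3)"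
proof -
  have "norm e \<le> (\<Sum>i\<in>UNIV. norm (e $ i))"
    unfolding norm_vec_def by (rule L2_set_le_sum) simp
  then show ?thesis by (simp add: sum_3)
qed

lemma exv_nth: "exv \<rho> \<alpha> j $ 1 = - of_real \<rho> + \<alpha> $ fst j" "exv \<rho> \<alpha> j $ 2 = - of_real \<rho> + \<alpha> $ fst (snd j)"
    "exv \<rho> \<alpha> j $ 3 = - of_real \<rho> + \<alpha> $ snd (snd j)"
  by (simp_all add: exv_def vector_3)

lemma cdiff_exv:
  assumes "cdiff F (exv \<rho> a j)" shows "cdiff (\<lambda>\<alpha>. F (exv \<rho> \<alpha> j)) a"
proof -
  define L :: "complex ^ 3 \<Rightarrow> complex ^ 3" where "L v = vector [v $ fst j, v $ fst (snd j), v $ snd (snd j)]" for v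
  have nth: "L v $ 1 = v $ fst j" "L v $ 2 = v $ fst (snd j)" "L v $ 3 = v $ snd (snd j)" for v
    by (simp_all add: L_def vector_3)
  have lin: "linear L"
    by (rule linearI) (simp_all add: vec_eq_iff forall_3 nth)
  have sc: "L (c *s v) = c *s L v" for c v by (simp add: vec_eq_iff forall_3 nth)
  define e0 where "e0 = exv \<rho> 0 j"
  have ex: "exv \<rho> \<alpha> j = e0 + L \<alpha>" for \<alpha>
    by (simp add: vec_eq_iff forall_3 nth exv_nth e0_def)
  have bl: "bounded_linear L" using lin by (simp add: linear_conv_bounded_linear)
  obtain D where D: "(F has_derivative D) (at (exv \<rho> a j))" "\<forall>c v. D (c *s v) = c * D v"
    using assms unfolding cdiff_def by blast
  have "((\<lambda>\<alpha>. e0 + L \<alpha>) has_derivative (\<lambda>v. 0 + L v)) (at a)"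
    by (intro has_derivative_add has_derivative_const bounded_linear_imp_has_derivative[OF bl])
  then have 1: "((\<lambda>\<alpha>. exv \<rho> \<alpha> j) has_derivative L) (at a)" unfolding ex by simp
  have "((\<lambda>\<alpha>. F (exv \<rho> \<alpha> j)) has_derivative (\<lambda>v. D (L v))) (at a)"
    by (rule has_derivative_compose[OF 1 D(1)])
  then show ?thesis unfolding cdiff_def using D(2) sc by (intro exI[of _ "\<lambda>v. D (L v)"]) simp
qed

text \<open>Parameters that work for \<open>|\<alpha>| < M\<close>: dilation factor \<open>exp (- epsM M)\<close>, number \<open>mM\<close> of forms in each
  family, cutoff exponent \<open>NM\<close>.\<close>

definition epsM :: "nat \<Rightarrow> real" where "epsM M = 1 / (real M + 1)"
definition mM :: "nat \<Rightarrow> nat \<Rightarrow> nat" where "mM d M = 3 * M + d + 5"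
definition NM :: "nat \<Rightarrow> nat \<Rightarrow> nat" where "NM d M = 2 * mM d M + M + d + 1"
text \<open>A polydisc of exponent vectors that contains \<open>exv \<rho> \<alpha> j\<close> for
  all \<open>j\<close> and all \<open>\<alpha>\<close> of norm below \<open>M\<close>.\<close>

definition AM :: "real \<Rightarrow> nat \<Rightarrow> (complex ^ 3) set" where
  "AM \<rho> M = {e. \<forall>i. norm (e $ i + of_real \<rho>) < real M}"

lemma epsM_pos: "epsM M > 0" by (simp add: epsM_def)

lemma open_AM: "open (AM \<rho> M)"
proof -
  have "AM \<rho> M = (\<Inter>i\<in>UNIV. {e. norm (e $ i + of_real \<rho>) < real M})" by (auto simp: AM_def)
  also have "open \<dots>" by (intro open_INT ballI open_Collect_less continuous_intros) simp
  finally show ?thesis .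
qed

lemma AM_bounds:
  fixes e :: "complex ^ 3"
  assumes "e \<in> AM \<rho> M" "\<rho> \<ge> 0"
  shows "norm (e $ i) \<le> \<rho> + real M" "Re (e $ i) > - \<rho> - real M"
proof -
  have lt: "norm (e $ i + of_real \<rho>) < real M" using assms(1) by (simp add: AM_def)
  have "norm (e $ i) \<le> norm (e $ i + of_real \<rho>) + norm (complex_of_real \<rho>)"
    using norm_triangle_ineq4[of "e $ i + of_real \<rho>" "complex_of_real \<rho>"] by simp
  then show "norm (e $ i) \<le> \<rho> + real M" using lt assms(2) by simp
  have "\<bar>Re (e $ i + of_real \<rho>)\<bar> \<le> norm (e $ i + of_real \<rho>)" by (rule abs_Re_le_cmod)
  then show "Re (e $ i) > - \<rho> - real M" using lt by (simp add: abs_le_iff)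
qed

lemma exv_AM:
  assumes "\<alpha> \<in> ball 0 (real M)" shows "exv \<rho> \<alpha> j \<in> AM \<rho> M"
proof -
  have "norm (\<alpha> $ i) < real M" for i
    using Finite_Cartesian_Product.norm_nth_le[of \<alpha> i] assms by (simp add: dist_norm)
  then show ?thesis by (simp add: AM_def forall_3 exv_nth)
qed

text \<open>On \<open>AM \<rho> M\<close> each exponent has real part above
  \<open>- \<rho> - M\<close>. Hence \<open>Re z1 > \<rho> - 3 M\<close> and
  \<open>Re z2 > \<rho> - M\<close>, which \<open>mM\<close> outweighs, and \<open>NM\<close>
  exceeds \<open>2 mM\<close> by more than the \<open>(\<rho> + M) / 2\<close> that half an exponent
  can lose.\<close>

lemma sector_family_AM:
  assumes "\<rho> = real d / 2" "p < 6" and db: "dbounded K (\<lambda>g. g)"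
  shows "sector_family d (NM d M) (mM d M) (exp (- epsM M)) (AM \<rho> M) K (\<lambda>g :: ('n::finite) ambient3 \<Rightarrow> complex. g) (perm_maps ! p) (3 * (\<rho> + real M))"
proof
  show "dbounded K (\<lambda>g :: 'n ambient3 \<Rightarrow> complex. g)" by (rule db)
  show "good_map (perm_maps ! p :: 'n ambient3 \<Rightarrow> _)" using perms_preserves[OF assms(2)] unfolding preserves_def by (rule conjunct1)
  show "0 < exp (- epsM M)" "exp (- epsM M) < 1" using epsM_pos[of M] by simp_all
  fix e :: "complex ^ 3" assume e: "e \<in> AM \<rho> M"
  have r0: "\<rho> \<ge> 0" using assms(1) by simp
  note b = AM_bounds[OF e r0]
  show "norm e \<le> 3 * (\<rho> + real M)"
  proof -
    note norm_complex3_le[of e]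
    also have "norm (e $ 1) + norm (e $ 2) + norm (e $ 3) \<le> (\<rho> + real M) + (\<rho> + real M) + (\<rho> + real M)"
      by (intro add_mono b(1))
    finally show ?thesis by (simp add: algebra_simps)
  qed
  have "real (NM d M) = 2 * real (mM d M) + real M + real d + 1" by (simp add: NM_def)
  then show "real (2 * mM d M) < Re (e $ 1) / 2 + real (NM d M)"
    using b(2)[of 1] assms(1) by simp
  have mr: "real (mM d M) = 3 * real M + real d + 5" by (simp add: mM_def)
  have "Re (ze1 d e) = Re (e $ 1) + Re (e $ 2) + Re (e $ 3) + 2 * real d" by (simp add: ze1_def)
  then show "0 \<le> Re (ze1 d e) - 1 + real (mM d M)" using b(2)[of 1] b(2)[of 2] b(2)[of 3] assms(1) mr by linarith
  have "Re (ze2 d e) = Re (e $ 3) + real d" by (simp add: ze2_def)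
  then show "0 \<le> Re (ze2 d e) - 1 + real (mM d M)" using b(2)[of 3] assms(1) mr by linarith
qed

text \<open>The index \<open>None\<close> stands for the family of the sum.\<close>

definition pform :: "real \<Rightarrow> 3 option \<times> nat \<Rightarrow> complex ^ 3 \<Rightarrow> complex" where
  "pform \<rho> i \<alpha> = (case fst i of None \<Rightarrow> \<alpha> $ 1 + \<alpha> $ 2 + \<alpha> $ 3 | Some j \<Rightarrow> \<alpha> $ j) - (- of_real \<rho> - 2 * of_nat (snd i))"

section \<open>Pole forms and the common denominator\<close>

lemma pole_forms_eq: "pole_forms \<rho> = range (pform \<rho>)"
proof -
  have N: "pform \<rho> (None, k) = (\<lambda>\<alpha>. \<alpha> $ 1 + \<alpha> $ 2 + \<alpha> $ 3 - (- of_real \<rho> - 2 * of_nat k))" for k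
    by (simp add: pform_def fun_eq_iff)
  have S: "pform \<rho> (Some j, k) = (\<lambda>\<alpha>. \<alpha> $ j - (- of_real \<rho> - 2 * of_nat k))" for j k
    by (simp add: pform_def fun_eq_iff)
  show ?thesis
  proof (intro equalityI subsetI)
    fix l assume "l \<in> pole_forms \<rho>"
    then consider j k where "l = pform \<rho> (Some j, k)" | k where "l = pform \<rho> (None, k)"
      unfolding pole_forms_def N S by blast
    then show "l \<in> range (pform \<rho>)" by cases blast+
  next
    fix l assume "l \<in> range (pform \<rho>)"
    then obtain t k where l: "l = pform \<rho> (t, k)" by auto
    show "l \<in> pole_forms \<rho>"
    proof (cases t)
      case None
      show ?thesis unfolding l None pole_forms_def N S by blast
    next
      case (Some j)
      show ?thesis unfolding l Some pole_forms_def N S by blast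
    qed
  qed
qed

lemma pform_shift: "pform \<rho> (t, k) \<alpha> = pform \<rho> (t, 0) \<alpha> + 2 * of_nat k"
  by (simp add: pform_def)

lemma cdiff_pform: "cdiff (pform \<rho> i) a"
proof -
  have "cdiff (\<lambda>\<alpha>. case fst i of None \<Rightarrow> \<alpha> $ 1 + \<alpha> $ 2 + \<alpha> $ 3 | Some j \<Rightarrow> \<alpha> $ j) a"
    by (cases "fst i") (simp_all add: cdiff_add cdiff_nth)
  from cdiff_diff[OF this cdiff_const] show ?thesis unfolding pform_def[abs_def] .
qed

text \<open>\<open>pole_prod\<close> multiplies over indices, \<open>simple_poles_along\<close> over
  a set of forms; the products correspond because no form is listed twice.\<close>

lemma inj_pform: "inj (pform \<rho>)"
proof (rule injI)
  fix i i' assume eq: "pform \<rho> i = pform \<rho> i'"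
  obtain t k t' k' where i: "i = (t, k)" "i' = (t', k')" by (cases i, cases i')
  \<comment> \<open>The constant term reveals \<open>k\<close>. The linear parts are then told apart
    by the all-ones vector, with value 3 for the sum against 1 for a coordinate, and by unit
    vectors.\<close>
  have "pform \<rho> (t, k) 0 = pform \<rho> (t', k') 0" using eq i by simp
  then have "2 * complex_of_nat k = 2 * of_nat k'" by (simp add: pform_def split: option.splits)
  then have k: "k = k'" by simp
  have v: "(case t of None \<Rightarrow> v $ 1 + v $ 2 + v $ 3 | Some j \<Rightarrow> v $ j) = (case t' of None \<Rightarrow> v $ 1 + v $ 2 + v $ 3 | Some j \<Rightarrow> v $ j)"
    for v :: "complex ^ 3"
  proof -
    have "pform \<rho> (t, k) v = pform \<rho> (t', k) v" using eq i k by simp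
    then show ?thesis by (simp add: pform_def)
  qed
  have "t = t'"
  proof (cases t)
    case None
    show ?thesis
    proof (cases t')
      case (Some j)
      have "(3 :: complex) = 1"
        using v[of "\<chi> i. 1"] None Some by simp
      then show ?thesis by simp
    qed (use None in simp)
  next
    case (Some j)
    show ?thesis
    proof (cases t')
      case None
      have "(1 :: complex) = 3" using v[of "\<chi> i. 1"] None Some by simp
      then show ?thesis by simp
    next
      case (Some j')
      have "(1 :: complex) = (if j' = j then 1 else 0)"
        using v[of "\<chi> i. if i = j then 1 else 0"] Some \<open>t = Some j\<close> by simp
      then show ?thesis using Some \<open>t = Some j\<close> by (simp split: if_splits)
    qed
  qed
  then show "i = i'" using i k by simp
qed

definition pole_factor :: "real \<Rightarrow> nat \<Rightarrow> 3 option \<Rightarrow> complex ^ 3 \<Rightarrow> complex" where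
  "pole_factor \<rho> m t \<alpha> = (\<Prod>k<m. pform \<rho> (t, k) \<alpha>)"

text \<open>A common denominator for the six sectors, each of which by itself calls for two of the
  four families.\<close>

definition pole_prod :: "real \<Rightarrow> nat \<Rightarrow> complex ^ 3 \<Rightarrow> complex" where
  "pole_prod \<rho> m \<alpha> = (\<Prod>t\<in>UNIV. pole_factor \<rho> m t \<alpha>)"

lemma cdiff_pole_factor: "cdiff (pole_factor \<rho> m t) a"
  unfolding pole_factor_def[abs_def] by (intro cdiff_prod cdiff_pform)

lemma cdiff_pole_prod: "cdiff (pole_prod \<rho> m) a"
  unfolding pole_prod_def[abs_def] by (intro cdiff_prod cdiff_pole_factor)

lemma pole_prod_split: "pole_prod \<rho> m \<alpha> = pole_factor \<rho> m None \<alpha> * pole_factor \<rho> m (Some j) \<alpha> * (\<Prod>t\<in>UNIV - {None, Some j}. pole_factor \<rho> m t \<alpha>)"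
proof -
  have "pole_prod \<rho> m \<alpha> = (\<Prod>t\<in>UNIV - {None, Some j}. pole_factor \<rho> m t \<alpha>) * (\<Prod>t\<in>{None, Some j}. pole_factor \<rho> m t \<alpha>)"
    unfolding pole_prod_def by (rule prod.subset_diff) auto
  then show ?thesis by simp
qed

lemma pole_prod_prod: "pole_prod \<rho> m \<alpha> = (\<Prod>i\<in>UNIV \<times> {..<m}. pform \<rho> i \<alpha>)"
  unfolding pole_prod_def pole_factor_def by (simp add: prod.cartesian_product)

text \<open>At a zero, \<open>\<rho> + 2 k\<close> is the modulus of a coordinate or of the sum,
  hence at most \<open>3 M\<close>; so on the ball of radius \<open>M\<close> the truncation at
  \<open>mM\<close> misses no hyperplane.\<close>

lemma pform_zero_index:
  assumes "norm \<alpha> < real M" "pform \<rho> (t, k) \<alpha> = 0" "\<rho> \<ge> 0" shows "k < mM d M"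
proof -
  have n: "norm (\<alpha> $ i) < real M" for i
    using Finite_Cartesian_Product.norm_nth_le[of \<alpha> i] assms(1) by linarith
  have "(case t of None \<Rightarrow> \<alpha> $ 1 + \<alpha> $ 2 + \<alpha> $ 3 | Some j \<Rightarrow> \<alpha> $ j) = - complex_of_real (\<rho> + 2 * real k)"
    using assms(2) by (simp add: pform_def)
  then have "norm (case t of None \<Rightarrow> \<alpha> $ 1 + \<alpha> $ 2 + \<alpha> $ 3 | Some j \<Rightarrow> \<alpha> $ j) = \<rho> + 2 * real k"
    using assms(3) by (simp only: norm_minus_cancel norm_of_real)
  moreover have "norm (case t of None \<Rightarrow> \<alpha> $ 1 + \<alpha> $ 2 + \<alpha> $ 3 | Some j \<Rightarrow> \<alpha> $ j) \<le> 3 * real M"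
  proof (cases t)
    case None
    have "norm (\<alpha> $ 1 + \<alpha> $ 2 + \<alpha> $ 3) \<le> norm (\<alpha> $ 1) + norm (\<alpha> $ 2) + norm (\<alpha> $ 3)"
      by (intro order_trans[OF norm_triangle_ineq] add_right_mono norm_triangle_ineq)
    then show ?thesis using None n[of 1] n[of 2] n[of 3] by simp
  next
    case (Some j)
    then show ?thesis using n[of j] norm_ge_zero[of "\<alpha> $ j"] by simp
  qed
  ultimately have "2 * real k \<le> 3 * real M" using assms(3) by linarith
  then show ?thesis by (simp add: mM_def)
qed

lemma pole_prod_zero_iff:
  assumes "norm \<alpha> < real M" "\<rho> \<ge> 0"
  shows "pole_prod \<rho> (mM d M) \<alpha> = 0 \<longleftrightarrow> (\<exists>i. pform \<rho> i \<alpha> = 0)"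
proof
  assume "pole_prod \<rho> (mM d M) \<alpha> = 0"
  then show "\<exists>i. pform \<rho> i \<alpha> = 0" unfolding pole_prod_prod by (auto simp: prod_zero_iff)
next
  assume "\<exists>i. pform \<rho> i \<alpha> = 0"
  then obtain t k where z: "pform \<rho> (t, k) \<alpha> = 0" by auto
  have "k < mM d M" by (rule pform_zero_index[OF assms(1) z assms(2)])
  then show "pole_prod \<rho> (mM d M) \<alpha> = 0" unfolding pole_prod_prod by (intro prod_zero bexI[of _ "(t, k)"] z) auto
qed

lemma conv_domain_pform: "\<alpha> \<in> conv_domain \<rho> \<Longrightarrow> Re (pform \<rho> (t, 0) \<alpha>) > 0"
proof (cases t)
  case (Some j)
  assume "\<alpha> \<in> conv_domain \<rho>"
  then have "- \<rho> < Re (\<alpha> $ j)" by (simp add: conv_domain_def)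
  then show ?thesis using Some by (simp add: pform_def)
qed (simp add: conv_domain_def pform_def)

lemma conv_domain_nonzero: "\<alpha> \<in> conv_domain \<rho> \<Longrightarrow> pform \<rho> i \<alpha> \<noteq> 0"
proof
  assume a: "\<alpha> \<in> conv_domain \<rho>" and "pform \<rho> i \<alpha> = 0"
  then have "Re (pform \<rho> (fst i, 0) \<alpha> + 2 * of_nat (snd i)) = 0" using pform_shift[of \<rho> "fst i" "snd i" \<alpha>] by simp
  then show False using conv_domain_pform[OF a, of "fst i"] by simp
qed

lemma open_conv_domain: "open (conv_domain \<rho>)"
proof -
  have "conv_domain \<rho> = (\<Inter>j\<in>UNIV. {\<alpha>. - \<rho> < Re (\<alpha> $ j)}) \<inter> {\<alpha>. - \<rho> < Re (\<alpha> $ 1) + Re (\<alpha> $ 2) + Re (\<alpha> $ 3)}"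
    by (auto simp: conv_domain_def)
  also have "open \<dots>" by (intro open_Int open_INT ballI open_Collect_less continuous_intros) simp
  finally show ?thesis .
qed

lemma zero_conv_domain: "\<rho> > 0 \<Longrightarrow> 0 \<in> conv_domain \<rho>"
  by (simp add: conv_domain_def)

lemma ze_exv:
  assumes "\<rho> = real d / 2" "p < 6"
  shows "ze1 d (exv \<rho> \<alpha> (perm_idx ! p)) = pform \<rho> (None, 0) \<alpha>"
    "ze2 d (exv \<rho> \<alpha> (perm_idx ! p)) = pform \<rho> (Some (snd (snd (perm_idx ! p))), 0) \<alpha>"
proof -
  have "real d = 2 * \<rho>" using assms(1) by simp
  then have d: "of_nat d = 2 * complex_of_real \<rho>" by (metis of_real_of_nat_eq of_real_mult of_real_numeral)
  have "\<alpha> $ fst (perm_idx ! p) + \<alpha> $ fst (snd (perm_idx ! p)) + \<alpha> $ snd (snd (perm_idx ! p)) = \<alpha> $ 1 + \<alpha> $ 2 + \<alpha> $ 3"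
    using assms(2) unfolding less_6 by (auto simp: perm_idx_def)
  then show "ze1 d (exv \<rho> \<alpha> (perm_idx ! p)) = pform \<rho> (None, 0) \<alpha>"
    unfolding ze1_def exv_nth d by (simp add: pform_def algebra_simps)
  show "ze2 d (exv \<rho> \<alpha> (perm_idx ! p)) = pform \<rho> (Some (snd (snd (perm_idx ! p))), 0) \<alpha>"
    unfolding ze2_def exv_nth d by (simp add: pform_def algebra_simps)
qed

text \<open>This fixes the choice of \<open>epsM\<close>: on the ball the imaginary parts of the
  forms are at most \<open>3 M\<close>, and \<open>3 M / (M + 1)\<close> is at most 3, below
  \<open>2 pi\<close>.\<close>

lemma dunit_pform_nonzero:
  assumes "norm \<alpha> < real M" shows "dunit (epsM M) m (pform \<rho> (t, 0) \<alpha>) \<noteq> 0"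
proof (rule dunit_nonzero[OF epsM_pos])
  have n: "\<bar>Im (\<alpha> $ i)\<bar> < real M" for i
    using Finite_Cartesian_Product.norm_nth_le[of \<alpha> i] abs_Im_le_cmod[of "\<alpha> $ i"] assms by linarith
  have "\<bar>Im (pform \<rho> (t, 0) \<alpha>)\<bar> \<le> 3 * real M"
    using n[of 1] n[of 2] n[of 3] n[of "the t"] by (cases t) (auto simp: pform_def abs_le_iff abs_less_iff)
  then have "\<bar>Im (pform \<rho> (t, 0) \<alpha>)\<bar> * epsM M \<le> 3 * real M * epsM M"
    using epsM_pos[of M] by (intro mult_right_mono) auto
  also have "\<dots> \<le> 3" by (simp add: epsM_def field_simps)
  also have "\<dots> < 2 * pi" using pi_gt3 by simp
  finally show "\<bar>Im (pform \<rho> (t, 0) \<alpha>)\<bar> * epsM M < 2 * pi" .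
qed

lemma dfac_pole_factor: "dfac (exp (- epsM M)) m (pform \<rho> (t, 0) \<alpha>) = dunit (epsM M) m (pform \<rho> (t, 0) \<alpha>) * pole_factor \<rho> m t \<alpha>"
  unfolding dfac_factor[OF epsM_pos] pole_factor_def by (simp only: pform_shift[of \<rho> t _ \<alpha>, symmetric])

section \<open>Patching the continuations\<close>

lemma dbounded_singleton: "hsmooth g \<Longrightarrow> dbounded {g} (\<lambda>g. g)"
  using dbounded_const[of g "{g}"] unfolding dbounded_def by simp

lemma dbounded_range:
  assumes "\<And>i. hsmooth (f i)" "hsmooth g" "test_tendsto f g"
  shows "dbounded (insert g (range f)) (\<lambda>g. g)"
  unfolding dbounded_def
proof (intro conjI ballI allI)
  show "hsmooth p" if "p \<in> insert g (range f)" for p using that assms by auto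
  fix vs
  obtain C where C: "\<forall>p\<in>UNIV. \<forall>x\<in>sphere3. norm (iter_deriv vs (hom_ext (f p)) x) \<le> C"
    using dbounded_seq[OF assms] unfolding dbounded_def by blast
  obtain C' where C': "\<forall>x\<in>sphere3. norm (iter_deriv vs (hom_ext g) x) \<le> C'"
    using hsmooth_bounded[OF assms(2)] by blast
  show "\<exists>C. \<forall>p\<in>insert g (range f). \<forall>x\<in>sphere3. norm (iter_deriv vs (hom_ext p) x) \<le> C"
  proof (intro exI[of _ "max C C'"] ballI)
    fix p and x :: "'a ambient3" assume p: "p \<in> insert g (range f)" and x: "x \<in> sphere3"
    from p consider "p = g" | i where "p = f i" by blast
    then show "norm (iter_deriv vs (hom_ext p) x) \<le> max C C'"
    proof cases
      case 1
      then show ?thesis using bspec[OF C' x] by (simp add: le_max_iff_disj)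
    next
      case 2
      then show ?thesis using bspec[OF bspec[OF C UNIV_I] x, of i] by (simp add: le_max_iff_disj)
    qed
  qed
qed

text \<open>\<open>c\<close> is the constant produced by \<open>sector_integral\<close>,
  \<open>d\<close> is the dimension of the sphere, and \<open>ty\<close> pins down the ambient
  space.\<close>

locale kernel_continuation =
  fixes d :: nat and \<rho> c :: real and ty :: "('n::finite) itself"
  assumes d: "CARD('n) = Suc d" "d \<ge> 1" and rho: "\<rho> = real d / 2"
    and sect: "\<And>(F :: 'n ambient3 \<Rightarrow> complex) g. F \<in> borel_measurable borel \<Longrightarrow> integrable lborel g \<Longrightarrow>
      (\<And>z q. good z \<Longrightarrow> q \<in> box1 \<Longrightarrow> qweight d q * norm (F (polar_map z q)) \<le> g q) \<Longrightarrow>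
      integrable sb3 (\<lambda>x. indicator {x. sector x} x *\<^sub>R F x) \<and>
      (\<integral>x. indicator {x. sector x} x *\<^sub>R F x \<partial>sb3) =
      (\<integral>q. (c * qweight d q * indicator box1 q) *\<^sub>R (\<integral>z. F (polar_map z q) \<partial>good_measure) \<partial>lborel)"
begin

definition last_idx :: "nat \<Rightarrow> 3" where "last_idx p = snd (snd (perm_idx ! p))"

definition PsiM :: "nat \<Rightarrow> nat \<Rightarrow> complex ^ 3 \<Rightarrow> ('n ambient3 \<Rightarrow> complex) \<Rightarrow> complex" where
  "PsiM M p \<alpha> g = sector_family.Psi d (NM d M) (mM d M) (exp (- epsM M)) (\<lambda>g :: 'n ambient3 \<Rightarrow> complex. g) (perm_maps ! p) (exv \<rho> \<alpha> (perm_idx ! p)) g"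

text \<open>Meant to be \<open>pole_prod\<close> times the kernel distribution on the ball of radius
  \<open>M\<close> (\<open>ext_num_conv\<close>): \<open>Psi\<close> is divided by the nonvanishing
  factors \<open>dunit\<close> and multiplied by the two families absent from its sector.\<close>

definition ext_num :: "nat \<Rightarrow> complex ^ 3 \<Rightarrow> ('n ambient3 \<Rightarrow> complex) \<Rightarrow> complex" where
  "ext_num M \<alpha> g = (\<Sum>p<6. of_real c * of_real pi powr (pform \<rho> (None, 0) \<alpha>) * PsiM M p \<alpha> g /
     (dunit (epsM M) (mM d M) (pform \<rho> (None, 0) \<alpha>) * dunit (epsM M) (mM d M) (pform \<rho> (Some (last_idx p), 0) \<alpha>)) *
     (\<Prod>t\<in>UNIV - {None, Some (last_idx p)}. pole_factor \<rho> (mM d M) t \<alpha>))"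

definition base_term :: "nat \<Rightarrow> nat \<Rightarrow> complex ^ 3 \<Rightarrow> ('n ambient3 \<Rightarrow> complex) \<Rightarrow> 'n ambient3 \<Rightarrow> complex" where
  "base_term M p \<alpha> g x = indicator {x. sector x} x *\<^sub>R (kerN (NM d M) (exv \<rho> \<alpha> (perm_idx ! p)) x * sphext g ((perm_maps ! p) x))"

text \<open>\<open>M\<close> follows \<open>\<alpha>\<close>, so that one formula covers the whole
  space; on the hyperplanes division by 0 gives the value 0.\<close>

definition kernel_ext :: "complex ^ 3 \<Rightarrow> ('n ambient3 \<Rightarrow> complex) \<Rightarrow> complex" where
  "kernel_ext \<alpha> g = (let M = nat \<lceil>norm \<alpha>\<rceil> + 1 in ext_num M \<alpha> g / pole_prod \<rho> (mM d M) \<alpha>)"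

lemma rho_pos: "\<rho> > 0" "\<rho> \<ge> 0" using rho d(2) by auto

lemma base_term_terms:
  assumes g: "hsmooth g" and a: "\<alpha> \<in> conv_domain \<rho>" "\<alpha> \<in> ball 0 (real M)" and p: "p < 6"
  shows "integrable sb3 (base_term M p \<alpha> g)"
    and "dfac (exp (- epsM M)) (mM d M) (pform \<rho> (None, 0) \<alpha>) * dfac (exp (- epsM M)) (mM d M) (pform \<rho> (Some (last_idx p), 0) \<alpha>) * (\<integral>x. base_term M p \<alpha> g x \<partial>sb3)
      = of_real c * of_real pi powr (pform \<rho> (None, 0) \<alpha>) * PsiM M p \<alpha> g"
proof -
  interpret sector_family d "NM d M" "mM d M" "exp (- epsM M)" "AM \<rho> M" "{g}" "\<lambda>g :: 'n ambient3 \<Rightarrow> complex. g" "perm_maps ! p" "3 * (\<rho> + real M)"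
    by (rule sector_family_AM[OF rho p dbounded_singleton[OF g]])
  note z = ze_exv[OF rho p, of \<alpha>]
  have e: "exv \<rho> \<alpha> (perm_idx ! p) \<in> AM \<rho> M" by (rule exv_AM[OF a(2)])
  have z1: "Re (ze1 d (exv \<rho> \<alpha> (perm_idx ! p))) > 0" "Re (ze2 d (exv \<rho> \<alpha> (perm_idx ! p))) > 0"
    unfolding z by (rule conv_domain_pform[OF a(1)])+
  note st = sector_term[OF sect singletonI e z1 d(2)]
  show "integrable sb3 (base_term M p \<alpha> g)" using st(1) unfolding base_term_def[abs_def] phi_def .
  show "dfac (exp (- epsM M)) (mM d M) (pform \<rho> (None, 0) \<alpha>) * dfac (exp (- epsM M)) (mM d M) (pform \<rho> (Some (last_idx p), 0) \<alpha>) * (\<integral>x. base_term M p \<alpha> g x \<partial>sb3)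
      = of_real c * of_real pi powr (pform \<rho> (None, 0) \<alpha>) * PsiM M p \<alpha> g"
    using st(2) unfolding base_term_def phi_def PsiM_def last_idx_def z .
qed

lemma kernel_distr_base_term:
  assumes "hsmooth g" "\<alpha> \<in> conv_domain \<rho>" "\<alpha> \<in> ball 0 (real M)"
  shows "kernel_distr \<rho> \<alpha> g = (\<Sum>p<6. \<integral>x. base_term M p \<alpha> g x \<partial>sb3)"
  using base_term_terms(1)[OF assms] unfolding base_term_def[abs_def] by (rule kernel_distr_decomposition[OF d assms(1)])

lemma ext_num_conv:
  assumes "hsmooth g" "\<alpha> \<in> conv_domain \<rho>" "\<alpha> \<in> ball 0 (real M)"
  shows "ext_num M \<alpha> g = pole_prod \<rho> (mM d M) \<alpha> * kernel_distr \<rho> \<alpha> g"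
proof -
  have nz: "dunit (epsM M) (mM d M) (pform \<rho> (t, 0) \<alpha>) \<noteq> 0" for t
    using assms(3) by (intro dunit_pform_nonzero) (simp add: dist_norm)
  show ?thesis unfolding kernel_distr_base_term[OF assms] ext_num_def sum_distrib_left
  proof (rule sum.cong[OF refl])
    fix p :: nat assume "p \<in> {..<6}"
    then have p: "p < 6" by simp
    let ?D1 = "dunit (epsM M) (mM d M) (pform \<rho> (None, 0) \<alpha>)" and ?D2 = "dunit (epsM M) (mM d M) (pform \<rho> (Some (last_idx p), 0) \<alpha>)"
    let ?Q = "\<Prod>t\<in>UNIV - {None, Some (last_idx p)}. pole_factor \<rho> (mM d M) t \<alpha>"
    have eq: "?D1 * pole_factor \<rho> (mM d M) None \<alpha> * (?D2 * pole_factor \<rho> (mM d M) (Some (last_idx p)) \<alpha>) * (\<integral>x. base_term M p \<alpha> g x \<partial>sb3) = of_real c * of_real pi powr (pform \<rho> (None, 0) \<alpha>) * PsiM M p \<alpha> g"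
      using base_term_terms(2)[OF assms p] unfolding dfac_pole_factor .
    show "of_real c * of_real pi powr (pform \<rho> (None, 0) \<alpha>) * PsiM M p \<alpha> g / (?D1 * ?D2) * ?Q = pole_prod \<rho> (mM d M) \<alpha> * (\<integral>x. base_term M p \<alpha> g x \<partial>sb3)"
      unfolding eq[symmetric] pole_prod_split[of \<rho> "mM d M" \<alpha> "last_idx p"] using nz by simp
  qed
qed

lemma cdiff_ext_num:
  assumes g: "hsmooth g" and a: "a \<in> ball 0 (real M)"
  shows "cdiff (\<lambda>\<alpha>. ext_num M \<alpha> g) a"
proof -
  have psi: "cdiff (\<lambda>\<alpha>. PsiM M p \<alpha> g) a" if p: "p < 6" for p
  proof -
    interpret sector_family d "NM d M" "mM d M" "exp (- epsM M)" "AM \<rho> M" "{g}" "\<lambda>g :: 'n ambient3 \<Rightarrow> complex. g" "perm_maps ! p" "3 * (\<rho> + real M)"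
      by (rule sector_family_AM[OF rho p dbounded_singleton[OF g]])
    obtain R where "R > 0" "ball (exv \<rho> a (perm_idx ! p)) R \<subseteq> AM \<rho> M"
      by (rule openE[OF open_AM exv_AM[OF a]])
    then have "cdiff (\<lambda>e. Psi e g) (exv \<rho> a (perm_idx ! p))" by (intro cdiff_Psi) auto
    then show ?thesis unfolding PsiM_def by (rule cdiff_exv)
  qed
  have nz: "dunit (epsM M) (mM d M) (pform \<rho> (t, 0) a) \<noteq> 0" for t
    using a by (intro dunit_pform_nonzero) (simp add: dist_norm)
  show ?thesis unfolding ext_num_def
    by (intro cdiff_sum cdiff_mult cdiff_divide cdiff_const cdiff_powr cdiff_dunit cdiff_prod cdiff_pform cdiff_pole_factor psi) (use nz in auto)
qed

text \<open>The domain of convergence contains 0 because \<open>\<rho> > 0\<close>, so it meets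
  every ball in a nonempty open set.\<close>

lemma ball_identity:
  assumes "cholomorphic_on F (ball 0 (real M))" "M \<ge> 1"
    and "\<And>\<alpha>. \<alpha> \<in> conv_domain \<rho> \<Longrightarrow> \<alpha> \<in> ball 0 (real M) \<Longrightarrow> F \<alpha> = 0" and "a \<in> ball 0 (real M)"
  shows "F a = 0"
proof (rule cholomorphic_identity[OF assms(1) convex_ball open_ball, of "conv_domain \<rho> \<inter> ball 0 (real M)" 0])
  show "open (conv_domain \<rho> \<inter> ball 0 (real M))" by (intro open_Int open_conv_domain open_ball)
  show "0 \<in> conv_domain \<rho> \<inter> ball 0 (real M)" using zero_conv_domain[OF rho_pos(1)] assms(2) by simp
qed (use assms in auto)

text \<open>Stated after clearing denominators, so that both sides are holomorphic on the smaller
  ball; there they agree on the domain of convergence.\<close>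

lemma ext_num_consistent:
  assumes g: "hsmooth g" and a: "a \<in> ball 0 (real M)" and M: "1 \<le> M" "M \<le> M'"
  shows "ext_num M a g * pole_prod \<rho> (mM d M') a = ext_num M' a g * pole_prod \<rho> (mM d M) a"
proof -
  have sub: "\<alpha> \<in> ball 0 (real M')" if "\<alpha> \<in> ball 0 (real M)" for \<alpha> :: "complex ^ 3" using that M by simp
  have "ext_num M a g * pole_prod \<rho> (mM d M') a - ext_num M' a g * pole_prod \<rho> (mM d M) a = 0"
  proof (rule ball_identity[OF _ M(1) _ a])
    show "cholomorphic_on (\<lambda>\<alpha>. ext_num M \<alpha> g * pole_prod \<rho> (mM d M') \<alpha> - ext_num M' \<alpha> g * pole_prod \<rho> (mM d M) \<alpha>) (ball 0 (real M))"
      unfolding cholomorphic_on_iff by (intro ballI cdiff_diff cdiff_mult cdiff_ext_num cdiff_pole_prod g sub)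
    show "ext_num M \<alpha> g * pole_prod \<rho> (mM d M') \<alpha> - ext_num M' \<alpha> g * pole_prod \<rho> (mM d M) \<alpha> = 0"
      if "\<alpha> \<in> conv_domain \<rho>" "\<alpha> \<in> ball 0 (real M)" for \<alpha>
      unfolding ext_num_conv[OF g that] ext_num_conv[OF g that(1) sub[OF that(2)]] by simp
  qed
  then show ?thesis by simp
qed

lemma kernel_ext_eq:
  assumes g: "hsmooth g" and a: "a \<in> ball 0 (real M)" and nz: "pole_prod \<rho> (mM d M) a \<noteq> 0"
  shows "kernel_ext a g = ext_num M a g / pole_prod \<rho> (mM d M) a"
proof -
  define M0 where "M0 = nat \<lceil>norm a\<rceil> + 1"
  have n0: "norm a < real M0" unfolding M0_def by linarith
  have nM: "norm a < real M" using a by (simp add: dist_norm)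
  have M: "1 \<le> M" using nM norm_ge_zero[of a] by (cases M) auto
  have le: "M0 \<le> M \<or> M \<le> M0" "1 \<le> M0" by (auto simp: M0_def)
  \<comment> \<open>Inside its ball the zero set of \<open>pole_prod\<close> is the union of all
    hyperplanes, whatever \<open>M\<close> is used.\<close>
  have nz0: "pole_prod \<rho> (mM d M0) a \<noteq> 0" using nz pole_prod_zero_iff[OF n0 rho_pos(2)] pole_prod_zero_iff[OF nM rho_pos(2)] by simp
  have "ext_num M0 a g * pole_prod \<rho> (mM d M) a = ext_num M a g * pole_prod \<rho> (mM d M0) a"
    using ext_num_consistent[OF g, of a M0 M] ext_num_consistent[OF g a M, of M0] le n0 by (auto simp: dist_norm)
  then have "ext_num M0 a g / pole_prod \<rho> (mM d M0) a = ext_num M a g / pole_prod \<rho> (mM d M) a"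
    using nz nz0 by (simp add: field_simps)
  then show ?thesis by (simp add: kernel_ext_def Let_def M0_def)
qed

lemma ball_bound: "a \<in> ball 0 (real (nat \<lceil>norm (a :: complex ^ 3)\<rceil> + 1))"
proof -
  have "norm a < real (nat \<lceil>norm a\<rceil> + 1)" by linarith
  then show ?thesis by (simp add: dist_norm)
qed

lemma kernel_ext_conv:
  assumes "\<alpha> \<in> conv_domain \<rho>" "hsmooth f" shows "kernel_ext \<alpha> f = kernel_distr \<rho> \<alpha> f"
proof -
  let ?M = "nat \<lceil>norm \<alpha>\<rceil> + 1"
  have nz: "pole_prod \<rho> (mM d ?M) \<alpha> \<noteq> 0" unfolding pole_prod_prod using conv_domain_nonzero[OF assms(1)] by (simp add: prod_zero_iff)
  show ?thesis unfolding kernel_ext_eq[OF assms(2) ball_bound nz] ext_num_conv[OF assms(2,1) ball_bound] using nz by simp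
qed

text \<open>Linearity holds where the integral converges and is carried to the numerators by the
  identity theorem. Asking for equality on \<open>sphere3\<close> only also yields independence of
  the values off it.\<close>

lemma kernel_ext_lincomb:
  assumes h: "hsmooth f" "hsmooth g" "hsmooth h"
    and eq: "\<And>x. x \<in> sphere3 \<Longrightarrow> h x = a * f x + b * g x"
  shows "kernel_ext \<alpha> h = a * kernel_ext \<alpha> f + b * kernel_ext \<alpha> g"
proof -
  let ?M = "nat \<lceil>norm \<alpha>\<rceil> + 1"
  have kd: "kernel_distr \<rho> \<beta> h = a * kernel_distr \<rho> \<beta> f + b * kernel_distr \<rho> \<beta> g"
    if b: "\<beta> \<in> conv_domain \<rho>" "\<beta> \<in> ball 0 (real ?M)" for \<beta>
  proof -
    have sp: "sphext h x = a * sphext f x + b * sphext g x" for x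
      using eq[of x] by (simp add: sphext_def del: mem_Times_iff)
    have "base_term ?M p \<beta> h x = a * base_term ?M p \<beta> f x + b * base_term ?M p \<beta> g x" for p x
      unfolding base_term_def sp by (simp add: algebra_simps scaleR_conv_of_real)
    then have "(\<integral>x. base_term ?M p \<beta> h x \<partial>sb3) = a * (\<integral>x. base_term ?M p \<beta> f x \<partial>sb3) + b * (\<integral>x. base_term ?M p \<beta> g x \<partial>sb3)" if "p < 6" for p
      using base_term_terms(1)[OF h(1) b that] base_term_terms(1)[OF h(2) b that] by (simp add: Bochner_Integration.integral_add)
    then show ?thesis
      unfolding kernel_distr_base_term[OF h(1) b] kernel_distr_base_term[OF h(2) b] kernel_distr_base_term[OF h(3) b] sum_distrib_left sum.distrib[symmetric]
      by (intro sum.cong) auto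
  qed
  have "ext_num ?M \<alpha> h - (a * ext_num ?M \<alpha> f + b * ext_num ?M \<alpha> g) = 0"
  proof (rule ball_identity[of "\<lambda>\<alpha>. ext_num ?M \<alpha> h - (a * ext_num ?M \<alpha> f + b * ext_num ?M \<alpha> g)" ?M \<alpha>, OF _ _ _ ball_bound])
    show "cholomorphic_on (\<lambda>\<alpha>. ext_num ?M \<alpha> h - (a * ext_num ?M \<alpha> f + b * ext_num ?M \<alpha> g)) (ball 0 (real ?M))"
      unfolding cholomorphic_on_iff by (intro ballI cdiff_diff cdiff_add cdiff_mult cdiff_const cdiff_ext_num h)
    show "ext_num ?M \<beta> h - (a * ext_num ?M \<beta> f + b * ext_num ?M \<beta> g) = 0" if "\<beta> \<in> conv_domain \<rho>" "\<beta> \<in> ball 0 (real ?M)" for \<beta>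
      unfolding ext_num_conv[OF h(1) that] ext_num_conv[OF h(2) that] ext_num_conv[OF h(3) that] kd[OF that] by (simp add: algebra_simps)
  qed simp
  then have "ext_num ?M \<alpha> h = a * ext_num ?M \<alpha> f + b * ext_num ?M \<alpha> g" by simp
  then show ?thesis unfolding kernel_ext_def Let_def by (simp add: add_divide_distrib)
qed

text \<open>A convergent sequence together with its limit is a bounded family, so one set of
  majorants serves all of it. As \<open>M\<close> is determined by \<open>\<alpha>\<close>, it
  suffices that the six functions \<open>PsiM\<close> converge.\<close>

lemma kernel_ext_tendsto:
  assumes f: "\<And>i. hsmooth (f i)" and g: "hsmooth g" and lim: "test_tendsto f g"
  shows "(\<lambda>i. kernel_ext \<alpha> (f i)) \<longlonglongrightarrow> kernel_ext \<alpha> g"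
proof -
  let ?M = "nat \<lceil>norm \<alpha>\<rceil> + 1"
  have pt: "(\<lambda>i. f i x) \<longlonglongrightarrow> g x" if x: "x \<in> sphere3" for x
  proof -
    have "uniform_limit sphere3 (\<lambda>i. iter_deriv [] (hom_ext (f i))) (iter_deriv [] (hom_ext g)) sequentially"
      using lim unfolding test_tendsto_def by blast
    from tendsto_uniform_limitI[OF this x] show ?thesis by (simp add: hom_ext_sphere3[OF x] del: hom_ext.simps)
  qed
  have "(\<lambda>i. PsiM ?M p \<alpha> (f i)) \<longlonglongrightarrow> PsiM ?M p \<alpha> g" if p: "p < 6" for p
  proof -
    interpret sector_family d "NM d ?M" "mM d ?M" "exp (- epsM ?M)" "AM \<rho> ?M" "insert g (range f)" "\<lambda>g :: 'n ambient3 \<Rightarrow> complex. g" "perm_maps ! p" "3 * (\<rho> + real ?M)"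
      by (rule sector_family_AM[OF rho p dbounded_range[OF f g lim]])
    show ?thesis unfolding PsiM_def by (rule Psi_tendsto[OF _ _ exv_AM[OF ball_bound] pt]) auto
  qed
  then show ?thesis unfolding kernel_ext_def Let_def ext_num_def divide_inverse
    by (intro tendsto_mult_right tendsto_sum tendsto_mult_left) auto
qed

lemma kernel_ext_distribution: "is_distribution (kernel_ext \<alpha>)"
  unfolding is_distribution_def
proof (intro conjI ballI allI impI)
  show "kernel_ext \<alpha> f = kernel_ext \<alpha> g" if "f \<in> test_funs" "g \<in> test_funs" "\<forall>x\<in>sphere3. f x = g x" for f g
  proof -
    have "f x = 1 * g x + 0 * g x" if "x \<in> sphere3" for x
      using bspec[OF \<open>\<forall>x\<in>sphere3. f x = g x\<close> that] by simp
    from kernel_ext_lincomb[OF test_funs_hsmooth[OF that(2)] test_funs_hsmooth[OF that(2)] test_funs_hsmooth[OF that(1)] this]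
    show ?thesis by simp
  qed
  show "kernel_ext \<alpha> (\<lambda>x. a * f x + b * g x) = a * kernel_ext \<alpha> f + b * kernel_ext \<alpha> g" if "f \<in> test_funs" "g \<in> test_funs" for f g a b
    using that by (intro kernel_ext_lincomb hsmooth_lincomb test_funs_hsmooth refl)
  show "(\<lambda>i. kernel_ext \<alpha> (f i)) \<longlonglongrightarrow> kernel_ext \<alpha> g" if "(\<forall>i. f i \<in> test_funs) \<and> g \<in> test_funs \<and> test_tendsto f g" for f g
    using that by (intro kernel_ext_tendsto test_funs_hsmooth) auto
qed

lemma kernel_ext_meromorphic:
  assumes f: "hsmooth f" shows "cmeromorphic_on (\<lambda>\<alpha>. kernel_ext \<alpha> f) UNIV"
  unfolding cmeromorphic_on_def
proof (intro ballI)
  fix a :: "complex ^ 3"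
  let ?M = "nat \<lceil>norm a\<rceil> + 1"
  let ?B = "ball 0 (real ?M) :: (complex ^ 3) set"
  \<comment> \<open>\<open>pole_prod\<close> is holomorphic everywhere and nonzero at 0, a point of
    the domain of convergence, so by the identity theorem it vanishes on no nonempty open
    set.\<close>
  have int: "interior {z \<in> ?B. pole_prod \<rho> (mM d ?M) z = 0} = {}"
  proof (rule ccontr)
    assume "interior {z \<in> ?B. pole_prod \<rho> (mM d ?M) z = 0} \<noteq> {}"
    then obtain b where b: "b \<in> interior {z \<in> ?B. pole_prod \<rho> (mM d ?M) z = 0}" by blast
    have "pole_prod \<rho> (mM d ?M) 0 = 0"
    proof (rule cholomorphic_identity[OF _ convex_UNIV open_UNIV open_interior subset_UNIV b])
      show "cholomorphic_on (pole_prod \<rho> (mM d ?M)) UNIV" unfolding cholomorphic_on_iff by (intro ballI cdiff_pole_prod)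
      show "pole_prod \<rho> (mM d ?M) z = 0" if "z \<in> interior {z \<in> ?B. pole_prod \<rho> (mM d ?M) z = 0}" for z
        using that interior_subset by blast
    qed simp
    then show False using conv_domain_nonzero[OF zero_conv_domain[OF rho_pos(1)]]
      unfolding pole_prod_prod by (auto simp: prod_zero_iff)
  qed
  show "\<exists>U g h. open U \<and> a \<in> U \<and> U \<subseteq> UNIV \<and> cholomorphic_on g U \<and> cholomorphic_on h U \<and> interior {z \<in> U. h z = 0} = {} \<and>
      (\<forall>z\<in>U. h z \<noteq> 0 \<longrightarrow> kernel_ext z f = g z / h z)"
  proof (rule exI[of _ ?B], rule exI[of _ "\<lambda>\<alpha>. ext_num ?M \<alpha> f"], rule exI[of _ "pole_prod \<rho> (mM d ?M)"], intro conjI)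
    show "cholomorphic_on (\<lambda>\<alpha>. ext_num ?M \<alpha> f) ?B" unfolding cholomorphic_on_iff by (intro ballI cdiff_ext_num f)
    show "cholomorphic_on (pole_prod \<rho> (mM d ?M)) ?B" unfolding cholomorphic_on_iff by (intro ballI cdiff_pole_prod)
    show "\<forall>z\<in>?B. pole_prod \<rho> (mM d ?M) z \<noteq> 0 \<longrightarrow> kernel_ext z f = ext_num ?M z f / pole_prod \<rho> (mM d ?M) z"
      using kernel_ext_eq[OF f] by blast
  qed (rule open_ball ball_bound subset_UNIV int)+
qed

text \<open>Near \<open>a\<close> the factors of \<open>pole_prod\<close> that do not vanish at
  \<open>a\<close> are moved into the numerator; the remaining ones are exactly the forms through
  \<open>a\<close>, each once.\<close>

lemma kernel_ext_simple_poles: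
  assumes f: "hsmooth f" shows "simple_poles_along (\<lambda>\<alpha>. kernel_ext \<alpha> f) (pole_forms \<rho>)"
  unfolding simple_poles_along_def
proof (intro allI)
  fix a :: "complex ^ 3"
  let ?M = "nat \<lceil>norm a\<rceil> + 1"
  let ?B = "ball 0 (real ?M) :: (complex ^ 3) set"
  let ?m = "mM d ?M"
  define Ia where "Ia = {i \<in> UNIV \<times> {..<?m}. pform \<rho> i a = 0}"
  define Q where "Q z = (\<Prod>i\<in>UNIV \<times> {..<?m} - Ia. pform \<rho> i z)" for z
  have na: "norm a < real ?M" using ball_bound[of a] by (simp add: dist_norm)
  \<comment> \<open>The index set is truncated, but by \<open>pform_zero_index\<close> every
    hyperplane through \<open>a\<close> has an index below \<open>mM\<close>.\<close>
  have Ia: "{l \<in> pole_forms \<rho>. l a = 0} = pform \<rho> ` Ia"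
    unfolding pole_forms_eq Ia_def using pform_zero_index[OF na _ rho_pos(2), of _ _ d] by auto
  have fin: "finite Ia" unfolding Ia_def by simp
  have prod: "(\<Prod>l\<in>pform \<rho> ` Ia. l z) = (\<Prod>i\<in>Ia. pform \<rho> i z)" for z
    using inj_pform by (subst prod.reindex) (auto intro: inj_on_subset)
  have P: "pole_prod \<rho> ?m z = Q z * (\<Prod>i\<in>Ia. pform \<rho> i z)" for z
    unfolding pole_prod_prod Q_def by (rule prod.subset_diff) (auto simp: Ia_def)
  have cQ: "cdiff Q z" for z unfolding Q_def[abs_def] by (intro cdiff_prod cdiff_pform)
  have "continuous_on UNIV Q"
    by (rule continuous_at_imp_continuous_on) (use cdiff_imp_continuous[OF cQ] in auto)
  then have oQ: "open {z. Q z \<noteq> 0}" by (intro open_Collect_neq continuous_intros)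
  have Qa: "Q a \<noteq> 0" unfolding Q_def by (auto simp: prod_zero_iff Ia_def)
  show "finite {l \<in> pole_forms \<rho>. l a = 0} \<and>
    (\<exists>U g. open U \<and> a \<in> U \<and> cholomorphic_on g U \<and>
       (\<forall>z\<in>U. (\<Prod>l\<in>{l \<in> pole_forms \<rho>. l a = 0}. l z) \<noteq> 0 \<longrightarrow> kernel_ext z f = g z / (\<Prod>l\<in>{l \<in> pole_forms \<rho>. l a = 0}. l z)))"
    unfolding Ia prod
  proof (intro conjI exI[of _ "?B \<inter> {z. Q z \<noteq> 0}"] exI[of _ "\<lambda>z. ext_num ?M z f / Q z"])
    show "finite (pform \<rho> ` Ia)" using fin by simp
    show "open (?B \<inter> {z. Q z \<noteq> 0})" by (intro open_Int open_ball oQ)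
    show "a \<in> ?B \<inter> {z. Q z \<noteq> 0}" using ball_bound Qa by blast
    show "cholomorphic_on (\<lambda>z. ext_num ?M z f / Q z) (?B \<inter> {z. Q z \<noteq> 0})"
      unfolding cholomorphic_on_iff by (intro ballI cdiff_divide cdiff_ext_num cQ f) auto
    show "\<forall>z\<in>?B \<inter> {z. Q z \<noteq> 0}. (\<Prod>i\<in>Ia. pform \<rho> i z) \<noteq> 0 \<longrightarrow> kernel_ext z f = ext_num ?M z f / Q z / (\<Prod>i\<in>Ia. pform \<rho> i z)"
    proof (intro ballI impI)
      fix z assume z: "z \<in> ?B \<inter> {z. Q z \<noteq> 0}" "(\<Prod>i\<in>Ia. pform \<rho> i z) \<noteq> 0"
      then have "pole_prod \<rho> ?m z \<noteq> 0" unfolding P by simp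
      then have "kernel_ext z f = ext_num ?M z f / pole_prod \<rho> ?m z" using z by (intro kernel_ext_eq f) auto
      then show "kernel_ext z f = ext_num ?M z f / Q z / (\<Prod>i\<in>Ia. pform \<rho> i z)" unfolding P by (simp only: divide_divide_eq_left)
    qed
  qed
qed

end

theorem theorem2p3:
  fixes \<rho> :: real
  assumes "CARD('n::finite) \<ge> 3"
    and "\<rho> = (real CARD('n) - 1) / 2"
  shows "\<exists>E :: complex ^ 3 \<Rightarrow> ('n ambient3 \<Rightarrow> complex) \<Rightarrow> complex.
     (\<forall>\<alpha>\<in>conv_domain \<rho>. \<forall>f\<in>test_funs. E \<alpha> f = kernel_distr \<rho> \<alpha> f) \<and>
     (\<forall>\<alpha>. (\<forall>l\<in>pole_forms \<rho>. l \<alpha> \<noteq> 0) \<longrightarrow> is_distribution (E \<alpha>)) \<and>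
     (\<forall>f\<in>test_funs. cmeromorphic_on (\<lambda>\<alpha>. E \<alpha> f) UNIV \<and>
        simple_poles_along (\<lambda>\<alpha>. E \<alpha> f) (pole_forms \<rho>))"
proof -
  define d where "d = CARD('n) - 1"
  have d: "CARD('n) = Suc d" "d \<ge> 1" using assms(1) by (auto simp: d_def)
  have rho: "\<rho> = real d / 2" using assms(2) d by simp
  obtain c where "kernel_continuation TYPE('n) d \<rho> c"
  proof (rule sector_integral[OF d])
    fix c :: real
    assume c: "\<And>(F :: 'n ambient3 \<Rightarrow> complex) g. F \<in> borel_measurable borel \<Longrightarrow> integrable lborel g \<Longrightarrow>
      (\<And>z q. good z \<Longrightarrow> q \<in> box1 \<Longrightarrow> qweight d q * norm (F (polar_map z q)) \<le> g q) \<Longrightarrow>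
      integrable sb3 (\<lambda>x. indicator {x. sector x} x *\<^sub>R F x) \<and>
      (\<integral>x. indicator {x. sector x} x *\<^sub>R F x \<partial>sb3) =
      (\<integral>q. (c * qweight d q * indicator box1 q) *\<^sub>R (\<integral>z. F (polar_map z q) \<partial>good_measure) \<partial>lborel)"
    have "kernel_continuation TYPE('n) d \<rho> c"
      by (rule kernel_continuation.intro) (fact d rho c)+
    then show thesis by (rule that)
  qed
  then interpret kernel_continuation d \<rho> c "TYPE('n)" .
  show ?thesis
    by (intro exI[of _ kernel_ext] conjI ballI allI impI kernel_ext_conv kernel_ext_distribution kernel_ext_meromorphic kernel_ext_simple_poles test_funs_hsmooth)
qed

end
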